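(* Let $\gamma>0$ and let $f\in W^{1,\infty}(\mathbb{R}^2)^2\cap H^1(\mathbb{R}^2)^2$ be time independent with zero mean, $g=\nabla^\perp\cdot f$. Given a sequence $\{\mu^\nu\}$, with $\nu\to0$, of stationary statistical solutions of the damped and driven Navier-Stokes equations with viscosity $\nu$ in vorticity phase space (SSSNS), there exist a subsequence, denoted also $\{\mu^\nu\}$, and a Borel probability measure $\mu^0$ on $L^2(\mathbb{R}^2)$ such that $$ \lim_{\nu\to0}\int_{L^2(\mathbb{R}^2)}\Phi(\omega)\,d\mu^\nu(\omega)=\int_{L^2(\mathbb{R}^2)}\Phi(\omega)\,d\mu^0(\omega) $$ holds for all weakly continuous, locally bounded real-valued functions $\Phi$ on $L^2(\mathbb{R}^2)$. Furthermore, the weak limit measure $\mu^0$ is a renormalized stationary statistical solution of the damped and driven Euler equation.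
   Context: Notation: $\nabla^\perp\cdot f=\partial_1f_2-\partial_2f_1$; $\langle a,b\rangle=\int_{\mathbb{R}^2}a(x)b(x)\,dx$ (sum over components for vectors). "Weakly continuous" means continuous for the weak topology of $L^2(\mathbb{R}^2)$; "locally bounded" means bounded on bounded sets. $\gamma$ and $f$ are fixed as $\nu\to0$. Test functionals: let $j\ge0$ be a fixed smooth even function on $\mathbb{R}^2$ supported in $|z|\le1$ with $\int j=1$, $j_\epsilon(z)=\epsilon^{-2}j(\epsilon^{-1}z)$, $J_\epsilon\omega=j_\epsilon\star\omega$. The class $\mathcal{T}$ is the set of functions $\Psi:L^2(\mathbb{R}^2)\to\mathbb{R}$ of the form $\Psi(\omega)=\psi(\langle\omega,\mathbf{w}_1\rangle,\dots,\langle\omega,\mathbf{w}_m\rangle)$ or $\Psi(\omega)=\psi(\langle\alpha_\epsilon(\omega),\mathbf{w}_1\rangle,\dots,\langle\alpha_\epsilon(\omega),\mathbf{w}_m\rangle)$, where $m\in\mathbb{N}$, $\psi\in C^1(\mathbb{R}^m;\mathbb{R})$, $\mathbf{w}_1,\dots,\mathbf{w}_m\in C_0^2(\mathbb{R}^2)$ (compactly supported), $\epsilon>0$, $\alpha_\epsilon(\omega)=J_\epsilon\beta(J_\epsilon\omega)$, and $\beta\in C^3(\mathbb{R})$ is compactly supported. $\Psi'(\omega)\in L^2(\mathbb{R}^2)$ represents the derivative of $\Psi$ at $\omega$: $\nabla_\omega\Psi(\omega)\cdot v=\langle\Psi'(\omega),v\rangle$ for all $v\in L^2(\mathbb{R}^2)$;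 it is a compactly supported $C^2$ function of $x$. Throughout, $u=\frac1{2\pi}\frac{x^\perp}{|x|^2}\star\omega$ with $x^\perp=(-x_2,x_1)$ is the Biot-Savart velocity of $\omega$ (divergence-free, with vorticity $\omega$, in $L^r_{loc}(\mathbb{R}^2)$ for $r<\infty$); $\langle u\cdot\nabla\omega,\Psi'(\omega)\rangle$ means $-\langle u\cdot\nabla_x\Psi'(\omega),\omega\rangle$ and $\langle\nabla_x\omega,\nabla_x\Psi'(\omega)\rangle$ means $-\langle\Delta_x\Psi'(\omega),\omega\rangle$. SSSNS: a stationary statistical solution of the damped and driven Navier-Stokes equation (with viscosity $\nu$) in vorticity phase space is a Borel probability measure $\mu^\nu$ on $L^2(\mathbb{R}^2)$ such that (1) $\int_{L^2}\|\omega\|_{H^1(\mathbb{R}^2)}^2\,d\mu^\nu(\omega)<\infty$ (with $\|\omega\|_{H^1}=\infty$ if $\omega\notin H^1$); (2) $\int_{L^2}\left(\langle u\cdot\nabla\omega+\gamma\omega-g,\Psi'(\omega)\rangle+\nu\langle\nabla_x\omega,\nabla_x\Psi'(\omega)\rangle\right)d\mu^\nu(\omega)=0$ for all $\Psi\in\mathcal{T}$; (3) $\int_{E_1\le\|\omega\|_{L^2}\le E_2}\left\{\gamma\|\omega\|_{L^2}^2+\nu\|\nabla\omega\|_{L^2}^2-\langle g,\omega\rangle\right\}d\mu^\nu(\omega)\le0$ for all $E_1,E_2\ge0$. Renormalized stationary statistical solution of the damped and driven Euler equation: a Borel probability measure $\mu^0$ on $L^2(\mathbb{R}^2)$ such that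 $\int_{L^2}\langle u\cdot\nabla\omega+\gamma\omega-g,\Psi'(\omega)\rangle\,d\mu^0(\omega)=0$ for all $\Psi\in\mathcal{T}$.
   Formalization: The Biot-Savart convolution, undefined for some ω in L², is read as the limit of integrals over discs |x−y|≤R; where this limit diverges, the far field at the origin is subtracted first. It agrees with the ordinary convolution whenever that converges. *)

theory Defs
  imports "HOL-Probability.Probability"
begin

type_synonym plane = "real ^ 2"

section \<open>The Hilbert space of square integrable functions on the plane\<close>

definition sq_integrable :: "(plane \<Rightarrow> real) \<Rightarrow> bool" where
  "sq_integrable h \<longleftrightarrow> h \<in> borel_measurable lborel \<and> integrable lborel (\<lambda>x. (h x)\<^sup>2)"

lemma sq_integrable_mult:
  assumes "sq_integrable a" "sq_integrable b"
  shows "integrable lborel (\<lambda>x. a x * b x)"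
proof (rule Bochner_Integration.integrable_bound)
  show "integrable lborel (\<lambda>x. (a x)\<^sup>2 + (b x)\<^sup>2)"
    using assms by (auto simp: sq_integrable_def)
  show "(\<lambda>x. a x * b x) \<in> borel_measurable lborel"
    using assms by (auto simp: sq_integrable_def)
  have "norm (a x * b x) \<le> norm ((a x)\<^sup>2 + (b x)\<^sup>2)" for x
  proof -
    have "0 \<le> (\<bar>a x\<bar> - \<bar>b x\<bar>)\<^sup>2" by simp
    then have "2 * (\<bar>a x\<bar> * \<bar>b x\<bar>) \<le> (a x)\<^sup>2 + (b x)\<^sup>2"
      by (simp add: power2_diff)
    moreover have "0 \<le> \<bar>a x\<bar> * \<bar>b x\<bar>" by simp
    ultimately have "\<bar>a x\<bar> * \<bar>b x\<bar> \<le> (a x)\<^sup>2 + (b x)\<^sup>2" by linarith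
    then show ?thesis by (simp add: abs_mult)
  qed
  then show "AE x in lborel. norm (a x * b x) \<le> norm ((a x)\<^sup>2 + (b x)\<^sup>2)"
    by simp
qed

lemma sq_integrable_add:
  assumes "sq_integrable a" "sq_integrable b"
  shows "sq_integrable (\<lambda>x. a x + b x)"
proof -
  have "integrable lborel (\<lambda>x. (a x)\<^sup>2 + (b x)\<^sup>2 + 2 * (a x * b x))"
    using assms sq_integrable_mult[OF assms] by (auto simp: sq_integrable_def)
  then show ?thesis
    using assms by (auto simp: sq_integrable_def power2_sum mult.assoc)
qed

lemma sq_integrable_cmult: "sq_integrable a \<Longrightarrow> sq_integrable (\<lambda>x. c * a x)"
  by (auto simp: sq_integrable_def power_mult_distrib)

lemma sq_integrable_zero: "sq_integrable (\<lambda>x. 0)"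
  by (simp add: sq_integrable_def)

quotient_type l2 = "plane \<Rightarrow> real" / partial:
  "\<lambda>a b. sq_integrable a \<and> sq_integrable b \<and> (AE x in lborel. a x = b x)"
proof (rule part_equivpI)
  show "\<exists>a. sq_integrable a \<and> sq_integrable a \<and> (AE x in lborel. a x = a x)"
    using sq_integrable_zero by auto
  show "symp (\<lambda>a b. sq_integrable a \<and> sq_integrable b \<and> (AE x in lborel. a x = b x))"
    by (rule sympI) auto
  show "transp (\<lambda>a b. sq_integrable a \<and> sq_integrable b \<and> (AE x in lborel. a x = b x))"
  proof (rule transpI)
    fix a b c :: "plane \<Rightarrow> real"
    assume 1: "sq_integrable a \<and> sq_integrable b \<and> (AE x in lborel. a x = b x)"
      and 2: "sq_integrable b \<and> sq_integrable c \<and> (AE x in lborel. b x = c x)"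
    from 1 2 have "AE x in lborel. a x = b x" "AE x in lborel. b x = c x" by auto
    then have "AE x in lborel. a x = c x" by eventually_elim simp
    with 1 2 show "sq_integrable a \<and> sq_integrable c \<and> (AE x in lborel. a x = c x)" by simp
  qed
qed

instantiation l2 :: real_inner
begin

lift_definition zero_l2 :: l2 is "\<lambda>x. 0"
  by (simp add: sq_integrable_zero)

lift_definition plus_l2 :: "l2 \<Rightarrow> l2 \<Rightarrow> l2" is "\<lambda>a b x. a x + b x"
  by (auto simp: sq_integrable_add)

lift_definition scaleR_l2 :: "real \<Rightarrow> l2 \<Rightarrow> l2" is "\<lambda>c a x. c * a x"
  by (auto simp: sq_integrable_cmult)

lift_definition inner_l2 :: "l2 \<Rightarrow> l2 \<Rightarrow> real" is "\<lambda>a b. LINT x|lborel. a x * b x"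
  by (intro integral_cong_AE) (auto simp: sq_integrable_def)

definition uminus_l2 :: "l2 \<Rightarrow> l2" where "uminus_l2 a = (-1) *\<^sub>R a"
definition minus_l2 :: "l2 \<Rightarrow> l2 \<Rightarrow> l2" where "minus_l2 a b = a + - b"
definition norm_l2 :: "l2 \<Rightarrow> real" where "norm_l2 a = sqrt (inner a a)"
definition dist_l2 :: "l2 \<Rightarrow> l2 \<Rightarrow> real" where "dist_l2 a b = norm (a - b)"
definition sgn_l2 :: "l2 \<Rightarrow> l2" where "sgn_l2 a = inverse (norm a) *\<^sub>R a"
definition uniformity_l2 :: "(l2 \<times> l2) filter" where
  "uniformity_l2 = (INF e\<in>{0<..}. principal {(x, y). dist x y < e})"
definition open_l2 :: "l2 set \<Rightarrow> bool" where
  "open_l2 U \<longleftrightarrow> (\<forall>x\<in>U. \<forall>\<^sub>F (x', y) in uniformity. x' = x \<longrightarrow> y \<in> U)"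

instance
proof
  fix a b c :: l2 and r s :: real
  show "a + b + c = a + (b + c)"
    by transfer (auto intro!: sq_integrable_add simp: add.assoc)
  show "a + b = b + a"
    by transfer (auto intro!: sq_integrable_add simp: add.commute)
  show "0 + a = a"
    by transfer (auto intro!: sq_integrable_add)
  show "- a + a = 0"
    unfolding uminus_l2_def
    by transfer (auto intro!: sq_integrable_add sq_integrable_zero
        simp: sq_integrable_cmult[of _ "- 1", simplified])
  show "a - b = a + - b" by (rule minus_l2_def)
  show "r *\<^sub>R (a + b) = r *\<^sub>R a + r *\<^sub>R b"
    by transfer (auto intro!: sq_integrable_add sq_integrable_cmult simp: distrib_left)
  show "(r + s) *\<^sub>R a = r *\<^sub>R a + s *\<^sub>R a"
    by transfer (auto intro!: sq_integrable_add sq_integrable_cmult simp: distrib_right)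
  show "r *\<^sub>R s *\<^sub>R a = (r * s) *\<^sub>R a"
    by transfer (auto intro!: sq_integrable_cmult simp: mult.assoc)
  show "1 *\<^sub>R a = a"
    by transfer (auto intro!: sq_integrable_cmult)
  show "dist a b = norm (a - b)" by (rule dist_l2_def)
  show "sgn a = inverse (norm a) *\<^sub>R a" by (rule sgn_l2_def)
  show "uniformity = (INF e\<in>{0<..}. principal {(x::l2, y). dist x y < e})"
    by (rule uniformity_l2_def)
  show "open U \<longleftrightarrow> (\<forall>x\<in>U. \<forall>\<^sub>F (x', y) in uniformity. x' = x \<longrightarrow> y \<in> U)" for U :: "l2 set"
    by (rule open_l2_def)
  show "inner a b = inner b a"
    by transfer (simp add: mult.commute)
  show "inner (a + b) c = inner a c + inner b c"
    by transfer (auto simp: distrib_right sq_integrable_mult intro!: Bochner_Integration.integral_add)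
  show "inner (r *\<^sub>R a) b = r * inner a b"
    by transfer (simp add: mult.assoc)
  show "0 \<le> inner a a"
    by transfer simp
  show "inner a a = 0 \<longleftrightarrow> a = 0"
  proof transfer
    fix a :: "plane \<Rightarrow> real"
    assume a: "sq_integrable a \<and> sq_integrable a \<and> (AE x in lborel. a x = a x)"
    then have "(LINT x|lborel. a x * a x) = 0 \<longleftrightarrow> (AE x in lborel. a x * a x = 0)"
      by (intro integral_nonneg_eq_0_iff_AE) (auto simp: sq_integrable_mult)
    with a show "(LINT x|lborel. a x * a x) = 0 \<longleftrightarrow>
        sq_integrable a \<and> sq_integrable (\<lambda>x. 0) \<and> (AE x in lborel. a x = 0)"
      by (auto simp: sq_integrable_zero)
  qed
  show "norm a = sqrt (inner a a)" by (rule norm_l2_def)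
qed

end

text \<open>For \<open>\<omega> :: l2\<close>, the function \<^term>\<open>rep_l2 \<omega>\<close> is some representative of the class
  \<open>\<omega>\<close>; all uses below are insensitive to modification on null sets.\<close>

definition pairing :: "(plane \<Rightarrow> real) \<Rightarrow> (plane \<Rightarrow> real) \<Rightarrow> real" where
  "pairing a b = (LINT x|lborel. a x * b x)"

definition weak_topology_l2 :: "l2 topology" where
  "weak_topology_l2 =
     topology_generated_by {F -` U | (F :: l2 \<Rightarrow> real) U. bounded_linear F \<and> open U}"

definition weakly_continuous :: "(l2 \<Rightarrow> real) \<Rightarrow> bool" where
  "weakly_continuous \<Phi> \<longleftrightarrow> continuous_map weak_topology_l2 euclideanreal \<Phi>"

definition locally_bounded :: "(l2 \<Rightarrow> real) \<Rightarrow> bool" where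
  "locally_bounded \<Phi> \<longleftrightarrow> (\<forall>B. bounded B \<longrightarrow> bounded (\<Phi> ` B))"

definition borel_probability :: "l2 measure \<Rightarrow> bool" where
  "borel_probability \<mu> \<longleftrightarrow> prob_space \<mu> \<and> sets \<mu> = sets borel"

section \<open>Classical and weak derivatives\<close>

text \<open>\<open>Ck n h\<close>: \<open>h\<close> is \<open>n\<close> times continuously differentiable on the whole space.\<close>

fun Ck :: "nat \<Rightarrow> ('a::euclidean_space \<Rightarrow> real) \<Rightarrow> bool" where
  "Ck 0 h \<longleftrightarrow> continuous_on UNIV h"
| "Ck (Suc n) h \<longleftrightarrow> (\<forall>x. h differentiable (at x)) \<and>
     (\<forall>b\<in>Basis. Ck n (\<lambda>x. frechet_derivative h (at x) b))"

definition smooth :: "('a::euclidean_space \<Rightarrow> real) \<Rightarrow> bool" where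
  "smooth h \<longleftrightarrow> (\<forall>n. Ck n h)"

definition compactly_supported :: "('a::topological_space \<Rightarrow> real) \<Rightarrow> bool" where
  "compactly_supported h \<longleftrightarrow> compact (closure {x. h x \<noteq> 0})"

definition C2_0 :: "(plane \<Rightarrow> real) \<Rightarrow> bool" where
  "C2_0 h \<longleftrightarrow> Ck 2 h \<and> compactly_supported h"

definition pd :: "2 \<Rightarrow> (plane \<Rightarrow> real) \<Rightarrow> plane \<Rightarrow> real" where
  "pd i h x = frechet_derivative h (at x) (axis i 1)"

definition laplacian :: "(plane \<Rightarrow> real) \<Rightarrow> plane \<Rightarrow> real" where
  "laplacian h x = (\<Sum>i\<in>UNIV. pd i (pd i h) x)"

definition locally_integrable :: "(plane \<Rightarrow> real) \<Rightarrow> bool" where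
  "locally_integrable h \<longleftrightarrow>
     h \<in> borel_measurable lborel \<and> (\<forall>C. compact C \<longrightarrow> set_integrable lborel C h)"

definition weak_pd :: "2 \<Rightarrow> (plane \<Rightarrow> real) \<Rightarrow> (plane \<Rightarrow> real) \<Rightarrow> bool" where
  "weak_pd i h d \<longleftrightarrow> locally_integrable h \<and> locally_integrable d \<and>
     (\<forall>\<phi>. smooth \<phi> \<and> compactly_supported \<phi> \<longrightarrow> pairing h (pd i \<phi>) = - pairing d \<phi>)"

definition essentially_bounded :: "(plane \<Rightarrow> real) \<Rightarrow> bool" where
  "essentially_bounded h \<longleftrightarrow>
     h \<in> borel_measurable lborel \<and> (\<exists>M. AE x in lborel. \<bar>h x\<bar> \<le> M)"

definition W1_infinity :: "(plane \<Rightarrow> real) \<Rightarrow> bool" where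
  "W1_infinity h \<longleftrightarrow>
     essentially_bounded h \<and> (\<forall>i. \<exists>d. weak_pd i h d \<and> essentially_bounded d)"

definition H1 :: "(plane \<Rightarrow> real) \<Rightarrow> bool" where
  "H1 h \<longleftrightarrow> sq_integrable h \<and> (\<forall>i. \<exists>d. weak_pd i h d \<and> sq_integrable d)"

definition is_curl :: "(plane \<Rightarrow> plane) \<Rightarrow> l2 \<Rightarrow> bool" where
  "is_curl f g \<longleftrightarrow> (\<exists>d1 d2. weak_pd 1 (\<lambda>x. f x $ 2) d1 \<and> weak_pd 2 (\<lambda>x. f x $ 1) d2 \<and>
     (AE x in lborel. rep_l2 g x = d1 x - d2 x))"

text \<open>Weak derivatives are unique, so the infimum ranges over at most one value; it is over the
  empty set, hence \<open>\<infinity>\<close>, exactly when \<open>\<omega>\<close> is not in the Sobolev space \<open>H\<^sup>1\<close>.\<close>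

definition grad_norm_sq :: "l2 \<Rightarrow> ennreal" where
  "grad_norm_sq \<omega> = (INF D\<in>{D :: 2 \<Rightarrow> l2. \<forall>i. weak_pd i (rep_l2 \<omega>) (rep_l2 (D i))}.
     ennreal (\<Sum>i\<in>UNIV. (norm (D i))\<^sup>2))"

definition H1_norm_sq :: "l2 \<Rightarrow> ennreal" where
  "H1_norm_sq \<omega> = ennreal ((norm \<omega>)\<^sup>2) + grad_norm_sq \<omega>"

section \<open>Biot-Savart velocity\<close>

definition biot_savart_kernel :: "plane \<Rightarrow> plane" where
  "biot_savart_kernel z = (1 / (2 * pi * (norm z)\<^sup>2)) *\<^sub>R vector [- (z $ 2), z $ 1]"

text \<open>The kernel \<open>K\<close> decays like \<open>1 / \<bar>z\<bar>\<close>, which just fails to be square integrable at infinity,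
  so that for \<open>\<omega>\<close> in \<open>L\<^sup>2\<close> the convolution \<open>K \<star> \<omega>\<close> need not converge absolutely. It is
  therefore read as the limit for \<open>R \<rightarrow> \<infinity>\<close> of the integrals over the discs \<open>\<bar>x - y\<bar> \<le> R\<close>. This is the
  ordinary Lebesgue integral whenever that exists, and it recovers almost everywhere every
  divergence-free \<open>L\<^sup>2\<close> velocity whose vorticity is \<open>\<omega>\<close>.

  As differences of translates of \<open>K\<close> are square integrable at infinity, the limit exists either for
  almost all \<open>x\<close> or for almost no \<open>x\<close>, and it does so iff the far field at the origin converges. In
  the remaining case the convolution diverges, and only the velocity up to an additive constant is
  determined by \<open>\<omega>\<close>; the constant is then fixed by subtracting the far field at the
  origin. With this convention every \<open>\<omega>\<close> in \<open>L\<^sup>2\<close> has a divergence-free velocity with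
  vorticity \<open>\<omega>\<close> which is locally in \<open>L\<^sup>r\<close> for all \<open>r < \<infinity>\<close>.\<close>

definition truncated_biot_savart :: "real \<Rightarrow> l2 \<Rightarrow> plane \<Rightarrow> plane" where
  "truncated_biot_savart R \<omega> x =
     (LINT y:cball x R|lborel. rep_l2 \<omega> y *\<^sub>R biot_savart_kernel (x - y))"

definition far_field :: "real \<Rightarrow> l2 \<Rightarrow> plane" where
  "far_field R \<omega> = (LINT y:cball 0 R - cball 0 1|lborel. rep_l2 \<omega> y *\<^sub>R biot_savart_kernel (- y))"

definition velocity :: "l2 \<Rightarrow> plane \<Rightarrow> plane" where
  "velocity \<omega> x =
    (if \<exists>l. ((\<lambda>R. far_field R \<omega>) \<longlongrightarrow> l) at_top
     then Lim at_top (\<lambda>R. truncated_biot_savart R \<omega> x)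
     else Lim at_top (\<lambda>R. truncated_biot_savart R \<omega> x - far_field R \<omega>))"

section \<open>Test functionals\<close>

definition is_mollifier :: "(plane \<Rightarrow> real) \<Rightarrow> bool" where
  "is_mollifier j \<longleftrightarrow> smooth j \<and> (\<forall>z. 0 \<le> j z) \<and> (\<forall>z. j (- z) = j z) \<and>
     (\<forall>z. norm z > 1 \<longrightarrow> j z = 0) \<and> (LINT z|lborel. j z) = 1"

definition mollify :: "(plane \<Rightarrow> real) \<Rightarrow> real \<Rightarrow> (plane \<Rightarrow> real) \<Rightarrow> plane \<Rightarrow> real" where
  "mollify j \<epsilon> h x = (LINT y|lborel. (1 / \<epsilon>\<^sup>2) * j ((1 / \<epsilon>) *\<^sub>R (x - y)) * h y)"

definition alpha ::
  "(plane \<Rightarrow> real) \<Rightarrow> real \<Rightarrow> (real \<Rightarrow> real) \<Rightarrow> l2 \<Rightarrow> plane \<Rightarrow> real" where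
  "alpha j \<epsilon> \<beta> \<omega> = mollify j \<epsilon> (\<lambda>x. \<beta> (mollify j \<epsilon> (rep_l2 \<omega>) x))"

text \<open>As \<open>m\<close> varies, \<open>\<real>\<^sup>m\<close> is represented by the real sequences vanishing from index \<open>m\<close> on;
  the product topology of \<open>nat \<Rightarrow> real\<close> induces the Euclidean one there.\<close>

definition Rm :: "nat \<Rightarrow> (nat \<Rightarrow> real) set" where
  "Rm m = {p. \<forall>k\<ge>m. p k = 0}"

definition C1_Rm :: "nat \<Rightarrow> ((nat \<Rightarrow> real) \<Rightarrow> real) \<Rightarrow> bool" where
  "C1_Rm m \<psi> \<longleftrightarrow> (\<exists>D. \<forall>k<m. continuous_on (Rm m) (D k) \<and>
     (\<forall>p\<in>Rm m. ((\<lambda>t. \<psi> (p(k := t))) has_real_derivative D k p) (at (p k))))"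

definition pairings :: "nat \<Rightarrow> (nat \<Rightarrow> plane \<Rightarrow> real) \<Rightarrow> (plane \<Rightarrow> real) \<Rightarrow> nat \<Rightarrow> real" where
  "pairings m w h = (\<lambda>k. if k < m then pairing h (w k) else 0)"

definition test_functionals :: "(plane \<Rightarrow> real) \<Rightarrow> (l2 \<Rightarrow> real) set" where
  "test_functionals j = {\<Psi>. \<exists>m \<psi> w. C1_Rm m \<psi> \<and> (\<forall>k<m. C2_0 (w k)) \<and>
     (\<Psi> = (\<lambda>\<omega>. \<psi> (pairings m w (rep_l2 \<omega>))) \<or>
      (\<exists>\<epsilon> \<beta>. 0 < \<epsilon> \<and> Ck 3 \<beta> \<and> compactly_supported \<beta> \<and>
         \<Psi> = (\<lambda>\<omega>. \<psi> (pairings m w (alpha j \<epsilon> \<beta> \<omega>)))))}"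

text \<open>The continuous representative of the \<open>L\<^sup>2\<close> gradient of \<open>\<Psi>\<close> at \<open>\<omega>\<close>; it exists and is unique
  for every test functional.\<close>

definition func_deriv :: "(l2 \<Rightarrow> real) \<Rightarrow> l2 \<Rightarrow> plane \<Rightarrow> real" where
  "func_deriv \<Psi> \<omega> = (THE p. C2_0 p \<and>
     (\<Psi> has_derivative (\<lambda>v. pairing p (rep_l2 v))) (at \<omega>))"

section \<open>Stationary statistical solutions\<close>

text \<open>\<open>\<langle>u \<cdot> \<nabla>\<omega> + \<gamma>\<omega> - g, p\<rangle>\<close>, with the derivative moved to \<open>p\<close> in the transport term.\<close>

definition euler_pairing :: "real \<Rightarrow> l2 \<Rightarrow> l2 \<Rightarrow> (plane \<Rightarrow> real) \<Rightarrow> real" where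
  "euler_pairing \<gamma> g \<omega> p =
     - (LINT x|lborel. (\<Sum>i\<in>UNIV. velocity \<omega> x $ i * pd i p x) * rep_l2 \<omega> x)
     + \<gamma> * pairing (rep_l2 \<omega>) p - pairing (rep_l2 g) p"

text \<open>Writing \<^const>\<open>has_bochner_integral\<close> makes the integrability of the integrand part of the
  equation. The gradient term of the third clause is finite almost surely, by the first
  clause.\<close>

definition stat_sol_NS ::
  "(plane \<Rightarrow> real) \<Rightarrow> real \<Rightarrow> l2 \<Rightarrow> real \<Rightarrow> l2 measure \<Rightarrow> bool" where
  "stat_sol_NS j \<gamma> g \<nu> \<mu> \<longleftrightarrow>
     borel_probability \<mu> \<and>
     (\<integral>\<^sup>+ \<omega>. H1_norm_sq \<omega> \<partial>\<mu>) < \<infinity> \<and>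
     (\<forall>\<Psi>\<in>test_functionals j.
        has_bochner_integral \<mu>
          (\<lambda>\<omega>. euler_pairing \<gamma> g \<omega> (func_deriv \<Psi> \<omega>)
             + \<nu> * (- pairing (laplacian (func_deriv \<Psi> \<omega>)) (rep_l2 \<omega>))) 0) \<and>
     (\<forall>E1\<ge>0. \<forall>E2\<ge>0.
        (LINT \<omega>:{\<omega>. E1 \<le> norm \<omega> \<and> norm \<omega> \<le> E2}|\<mu>.
           \<gamma> * (norm \<omega>)\<^sup>2 + \<nu> * enn2real (grad_norm_sq \<omega>) - inner g \<omega>) \<le> 0)"

definition renormalized_stat_sol_Euler ::
  "(plane \<Rightarrow> real) \<Rightarrow> real \<Rightarrow> l2 \<Rightarrow> l2 measure \<Rightarrow> bool" where
  "renormalized_stat_sol_Euler j \<gamma> g \<mu> \<longleftrightarrow>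
     borel_probability \<mu> \<and>
     (\<forall>\<Psi>\<in>test_functionals j.
        has_bochner_integral \<mu> (\<lambda>\<omega>. euler_pairing \<gamma> g \<omega> (func_deriv \<Psi> \<omega>)) 0)"

end

theory Submission
 imports Defs
begin

text \<open>Beyond the radius \<open>\<parallel>g\<parallel> / \<gamma>\<close> the damping exceeds the forcing, so the energy inequality on shells
 confines every stationary solution to one ball of \<open>L\<^sup>2\<close> (\<open>energy_support\<close>). Probability
 measures on a ball are sequentially compact for integration of weakly continuous functions
 (\<open>weak_compactness_probability\<close>). This gives the subsequence and the limit measure, and it remains to
 pass to the limit in the weak equation, whose viscous term vanishes.

 Off a null set, the velocity is the sum of a renormalised velocity, the convolution with
 \<open>K (x - y) - Khat (- y)\<close>, and of a constant vector, the drift, the limit of the far field at the origin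
 (\<open>velocity_good\<close>). The gradients of test functionals and the transport by the renormalised
 velocity are weakly continuous on bounded sets (\<open>gradient_family_test_functional\<close>,
 \<open>transport_wconv\<close>). The drift is not: since the kernel just fails to be square integrable at infinity, a weakly
 null sequence may carry a far field of order one. The difficulty of the theorem is to exclude
 this, uniformly in the viscosity.

 The equation itself does so. Let \<open>z\<close> be the far field between the radii \<open>L\<close> and \<open>n\<close>, the pairing of the vorticity \<open>W\<close> with
 a smoothly truncated kernel, whose gradient is small in \<open>L\<^sup>2\<close> for large \<open>L\<close>. In the equation for
 \<open>z\<close> the damping \<open>\<gamma> z\<close> then dominates the transport, the viscosity and, as \<open>g\<close> is a curl, the forcing,
 up to errors that vanish with \<open>1 / L\<close>, but grow linearly with the drift. If the drift is bounded,
 the stationary equation for a function of \<open>\<bar>z\<bar>\<^sup>2\<close> that is constant up to a small value and increases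
 afterwards shows that \<open>z\<close> never exceeds this value (\<open>far_field_confined\<close>).

 That the drift is bounded (\<open>drift_bounded\<close>) follows from the same argument with \<open>n \<rightarrow> \<infinity>\<close>, when the
 drift is \<open>z\<close> up to a bounded vector and is absorbed by the damping. Without moments of the drift, this
 limit requires a second, logarithmic cutoff at a larger radius. The cutoff is removed by
 dominated convergence, where the integrability of the drift on the event that \<open>\<bar>z\<bar>\<close> is not small comes
 from the equations for finitely many translates of a test function (\<open>drift_controlled\<close>).

 Hence almost surely the drift is the uniform limit of weakly continuous functions
 (\<open>uniform_confinement\<close>). This property passes to the limit measure, and so does the
 equation (\<open>euler_limit\<close>).\<close>

abbreviation "Borel \<equiv> borel_measurable borel"

abbreviation (input) seq_limit :: "(nat => 'a :: topological_space) => 'a => bool"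
 ("((_)/ ----> (_))" [60, 60] 60) where
 "X ----> l \<equiv> X \<longlonglongrightarrow> l"

abbreviation nn_lborel :: "('a :: euclidean_space => real) => ennreal" (binder "nnint " 10) where
 "nn_lborel f \<equiv> \<integral>\<^sup>+ x. ennreal (f x) \<partial>lborel"


section \<open>The Hilbert space\<close>

lemma sq_integrable_rep: "sq_integrable (rep_l2 a)"
 using Quotient3_rep_reflp[OF Quotient3_l2] by simp

lemma abs_rep_l2 [simp]: "abs_l2 (rep_l2 a) = a"
 by (rule Quotient3_abs_rep[OF Quotient3_l2])

lemma rep_abs_l2:
 assumes "sq_integrable h"
 shows "AE x in lborel. rep_l2 (abs_l2 h) x = h x"
 using Quotient3_rep_abs[OF Quotient3_l2, of h] assms by auto

lemma abs_l2_cong: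
 assumes "sq_integrable a" "sq_integrable b" "AE x in lborel. a x = b x"
 shows "abs_l2 a = abs_l2 b"
 using Quotient3_rel_abs[OF Quotient3_l2, of a b] assms by auto

lemma measurable_rep_l2 [measurable]: "rep_l2 a \<in> Borel"
 using sq_integrable_rep[of a] by (simp add: sq_integrable_def)

lemma integrable_rep_mult:
 "sq_integrable h ==> integrable lborel (%x. rep_l2 a x * h x)"
 by (rule sq_integrable_mult[OF sq_integrable_rep])

lemma inner_abs_l2:
 assumes "sq_integrable a" "sq_integrable b"
 shows "inner (abs_l2 a) (abs_l2 b) = (LINT x|lborel. a x * b x)"
 using assms inner_l2.abs_eq[of a b] by (simp add: eq_onp_def)

lemma pairing_eq_inner:
 assumes "sq_integrable h"
 shows "pairing (rep_l2 a) h = inner a (abs_l2 h)"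
 using inner_abs_l2[OF sq_integrable_rep assms, of a] by (simp add: pairing_def)

lemma pairing_commute: "pairing a b = pairing b a"
 by (simp add: pairing_def mult.commute)

lemma norm_abs_l2_sq:
 assumes "sq_integrable a"
 shows "(norm (abs_l2 a))^2 = (LINT x|lborel. (a x)^2)"
 unfolding power2_norm_eq_inner using inner_abs_l2[OF assms assms]
 by (simp add: power2_eq_square)

lemma nn_integral_sq_abs_l2:
 assumes "sq_integrable a"
 shows "(nnint x. (a x)^2) = ennreal ((norm (abs_l2 a))^2)"
 using assms unfolding norm_abs_l2_sq[OF assms]
 by (intro nn_integral_eq_integral) (auto simp: sq_integrable_def)

lemma nn_integral_sq_rep:
 "(nnint x. (rep_l2 a x)^2) = ennreal ((norm a)^2)"
 using nn_integral_sq_abs_l2[OF sq_integrable_rep, of a] by simp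

lemma sq_integrableI_nn:
 assumes [measurable]: "h \<in> Borel"
  and "(nnint x. (h x)^2) < \<infinity>"
 shows "sq_integrable h"
 unfolding sq_integrable_def using assms(2)
 by (auto intro!: integrableI_nonneg)

lemma abs_l2_add:
 "sq_integrable a ==> sq_integrable b ==> abs_l2 (%x. a x + b x) = abs_l2 a + abs_l2 b"
 using plus_l2.abs_eq[of a b] by (simp add: eq_onp_def)

lemma abs_l2_cmult:
 "sq_integrable a ==> abs_l2 (%x. c * a x) = c *\<^sub>R abs_l2 a"
 using scaleR_l2.abs_eq[of a c] by (simp add: eq_onp_def)

lemma sq_integrable_diff:
 "sq_integrable a ==> sq_integrable b ==> sq_integrable (%x. a x - b x)"
 using sq_integrable_add[of a "%x. (-1) * b x"] sq_integrable_cmult[of b "-1"] by simp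

lemma abs_l2_diff:
 assumes "sq_integrable a" "sq_integrable b"
 shows "abs_l2 (%x. a x - b x) = abs_l2 a - abs_l2 b"
 using abs_l2_add[OF assms(1) sq_integrable_cmult[OF assms(2), of "-1"]]
  abs_l2_cmult[OF assms(2), of "-1"] by simp

lemma emeasure_cball_plane_finite: "emeasure lborel (cball (x :: plane) r) < \<infinity>"
 by (rule emeasure_lborel_cball_finite)

lemma measurable_cball_plane [measurable]: "cball (x :: plane) r \<in> sets borel"
 by simp

lemma integrable_dominated:
 fixes h :: "'a => 'b :: {banach, second_countable_topology}" and c :: "'a => real"
 assumes "integrable M c" "h \<in> borel_measurable M" "!!x. norm (h x) <= norm (c x)"
 shows "integrable M h"
 using Bochner_Integration.integrable_bound[OF assms(1,2)] assms(3) by simp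

lemma integrable_bounded_support:
 fixes h :: "plane => 'b :: {banach, second_countable_topology}"
 assumes [measurable]: "h \<in> Borel"
  and "!!x. norm (h x) <= M" "!!x. norm x > r ==> h x = 0"
 shows "integrable lborel h"
proof (rule integrable_dominated)
 show "integrable lborel (%x. M * indicator (cball (0 :: plane) r) x :: real)"
  using emeasure_cball_plane_finite[of 0 r] by simp
 show "norm (h x) <= norm (M * indicator (cball 0 r) x :: real)" for x
   using assms(2)[of x] assms(3)[of x] by (cases "norm x <= r") (auto simp: indicator_def)
qed simp

text \<open>This is how all the test functions below enter the Hilbert space.\<close>

lemma sq_integrable_bounded_support:
 assumes [measurable]: "h \<in> Borel"
  and "!!x. \<bar>h x\<bar> <= M" "!!x. norm x > r ==> h x = 0"
 shows "sq_integrable h"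
 unfolding sq_integrable_def
proof (intro conjI)
 show "integrable lborel (%x. (h x)^2)"
 proof (rule integrable_bounded_support[of _ "M^2" r])
  show "norm ((h x)^2) <= M^2" for x
   using power_mono[OF assms(2)[of x] abs_ge_zero, of 2] by simp
 qed (use assms(3) in auto)
qed simp

text \<open>Convergence of the absolute series \<open>\<Sum> \<bar>x\<^sub>n\<^sub>+\<^sub>1 - x\<^sub>n\<bar>\<close> is tested against the indicators of
 discs, which reduces Riesz-Fischer to the Cauchy-Schwarz inequality and monotone convergence.\<close>

lemma l2_fast_Cauchy_convergent:
 fixes X :: "nat => l2"
 assumes fast: "!!n. norm (X (Suc n) - X n) <= (1/2)^n"
 shows "convergent X"
proof -
 define h where "h n = rep_l2 (X n)" for n
 have [measurable]: "h n \<in> Borel" for n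
  by (simp add: h_def)
 define d where "d n x = \<bar>h (Suc n) x - h n x\<bar>" for n x
 have [measurable]: "d n \<in> Borel" for n
  by (simp add: d_def[abs_def])
 have sqd: "sq_integrable (%x. h (Suc n) x - h n x)" for n
  unfolding h_def by (intro sq_integrable_diff sq_integrable_rep)
 have sqad: "sq_integrable (d n)" for n
  using sqd[of n] by (simp add: sq_integrable_def d_def[abs_def])
 have nd: "norm (abs_l2 (d n)) <= (1/2)^n" for n
 proof -
  have "(norm (abs_l2 (d n)))^2 = (norm (abs_l2 (%x. h (Suc n) x - h n x)))^2"
   unfolding norm_abs_l2_sq[OF sqad] norm_abs_l2_sq[OF sqd] by (simp add: d_def)
  then have "norm (abs_l2 (d n)) = norm (abs_l2 (%x. h (Suc n) x - h n x))"
   by simp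
  also have "abs_l2 (%x. h (Suc n) x - h n x) = X (Suc n) - X n"
   unfolding h_def by (subst abs_l2_diff) (auto simp: sq_integrable_rep)
  finally show ?thesis using fast[of n] by simp
 qed
 have fin: "AE x in lborel. x \<in> cball 0 (real k) --> (\<Sum>n. ennreal (d n x)) < \<infinity>" for k :: nat
 proof -
  let ?i = "%x :: plane. indicator (cball 0 (real k)) x :: real"
  have sqi: "sq_integrable ?i"
   by (rule sq_integrable_bounded_support[of _ 1 "real k"]) (auto simp: indicator_def)
  have int: "integrable lborel (%x. d n x * ?i x)" for n
   by (rule sq_integrable_mult[OF sqad sqi])
  have le: "(nnint x. d n x * ?i x) <= ennreal ((1/2)^n * norm (abs_l2 ?i))" for n
  proof -
   have "(nnint x. d n x * ?i x) = ennreal (inner (abs_l2 (d n)) (abs_l2 ?i))"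
    unfolding inner_abs_l2[OF sqad sqi]
    by (rule nn_integral_eq_integral[OF int]) (auto simp: d_def)
   also have "... <= ennreal (norm (abs_l2 (d n)) * norm (abs_l2 ?i))"
    by (intro ennreal_leI norm_cauchy_schwarz)
   also have "... <= ennreal ((1/2)^n * norm (abs_l2 ?i))"
    using nd[of n] by (intro ennreal_leI mult_right_mono) auto
   finally show ?thesis .
  qed
  have "(\<integral>\<^sup>+ x. (\<Sum>n. ennreal (d n x * ?i x)) \<partial>lborel)
    = (\<Sum>n. nnint x. d n x * ?i x)"
   by (rule nn_integral_suminf) measurable
  also have "... <= (\<Sum>n. ennreal ((1/2)^n * norm (abs_l2 ?i)))"
   by (intro suminf_le le) auto
  also have "... = ennreal (\<Sum>n. (1/2)^n * norm (abs_l2 ?i))"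
   by (intro suminf_ennreal2 summable_mult2) (auto intro: summable_geometric)
  also have "... < \<infinity>" by simp
  finally have "AE x in lborel. (\<Sum>n. ennreal (d n x * ?i x)) ~= \<infinity>"
   by (intro nn_integral_PInf_AE) auto
  then show ?thesis
  proof eventually_elim
   case (elim x)
   then show ?case by (cases "x \<in> cball 0 (real k)") (simp_all add: less_top[symmetric])
  qed
 qed
 have "AE x in lborel. \<forall>k :: nat. x \<in> cball 0 (real k) --> (\<Sum>n. ennreal (d n x)) < \<infinity>"
  using fin by (subst AE_all_countable) auto
 then have conv: "AE x in lborel. convergent (%n. h n x)"
 proof eventually_elim
  case (elim x)
  obtain k :: nat where "norm x <= real k" using real_arch_simple by blast
  with elim have "(\<Sum>n. ennreal (d n x)) < \<infinity>" by (metis mem_cball_0)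
  then have "summable (%n. d n x)"
   using summable_suminf_not_top[of "%n. d n x"] by (simp add: d_def)
  then have "summable (%n. h (Suc n) x - h n x)"
   using summable_rabs_cancel[of "%n. h (Suc n) x - h n x"] by (simp add: d_def)
  then have "convergent (%n. \<Sum>i<n. h (Suc i) x - h i x)"
   by (simp add: summable_iff_convergent)
  then have "convergent (%n. h n x - h 0 x)"
   using sum_lessThan_telescope[of "%i. h i x"] by simp
  then show ?case
   by (simp add: convergent_diff_const_right_iff)
 qed
 define l where "l x = lim (%n. h n x)" for x
 have [measurable]: "l \<in> Borel"
  unfolding l_def[abs_def] by measurable
 have lim: "AE x in lborel. (%n. h n x) ----> l x"
  using conv by eventually_elim (simp add: l_def convergent_LIMSEQ_iff)
 have tail: "norm (X m - X n) <= 2 * (1/2)^n" if "n <= m" for n m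
 proof -
  have "norm (X m - X n) <= 2 * (1/2)^n - 2 * (1/2)^m"
   using that
  proof (induction rule: dec_induct)
   case (step m)
   have "norm (X (Suc m) - X n) <= norm (X (Suc m) - X m) + norm (X m - X n)"
    using norm_triangle_ineq[of "X (Suc m) - X m" "X m - X n"] by simp
   with step fast[of m] show ?case by simp
  qed simp
  also have "... <= 2 * (1/2)^n" by simp
  finally show ?thesis .
 qed
 have fatou: "(nnint x. (l x - h n x)^2) <= ennreal ((2 * (1/2)^n)^2)" for n
 proof -
  have "(nnint x. (l x - h n x)^2)
    = (\<integral>\<^sup>+ x. liminf (%m. ennreal ((h m x - h n x)^2)) \<partial>lborel)"
  proof (rule nn_integral_cong_AE)
   show "AE x in lborel. ennreal ((l x - h n x)^2) = liminf (%m. ennreal ((h m x - h n x)^2))"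
    using lim
   proof eventually_elim
    case (elim x)
    then have "(%m. ennreal ((h m x - h n x)^2)) ----> ennreal ((l x - h n x)^2)"
     by (intro tendsto_ennrealI tendsto_intros)
    then show ?case
     by (metis lim_imp_Liminf sequentially_bot)
   qed
  qed
  also have "... <= liminf (%m. nnint x. (h m x - h n x)^2)"
   by (rule nn_integral_liminf) simp
  also have "... <= ennreal ((2 * (1/2)^n)^2)"
  proof -
   have "(nnint x. (h m x - h n x)^2) <= ennreal ((2 * (1/2)^n)^2)"
    if "n <= m" for m
   proof -
    have "(nnint x. (h m x - h n x)^2) = ennreal ((norm (X m - X n))^2)"
     using nn_integral_sq_abs_l2[of "%x. h m x - h n x"]
     by (simp add: h_def abs_l2_diff sq_integrable_diff sq_integrable_rep)
    also have "... <= ennreal ((2 * (1/2)^n)^2)"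
     by (intro ennreal_leI power_mono tail that norm_ge_zero)
    finally show ?thesis .
   qed
   then have "\<forall>\<^sub>F m in sequentially. (nnint x. (h m x - h n x)^2) <= ennreal ((2 * (1/2)^n)^2)"
    by (auto simp: eventually_sequentially)
   then have "liminf (%m. nnint x. (h m x - h n x)^2) <= liminf (%m. ennreal ((2 * (1/2)^n)^2))"
    by (rule Liminf_mono)
   then show ?thesis by (simp add: Liminf_const)
  qed
  finally show ?thesis .
 qed
 have sq0: "sq_integrable (%x. l x - h n x)" for n
  using fatou[of n] by (intro sq_integrableI_nn) (auto intro: le_less_trans)
 have sql: "sq_integrable l"
  using sq_integrable_add[OF sq0[of 0] sq_integrable_rep[of "X 0"]] by (simp add: h_def)
 have bound: "norm (abs_l2 l - X n) <= 2 * (1/2)^n" for n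
 proof -
  have "abs_l2 (%x. l x - h n x) = abs_l2 l - X n"
   by (simp add: h_def abs_l2_diff sql sq_integrable_rep)
  with nn_integral_sq_abs_l2[OF sq0[of n]] fatou[of n]
  have "(norm (abs_l2 l - X n))^2 <= (2 * (1/2)^n)^2" by simp
  then show ?thesis by (rule power2_le_imp_le) simp
 qed
 have "X ----> abs_l2 l"
 proof (rule LIMSEQ_I)
  fix e :: real assume "0 < e"
  have "(%n. 2 * (1/2 :: real)^n) ----> 2 * 0"
   by (intro tendsto_mult tendsto_const LIMSEQ_realpow_zero) auto
  from order_tendstoD(2)[OF this, of e] obtain N where "!!n. n >= N ==> 2 * (1/2 :: real)^n < e"
   using \<open>0 < e\<close> by (auto simp: eventually_sequentially)
  then show "\<exists>N. \<forall>n\<ge>N. norm (X n - abs_l2 l) < e"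
   using bound by (metis le_less_trans norm_minus_commute)
 qed
 then show ?thesis by (rule convergentI)
qed

instance l2 :: complete_space
proof
 fix X :: "nat => l2" assume X: "Cauchy X"
 have "\<exists>N. \<forall>m\<ge>N. \<forall>n\<ge>N. norm (X m - X n) < (1/2)^k" for k
  using CauchyD[OF X, of "(1/2)^k"] by simp
 then obtain N where N: "!!k m n. m >= N k ==> n >= N k ==> norm (X m - X n) < (1/2)^k"
  by metis
 define r where "r k = (\<Sum>i\<le>k. N i) + k" for k
 have r: "strict_mono r" by (rule strict_monoI_Suc) (simp add: r_def)
 have ge: "r k >= N k" for k
  using member_le_sum[of k "{..k}" N] by (simp add: r_def)
 have ge': "r (Suc k) >= N k" for k
  using member_le_sum[of k "{..Suc k}" N] by (simp add: r_def)
 have "convergent (X \<circ> r)"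
  by (rule l2_fast_Cauchy_convergent) (auto intro!: less_imp_le N ge ge')
 then obtain l where "(X \<circ> r) ----> l" by (auto simp: convergent_def)
 from LIMSEQ_subseq_LIMSEQ[OF _ r] Cauchy_converges_subseq[OF X r this]
 show "convergent X" by (auto simp: convergent_def)
qed

text \<open>Distance minimisation: a minimising sequence is Cauchy by the parallelogram law.\<close>

lemma closed_subspace_orthogonal:
 fixes V :: "l2 set"
 assumes cl: "closed V" and sub: "subspace V" and ne: "V ~= UNIV"
 shows "\<exists>z. z ~= 0 \<and> (\<forall>v\<in>V. inner z v = 0)"
proof -
 obtain x where x: "x \<notin> V" using ne by auto
 define d where "d = (INF v\<in>V. norm (x - v))"
 have V0: "V ~= {}" using subspace_0[OF sub] by auto
 have bdd: "bdd_below ((%v. norm (x - v)) ` V)" by (rule bdd_belowI[of _ 0]) auto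
 have dle: "d <= norm (x - v)" if "v \<in> V" for v
  unfolding d_def by (rule cINF_lower[OF bdd that])
 have d0: "d >= 0" unfolding d_def by (rule cINF_greatest[OF V0]) simp
 have "\<exists>v\<in>V. norm (x - v) < d + 1 / real (Suc n)" for n
  using cINF_less_iff[OF V0 bdd, of "d + 1 / real (Suc n)"] by (simp add: d_def)
 then obtain s where sV: "!!n. s n \<in> V" and s: "!!n. norm (x - s n) < d + 1 / real (Suc n)"
  by metis
 have par: "(norm (s n - s m))^2 <= 2 * (norm (x - s n))^2 + 2 * (norm (x - s m))^2 - 4 * d^2" for n m
 proof -
  let ?a = "x - s n" and ?b = "x - s m"
  have "(1/2) *\<^sub>R (s n + s m) \<in> V"
   using sub sV by (intro subspace_scale subspace_add)
  then have "d <= norm (x - (1/2) *\<^sub>R (s n + s m))" by (rule dle)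
  also have "x - (1/2) *\<^sub>R (s n + s m) = (1/2) *\<^sub>R (?a + ?b)"
   by (simp add: algebra_simps flip: scaleR_add_left)
  finally have "2 * d <= norm (?a + ?b)" by simp
  then have "(2 * d)^2 <= (norm (?a + ?b))^2" using d0 by (intro power_mono) auto
  moreover have "(norm (?a + ?b))^2 + (norm (?a - ?b))^2 = 2 * (norm ?a)^2 + 2 * (norm ?b)^2"
   by (simp add: power2_norm_eq_inner inner_add_left inner_add_right inner_diff_left
     inner_diff_right inner_commute)
  moreover have "norm (?a - ?b) = norm (s n - s m)" by (simp add: norm_minus_commute)
  ultimately show ?thesis by (simp add: power_mult_distrib)
 qed
 have lim: "(%n. norm (x - s n)) ----> d"
 proof (rule tendsto_sandwich[OF _ _ tendsto_const])
  show "\<forall>\<^sub>F n in sequentially. d <= norm (x - s n)" using dle sV by simp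
  show "\<forall>\<^sub>F n in sequentially. norm (x - s n) <= d + 1 / real (Suc n)" using s by (simp add: less_imp_le)
  show "(%n. d + 1 / real (Suc n)) ----> d"
   using tendsto_add[OF tendsto_const[of d] LIMSEQ_inverse_real_of_nat] by (simp add: inverse_eq_divide)
 qed
 have "Cauchy s"
 proof (rule metric_CauchyI)
  fix e :: real assume e: "0 < e"
  have "(%n. 2 * (norm (x - s n))^2) ----> 2 * d^2" by (intro tendsto_intros lim)
  then have "\<forall>\<^sub>F n in sequentially. 2 * (norm (x - s n))^2 < 2 * d^2 + e^2 / 2"
   by (rule order_tendstoD(2)) (use e in simp)
  then obtain N where N: "!!n. n >= N ==> 2 * (norm (x - s n))^2 < 2 * d^2 + e^2 / 2"
   by (auto simp: eventually_sequentially)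
  have "dist (s m) (s n) < e" if "m >= N" "n >= N" for m n
  proof -
   have "(norm (s m - s n))^2 < e^2" using par[of m n] N[OF that(1)] N[OF that(2)] by simp
   then show ?thesis using e by (simp add: dist_norm power2_less_imp_less)
  qed
  then show "\<exists>M. \<forall>m\<ge>M. \<forall>n\<ge>M. dist (s m) (s n) < e" by blast
 qed
 then obtain p where p: "s ----> p" by (auto simp: Cauchy_convergent_iff convergent_def)
 have pV: "p \<in> V" using closed_sequentially[OF cl] sV p by blast
 have pd: "norm (x - p) = d"
  using LIMSEQ_unique[OF lim tendsto_norm[OF tendsto_diff[OF tendsto_const[of x] p]]] by simp
 have orth: "inner (x - p) v = 0" if v: "v \<in> V" for v
 proof (rule ccontr)
  assume nz: "inner (x - p) v ~= 0"
  then have "v ~= 0" by auto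
  define t where "t = inner (x - p) v / (norm v)^2"
  have "p + t *\<^sub>R v \<in> V" using sub pV v by (intro subspace_add subspace_scale)
  then have "d^2 <= (norm (x - (p + t *\<^sub>R v)))^2" using d0 by (intro power_mono dle) auto
  also have "... = d^2 - 2 * t * inner (x - p) v + t^2 * (norm v)^2"
  proof -
   have "x - (p + t *\<^sub>R v) = (x - p) - t *\<^sub>R v" by simp
   then show ?thesis unfolding pd[symmetric] power2_norm_eq_inner
    by (simp add: inner_diff_left inner_diff_right inner_commute power2_eq_square algebra_simps)
  qed
  also have "... = d^2 - (inner (x - p) v)\<^sup>2 / (norm v)^2"
   using \<open>v ~= 0\<close> by (simp add: t_def field_simps power2_eq_square)
  finally show False using nz \<open>v ~= 0\<close> by (simp add: divide_le_0_iff)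
 qed
 show ?thesis using orth pV x by (intro exI[of _ "x - p"]) auto
qed

lemma l2_Riesz_representation:
 fixes F :: "l2 => real"
 assumes F: "bounded_linear F"
 shows "\<exists>z. \<forall>v. F v = inner z v"
proof (cases "\<forall>v. F v = 0")
 case True then show ?thesis by (intro exI[of _ 0]) auto
next
 case False
 interpret F: bounded_linear F by fact
 let ?V = "{v. F v = 0}"
 have "closed ?V"
  using continuous_closed_vimage[of "{0}" F] F.isCont[OF continuous_ident]
  by (simp add: vimage_def)
 moreover have "subspace ?V" by (auto simp: subspace_def F.add F.scaleR F.zero)
 ultimately obtain z where z: "z ~= 0" "!!v. F v = 0 ==> inner z v = 0"
  using closed_subspace_orthogonal[of ?V] False by auto
 have Fz: "F z ~= 0" using z(2)[of z] z(1) by auto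
 have "F v = inner ((F z / (norm z)^2) *\<^sub>R z) v" for v
 proof -
  have "F (v - (F v / F z) *\<^sub>R z) = 0" using Fz by (simp add: F.diff F.scaleR)
  then have "inner z v = (F v / F z) * (norm z)^2"
   using z(2) by (fastforce simp: inner_diff_right power2_norm_eq_inner)
  then show ?thesis using Fz z(1) by (simp add: field_simps)
 qed
 then show ?thesis by blast
qed

subsection \<open>A countable total family\<close>

lemma countable_Int_stable_generator:
 "\<exists>B :: plane set set. countable B \<and> Int_stable B \<and> sets borel = sigma_sets UNIV B \<and> B ~= {}"
proof -
 obtain A :: "plane set set" where A: "countable A" "topological_basis A"
  using ex_countable_basis by blast
 define B where "B = (%F. \<Inter>F) ` {F. finite F \<and> F \<subseteq> A}"
 have cB: "countable B"
  unfolding B_def by (intro countable_image countable_Collect_finite_subset A)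
 have AB: "A \<subseteq> B"
 proof
  fix a assume "a \<in> A"
  then show "a \<in> B" unfolding B_def by (intro image_eqI[of _ _ "{a}"]) auto
 qed
 have "Int_stable B"
 proof (rule Int_stableI)
  fix a b assume "a \<in> B" "b \<in> B"
  then obtain F G where "finite F" "F \<subseteq> A" "finite G" "G \<subseteq> A" "a = \<Inter>F" "b = \<Inter>G"
   by (auto simp: B_def)
  then show "a \<inter> b \<in> B" unfolding B_def by (intro image_eqI[of _ _ "F \<union> G"]) auto
 qed
 moreover have "sets borel = sigma_sets UNIV B"
 proof
  have "sets (borel :: plane measure) = sigma_sets UNIV A"
   by (subst borel_eq_countable_basis[OF A]) (rule sets_measure_of, simp)
  also have "... \<subseteq> sigma_sets UNIV B" by (rule sigma_sets_mono') (rule AB)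
  finally show "sets (borel :: plane measure) \<subseteq> sigma_sets UNIV B" .
  have "open b" if "b \<in> B" for b
   using that topological_basis_open[OF A(2)] by (auto simp: B_def intro!: open_Inter)
  then have "B \<subseteq> sets borel" by auto
  then show "sigma_sets UNIV B \<subseteq> sets (borel :: plane measure)"
   using sets.sigma_sets_subset[of B borel] by simp
 qed
 moreover have "B ~= {}" by (auto simp: B_def)
 ultimately show ?thesis using cB by blast
qed

lemma l2_eq_0_iff_AE: "a = 0 \<longleftrightarrow> (AE x in lborel. rep_l2 a x = 0)"
proof
 have z: "0 = abs_l2 (%x. 0)"
  by (simp add: zero_l2_def)
 show "AE x in lborel. rep_l2 a x = 0" if "a = 0"
  using rep_abs_l2[OF sq_integrable_zero] that z by simp
 show "a = 0" if "AE x in lborel. rep_l2 a x = 0"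
  using abs_l2_cong[OF sq_integrable_rep sq_integrable_zero that] z by simp
qed

lemma sq_integrable_indicator_disc:
 assumes [measurable]: "A \<in> sets borel"
 shows "sq_integrable (indicator (A \<inter> cball 0 r))"
 by (rule sq_integrable_bounded_support[of _ 1 r]) (auto simp: indicator_def)

text \<open>A countable \<open>\<pi>\<close>-system generating the Borel sets suffices: if \<open>a\<close> integrates to zero over the traces
 of its members on all discs, it does so over every bounded Borel set, by Dynkin's argument.\<close>

lemma countable_total_family:
 "\<exists>e :: nat => l2. \<forall>a. (\<forall>k. inner a (e k) = 0) --> a = 0"
proof -
 obtain B :: "plane set set" where B: "countable B" "Int_stable B" "sets borel = sigma_sets UNIV B" "B ~= {}"
  using countable_Int_stable_generator by blast
 define E :: "l2 set" where
  "E = (%(A, n). abs_l2 (indicator (A \<inter> cball 0 (real n)))) ` (insert UNIV B \<times> UNIV)"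
 have E0: "E ~= {}" by (auto simp: E_def)
 have cE: "countable E"
  unfolding E_def using B(1) by (intro countable_image countable_SIGMA) auto
 have E: "range (from_nat_into E) = E" by (rule range_from_nat_into[OF E0 cE])
 have "a = 0" if a: "!!k. inner a (from_nat_into E k) = 0" for a
 proof -
  have aE: "inner a v = 0" if "v \<in> E" for v using that a E by (metis imageE)
  have borelB: "A \<in> sets borel" if "A \<in> B" for A using that B(3) by auto
  let ?I = "%A n. LINT x|lborel. rep_l2 a x * indicator (A \<inter> cball 0 (real n)) x"
  have int: "integrable lborel (%x. rep_l2 a x * indicator (A \<inter> cball 0 (real n)) x)"
   if "A \<in> sets borel" for A n
   by (rule integrable_rep_mult[OF sq_integrable_indicator_disc[OF that]])
  have I0: "?I A n = 0" if "A \<in> insert UNIV B" for A n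
  proof -
   have "A \<in> sets borel" using that borelB by auto
   from pairing_eq_inner[OF sq_integrable_indicator_disc[OF this], of a]
   show ?thesis using aE[of "abs_l2 (indicator (A \<inter> cball 0 (real n)))"] that
    by (force simp: pairing_def E_def)
  qed
  have all: "?I A n = 0" if "A \<in> sets borel" for A n
  proof -
   have Bp: "B \<subseteq> Pow UNIV" by simp
   from that have "A \<in> sigma_sets UNIV B" using B(3) by simp
   then show ?thesis
   proof (induction rule: sigma_sets_induct_disjoint[OF B(2) Bp, consumes 1,
      case_names basic empty compl union])
    case (basic A) then show ?case using I0 by simp
   next
    case empty then show ?case by simp
   next
    case (compl A)
    then have Ab: "A \<in> sets borel" using B(3) by simp
    have "?I (UNIV - A) n = (LINT x|lborel. rep_l2 a x * indicator (UNIV \<inter> cball 0 (real n)) x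
      - rep_l2 a x * indicator (A \<inter> cball 0 (real n)) x)"
     by (intro Bochner_Integration.integral_cong) (auto simp: indicator_def)
    also have "... = ?I UNIV n - ?I A n"
     using int[OF Ab, of n] int[of UNIV n] by (intro Bochner_Integration.integral_diff) auto
    finally show ?case using I0[of UNIV n] compl by simp
   next
    case (union A)
    then have Ab: "!!i. A i \<in> sets borel" using B(3) by auto
    have eq: "?I C n = (LINT x:C|lborel. rep_l2 a x * indicator (cball 0 (real n)) x)" for C
     unfolding set_lebesgue_integral_def
     by (intro Bochner_Integration.integral_cong) (auto simp: indicator_def)
    have "set_integrable lborel (\<Union>i. A i) (%x. rep_l2 a x * indicator (cball 0 (real n)) x)"
     unfolding set_integrable_def
     by (rule Bochner_Integration.integrable_cong[THEN iffD1, OF refl _ int[of "\<Union>i. A i" n]])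
      (use Ab in \<open>auto simp: indicator_def\<close>)
    moreover have "A i \<inter> A j = {}" if "i ~= j" for i j
     using union(1) that by (auto simp: disjoint_family_on_def)
    ultimately have "?I (\<Union>i. A i) n = (\<Sum>i. ?I (A i) n)"
     unfolding eq using Ab by (intro lebesgue_integral_countable_add) auto
    then show ?case using union by simp
   qed
  qed
  have "AE x in lborel. x \<in> cball 0 (real n) --> rep_l2 a x = 0" for n
  proof -
   let ?P = "{x. rep_l2 a x > 0}" and ?N = "{x. rep_l2 a x < 0}"
   have P: "?P \<in> sets borel" and N: "?N \<in> sets borel" by measurable
   have "AE x in lborel. rep_l2 a x * indicator (?P \<inter> cball 0 (real n)) x = 0"
    using integral_nonneg_eq_0_iff_AE[OF int[OF P, of n]] all[OF P, of n]
    by (auto simp: indicator_def)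
   moreover have "AE x in lborel. - (rep_l2 a x * indicator (?N \<inter> cball 0 (real n)) x) = 0"
    using integral_nonneg_eq_0_iff_AE[OF Bochner_Integration.integrable_minus[OF int[OF N, of n]]] all[OF N, of n]
    by (auto simp: indicator_def)
   ultimately show ?thesis
    by eventually_elim (auto simp: indicator_def split: if_splits)
  qed
  then have "AE x in lborel. \<forall>n :: nat. x \<in> cball 0 (real n) --> rep_l2 a x = 0"
   by (subst AE_all_countable) auto
  then have "AE x in lborel. rep_l2 a x = 0"
  proof eventually_elim
   case (elim x)
   obtain n :: nat where "norm x <= real n" using real_arch_simple by blast
   with elim show ?case by auto
  qed
  then show ?thesis by (simp add: l2_eq_0_iff_AE)
 qed
 then show ?thesis by blast
qed

definition total_seq :: "nat => l2" where
 "total_seq = (SOME e. \<forall>a. (\<forall>k. inner a (e k) = 0) --> a = 0)"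

lemma total_seq: "(!!k. inner a (total_seq k) = 0) ==> a = 0"
 unfolding total_seq_def using someI_ex[OF countable_total_family] by blast

lemma closed_subspace_total_UNIV:
 assumes "closed V" "subspace V" "!!k. total_seq k \<in> V"
 shows "V = UNIV"
 using closed_subspace_orthogonal[OF assms(1,2)] total_seq assms(3) by blast

text \<open>The rational combinations of a total sequence are dense, because the closure of their set is a
 subspace without orthogonal complement.\<close>

lemma countable_dense_l2: "\<exists>d :: nat => l2. closure (range d) = UNIV"
proof -
 define comb where "comb l = (\<Sum>(q, k)\<leftarrow>l. real_of_rat q *\<^sub>R total_seq k)" for l :: "(rat \<times> nat) list"
 let ?D = "range comb"
 have app: "comb (l @ l') = comb l + comb l'" for l l' by (simp add: comb_def)
 have sc: "comb (map (%(p, k). (q * p, k)) l) = real_of_rat q *\<^sub>R comb l" for q l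
  by (induction l) (auto simp: comb_def scaleR_add_right of_rat_mult)
 have sub: "subspace (closure ?D)"
  unfolding subspace_def
 proof (intro conjI ballI allI)
  have "comb [] = 0" by (simp add: comb_def)
  then show "0 \<in> closure ?D" by (metis closure_subset rangeI subsetD)
 next
  fix x y assume "x \<in> closure ?D" "y \<in> closure ?D"
  then obtain f g where fg: "!!n. f n \<in> ?D" "f ----> x" "!!n. g n \<in> ?D" "g ----> y"
   unfolding closure_sequential by blast
  have "f n + g n \<in> ?D" for n
  proof -
   obtain a b where "f n = comb a" "g n = comb b" using fg(1,3)[of n] by blast
   then show ?thesis using app[of a b] by (metis rangeI)
  qed
  moreover have "(%n. f n + g n) ----> x + y" by (intro tendsto_intros fg)
  ultimately show "x + y \<in> closure ?D" unfolding closure_sequential by (intro exI[of _ "%n. f n + g n"]) auto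
 next
  fix c :: real and x assume "x \<in> closure ?D"
  then obtain f where f: "!!n. f n \<in> ?D" "f ----> x" unfolding closure_sequential by blast
  have "c \<in> closure (\<rat> :: real set)"
   by (simp add: Rats_closure_real)
  then obtain q where "(\<forall>n. q n \<in> \<rat>) \<and> q ----> c" unfolding closure_sequential by blast
  then have q: "!!n. q n \<in> \<rat>" "q ----> c" by auto
  have "q n *\<^sub>R f n \<in> ?D" for n
  proof -
   obtain a where a: "f n = comb a" using f(1)[of n] by blast
   obtain p where "q n = real_of_rat p" using q(1)[of n] by (auto elim: Rats_cases)
   with a show ?thesis using sc[of p a] by (metis rangeI)
  qed
  moreover have "(%n. q n *\<^sub>R f n) ----> c *\<^sub>R x" by (intro tendsto_intros f q)
  ultimately show "c *\<^sub>R x \<in> closure ?D" unfolding closure_sequential by (intro exI[of _ "%n. q n *\<^sub>R f n"]) auto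
 qed
 have "total_seq k \<in> closure ?D" for k
 proof -
  have "comb [(1, k)] = total_seq k" by (simp add: comb_def)
  then show ?thesis by (metis closure_subset rangeI subsetD)
 qed
 then have "closure ?D = UNIV" by (intro closed_subspace_total_UNIV sub) auto
 moreover have "range (from_nat_into ?D) = ?D" by (rule range_from_nat_into) auto
 ultimately show ?thesis by metis
qed

subsection \<open>Weak convergence\<close>

definition wconv :: "(nat => l2) => l2 => bool" where
 "wconv X x \<longleftrightarrow> (\<forall>v. (%n. inner (X n) v) ----> inner x v)"

lemma wconvD: "wconv X x ==> (%n. inner (X n) v) ----> inner x v"
 by (simp add: wconv_def)

lemma wconv_of_tendsto: "X ----> x ==> wconv X x"
 unfolding wconv_def by (intro allI tendsto_inner) auto

lemma wconv_subseq: "wconv X x ==> strict_mono r ==> wconv (X \<circ> r) x"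
 unfolding wconv_def using LIMSEQ_subseq_LIMSEQ by (fastforce simp: o_def)

lemma wconv_unique: "wconv X x ==> wconv X y ==> x = y"
 by (rule vector_eq_rdot[THEN iffD1]) (blast intro: LIMSEQ_unique dest: wconvD)

lemma wconv_norm_le:
 assumes "wconv X x" "!!n. norm (X n) <= R"
 shows "norm x <= R"
proof (cases "x = 0")
 case True then show ?thesis using order_trans[OF norm_ge_zero assms(2)[of 0]] by simp
next
 case False
 have "inner (X n) x <= R * norm x" for n
  using norm_cauchy_schwarz[of "X n" x] mult_right_mono[OF assms(2)[of n], of "norm x"] by simp
 then have "inner x x <= R * norm x" by (intro LIMSEQ_le_const2[OF wconvD[OF assms(1)]]) auto
 then show ?thesis using False by (simp add: power2_norm_eq_inner[symmetric] power2_eq_square)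
qed

lemma bounded_inner_limits_closed_subspace:
 fixes X :: "nat => l2"
 assumes R: "!!n. norm (X n) <= R"
 shows "closed {v. convergent (%n. inner (X n) v)}" "subspace {v. convergent (%n. inner (X n) v)}"
proof -
 have R0: "R >= 0" using R[of 0] norm_ge_zero order_trans by blast
 show "closed {v. convergent (%n. inner (X n) v)}"
  unfolding closed_sequential_limits
 proof (intro allI impI, elim conjE)
  fix V v assume V: "\<forall>k :: nat. V k \<in> {v. convergent (%n. inner (X n) v)}" and lim: "V ----> v"
  have "Cauchy (%n. inner (X n) v)"
  proof (rule metric_CauchyI)
   fix e :: real assume e: "0 < e"
   from lim have "\<forall>\<^sub>F k in sequentially. norm (V k - v) < e / (4 * (R + 1))"
    using e R0 by (auto simp: tendsto_iff dist_norm)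
   then obtain k where k: "norm (V k - v) < e / (4 * (R + 1))" by (auto simp: eventually_sequentially)
   have close: "\<bar>inner (X n) v - inner (X n) (V k)\<bar> <= e / 4" for n
   proof -
    have "\<bar>inner (X n) v - inner (X n) (V k)\<bar> <= norm (X n) * norm (V k - v)"
     using Cauchy_Schwarz_ineq2[of "X n" "v - V k"] by (simp add: inner_diff_right norm_minus_commute)
    also have "... <= (R + 1) * (e / (4 * (R + 1)))"
     using R[of n] k R0 by (intro mult_mono) auto
    also have "... = e / 4"
    proof -
     have "R + 1 ~= 0" using R0 by simp
     then show ?thesis by (simp add: divide_simps)
    qed
    finally show ?thesis .
   qed
   have "Cauchy (%n. inner (X n) (V k))" using V by (simp add: Cauchy_convergent_iff)
   then obtain M where M: "!!m n. m >= M ==> n >= M ==> \<bar>inner (X m) (V k) - inner (X n) (V k)\<bar> < e / 4"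
    using e by (metis metric_CauchyD dist_real_def zero_less_divide_iff zero_less_numeral)
   have "dist (inner (X m) v) (inner (X n) v) < e" if "m >= M" "n >= M" for m n
    using close[of m] close[of n] M[OF that] e unfolding dist_real_def by linarith
   then show "\<exists>M. \<forall>m\<ge>M. \<forall>n\<ge>M. dist (inner (X m) v) (inner (X n) v) < e" by blast
  qed
  then show "v \<in> {v. convergent (%n. inner (X n) v)}" by (simp add: Cauchy_convergent_iff)
 qed
 show "subspace {v. convergent (%n. inner (X n) v)}"
  unfolding subspace_def by (auto simp: inner_add_right intro!: convergent_add convergent_mult convergent_const)
qed

text \<open>The limits on the total family determine a bounded functional; its Riesz representative is
 the weak limit.\<close>

lemma wconv_if_total_convergent:
 fixes X :: "nat => l2"
 assumes R: "!!n. norm (X n) <= R" and conv: "!!k. convergent (%n. inner (X n) (total_seq k))"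
 shows "\<exists>x. wconv X x"
proof -
 have all: "convergent (%n. inner (X n) v)" for v
  using closed_subspace_total_UNIV[OF bounded_inner_limits_closed_subspace[where X = X, OF R]] conv by auto
 define F where "F v = lim (%n. inner (X n) v)" for v
 have F: "(%n. inner (X n) v) ----> F v" for v
  using all by (simp add: F_def convergent_LIMSEQ_iff)
 have "bounded_linear F"
 proof (rule bounded_linear_intro[of _ R])
  show "F (x + y) = F x + F y" for x y
   by (rule LIMSEQ_unique[OF F]) (simp add: inner_add_right tendsto_add F)
  show "F (r *\<^sub>R x) = r *\<^sub>R F x" for r x
   by (rule LIMSEQ_unique[OF F]) (simp add: tendsto_mult_left F)
  show "norm (F x) <= norm x * R" for x
  proof (rule LIMSEQ_le_const2[OF tendsto_norm[OF F]])
   show "\<exists>N. \<forall>n\<ge>N. norm (inner (X n) x) <= norm x * R"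
   proof (intro exI[of _ 0] allI impI)
    fix n show "norm (inner (X n) x) <= norm x * R"
     using Cauchy_Schwarz_ineq2[of "X n" x] mult_right_mono[OF R[of n], of "norm x"]
     by (simp add: mult.commute)
   qed
  qed
 qed
 then obtain z where "!!v. F v = inner z v" using l2_Riesz_representation by blast
 with F show ?thesis unfolding wconv_def by auto
qed

lemma wconvI_total:
 fixes X :: "nat => l2"
 assumes R: "!!n. norm (X n) <= R"
  and conv: "!!k. (%n. inner (X n) (total_seq k)) ----> inner x (total_seq k)"
 shows "wconv X x"
proof -
 have "convergent (%n. inner (X n) (total_seq k))" for k
  using conv by (auto simp: convergent_def)
 from wconv_if_total_convergent[of X, OF R this] obtain y where y: "wconv X y" by blast
 have "y - x = 0"
 proof (rule total_seq)
  show "inner (y - x) (total_seq k) = 0" for k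
   using LIMSEQ_unique[OF conv wconvD[OF y]] by (simp add: inner_diff_left)
 qed
 then show ?thesis using y by simp
qed

text \<open>A diagonal argument over the total sequence.\<close>

lemma bounded_wconv_subseq:
 fixes X :: "nat => l2"
 assumes R: "!!n. norm (X n) <= R"
 shows "\<exists>r x. strict_mono r \<and> wconv (X \<circ> r) x"
proof -
 let ?P = "%k r. convergent (%n. inner (X (r n)) (total_seq k))"
 interpret subseqs ?P
 proof
  fix k and s :: "nat => nat" assume "strict_mono s"
  have "bounded (range (%n. inner (X (s n)) (total_seq k)))"
  proof (rule boundedI)
   fix y assume "y \<in> range (%n. inner (X (s n)) (total_seq k))"
   then obtain n where y: "y = inner (X (s n)) (total_seq k)" by auto
   show "norm y <= R * norm (total_seq k)"
    unfolding y using Cauchy_Schwarz_ineq2[of "X (s n)" "total_seq k"]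
     mult_right_mono[OF R[of "s n"], of "norm (total_seq k)"] by simp
  qed
  from bounded_imp_convergent_subsequence[OF this]
  show "\<exists>r. strict_mono r \<and> ?P k (s \<circ> r)" by (auto simp: o_def convergent_def)
 qed
 have "?P k diagseq" for k
 proof -
  have "?P k (diagseq \<circ> (+) (Suc k))"
  proof (rule diagseq_holds)
   fix r s :: "nat => nat" and n assume "strict_mono r" "?P n s"
   then show "?P n (s \<circ> r)" using convergent_subseq_convergent by (fastforce simp: o_def)
  qed
  then have "convergent (%n. inner (X (diagseq (n + Suc k))) (total_seq k))"
   by (simp add: o_def add.commute)
  then show ?thesis
   using convergent_ignore_initial_segment[of "%n. inner (X (diagseq n)) (total_seq k)" "Suc k"] by simp
 qed
 then obtain x where "wconv (X \<circ> diagseq) x"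
  using wconv_if_total_convergent[of "X \<circ> diagseq" R] R by auto
 then show ?thesis using subseq_diagseq by blast
qed

section \<open>Weak compactness of sets of measures\<close>

text \<open>By separability the norm Borel sets are generated by the linear functionals.\<close>

lemma measurable_into_l2:
 fixes h :: "'a => l2"
 assumes h: "!!v. (%x. inner (h x) v) \<in> borel_measurable M"
 shows "h \<in> borel_measurable M"
proof (rule borel_measurableI)
 fix U :: "l2 set" assume U: "open U"
 obtain d :: "nat => l2" where d: "closure (range d) = UNIV"
  using countable_dense_l2 by blast
 have near: "\<exists>k. norm (y - d k) < e" if e: "e > 0" for y e
 proof -
  have "y \<in> closure (range d)" using d by simp
  then obtain k where "dist (d k) y < e" using e by (auto simp: closure_approachable)
  then show ?thesis by (auto simp: dist_norm norm_minus_commute)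
 qed
 have norm_iff: "norm v <= q \<longleftrightarrow> (\<forall>k. inner v (d k) <= q * norm (d k))" if q: "0 <= q" for v q
 proof
  assume nv: "norm v <= q"
  show "\<forall>k. inner v (d k) <= q * norm (d k)"
  proof
   fix k show "inner v (d k) <= q * norm (d k)"
    using norm_cauchy_schwarz[of v "d k"] mult_right_mono[OF nv, of "norm (d k)"] by simp
  qed
 next
  assume a: "\<forall>k. inner v (d k) <= q * norm (d k)"
  have "\<exists>k. norm (v - d k) < 1 / real (Suc n)" for n by (rule near) simp
  then obtain k where k: "!!n. norm (v - d (k n)) < 1 / real (Suc n)" by metis
  have "(%n. norm (d (k n) - v)) ----> 0"
  proof (rule tendsto_sandwich[OF _ _ tendsto_const LIMSEQ_inverse_real_of_nat])
   show "\<forall>\<^sub>F n in sequentially. norm (d (k n) - v) <= inverse (real (Suc n))"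
    using k by (simp add: norm_minus_commute less_imp_le inverse_eq_divide)
  qed simp
  then have lim: "(%n. d (k n)) ----> v"
   by (simp add: tendsto_norm_zero_iff LIM_zero_iff)
  have "inner v v <= q * norm v"
  proof (rule LIMSEQ_le)
   show "(%n. inner v (d (k n))) ----> inner v v" by (intro tendsto_intros lim)
   show "(%n. q * norm (d (k n))) ----> q * norm v" by (intro tendsto_intros lim)
  qed (use a in auto)
  then have "norm v * norm v <= q * norm v" by (simp add: power2_norm_eq_inner[symmetric] power2_eq_square)
  then show "norm v <= q" using q by (cases "v = 0") auto
 qed
 have ball: "{x \<in> space M. norm (h x - d k) <= q} \<in> sets M" if "0 <= q" for k q
 proof -
  have "{x \<in> space M. norm (h x - d k) <= q}
    = {x \<in> space M. \<forall>j. inner (h x) (d j) - inner (d k) (d j) <= q * norm (d j)}"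
   using norm_iff[OF that] by (simp add: inner_diff_left)
  also have "... \<in> sets M" using h by measurable
  finally show ?thesis .
 qed
 define I where "I = {(k, q). q \<in> \<rat> \<and> 0 <= q \<and> cball (d k) q \<subseteq> U}"
 have cI: "countable I"
  by (rule countable_subset[of _ "UNIV \<times> \<rat>"]) (auto simp: I_def intro: countable_rat)
 have "h -` U \<inter> space M = (\<Union>(k, q)\<in>I. {x \<in> space M. norm (h x - d k) <= q})"
 proof (intro equalityI subsetI)
  fix x assume x: "x \<in> h -` U \<inter> space M"
  then obtain r where r: "r > 0" "ball (h x) r \<subseteq> U" using U by (auto simp: open_contains_ball)
  obtain q where q: "q \<in> \<rat>" "r / 4 < q" "q < r / 2" using Rats_dense_in_real[of "r/4" "r/2"] r by auto
  obtain k where k: "norm (h x - d k) < r / 4" using near[of "r/4" "h x"] r by auto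
  have "cball (d k) q \<subseteq> ball (h x) r"
  proof
   fix y assume "y \<in> cball (d k) q"
   then have "dist (d k) y <= q" by simp
   moreover have "dist (h x) (d k) < r / 4" using k by (simp add: dist_norm)
   ultimately have "dist (h x) y < r" using dist_triangle[of "h x" y "d k"] q r by linarith
   then show "y \<in> ball (h x) r" by simp
  qed
  then have "(k, q) \<in> I" using r q unfolding I_def by auto
  moreover have "norm (h x - d k) <= q" "x \<in> space M" using k q x by auto
  ultimately show "x \<in> (\<Union>(k, q)\<in>I. {x \<in> space M. norm (h x - d k) <= q})"
   by (intro UN_I[of "(k, q)"]) auto
 next
  fix x assume "x \<in> (\<Union>(k, q)\<in>I. {x \<in> space M. norm (h x - d k) <= q})"
  then obtain k q where "(k, q) \<in> I" "x \<in> space M" "norm (h x - d k) <= q" by auto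
  then show "x \<in> h -` U \<inter> space M" by (auto simp: I_def dist_norm norm_minus_commute)
 qed
 also have "... \<in> sets M"
  using ball by (intro sets.countable_UN'[OF cI]) (auto simp: I_def)
 finally show "h -` U \<inter> space M \<in> sets M" .
qed

subsection \<open>Coding points of the Hilbert space by real numbers\<close>

text \<open>The comparisons of the coordinates with rational numbers form a binary sequence, which is
 read as a ternary expansion. Reading it in base three makes each digit a locally constant
 function of the code, so that on bounded sets the code determines its point continuously for the
 weak topology, although it is not itself weakly continuous.\<close>

definition code_bit :: "nat => l2 => real" where
 "code_bit n W = (case from_nat n :: nat \<times> rat of (k, q) =>
  if inner W (total_seq k) <= of_rat q then 1 else 0)"

definition code :: "l2 => real" where
 "code W = (\<Sum>n. code_bit n W * (1/3)^n)"

lemma code_bit_cases: "code_bit n W = 0 \<or> code_bit n W = 1"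
 by (auto simp: code_bit_def split: prod.splits)

lemma summable_code: "summable (%n. code_bit n W * (1/3)^n)"
proof (rule summable_comparison_test')
 show "summable (%n. (1/3 :: real)^n)" by (simp add: summable_geometric)
 show "norm (code_bit n W * (1/3)^n) <= (1/3)^n" for n
  using code_bit_cases[of n W] by auto
qed

lemma code_range: "0 <= code W" "code W <= 3/2"
proof -
 show "0 <= code W"
  unfolding code_def using code_bit_cases[of _ W]
  by (intro suminf_nonneg summable_code) (metis mult_nonneg_nonneg order_refl zero_le_one zero_le_power zero_le_divide_1_iff zero_le_numeral)
 have "code W <= (\<Sum>n. (1/3 :: real)^n)"
  unfolding code_def
 proof (intro suminf_le summable_code summable_geometric)
  show "code_bit n W * (1/3)^n <= (1/3)^n" for n
   using code_bit_cases[of n W] by auto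
 qed simp
 then show "code W <= 3/2" by (simp add: suminf_geometric)
qed

lemma measurable_inner_l2 [measurable]: "(%W :: l2. inner W v) \<in> Borel"
 by (intro borel_measurable_continuous_onI continuous_intros)

lemma measurable_code_bit [measurable]: "code_bit n \<in> Borel"
proof -
 obtain k :: nat and q :: rat where "from_nat n = (k, q)" by fastforce
 then have "code_bit n = (%W. if inner W (total_seq k) <= of_rat q then 1 else 0)"
  by (simp add: code_bit_def[abs_def])
 then show ?thesis by simp
qed

lemma measurable_code [measurable]: "code \<in> Borel"
 unfolding code_def[abs_def] by measurable

text \<open>Two codes that differ first in digit \<open>m\<close> are at least \<open>(1/3)^m / 2\<close> apart, as the digits are \<open>0\<close> or \<open>1\<close>.\<close>

lemma code_bits_eq:
 assumes d: "\<bar>code v - code w\<bar> < (1/3)^N / 2" and "n <= N"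
 shows "code_bit n v = code_bit n w"
proof (rule ccontr)
 assume ne: "code_bit n v ~= code_bit n w"
 define m where "m = (LEAST n. code_bit n v ~= code_bit n w)"
 have m: "code_bit m v ~= code_bit m w" using ne unfolding m_def by (rule LeastI)
 have lt: "code_bit i v = code_bit i w" if "i < m" for i
  using not_less_Least[of i] that unfolding m_def by blast
 have mN: "m <= N" using Least_le[of "%n. code_bit n v ~= code_bit n w", OF ne] \<open>n <= N\<close> by (simp add: m_def)
 define t where "t i = (code_bit i v - code_bit i w) * (1/3)^i" for i
 have st: "summable t"
  using summable_diff[OF summable_code[of v] summable_code[of w]]
  by (simp add: t_def[abs_def] left_diff_distrib)
 have "code v - code w = suminf t"
  unfolding code_def using suminf_diff[OF summable_code[of v] summable_code[of w]]
  by (simp add: t_def[abs_def] left_diff_distrib)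
 also have "... = (\<Sum>i. t (i + Suc m)) + (\<Sum>i<Suc m. t i)"
  by (rule suminf_split_initial_segment[OF st])
 also have "(\<Sum>i<Suc m. t i) = t m" using lt by (simp add: t_def)
 finally have eq: "code v - code w = (\<Sum>i. t (i + Suc m)) + t m" .
 have tm: "\<bar>t m\<bar> = (1/3)^m"
  using m code_bit_cases[of m v] code_bit_cases[of m w] by (auto simp: t_def)
 have sg: "summable (%i. (1/3 :: real)^(i + Suc m))"
  unfolding power_add by (intro summable_mult2 summable_geometric) simp
 have "\<bar>\<Sum>i. t (i + Suc m)\<bar> <= (\<Sum>i. (1/3)^(i + Suc m))"
 proof -
  have b: "\<bar>t i\<bar> <= (1/3)^i" for i
   using code_bit_cases[of i v] code_bit_cases[of i w] by (auto simp: t_def)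
  have sa: "summable (%i. \<bar>t (i + Suc m)\<bar>)"
   by (rule summable_comparison_test'[OF sg, of 0]) (unfold real_norm_def abs_idempotent, rule b)
  have "\<bar>\<Sum>i. t (i + Suc m)\<bar> <= (\<Sum>i. \<bar>t (i + Suc m)\<bar>)" by (rule summable_rabs[OF sa])
  also have "... <= (\<Sum>i. (1/3)^(i + Suc m))" by (intro suminf_le b sa sg)
  finally show ?thesis .
 qed
 also have "... = (1/3)^m / 2"
 proof -
  have "(\<Sum>i. (1/3 :: real)^(i + Suc m)) = (\<Sum>i. (1/3)^i) * (1/3)^Suc m"
   unfolding power_add by (rule suminf_mult2[symmetric]) (simp add: summable_geometric)
  then show ?thesis by (simp add: suminf_geometric)
 qed
 finally have "(1/3 :: real)^m / 2 <= \<bar>code v - code w\<bar>" using eq tm by linarith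
 moreover have "(1/3 :: real)^N <= (1/3)^m" using mN by (intro power_decreasing) auto
 ultimately show False using d by linarith
qed

text \<open>Equal digits up to a large index place corresponding coordinates in the same rational intervals.\<close>

lemma wconv_if_code_close:
 assumes RX: "!!n. norm (X n) <= R" and RY: "!!n. norm (Y n) <= R"
  and d: "(%n. code (X n) - code (Y n)) ----> 0" and X: "wconv X x"
 shows "wconv Y x"
proof (rule wconvI_total[OF RY])
 fix k
 let ?a = "inner x (total_seq k)"
 have same: "\<forall>\<^sub>F n in sequentially. inner (X n) (total_seq k) <= of_rat q \<longleftrightarrow> inner (Y n) (total_seq k) <= of_rat q" for q
 proof -
  define N where "N = to_nat (k, q)"
  have "\<forall>\<^sub>F n in sequentially. dist (code (X n) - code (Y n)) 0 < (1/3)^N / 2"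
   using tendstoD[OF d, of "(1/3)^N / 2"] by simp
  then show ?thesis
  proof eventually_elim
   case (elim n)
   then have "code_bit N (X n) = code_bit N (Y n)" by (intro code_bits_eq[of _ _ N]) auto
   then show ?case by (auto simp: code_bit_def N_def split: if_splits)
  qed
 qed
 show "(%n. inner (Y n) (total_seq k)) ----> ?a"
 proof (rule order_tendstoI)
  fix l assume "l < ?a"
  then obtain q where q: "l < of_rat q" "of_rat q < ?a" using of_rat_dense by blast
  from order_tendstoD(1)[OF wconvD[OF X] q(2)] same[of q]
  show "\<forall>\<^sub>F n in sequentially. l < inner (Y n) (total_seq k)"
   by eventually_elim (use q in auto)
 next
  fix u assume "?a < u"
  then obtain q where q: "?a < of_rat q" "of_rat q < u" using of_rat_dense by blast
  from order_tendstoD(2)[OF wconvD[OF X] q(1)] same[of q]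
  show "\<forall>\<^sub>F n in sequentially. inner (Y n) (total_seq k) < u"
   by eventually_elim (use q in auto)
 qed
qed

text \<open>A point of the closure of the codes of a ball may fail to be a code itself; it still determines
 the weak limit of the points whose codes approach it.\<close>

definition decodes :: "real => real => l2 => bool" where
 "decodes R y W \<longleftrightarrow> (\<exists>X. (\<forall>n. norm (X n) <= R) \<and> (%n. code (X n)) ----> y \<and> wconv X W)"

lemma decodes_norm_le: "decodes R y W ==> norm W <= R"
 unfolding decodes_def using wconv_norm_le by blast

lemma decodes_continuous:
 assumes dn: "!!n. decodes R (y n) (w n)" and y: "y ----> z" and dz: "decodes R z W"
 shows "wconv w W"
proof -
 have "\<exists>v. norm v <= R \<and> \<bar>code v - y n\<bar> < 1 / real (Suc n) \<and>
   (\<forall>k\<le>n. \<bar>inner v (total_seq k) - inner (w n) (total_seq k)\<bar> < 1 / real (Suc n))" for n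
 proof -
  obtain X where X: "!!i. norm (X i) <= R" "(%i. code (X i)) ----> y n" "wconv X (w n)"
   using dn[of n] by (auto simp: decodes_def)
  have "\<forall>\<^sub>F i in sequentially. \<forall>k\<in>{..n}. \<bar>inner (X i) (total_seq k) - inner (w n) (total_seq k)\<bar> < 1 / real (Suc n)"
  proof (rule eventually_ball_finite)
   show "\<forall>k\<in>{..n}. \<forall>\<^sub>F i in sequentially. \<bar>inner (X i) (total_seq k) - inner (w n) (total_seq k)\<bar> < 1 / real (Suc n)"
    using tendstoD[OF wconvD[OF X(3)], of "1 / real (Suc n)"] by (simp add: dist_real_def)
  qed simp
  moreover have "\<forall>\<^sub>F i in sequentially. \<bar>code (X i) - y n\<bar> < 1 / real (Suc n)"
   using tendstoD[OF X(2), of "1 / real (Suc n)"] by (simp add: dist_real_def)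
  ultimately have "\<forall>\<^sub>F i in sequentially. \<bar>code (X i) - y n\<bar> < 1 / real (Suc n) \<and>
   (\<forall>k\<in>{..n}. \<bar>inner (X i) (total_seq k) - inner (w n) (total_seq k)\<bar> < 1 / real (Suc n))"
   by eventually_elim simp
  then obtain i where "\<bar>code (X i) - y n\<bar> < 1 / real (Suc n) \<and>
   (\<forall>k\<in>{..n}. \<bar>inner (X i) (total_seq k) - inner (w n) (total_seq k)\<bar> < 1 / real (Suc n))"
   by (auto simp: eventually_sequentially)
  with X(1)[of i] show ?thesis by auto
 qed
 then obtain V where V: "!!n. norm (V n) <= R" "!!n. \<bar>code (V n) - y n\<bar> < 1 / real (Suc n)"
  "!!n k. k <= n ==> \<bar>inner (V n) (total_seq k) - inner (w n) (total_seq k)\<bar> < 1 / real (Suc n)"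
  by metis
 have small: "a ----> 0" if "!!n. n >= N ==> \<bar>a n\<bar> < 1 / real (Suc n)" for a :: "nat => real" and N
 proof (rule tendsto_rabs_zero_cancel, rule tendsto_sandwich[OF _ _ tendsto_const LIMSEQ_inverse_real_of_nat])
  show "\<forall>\<^sub>F n in sequentially. \<bar>a n\<bar> <= inverse (real (Suc n))"
   using that by (auto simp: eventually_sequentially inverse_eq_divide intro!: exI[of _ N] less_imp_le)
 qed simp
 obtain X where X: "!!i. norm (X i) <= R" "(%i. code (X i)) ----> z" "wconv X W"
  using dz by (auto simp: decodes_def)
 have "(%n. code (X n) - y n - (code (V n) - y n)) ----> z - z - 0"
  by (intro tendsto_diff X y small[of 0]) (rule V(2))
 then have "wconv V W"
  by (intro wconv_if_code_close[OF X(1) V(1) _ X(3)]) simp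
 show ?thesis
 proof (rule wconvI_total)
  show "norm (w n) <= R" for n by (rule decodes_norm_le[OF dn])
  fix k
  have "(%n. inner (V n) (total_seq k) - (inner (V n) (total_seq k) - inner (w n) (total_seq k)))
    ----> inner W (total_seq k) - 0"
   by (intro tendsto_diff wconvD[OF \<open>wconv V W\<close>] small[of k] V(3))
  then show "(%n. inner (w n) (total_seq k)) ----> inner W (total_seq k)" by simp
 qed
qed

lemma decodes_unique:
 assumes "decodes R y v" "decodes R y w"
 shows "v = w"
 using decodes_continuous[of R "%_. y" "%_. v" y w] assms
 by (intro wconv_unique[of "%_. v"]) (auto simp: wconv_def)

lemma decodes_code: "norm W <= R ==> decodes R (code W) W"
 unfolding decodes_def by (intro exI[of _ "%_. W"]) (auto simp: wconv_def)

lemma decodes_exists: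
 assumes "y \<in> closure (code ` cball 0 R)"
 shows "\<exists>W. decodes R y W"
proof -
 obtain c where "\<forall>n. c n \<in> code ` cball 0 R" and c: "c ----> y"
  using assms unfolding closure_sequential by blast
 then have "\<forall>n. \<exists>v. norm v <= R \<and> c n = code v" by (metis image_iff mem_cball_0)
 then obtain X where X: "!!n. norm (X n) <= R" "!!n. c n = code (X n)" by metis
 obtain r x where r: "strict_mono r" "wconv (X \<circ> r) x" using bounded_wconv_subseq[of X, OF X(1)] by blast
 have "(%n. code ((X \<circ> r) n)) ----> y" using LIMSEQ_subseq_LIMSEQ[OF c r(1)] X(2) by (simp add: o_def)
 then show ?thesis unfolding decodes_def using r X(1) by (intro exI[of _ x] exI[of _ "X \<circ> r"]) auto
qed

subsection \<open>Sequential compactness of probability measures on a ball\<close>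

definition wcont_on_ball :: "real => (l2 => real) => bool" where
 "wcont_on_ball R F \<longleftrightarrow>
  (\<forall>X x. (\<forall>n. norm (X n) <= R) \<and> wconv X x --> (%n. F (X n)) ----> F x)"

lemma wcont_on_ballD:
 "wcont_on_ball R F ==> (!!n. norm (X n) <= R) ==> wconv X x ==> (%n. F (X n)) ----> F x"
 by (simp add: wcont_on_ball_def)

lemma wcont_on_ball_bounded:
 assumes "wcont_on_ball R F"
 shows "\<exists>K\<ge>0. \<forall>x. norm x <= R --> \<bar>F x\<bar> <= K"
proof (rule ccontr)
 assume "\<not> ?thesis"
 then have "\<forall>n :: nat. \<exists>x. norm x <= R \<and> \<bar>F x\<bar> > real n" by (meson not_le of_nat_0_le_iff)
 then obtain X where X: "!!n. norm (X n) <= R" "!!n :: nat. \<bar>F (X n)\<bar> > real n" by metis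
 obtain r x where r: "strict_mono r" "wconv (X \<circ> r) x" using bounded_wconv_subseq[of X, OF X(1)] by blast
 have "(%n. F ((X \<circ> r) n)) ----> F x" by (intro wcont_on_ballD[OF assms _ r(2)]) (use X in auto)
 then have "Bseq (%n. F ((X \<circ> r) n))" by (intro convergent_imp_Bseq) (auto simp: convergent_def)
 then obtain K where K: "!!n. \<bar>F (X (r n))\<bar> <= K" by (auto simp: Bseq_def)
 obtain n :: nat where "K < real n" using reals_Archimedean2 by blast
 also have "real n <= real (r n)" using seq_suble[OF r(1)] by simp
 also have "... < \<bar>F (X (r n))\<bar>" by (rule X)
 finally show False using K[of n] by simp
qed

text \<open>The images of the measures under the code are probability measures on a bounded interval, for
 which Helly's theorem gives a weakly convergent subsequence. Its limit is carried by the closure \<open>C\<close>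
 of the codes of the ball and is transported back by decoding. A weakly continuous function of
 the decoded point is continuous on \<open>C\<close>, so Tietze's theorem turns it into a continuous
 function of the code. This avoids metrising the weak topology.\<close>

theorem weak_compactness_probability:
 fixes \<mu> :: "nat => l2 measure"
 assumes \<mu>: "!!n. borel_probability (\<mu> n)" and R: "!!n. AE W in \<mu> n. norm W <= R" and R0: "0 <= R"
 shows "\<exists>r \<mu>0. strict_mono r \<and> borel_probability \<mu>0 \<and> (AE W in \<mu>0. norm W <= R) \<and>
  (\<forall>F. F \<in> Borel \<and> wcont_on_ball R F -->
   (%n. LINT W|\<mu> (r n). F W) ----> (LINT W|\<mu>0. F W))"
proof -
 have prob: "prob_space (\<mu> n)" and sets[measurable_cong]: "sets (\<mu> n) = sets borel" for n
  using \<mu>[of n] by (auto simp: borel_probability_def)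
 define M where "M n = distr (\<mu> n) borel code" for n
 have cm[measurable]: "code \<in> \<mu> n \<rightarrow>\<^sub>M borel" for n
  using measurable_code sets[of n] by (simp cong: measurable_cong_sets)
 have rd: "real_distribution (M n)" for n
  unfolding M_def by (intro prob_space.real_distribution_distr prob cm)
 have "measure (M n) {-1<..2} = 1" for n
 proof -
  interpret prob_space "\<mu> n" by (rule prob)
  have "code -` {-1<..2} \<inter> space (\<mu> n) = space (\<mu> n)"
  proof -
   have "code W \<in> {-1<..2}" for W using code_range[of W] by auto
   then show ?thesis by blast
  qed
  then show ?thesis by (simp add: M_def measure_distr prob_space)
 qed
 then have "tight M"
  unfolding tight_def using rd by (intro conjI allI impI exI[of _ "-1"] exI[of _ 2]) auto
 from tight_imp_convergent_subsubsequence[OF this strict_mono_id]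
 obtain r N where r: "strict_mono r" and N: "real_distribution N" and wc: "weak_conv_m (%n. M (r n)) N"
  by (auto simp: o_def)
 interpret N: real_distribution N by (rule N)
 have conv: "(%n. LINT x|M (r n). H x) ----> (LINT x|N. H x)"
  if "continuous_on UNIV H" "!!x. \<bar>H x\<bar> <= B" for H :: "real => real" and B
  by (rule weak_conv_imp_integral_bdd_continuous_conv[OF rd N wc])
   (use that in \<open>auto simp: continuous_on_eq_continuous_at\<close>)
 have convc: "(%n. LINT W|\<mu> (r n). H (code W)) ----> (LINT x|N. H x)"
  if "continuous_on UNIV H" "!!x. \<bar>H x\<bar> <= B" for H :: "real => real" and B
 proof -
  have [measurable]: "H \<in> Borel" using that(1) by (rule borel_measurable_continuous_onI)
  show ?thesis using conv[OF that] by (simp add: M_def integral_distr)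
 qed
 define C where "C = closure (code ` cball 0 R)"
 have C0: "C ~= {}" using R0 by (auto simp: C_def)
 have [measurable]: "C \<in> sets borel" by (simp add: C_def)
 have AEC: "AE x in N. x \<in> C"
 proof -
  define H where "H x = min 1 (infdist x C)" for x :: real
  have Hc: "continuous_on UNIV H" unfolding H_def by (intro continuous_intros)
  have [measurable]: "H \<in> Borel" using Hc by (rule borel_measurable_continuous_onI)
  have Hb: "\<bar>H x\<bar> <= 1" for x by (simp add: H_def infdist_nonneg)
  have "(LINT W|\<mu> (r n). H (code W)) = 0" for n
  proof -
   have "AE W in \<mu> (r n). H (code W) = 0"
    using R[of "r n"]
   proof eventually_elim
    case (elim W)
    then have "code W \<in> C" using closure_subset by (fastforce simp: C_def)
    then show ?case by (simp add: H_def)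
   qed
   then have "(LINT W|\<mu> (r n). H (code W)) = (LINT W|\<mu> (r n). 0)"
    by (intro integral_cong_AE) auto
   then show ?thesis by simp
  qed
  with convc[OF Hc Hb] have "(LINT x|N. H x) = 0" by (simp add: LIMSEQ_const_iff)
  moreover have "integrable N H"
   by (rule N.integrable_const_bound[of _ 1]) (use Hb in auto)
  ultimately have "AE x in N. H x = 0"
   by (subst (asm) integral_nonneg_eq_0_iff_AE) (auto simp: H_def infdist_nonneg)
  then show ?thesis
  proof eventually_elim
   case (elim x)
   then have "infdist x C = 0" by (auto simp: H_def min_def split: if_splits)
   then show ?case using C0 by (simp add: C_def in_closed_iff_infdist_zero)
  qed
 qed
 define \<pi> where "\<pi> y = (if y \<in> C then SOME W. decodes R y W else 0)" for y
 have dec: "decodes R y (\<pi> y)" if "y \<in> C" for y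
  using someI_ex[OF decodes_exists, of y R] that by (simp add: \<pi>_def C_def)
 have contC: "continuous_on C (%y. F (\<pi> y))" if F: "wcont_on_ball R F" for F
  unfolding continuous_on_sequentially o_def
 proof (intro allI impI ballI, elim conjE)
  fix y z assume y: "\<forall>n. y n \<in> C" "y ----> z" and z: "z \<in> C"
  show "(%n. F (\<pi> (y n))) ----> F (\<pi> z)"
   by (rule wcont_on_ballD[OF F])
    (use y z dec in \<open>auto intro: decodes_norm_le decodes_continuous\<close>)
 qed
 have wi: "wcont_on_ball R (%W. inner W v)" for v
  by (simp add: wcont_on_ball_def wconv_def)
 have m\<pi>[measurable]: "\<pi> \<in> Borel"
 proof (rule measurable_into_l2)
  fix v
  have "(%y. if y \<in> C then inner (\<pi> y) v else 0) \<in> Borel"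
   by (intro borel_measurable_continuous_on_if contC[OF wi]) auto
  moreover have "(%y. if y \<in> C then inner (\<pi> y) v else 0) = (%y. inner (\<pi> y) v)"
   by (auto simp: \<pi>_def)
  ultimately show "(%y. inner (\<pi> y) v) \<in> Borel" by simp
 qed
 define \<mu>0 where "\<mu>0 = distr N borel \<pi>"
 have mN: "\<pi> \<in> N \<rightarrow>\<^sub>M borel" using m\<pi> by simp
 have p0: "borel_probability \<mu>0"
  unfolding borel_probability_def \<mu>0_def using N.prob_space_distr[OF mN] by simp
 have R\<mu>0: "AE W in \<mu>0. norm W <= R"
  unfolding \<mu>0_def
 proof (subst AE_distr_iff[OF mN])
  show "AE x in N. norm (\<pi> x) <= R" using AEC by eventually_elim (auto intro: decodes_norm_le dec)
 qed measurable
 have lim: "(%n. LINT W|\<mu> (r n). F W) ----> (LINT W|\<mu>0. F W)"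
  if [measurable]: "F \<in> Borel" and F: "wcont_on_ball R F" for F
 proof -
  obtain K where K: "0 <= K" "!!x. norm x <= R ==> \<bar>F x\<bar> <= K" using wcont_on_ball_bounded[OF F] by blast
  have "closedin (top_of_set UNIV) C" by (simp add: C_def)
  then obtain H where H: "continuous_on UNIV H" "!!x. x \<in> C ==> H x = F (\<pi> x)" "!!x. norm (H x) <= K"
   using Tietze[OF contC[OF F], of UNIV K] K dec decodes_norm_le by (metis UNIV_I real_norm_def)
  have [measurable]: "H \<in> Borel" using H(1) by (rule borel_measurable_continuous_onI)
  have "(LINT W|\<mu> (r n). F W) = (LINT W|\<mu> (r n). H (code W))" for n
  proof (rule integral_cong_AE)
   show "AE W in \<mu> (r n). F W = H (code W)"
    using R[of "r n"]
   proof eventually_elim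
    case (elim W)
    then have c: "code W \<in> C" using closure_subset by (fastforce simp: C_def)
    have "\<pi> (code W) = W" by (rule decodes_unique[OF dec[OF c] decodes_code[OF elim]])
    then show ?case using H(2)[OF c] by simp
   qed
  qed auto
  moreover have "(LINT W|\<mu>0. F W) = (LINT x|N. H x)"
  proof -
   have "(LINT W|\<mu>0. F W) = (LINT x|N. F (\<pi> x))" unfolding \<mu>0_def by (rule integral_distr) auto
   also have "... = (LINT x|N. H x)"
   proof (rule integral_cong_AE)
    show "AE x in N. F (\<pi> x) = H x" using AEC by eventually_elim (use H(2) in auto)
   qed auto
   finally show ?thesis .
  qed
  ultimately show ?thesis using convc[of H K] H by simp
 qed
 show ?thesis using r p0 R\<mu>0 lim by blast
qed

section \<open>Calculus of test functions\<close>

definition has_grad :: "(plane => real) => (2 => plane => real) => bool" where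
 "has_grad h G \<longleftrightarrow> (\<forall>x. (h has_derivative (%v. \<Sum>i\<in>UNIV. v $ i * G i x)) (at x))"

lemma has_gradD: "has_grad h G ==> (h has_derivative (%v. \<Sum>i\<in>UNIV. v $ i * G i x)) (at x)"
 by (simp add: has_grad_def)

lemma Basis_plane: "(Basis :: plane set) = range (%i. axis i 1)"
 by (auto simp: Basis_vec_def)

lemma has_grad_pd:
 assumes "has_grad h G"
 shows "pd i h = G i"
proof
 fix x
 have "pd i h x = (\<Sum>k\<in>UNIV. (axis i 1 :: plane) $ k * G k x)"
  using frechet_derivative_at[OF has_gradD[OF assms, of x]] by (simp add: pd_def fun_eq_iff)
 also have "... = (\<Sum>k\<in>UNIV. if k = i then G k x else 0)"
  by (intro sum.cong) (auto simp: axis_def)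
 finally show "pd i h x = G i x" by simp
qed

lemma plane_expansion: "(v :: plane) = (\<Sum>i\<in>UNIV. v $ i *\<^sub>R axis i 1)"
 by (simp add: vec_eq_iff axis_def if_distrib cong: if_cong)

lemma has_grad_differentiable:
 "(\<forall>x. h differentiable (at x)) \<longleftrightarrow> has_grad h (%i. pd i h)"
proof
 assume d: "\<forall>x. h differentiable (at x)"
 show "has_grad h (%i. pd i h)"
  unfolding has_grad_def
 proof
  fix x
  have D: "(h has_derivative frechet_derivative h (at x)) (at x)"
   using d frechet_derivative_works by blast
  then have lin: "linear (frechet_derivative h (at x))" by (rule has_derivative_linear)
  have "frechet_derivative h (at x) v = (\<Sum>i\<in>UNIV. v $ i * pd i h x)" for v
   by (subst (1) plane_expansion) (simp add: linear_sum[OF lin] linear_cmul[OF lin] pd_def)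
  with D show "(h has_derivative (%v. \<Sum>i\<in>UNIV. v $ i * pd i h x)) (at x)"
   by (metis (no_types, lifting) ext)
 qed
qed (auto simp: has_grad_def differentiable_def)

lemma Ck_Suc_iff:
 "Ck (Suc n) (h :: plane => real) \<longleftrightarrow> has_grad h (%i. pd i h) \<and> (\<forall>i. Ck n (pd i h))"
 by (simp add: has_grad_differentiable Basis_plane pd_def[abs_def])

lemma has_grad_continuous: "has_grad h G ==> continuous_on UNIV h"
 by (meson continuous_at_imp_continuous_on has_derivative_continuous has_gradD)

lemma has_grad_add: "has_grad a A ==> has_grad b B ==> has_grad (%x. a x + b x) (%i x. A i x + B i x)"
 unfolding has_grad_def
 by (auto intro!: has_derivative_eq_rhs[OF has_derivative_add] simp: distrib_left sum.distrib)

lemma has_grad_cmult: "has_grad a A ==> has_grad (%x. c * a x) (%i x. c * A i x)"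
 unfolding has_grad_def
 by (auto intro!: has_derivative_eq_rhs[OF has_derivative_mult_right] simp: sum_distrib_left mult_ac)

lemma has_grad_zero: "has_grad (%x. 0) (%i x. 0)"
 by (simp add: has_grad_def)

lemma has_grad_shift: "has_grad a A ==> has_grad (%x. a (x + z)) (%i x. A i (x + z))"
 unfolding has_grad_def
proof
 fix x assume a: "\<forall>x. (a has_derivative (%v. \<Sum>i\<in>UNIV. v $ i * A i x)) (at x)"
 have "((%x. x + z) has_derivative (%v. v)) (at x)" by (auto intro!: derivative_eq_intros)
 from has_derivative_compose[OF this a[rule_format, of "x + z"]]
 show "((%x. a (x + z)) has_derivative (%v. \<Sum>i\<in>UNIV. v $ i * A i (x + z))) (at x)" .
qed

lemma has_grad_zero_outside:
 assumes "has_grad h G" "!!x. norm x > r ==> h x = 0" "norm x > r"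
 shows "G i x = 0"
proof -
 have "open {x :: plane. norm x > r}" by (intro open_Collect_less continuous_intros)
 from has_derivative_transform_within_open[OF has_derivative_const this, of x 0 h UNIV]
 have "(h has_derivative (%v. 0)) (at x)" using assms(2,3) by simp
 from fun_cong[OF has_derivative_unique[OF this has_gradD[OF assms(1), of x]], of "axis i 1"]
 have "(\<Sum>k\<in>UNIV. (axis i 1 :: plane) $ k * G k x) = 0" by simp
 moreover have "(\<Sum>k\<in>UNIV. (axis i 1 :: plane) $ k * G k x) = (\<Sum>k\<in>UNIV. if k = i then G k x else 0)"
  by (intro sum.cong) (auto simp: axis_def)
 ultimately show ?thesis by simp
qed

lemma compactly_supported_iff:
 fixes h :: "'a :: euclidean_space => real"
 shows "compactly_supported h \<longleftrightarrow> (\<exists>r. \<forall>x. norm x > r --> h x = 0)"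
proof
 assume "compactly_supported h"
 then have "bounded (closure {x. h x ~= 0})" by (simp add: compactly_supported_def compact_imp_bounded)
 then obtain r where "\<forall>x\<in>closure {x. h x ~= 0}. norm x <= r" by (auto simp: bounded_iff)
 then have "norm x > r --> h x = 0" for x
  using closure_subset[of "{x. h x ~= 0}"] by (metis (mono_tags) mem_Collect_eq not_le subsetD)
 then show "\<exists>r. \<forall>x. norm x > r --> h x = 0" by blast
next
 assume "\<exists>r. \<forall>x. norm x > r --> h x = 0"
 then obtain r where r: "!!x. norm x > r ==> h x = 0" by blast
 have "closure {x. h x ~= 0} \<subseteq> cball 0 r"
  by (rule closure_minimal) (use r in \<open>auto simp: not_less[symmetric]\<close>)
 then show "compactly_supported h"
  unfolding compactly_supported_def by (simp add: compact_eq_bounded_closed bounded_subset[OF bounded_cball])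
qed

lemma continuous_bounded_support:
 fixes h :: "'a :: euclidean_space => real"
 assumes "continuous_on UNIV h" "!!x. norm x > r ==> h x = 0"
 shows "\<exists>M\<ge>0. \<forall>x. \<bar>h x\<bar> <= M"
proof -
 have "bounded (h ` cball 0 r)"
  by (intro compact_imp_bounded compact_continuous_image continuous_on_subset[OF assms(1)]) auto
 then obtain M where "\<forall>x\<in>cball 0 r. \<bar>h x\<bar> <= M" by (auto simp: bounded_iff)
 then have M: "norm x <= r ==> \<bar>h x\<bar> <= M" for x by simp
 have "\<bar>h x\<bar> <= max 0 M" for x
  using M[of x] assms(2)[of x] by (cases "norm x <= r") auto
 then show ?thesis by (intro exI[of _ "max 0 M"]) auto
qed

text \<open>Quantitative membership in \<^const>\<open>C2_0\<close>: the disc of radius \<open>r\<close> contains the support, and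
 \<open>M\<close> bounds all derivatives of order at most two.\<close>

definition C2_bounds :: "real => real => (plane => real) => bool" where
 "C2_bounds r M h \<longleftrightarrow> C2_0 h \<and>
  (\<forall>x. \<bar>h x\<bar> <= M \<and> (\<forall>i. \<bar>pd i h x\<bar> <= M) \<and> (\<forall>i k. \<bar>pd k (pd i h) x\<bar> <= M)) \<and>
  (\<forall>x. norm x > r --> h x = 0 \<and> (\<forall>i. pd i h x = 0) \<and> (\<forall>i k. pd k (pd i h) x = 0))"

lemma C2_boundsD:
 assumes "C2_bounds r M h"
 shows "C2_0 h" "\<bar>h x\<bar> <= M" "\<bar>pd i h x\<bar> <= M" "\<bar>pd k (pd i h) x\<bar> <= M"
  "norm x > r ==> h x = 0" "norm x > r ==> pd i h x = 0" "norm x > r ==> pd k (pd i h) x = 0"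
 using assms by (auto simp: C2_bounds_def)

lemma C2_0D:
 assumes "C2_0 h"
 shows "has_grad h (%i. pd i h)" "has_grad (pd i h) (%k. pd k (pd i h))"
  "continuous_on UNIV (pd k (pd i h))"
 using assms by (auto simp: C2_0_def numeral_2_eq_2 Ck_Suc_iff simp del: Ck.simps(2))

lemma C2_0_cont:
 assumes "C2_0 h"
 shows "continuous_on UNIV h" "continuous_on UNIV (pd i h)"
 using C2_0D[OF assms] has_grad_continuous by blast+

lemma C2_0_measurable:
 assumes "C2_0 h"
 shows "h \<in> Borel" "pd i h \<in> Borel" "pd k (pd i h) \<in> Borel"
 using C2_0_cont[OF assms] C2_0D(3)[OF assms] by (auto intro: borel_measurable_continuous_onI)

lemma C2_0I:
 assumes g: "has_grad h G" "!!i. has_grad (G i) (H i)" and c: "!!i k. continuous_on UNIV (H i k)"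
  and s: "!!x. norm x > r ==> h x = 0"
 shows "C2_0 h" "pd i h = G i" "pd k (pd i h) = H i k"
proof -
 have p: "pd i h = G i" for i by (rule has_grad_pd[OF g(1)])
 have p2: "pd k (pd i h) = H i k" for i k unfolding p by (rule has_grad_pd[OF g(2)])
 show "pd i h = G i" "pd k (pd i h) = H i k" by (fact p, fact p2)
 have e: "(%i. pd i h) = G" using p by auto
 have e2: "(%k. pd k (G i)) = H i" for i using p2 p by auto
 have "Ck 2 h"
  unfolding numeral_2_eq_2 Ck_Suc_iff using g c p p2 e e2 by auto
 then show "C2_0 h" using s by (auto simp: C2_0_def compactly_supported_iff)
qed

lemma C2_0_bounds:
 assumes "C2_0 h"
 shows "\<exists>r M. r >= 0 \<and> M >= 0 \<and> C2_bounds r M h"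
proof -
 note D = C2_0D[OF assms]
 obtain r where r: "!!x. norm x > r ==> h x = 0"
  using assms by (auto simp: C2_0_def compactly_supported_iff)
 have r1: "pd i h x = 0" if "norm x > r" for i x by (rule has_grad_zero_outside[OF D(1) r that])
 have r2: "pd k (pd i h) x = 0" if "norm x > r" for i k x by (rule has_grad_zero_outside[OF D(2) r1 that])
 have "\<exists>M\<ge>0. \<forall>x. \<bar>h x\<bar> <= M" by (rule continuous_bounded_support[OF C2_0_cont(1)[OF assms] r])
 then obtain M0 where M0: "!!x. \<bar>h x\<bar> <= M0" "M0 >= 0" by blast
 have "\<exists>M\<ge>0. \<forall>x. \<bar>pd i h x\<bar> <= M" for i by (rule continuous_bounded_support[OF C2_0_cont(2)[OF assms] r1])
 then obtain M1 where M1: "!!i x. \<bar>pd i h x\<bar> <= M1 i" "!!i. M1 i >= 0" by metis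
 have "\<exists>M\<ge>0. \<forall>x. \<bar>pd k (pd i h) x\<bar> <= M" for i k by (rule continuous_bounded_support[OF D(3) r2])
 note ex2 = this
 define M2 where "M2 i k = (SOME M. 0 <= M \<and> (\<forall>x. \<bar>pd k (pd i h) x\<bar> <= M))" for i k
 have M2: "\<bar>pd k (pd i h) x\<bar> <= M2 i k" "M2 i k >= 0" for i k x
  using someI_ex[OF ex2[of k i]] by (auto simp: M2_def)
 define M where "M = M0 + (\<Sum>i\<in>UNIV. M1 i) + (\<Sum>i\<in>UNIV. \<Sum>k\<in>UNIV. M2 i k)"
 have s1: "0 <= (\<Sum>i\<in>UNIV. M1 i)" "0 <= (\<Sum>i\<in>UNIV. \<Sum>k\<in>UNIV. M2 i k)"
  using M1 M2 by (auto intro!: sum_nonneg)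
 have "M1 i <= (\<Sum>i\<in>UNIV. M1 i)" for i by (rule member_le_sum) (use M1 in auto)
 moreover have "M2 i k <= (\<Sum>i\<in>UNIV. \<Sum>k\<in>UNIV. M2 i k)" for i k
 proof -
  have "M2 i k <= (\<Sum>k\<in>UNIV. M2 i k)" by (rule member_le_sum) (use M2 in auto)
  also have "... <= (\<Sum>i\<in>UNIV. \<Sum>k\<in>UNIV. M2 i k)"
   by (rule member_le_sum[of i UNIV "%i. \<Sum>k\<in>UNIV. M2 i k"]) (use M2 in \<open>auto intro!: sum_nonneg\<close>)
  finally show ?thesis .
 qed
 ultimately have "M0 <= M" "M1 i <= M" "M2 i k <= M" for i k
  using s1 M0(2) unfolding M_def by (smt (verit))+
 then have "C2_bounds r M h"
  unfolding C2_bounds_def using assms r r1 r2 M0 M1 M2 by (meson order_trans)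
 then have "C2_bounds (max 0 r) M h" by (auto simp: C2_bounds_def)
 moreover have "0 <= M" using \<open>M0 <= M\<close> M0 by simp
 ultimately show ?thesis by (metis max.cobounded1)
qed

lemma C2_0_sq_integrable:
 assumes "C2_0 h"
 shows "sq_integrable h" "sq_integrable (pd i h)" "sq_integrable (pd k (pd i h))" "sq_integrable (laplacian h)"
proof -
 obtain r M where b: "C2_bounds r M h" using C2_0_bounds[OF assms] by blast
 note m = C2_0_measurable[OF assms]
 show "sq_integrable h" by (rule sq_integrable_bounded_support[OF m(1) C2_boundsD(2)[OF b] C2_boundsD(5)[OF b]])
 show "sq_integrable (pd i h)"
  by (rule sq_integrable_bounded_support[OF m(2) C2_boundsD(3)[OF b] C2_boundsD(6)[OF b]])
 have s: "sq_integrable (pd k (pd i h))" for i k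
  by (rule sq_integrable_bounded_support[OF m(3) C2_boundsD(4)[OF b] C2_boundsD(7)[OF b]])
 show "sq_integrable (pd k (pd i h))" by (rule s)
 have "laplacian h = (%x. pd 1 (pd 1 h) x + pd 2 (pd 2 h) x)"
  by (simp add: laplacian_def[abs_def] UNIV_2)
 then show "sq_integrable (laplacian h)" by (simp add: sq_integrable_add s)
qed

lemma has_grad_sum:
 fixes m :: nat
 assumes "!!k. k < m ==> has_grad (h k) (G k)"
 shows "has_grad (%x. \<Sum>k<m. a k * h k x) (%i x. \<Sum>k<m. a k * G k i x)"
 using assms
proof (induction m)
 case 0 show ?case by (simp add: has_grad_zero)
next
 case (Suc m) then show ?case by (simp add: has_grad_add has_grad_cmult)
qed

lemma C2_0_lincomb:
 fixes m :: nat
 assumes w: "!!k. k < m ==> C2_0 (w k)"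
 shows "C2_0 (%x. \<Sum>k<m. a k * w k x)"
  and "pd i (%x. \<Sum>k<m. a k * w k x) = (%x. \<Sum>k<m. a k * pd i (w k) x)"
  and "pd l (pd i (%x. \<Sum>k<m. a k * w k x)) = (%x. \<Sum>k<m. a k * pd l (pd i (w k)) x)"
proof -
 have "\<exists>r. \<forall>x. norm x > r --> w k x = 0" if "k < m" for k
  using w[OF that] by (simp add: C2_0_def compactly_supported_iff)
 then obtain r where r: "!!k x. k < m ==> norm x > r k ==> w k x = 0" by metis
 define R where "R = Max (insert 0 (r ` {..<m}))"
 have R: "r k <= R" if "k < m" for k unfolding R_def using that by (intro Max_ge) auto
 have 1: "has_grad (%x. \<Sum>k<m. a k * w k x) (%i x. \<Sum>k<m. a k * pd i (w k) x)"
  by (rule has_grad_sum) (rule C2_0D(1)[OF w])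
 have 2: "has_grad (%x. \<Sum>k<m. a k * pd i (w k) x) (%l x. \<Sum>k<m. a k * pd l (pd i (w k)) x)" for i
  by (rule has_grad_sum) (rule C2_0D(2)[OF w])
 have 3: "continuous_on UNIV (%x. \<Sum>k<m. a k * pd l (pd i (w k)) x)" for i l
  by (intro continuous_intros C2_0D(3) w) auto
 have 4: "(\<Sum>k<m. a k * w k x) = 0" if "norm x > R" for x
  by (rule sum.neutral) (use r R that in fastforce)
 show "C2_0 (%x. \<Sum>k<m. a k * w k x)"
  "pd i (%x. \<Sum>k<m. a k * w k x) = (%x. \<Sum>k<m. a k * pd i (w k) x)"
  "pd l (pd i (%x. \<Sum>k<m. a k * w k x)) = (%x. \<Sum>k<m. a k * pd l (pd i (w k)) x)"
  using C2_0I[OF 1 2 3 4] by auto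
qed

lemma C2_0_shift:
 assumes w: "C2_0 w"
 shows "C2_0 (%x. w (x + z))" "pd i (%x. w (x + z)) = (%x. pd i w (x + z))"
proof -
 obtain r M where b: "C2_bounds r M w" using C2_0_bounds[OF w] by blast
 have 4: "w (x + z) = 0" if "norm x > r + norm z" for x
 proof -
  have "norm x <= norm (x + z) + norm z" using norm_triangle_ineq[of "x + z" "- z"] by simp
  with that show ?thesis by (intro C2_boundsD(5)[OF b]) simp
 qed
 have 3: "continuous_on UNIV (%x. pd k (pd i w) (x + z))" for i k
  by (rule continuous_on_compose2[OF C2_0D(3)[OF w]]) (auto intro!: continuous_intros)
 show "C2_0 (%x. w (x + z))" "pd i (%x. w (x + z)) = (%x. pd i w (x + z))"
  using C2_0I[OF has_grad_shift[OF C2_0D(1)[OF w]] has_grad_shift[OF C2_0D(2)[OF w]] 3 4] by auto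
qed

subsection \<open>Taylor estimates\<close>

lemma has_grad_line:
 assumes "has_grad h G"
 shows "((%t. h (x + t *\<^sub>R v)) has_real_derivative (\<Sum>i\<in>UNIV. v $ i * G i (x + t *\<^sub>R v))) (at t)"
proof -
 have "((%t. x + t *\<^sub>R v) has_derivative (%s. s *\<^sub>R v)) (at t)" by (auto intro!: derivative_eq_intros)
 from has_derivative_compose[OF this has_gradD[OF assms, of "x + t *\<^sub>R v"]]
 have "((%t. h (x + t *\<^sub>R v)) has_derivative (%s. \<Sum>i\<in>UNIV. (s *\<^sub>R v) $ i * G i (x + t *\<^sub>R v))) (at t)" .
 then show ?thesis
  unfolding has_field_derivative_def by (rule has_derivative_eq_rhs) (auto simp: sum_distrib_left mult_ac)
qed

lemma sum_coord_le:
 fixes v :: plane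
 assumes "!!i. \<bar>a i\<bar> <= M"
 shows "\<bar>\<Sum>i\<in>UNIV. v $ i * a i\<bar> <= 2 * M * norm v"
proof -
 have "\<bar>\<Sum>i\<in>UNIV. v $ i * a i\<bar> <= (\<Sum>i\<in>UNIV. \<bar>v $ i * a i\<bar>)" by (rule sum_abs)
 also have "... <= (\<Sum>i\<in>(UNIV :: 2 set). norm v * M)"
  using assms by (intro sum_mono) (auto simp: abs_mult intro!: mult_mono component_le_norm_cart)
 finally show ?thesis by (simp add: mult_ac)
qed

lemma grad_Lipschitz:
 assumes "has_grad h G" "!!i x. \<bar>G i x\<bar> <= M"
 shows "\<bar>h (x + v) - h x\<bar> <= 2 * M * norm v"
proof -
 have "\<exists>z. h (x + 1 *\<^sub>R v) - h (x + 0 *\<^sub>R v) = (1 - 0) * (\<Sum>i\<in>UNIV. v $ i * G i (x + z *\<^sub>R v))"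
  using MVT2[of 0 1 "%t. h (x + t *\<^sub>R v)", OF zero_less_one has_grad_line[OF assms(1)]] by blast
 then obtain z where "h (x + 1 *\<^sub>R v) - h (x + 0 *\<^sub>R v) = (1 - 0) * (\<Sum>i\<in>UNIV. v $ i * G i (x + z *\<^sub>R v))" by blast
 then show ?thesis using sum_coord_le[of "%i. G i (x + z *\<^sub>R v)" M v] assms(2) by simp
qed

lemma grad_Taylor:
 assumes h: "has_grad h G" and G: "!!i. has_grad (G i) (H i)" and M: "!!i k x. \<bar>H i k x\<bar> <= M"
 shows "\<bar>h (x + v) - h x - (\<Sum>i\<in>UNIV. v $ i * G i x)\<bar> <= 4 * M * (norm v)^2"
proof -
 have M0: "0 <= M" using M abs_ge_zero order_trans by blast
 have "\<exists>z. 0 < z \<and> z < 1 \<and>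
  h (x + 1 *\<^sub>R v) - h (x + 0 *\<^sub>R v) = (1 - 0) * (\<Sum>i\<in>UNIV. v $ i * G i (x + z *\<^sub>R v))"
  using MVT2[of 0 1 "%t. h (x + t *\<^sub>R v)", OF zero_less_one has_grad_line[OF h]] by simp
 then obtain z where z: "0 < z" "z < 1"
  "h (x + 1 *\<^sub>R v) - h (x + 0 *\<^sub>R v) = (1 - 0) * (\<Sum>i\<in>UNIV. v $ i * G i (x + z *\<^sub>R v))" by blast
 have "\<bar>G i (x + z *\<^sub>R v) - G i x\<bar> <= 2 * M * norm v" for i
 proof -
  have "\<bar>G i (x + z *\<^sub>R v) - G i x\<bar> <= 2 * M * norm (z *\<^sub>R v)" by (rule grad_Lipschitz[OF G M])
  also have "... <= 2 * M * norm v" using z M0 by (intro mult_left_mono) (auto simp: mult_left_le_one_le)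
  finally show ?thesis .
 qed
 then have "\<bar>\<Sum>i\<in>UNIV. v $ i * (G i (x + z *\<^sub>R v) - G i x)\<bar> <= 2 * (2 * M * norm v) * norm v"
  by (rule sum_coord_le)
 then show ?thesis using z(3) by (simp add: right_diff_distrib sum_subtractf power2_eq_square)
qed

text \<open>The functionals on \<open>L\<^sup>2\<close> below have quadratic Taylor remainders, controlled for small increments.\<close>

lemma has_derivative_quadratic:
 fixes f :: "'a :: real_normed_vector => real"
 assumes lin: "bounded_linear D" and C: "!!v. norm v <= 1 ==> \<bar>f (x + v) - f x - D v\<bar> <= C * (norm v)^2"
 shows "(f has_derivative D) (at x)"
 unfolding has_derivative_at
proof (intro conjI lin)
 show "(%h. norm (f (x + h) - f x - D h) / norm h) \<midarrow>0\<rightarrow> 0"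
 proof (rule tendsto_sandwich[OF _ _ tendsto_const])
  show "\<forall>\<^sub>F h in at 0. norm (f (x + h) - f x - D h) / norm h <= C * norm h"
   unfolding eventually_at
  proof (intro exI[of _ 1] conjI ballI impI zero_less_one)
   fix h :: 'a assume "h ~= 0 \<and> dist h 0 < 1"
   then show "norm (f (x + h) - f x - D h) / norm h <= C * norm h"
    using C[of h] by (simp add: divide_simps power2_eq_square mult_ac)
  qed
  show "(%h. C * norm h) \<midarrow>0\<rightarrow> 0" by (auto intro!: tendsto_eq_intros)
 qed auto
qed

subsection \<open>Convolution\<close>

definition conv :: "(plane => real) => (plane => real) => plane => real" where
 "conv k h x = (LINT y|lborel. k (x - y) * h y)"

lemma integrable_conv:
 assumes [measurable]: "k \<in> Borel" and "!!x. \<bar>k x\<bar> <= M" and h: "integrable lborel h"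
 shows "integrable lborel (%y. k (x - y) * h y :: real)"
proof (rule integrable_dominated)
 show "integrable lborel (%y. M * h y)" using h by simp
 have [measurable]: "h \<in> Borel" using h by auto
 show "(%y. k (x - y) * h y) \<in> borel_measurable lborel" by measurable
 show "norm (k (x - y) * h y) <= norm (M * h y)" for y
   using assms(2)[of "x - y"] by (auto simp: abs_mult intro!: mult_right_mono)
qed

lemma conv_has_grad:
 assumes k: "has_grad k G" and G: "!!i. has_grad (G i) (H i)"
  and M: "!!x. \<bar>k x\<bar> <= M" "!!i x. \<bar>G i x\<bar> <= M" "!!i l x. \<bar>H i l x\<bar> <= M"
  and h: "integrable lborel h"
 shows "has_grad (conv k h) (%i. conv (G i) h)"
 unfolding has_grad_def
proof
 fix x
 have mk: "k \<in> Borel" "G i \<in> Borel" for i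
  using has_grad_continuous[OF k] has_grad_continuous[OF G] by (auto intro: borel_measurable_continuous_onI)
 have ik: "integrable lborel (%y. k (z - y) * h y)" for z by (rule integrable_conv[OF mk(1) M(1) h])
 have iG: "integrable lborel (%y. G i (z - y) * h y)" for i z by (rule integrable_conv[OF mk(2) M(2) h])
 have hm[measurable]: "h \<in> Borel" using h by auto
 show "(conv k h has_derivative (%v. \<Sum>i\<in>UNIV. v $ i * conv (G i) h x)) (at x)"
 proof (rule has_derivative_quadratic)
  show "bounded_linear (%v. \<Sum>i\<in>UNIV. v $ i * conv (G i) h x)"
   by (intro bounded_linear_sum bounded_linear_mult_const bounded_linear_vec_nth)
  fix v
  have "conv k h (x + v) - conv k h x - (\<Sum>i\<in>UNIV. v $ i * conv (G i) h x)
    = (LINT y|lborel. k (x + v - y) * h y - k (x - y) * h y - (\<Sum>i\<in>UNIV. v $ i * (G i (x - y) * h y)))"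
   unfolding conv_def using ik iG by simp
  also have "\<bar>...\<bar> <= (LINT y|lborel. 4 * M * (norm v)^2 * \<bar>h y\<bar>)"
  proof (rule order_trans[OF integral_abs_bound], rule integral_mono)
   show "integrable lborel (%y. \<bar>k (x + v - y) * h y - k (x - y) * h y - (\<Sum>i\<in>UNIV. v $ i * (G i (x - y) * h y))\<bar>)"
    using ik iG by simp
   show "integrable lborel (%y. 4 * M * (norm v)^2 * \<bar>h y\<bar>)" using h by simp
   fix y
   have "k (x + v - y) * h y - k (x - y) * h y - (\<Sum>i\<in>UNIV. v $ i * (G i (x - y) * h y))
     = (k ((x - y) + v) - k (x - y) - (\<Sum>i\<in>UNIV. v $ i * G i (x - y))) * h y"
    by (simp add: algebra_simps sum_distrib_left)
   also have "\<bar>...\<bar> <= 4 * M * (norm v)^2 * \<bar>h y\<bar>"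
    unfolding abs_mult by (intro mult_right_mono grad_Taylor[OF k G M(3)]) auto
   finally show "\<bar>k (x + v - y) * h y - k (x - y) * h y - (\<Sum>i\<in>UNIV. v $ i * (G i (x - y) * h y))\<bar>
     <= 4 * M * (norm v)^2 * \<bar>h y\<bar>" .
  qed
  also have "... = 4 * M * (LINT y|lborel. \<bar>h y\<bar>) * (norm v)^2" by simp
  finally show "\<bar>conv k h (x + v) - conv k h x - (\<Sum>i\<in>UNIV. v $ i * conv (G i) h x)\<bar>
    <= 4 * M * (LINT y|lborel. \<bar>h y\<bar>) * (norm v)^2" .
 qed
qed

lemma lborel_distr_reflect: "distr lborel borel (%y. x - y) = (lborel :: plane measure)"
 using lborel_affine[of "-1" x] by (simp add: density_1)

lemma integral_reflect:
 fixes f :: "plane => real"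
 assumes [measurable]: "f \<in> Borel"
 shows "(LINT y|lborel. f (x - y)) = (LINT y|lborel. f y)"
 by (subst lborel_distr_reflect[symmetric, of x], subst integral_distr) auto

lemma nn_integral_reflect:
 fixes f :: "plane => ennreal"
 assumes [measurable]: "f \<in> Borel"
 shows "(\<integral>\<^sup>+ y. f (x - y) \<partial>lborel) = (\<integral>\<^sup>+ y. f y \<partial>lborel)"
 by (subst lborel_distr_reflect[symmetric, of x], subst nn_integral_distr) auto

lemma conv_commute:
 assumes [measurable]: "k \<in> Borel" "h \<in> Borel"
 shows "conv k h = conv h k"
proof
 fix x show "conv k h x = conv h k x"
  unfolding conv_def using integral_reflect[of "%y. k (x - y) * h y" x] by (simp add: mult.commute)
qed

lemma conv_support:
 assumes "!!x. norm x > a ==> k x = 0" "!!x. norm x > b ==> h x = 0" "norm x > a + b"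
 shows "conv k h x = 0"
proof -
 have "k (x - y) * h y = (0 :: real)" for y
  using assms(1)[of "x - y"] assms(2)[of y] assms(3) norm_triangle_ineq[of "x - y" y] by fastforce
 then have "(%y. k (x - y) * h y) = (%_. 0)" by blast
 then show ?thesis by (simp add: conv_def)
qed

definition smooth_cs :: "(plane => real) => bool" where
 "smooth_cs k \<longleftrightarrow> smooth k \<and> compactly_supported k"

lemma smooth_cs_C2_0: "smooth_cs k ==> C2_0 k"
 by (simp add: smooth_cs_def smooth_def C2_0_def)

lemma smooth_cs_pd:
 assumes "smooth_cs k"
 shows "smooth_cs (pd i k)"
proof -
 have "Ck (Suc n) k" for n using assms by (simp add: smooth_cs_def smooth_def del: Ck.simps)
 then have s: "smooth (pd i k)" by (simp add: smooth_def Ck_Suc_iff del: Ck.simps)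
 obtain r M where b: "C2_bounds r M k" using C2_0_bounds[OF smooth_cs_C2_0[OF assms]] by blast
 have "compactly_supported (pd i k)" using C2_boundsD(6)[OF b] by (auto simp: compactly_supported_iff)
 with s show ?thesis by (simp add: smooth_cs_def)
qed

lemma conv_C2_has_grad:
 assumes k: "C2_0 k" and h: "integrable lborel h"
 shows "has_grad (conv k h) (%i. conv (pd i k) h)"
proof -
 obtain r M where b: "C2_bounds r M k" using C2_0_bounds[OF k] by blast
 show ?thesis
  by (rule conv_has_grad[OF C2_0D(1,2)[OF k] C2_boundsD(2,3,4)[OF b] h])
qed

lemma conv_smooth:
 assumes k: "smooth_cs k" and h: "integrable lborel h"
 shows "smooth (conv k h)"
proof -
 have "Ck n (conv k h)" for n
  using k
 proof (induction n arbitrary: k)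
  case 0
  show ?case using has_grad_continuous[OF conv_C2_has_grad[OF smooth_cs_C2_0[OF 0] h]] by simp
 next
  case (Suc n)
  note g = conv_C2_has_grad[OF smooth_cs_C2_0[OF Suc.prems] h]
  have "Ck n (conv (pd i k) h)" for i by (rule Suc.IH[OF smooth_cs_pd[OF Suc.prems]])
  with g show ?case unfolding Ck_Suc_iff has_grad_pd[OF g] by blast
 qed
 then show ?thesis by (simp add: smooth_def)
qed

subsection \<open>Mollification\<close>

definition mker :: "(plane => real) => real => plane => real" where
 "mker j \<epsilon> z = (1 / \<epsilon>^2) * j ((1 / \<epsilon>) *\<^sub>R z)"

lemma mollify_conv: "mollify j \<epsilon> h = conv (mker j \<epsilon>) h"
 by (simp add: mollify_def conv_def mker_def fun_eq_iff)

lemma Ck_scale: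
 "Ck n (h :: plane => real) ==> Ck n (%x. c * h (a *\<^sub>R x))"
proof (induction n arbitrary: h c)
 case 0
 then show ?case by (auto intro!: continuous_intros continuous_on_compose2[of UNIV h])
next
 case (Suc n)
 have g: "has_grad h (%i. pd i h)" and C: "!!i. Ck n (pd i h)" using Suc.prems unfolding Ck_Suc_iff by auto
 have "has_grad (%x. c * h (a *\<^sub>R x)) (%i x. (c * a) * pd i h (a *\<^sub>R x))"
  unfolding has_grad_def
 proof
  fix x
  have "((%x :: plane. a *\<^sub>R x) has_derivative (%v. a *\<^sub>R v)) (at x)" by (auto intro!: derivative_eq_intros)
  from has_derivative_compose[OF this has_gradD[OF g, of "a *\<^sub>R x"]]
  have "((%x. h (a *\<^sub>R x)) has_derivative (%v. \<Sum>i\<in>UNIV. (a *\<^sub>R v) $ i * pd i h (a *\<^sub>R x))) (at x)" .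
  from has_derivative_mult_right[OF this, of c]
  show "((%x. c * h (a *\<^sub>R x)) has_derivative (%v. \<Sum>i\<in>UNIV. v $ i * ((c * a) * pd i h (a *\<^sub>R x)))) (at x)"
   by (rule has_derivative_eq_rhs) (auto simp: sum_distrib_left mult_ac)
 qed
 then show ?case
  unfolding Ck_Suc_iff using Suc.IH[OF C] has_grad_pd by (metis (no_types, lifting) ext)
qed

context
 fixes j :: "plane => real" and \<epsilon> :: real
 assumes j: "is_mollifier j" and \<epsilon>: "0 < \<epsilon>"
begin

lemma mker_zero: "norm z > \<epsilon> ==> mker j \<epsilon> z = 0"
proof -
 assume "norm z > \<epsilon>"
 then have "norm ((1 / \<epsilon>) *\<^sub>R z) > 1" using \<epsilon> by (simp add: divide_simps)
 then show ?thesis using j by (simp add: mker_def is_mollifier_def)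
qed

lemma mker_nonneg: "mker j \<epsilon> z >= 0"
 using j by (simp add: mker_def is_mollifier_def)

lemma mker_even: "mker j \<epsilon> (- z) = mker j \<epsilon> z"
 using j by (simp add: mker_def is_mollifier_def)

lemma mker_smooth: "smooth_cs (mker j \<epsilon>)"
proof -
 have "smooth (mker j \<epsilon>)"
  using j Ck_scale[of _ j "1 / \<epsilon>^2" "1 / \<epsilon>"] by (auto simp: is_mollifier_def smooth_def mker_def[abs_def])
 then show ?thesis using mker_zero by (auto simp: smooth_cs_def compactly_supported_iff)
qed

lemma mker_integral: "(LINT z|lborel. mker j \<epsilon> z) = 1"
proof -
 have "Ck 0 j" using j by (auto simp: is_mollifier_def smooth_def simp del: Ck.simps)
 then have [measurable]: "j \<in> Borel" by (auto intro: borel_measurable_continuous_onI)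
 have "(LINT z|lborel. mker j \<epsilon> z)
   = (LINT z|density (distr lborel borel (%x. 0 + \<epsilon> *\<^sub>R x)) (%_. ennreal (\<bar>\<epsilon>\<bar> ^ DIM(plane))). mker j \<epsilon> z)"
  using lborel_affine[of \<epsilon> "0 :: plane"] \<epsilon> by simp
 also have "... = (LINT z|distr lborel borel (%x. 0 + \<epsilon> *\<^sub>R x). \<epsilon>^2 * mker j \<epsilon> z)"
  by (subst integral_real_density) (auto simp: mker_def[abs_def] \<epsilon>)
 also have "... = (LINT z|lborel. j z)"
  by (subst integral_distr) (use \<epsilon> in \<open>auto simp: mker_def[abs_def]\<close>)
 finally show ?thesis using j by (simp add: is_mollifier_def)
qed

lemma mker_integrable: "integrable lborel (mker j \<epsilon>)"
 using mker_integral not_integrable_integral_eq by fastforce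

text \<open>The kernel has unit mass inside the disc of radius \<open>\<epsilon>\<close>, where \<open>h\<close> varies by at most \<open>L \<epsilon>\<close>.\<close>

lemma conv_mker_approx:
 assumes h: "continuous_on UNIV h" "!!x. \<bar>h x\<bar> <= M" and L: "!!x v. \<bar>h (x + v) - h x\<bar> <= L * norm v"
 shows "\<bar>conv h (mker j \<epsilon>) x - h x\<bar> <= L * \<epsilon>"
proof -
 have [measurable]: "h \<in> Borel" using h(1) by (rule borel_measurable_continuous_onI)
 have i: "integrable lborel (%y. h (x - y) * mker j \<epsilon> y)"
  by (rule integrable_conv[OF _ h(2) mker_integrable]) simp
 have "conv h (mker j \<epsilon>) x - h x = (LINT y|lborel. h (x - y) * mker j \<epsilon> y - h x * mker j \<epsilon> y)"
  unfolding conv_def using i mker_integrable by (simp add: mker_integral)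
 also have "\<bar>...\<bar> <= (LINT y|lborel. L * \<epsilon> * mker j \<epsilon> y)"
 proof (rule order_trans[OF integral_abs_bound], rule integral_mono)
  show "integrable lborel (%y. \<bar>h (x - y) * mker j \<epsilon> y - h x * mker j \<epsilon> y\<bar>)" using i mker_integrable by simp
  show "integrable lborel (%y. L * \<epsilon> * mker j \<epsilon> y)" using mker_integrable by simp
  fix y
  have L0: "0 <= L"
   using L[of 0 "axis 1 1"] abs_ge_zero[of "h (0 + axis 1 1) - h 0"] by (simp add: norm_axis_1)
  show "\<bar>h (x - y) * mker j \<epsilon> y - h x * mker j \<epsilon> y\<bar> <= L * \<epsilon> * mker j \<epsilon> y"
  proof (cases "norm y <= \<epsilon>")
   case True
   have "\<bar>h (x - y) - h x\<bar> <= L * norm y" using L[of x "- y"] by simp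
   also have "... <= L * \<epsilon>" using True L0 by (rule mult_left_mono)
   finally have "\<bar>h (x - y) - h x\<bar> * mker j \<epsilon> y <= L * \<epsilon> * mker j \<epsilon> y"
    by (rule mult_right_mono[OF _ mker_nonneg])
   moreover have "h (x - y) * mker j \<epsilon> y - h x * mker j \<epsilon> y = (h (x - y) - h x) * mker j \<epsilon> y"
    by (simp add: left_diff_distrib)
   ultimately show ?thesis by (simp add: abs_mult mker_nonneg)
  qed (simp add: mker_zero)
 qed
 also have "... = L * \<epsilon>" by (simp add: mker_integral)
 finally show ?thesis .
qed

end

text \<open>Weak derivatives are tested against smooth functions only; mollification extends the
 identity to \<open>C\<^sup>2\<close> test functions, because derivatives commute with convolution.\<close>

lemma weak_pd_C2_0:
 assumes j: "is_mollifier j" and wd: "weak_pd i h d" and \<phi>: "C2_0 \<phi>"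
  and h: "sq_integrable h" and d: "locally_integrable d"
 shows "pairing h (pd i \<phi>) = - pairing d \<phi>"
proof -
 obtain r M where b: "C2_bounds r M \<phi>" and r0: "r >= 0" using C2_0_bounds[OF \<phi>] by blast
 note mm[measurable] = C2_0_measurable[OF \<phi>]
 have i\<phi>: "integrable lborel \<phi>"
  by (rule integrable_bounded_support[of _ M r]) (use C2_boundsD[OF b] in auto)
 define e where "e n = 1 / real (Suc n)" for n
 have e: "0 < e n" "e n <= 1" for n by (auto simp: e_def)
 have e0: "e ----> 0" unfolding e_def by (rule LIMSEQ_Suc[OF lim_1_over_n])
 define p where "p n = conv \<phi> (mker j (e n))" for n
 have mk[measurable]: "mker j (e n) \<in> Borel" for n
  using C2_0_measurable(1)[OF smooth_cs_C2_0[OF mker_smooth[OF j e(1)]]] .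
 have p_eq: "p n = conv (mker j (e n)) \<phi>" for n unfolding p_def by (rule conv_commute) auto
 have sp: "smooth (p n)" for n unfolding p_eq by (rule conv_smooth[OF mker_smooth[OF j e(1)] i\<phi>])
 have zp: "p n x = 0" if "norm x > r + 1" for n x
  unfolding p_def by (rule conv_support[OF C2_boundsD(5)[OF b] mker_zero[OF j e(1)]]) (use that e(2)[of n] in auto)
 have gp: "has_grad (p n) (%i. conv (pd i \<phi>) (mker j (e n)))" for n
  unfolding p_def by (rule conv_C2_has_grad[OF \<phi> mker_integrable[OF j e(1)]])
 have pdp: "pd i (p n) = conv (pd i \<phi>) (mker j (e n))" for n by (rule has_grad_pd[OF gp])
 have zpd: "pd i (p n) x = 0" if "norm x > r + 1" for n x
  unfolding pdp by (rule conv_support[OF C2_boundsD(6)[OF b] mker_zero[OF j e(1)]]) (use that e(2)[of n] in auto)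
 have a0: "\<bar>p n x - \<phi> x\<bar> <= 2 * M * e n" for n x
  unfolding p_def by (rule conv_mker_approx[OF j e(1) C2_0_cont(1)[OF \<phi>] C2_boundsD(2)[OF b]
     grad_Lipschitz[OF C2_0D(1)[OF \<phi>] C2_boundsD(3)[OF b]]])
 have a1: "\<bar>pd i (p n) x - pd i \<phi> x\<bar> <= 2 * M * e n" for n x
  unfolding pdp by (rule conv_mker_approx[OF j e(1) C2_0_cont(2)[OF \<phi>] C2_boundsD(3)[OF b]
     grad_Lipschitz[OF C2_0D(2)[OF \<phi>] C2_boundsD(4)[OF b]]])
 have M0: "0 <= M" using C2_boundsD(2)[OF b, of 0] by linarith
 \<comment> \<open>uniform convergence with supports in a fixed disc passes to the limit in every local pairing\<close>
 have lim: "(%n. pairing a (q n)) ----> pairing a q'"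
  if a: "locally_integrable a" and m: "!!n. q n \<in> Borel" "q' \<in> Borel"
   and z: "!!n x. norm x > r + 1 ==> q n x = 0" and q': "!!x. \<bar>q' x\<bar> <= M"
   and ap: "!!n x. \<bar>q n x - q' x\<bar> <= 2 * M * e n" for a q q'
  unfolding pairing_def
 proof (rule integral_dominated_convergence)
  have [measurable]: "a \<in> Borel" using a by (simp add: locally_integrable_def)
  note m[measurable]
  show "(%x. a x * q' x) \<in> borel_measurable lborel" "(%x. a x * q n x) \<in> borel_measurable lborel" for n
   by measurable
  have "set_integrable lborel (cball 0 (r + 1)) a" using a by (simp add: locally_integrable_def)
  then show "integrable lborel (%x. 3 * M * \<bar>indicator (cball 0 (r + 1)) x * a x\<bar>)"
   unfolding set_integrable_def by simp
  show "AE x in lborel. (%n. a x * q n x) ----> a x * q' x"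
  proof (rule AE_I2)
   fix x
   have "(%n. q n x - q' x) ----> 0"
   proof (rule Lim_null_comparison)
    show "\<forall>\<^sub>F n in sequentially. norm (q n x - q' x) <= 2 * M * e n" using ap by simp
    show "(%n. 2 * M * e n) ----> 0" using tendsto_mult_left[OF e0, of "2 * M"] by simp
   qed
   then have "(%n. q n x) ----> q' x" by (rule LIM_zero_cancel)
   then show "(%n. a x * q n x) ----> a x * q' x" by (rule tendsto_mult_left)
  qed
  show "AE x in lborel. norm (a x * q n x) <= 3 * M * \<bar>indicator (cball 0 (r + 1)) x * a x\<bar>" for n
  proof (rule AE_I2)
   fix x
   show "norm (a x * q n x) <= 3 * M * \<bar>indicator (cball 0 (r + 1)) x * a x\<bar>"
   proof (cases "norm x <= r + 1")
    case True
    have "2 * M * e n <= 2 * M" using e(2)[of n] M0 mult_left_mono[of "e n" 1 "2 * M"] by simp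
    then have "\<bar>q n x\<bar> <= 3 * M" using ap[of n x] q'[of x] by linarith
    then show ?thesis using True by (simp add: abs_mult mult.commute mult_left_mono)
   qed (use z in auto)
  qed
 qed
 have hl: "locally_integrable h" using wd by (simp add: weak_pd_def)
 have m1: "p n \<in> Borel" "pd i (p n) \<in> Borel" for n
 proof -
  have "smooth_cs (p n)" using sp[of n] zp[of _ n] unfolding smooth_cs_def compactly_supported_iff by blast
  then have "C2_0 (p n)" by (rule smooth_cs_C2_0)
  from C2_0_measurable[OF this] show "p n \<in> Borel" "pd i (p n) \<in> Borel" by auto
 qed
 have "(%n. pairing h (pd i (p n))) ----> pairing h (pd i \<phi>)"
  by (rule lim[OF hl m1(2) mm(2) zpd C2_boundsD(3)[OF b] a1])
 moreover have "(%n. - pairing d (p n)) ----> - pairing d \<phi>"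
  by (intro tendsto_minus lim[OF d m1(1) mm(1) zp C2_boundsD(2)[OF b] a0])
 moreover have "pairing h (pd i (p n)) = - pairing d (p n)" for n
 proof -
  have "compactly_supported (p n)" using zp[of _ n] unfolding compactly_supported_iff by blast
  with wd sp[of n] show ?thesis by (simp add: weak_pd_def)
 qed
 ultimately show ?thesis using LIMSEQ_unique by simp
qed

lemma sq_integrable_locally_integrable:
 assumes "sq_integrable h"
 shows "locally_integrable h"
 unfolding locally_integrable_def
proof (intro conjI allI impI)
 show "h \<in> borel_measurable lborel" using assms by (simp add: sq_integrable_def)
 fix C :: "plane set" assume C: "compact C"
 obtain r where r: "\<forall>x\<in>C. norm x <= r" using compact_imp_bounded[OF C] by (auto simp: bounded_iff)
 have "sq_integrable (indicator C)"
  by (rule sq_integrable_bounded_support[of _ 1 r])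
   (use r C in \<open>auto simp: indicator_def not_le[symmetric] intro!: borel_measurable_indicator borel_compact\<close>)
 from sq_integrable_mult[OF this assms] show "set_integrable lborel C h" by (simp add: set_integrable_def)
qed

section \<open>The Biot-Savart kernel\<close>

abbreviation "K \<equiv> biot_savart_kernel"

lemma forall_2_cases: "(P :: 2 => bool) 1 ==> P 2 ==> P i"
 using exhaust_2 by metis

lemma norm_plane_sq: "(norm (z :: plane))^2 = (z $ 1)^2 + (z $ 2)^2"
 unfolding norm_vec_def L2_set_def by (simp add: UNIV_2)

lemma K_nth: "K z $ 1 = - (z $ 2) / (2 * pi * (norm z)^2)" "K z $ 2 = z $ 1 / (2 * pi * (norm z)^2)"
 by (simp_all add: biot_savart_kernel_def)

lemma measurable_vec_nth_plane [measurable]: "(%z :: plane. z $ i) \<in> Borel"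
 by (intro borel_measurable_continuous_onI continuous_intros)

lemma measurable_K_nth [measurable]: "(%z. K z $ i) \<in> Borel"
 by (rule forall_2_cases[of "%i. (%z. K z $ i) \<in> Borel"]) (simp_all add: K_nth)

lemma borel_measurable_planeI:
 fixes h :: "'a => plane"
 assumes [measurable]: "!!i. (%x. h x $ i) \<in> borel_measurable M"
 shows "h \<in> borel_measurable M"
proof -
 have "h = (%x. \<Sum>i\<in>UNIV. h x $ i *\<^sub>R axis i 1)"
  using plane_expansion by (intro ext) blast
 moreover have "(%x. \<Sum>i\<in>UNIV. h x $ i *\<^sub>R axis i 1 :: plane) \<in> borel_measurable M"
  by measurable
 ultimately show ?thesis by simp
qed

lemma measurable_K [measurable]: "K \<in> Borel"
 by (rule borel_measurable_planeI) measurable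

lemma norm_K: "norm (K z) = 1 / (2 * pi * norm z)"
proof -
 have "(norm (K z))^2 = (1 / (2 * pi * norm z))^2"
 proof (cases "z = 0")
  case True then show ?thesis by (simp add: biot_savart_kernel_def)
 next
  case False
  have "(norm (K z))^2 = ((z $ 1)^2 + (z $ 2)^2) / (2 * pi * (norm z)^2)^2"
   unfolding norm_plane_sq[of "K z"] K_nth by (simp add: power_divide add_divide_distrib add.commute)
  also have "... = (norm z)^2 / (2 * pi * (norm z)^2)^2" by (simp add: norm_plane_sq)
  also have "... = (1 / (2 * pi * norm z))^2" using False by (simp add: divide_simps power2_eq_square)
  finally show ?thesis .
 qed
 then show ?thesis by (simp add: power2_eq_iff_nonneg)
qed

lemma K_nth_le: "\<bar>K z $ i\<bar> <= norm (K z)"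
 by (rule component_le_norm_cart)

lemma norm_K_le: "a > 0 ==> norm z >= a ==> norm (K z) <= 1 / a"
proof -
 assume a: "a > 0" "norm z >= a"
 have "1 * a <= (2 * pi) * norm z" using a pi_ge_two by (intro mult_mono) auto
 then show ?thesis unfolding norm_K using a by (intro divide_left_mono) auto
qed

text \<open>The kernel is an inversion composed with a rotation, whence the exact distance formula.\<close>

lemma norm_K_diff:
 assumes "a ~= 0" "b ~= 0"
 shows "norm (K a - K b) = norm (a - b) / (2 * pi * norm a * norm b)"
proof -
 define A where "A = (norm a)^2"
 define B where "B = (norm b)^2"
 have A: "A > 0" "A = (a $ 1)^2 + (a $ 2)^2" and B: "B > 0" "B = (b $ 1)^2 + (b $ 2)^2"
  using assms by (simp_all add: A_def B_def) (simp_all add: norm_plane_sq)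
 have "(norm (K a - K b))^2 = (- (a $ 2) / (2 * pi * A) + b $ 2 / (2 * pi * B))^2
   + (a $ 1 / (2 * pi * A) - b $ 1 / (2 * pi * B))^2"
  unfolding norm_plane_sq[of "K a - K b"] by (simp add: K_nth A_def B_def)
 also have "... = ((a $ 2 * B - b $ 2 * A)^2 + (a $ 1 * B - b $ 1 * A)^2) / (2 * pi * A * B)^2"
 proof -
  have "- (a $ 2) / (2 * pi * A) + b $ 2 / (2 * pi * B) = - (a $ 2 * B - b $ 2 * A) / (2 * pi * A * B)"
   "a $ 1 / (2 * pi * A) - b $ 1 / (2 * pi * B) = (a $ 1 * B - b $ 1 * A) / (2 * pi * A * B)"
   using A(1) B(1) by (simp_all add: field_simps)
  then show ?thesis by (simp only: power_divide add_divide_distrib power2_minus)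
 qed
 also have "(a $ 2 * B - b $ 2 * A)^2 + (a $ 1 * B - b $ 1 * A)^2
   = ((a $ 1)^2 + (a $ 2)^2) * B^2 + ((b $ 1)^2 + (b $ 2)^2) * A^2
    - 2 * A * B * (a $ 1 * b $ 1 + a $ 2 * b $ 2)"
  by (simp add: algebra_simps power2_eq_square)
 also have "... = A * B * ((a $ 1 - b $ 1)^2 + (a $ 2 - b $ 2)^2)"
  unfolding A(2)[symmetric] B(2)[symmetric]
  using A(2) B(2) by (simp add: algebra_simps power2_eq_square)
 also have "(a $ 1 - b $ 1)^2 + (a $ 2 - b $ 2)^2 = (norm (a - b))^2"
  by (simp add: norm_plane_sq)
 also have "A * B * (norm (a - b))^2 / (2 * pi * A * B)^2 = (norm (a - b) / (2 * pi * norm a * norm b))^2"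
  using assms by (simp add: A_def B_def divide_simps power2_eq_square)
 finally show ?thesis by (simp add: power2_eq_iff_nonneg)
qed

text \<open>The far field at the origin is the pairing with the kernel outside the unit disc.\<close>

definition Khat :: "plane => plane" where
 "Khat z = (if norm z > 1 then K z else 0)"

lemma measurable_Khat_nth [measurable]: "(%z. Khat z $ i) \<in> Borel"
proof -
 have "(%z. Khat z $ i) = (%z. if norm z > 1 then K z $ i else 0)" by (auto simp: Khat_def)
 then show ?thesis by simp
qed

lemma measurable_Khat [measurable]: "Khat \<in> Borel"
 unfolding Khat_def[abs_def] by measurable

subsection \<open>Integral bounds\<close>

lemma nn_integral_plane_prod:
 fixes f :: "real => real"
 assumes [measurable]: "f \<in> Borel" and "!!s. 0 <= f s"
 shows "(\<integral>\<^sup>+ z. ennreal (f (z $ 1) * f (z $ 2)) \<partial>(lborel :: plane measure)) = (nnint s. f s)^2"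
proof -
 have ne: "axis 1 1 ~= (axis 2 1 :: plane)" by (simp add: axis_eq_axis)
 have B: "(Basis :: plane set) = {axis 1 1, axis 2 1}" by (auto simp: Basis_plane UNIV_2)
 have "(\<integral>\<^sup>+ z. (\<Prod>b\<in>Basis. ennreal (f (z \<bullet> b))) \<partial>(lborel :: plane measure)) = (\<Prod>b\<in>(Basis :: plane set). nnint s. f s)"
  by (rule nn_integral_lborel_prod) auto
 moreover have "(\<Prod>b\<in>Basis. ennreal (f (z \<bullet> b))) = ennreal (f (z $ 1) * f (z $ 2))" for z :: plane
  using ne assms(2) by (simp add: B inner_axis ennreal_mult)
 ultimately show ?thesis using ne by (simp add: B power2_eq_square)
qed

definition nearK :: "real => plane => real" where
 "nearK \<delta> z = (if norm z <= \<delta> then norm (K z) else 0)"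

lemma measurable_nearK [measurable]: "nearK \<delta> \<in> Borel"
 unfolding nearK_def[abs_def] by measurable

lemma nearK_nonneg: "0 <= nearK \<delta> z" by (simp add: nearK_def)

text \<open>Here \<open>\<bar>z\<bar>\<^sup>2 \<ge> \<bar>z\<^sub>1\<bar> \<bar>z\<^sub>2\<bar>\<close> reduces the singularity to one-dimensional inverse square roots.\<close>

lemma nn_integral_nearK_finite: "(nnint z. nearK 1 z) < \<infinity>"
proof -
 define f :: "real => real" where "f s = (if \<bar>s\<bar> <= 1 then \<bar>s\<bar> powr (-1/2) else 0)" for s
 have [measurable]: "f \<in> Borel" unfolding f_def[abs_def] by measurable
 have f0: "0 <= f s" for s by (simp add: f_def)
 have le: "nearK 1 z <= f (z $ 1) * f (z $ 2)" if "z $ 1 ~= 0" "z $ 2 ~= 0" for z :: plane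
 proof (cases "norm z <= 1")
  case True
  have c: "\<bar>z $ 1\<bar> <= 1" "\<bar>z $ 2\<bar> <= 1" using True component_le_norm_cart order_trans by blast+
  have "\<bar>z $ 1\<bar> * \<bar>z $ 2\<bar> <= norm z * norm z" by (intro mult_mono component_le_norm_cart) auto
  then have "sqrt (\<bar>z $ 1\<bar> * \<bar>z $ 2\<bar>) <= norm z" by (simp add: real_le_lsqrt power2_eq_square)
  moreover have p: "0 < sqrt (\<bar>z $ 1\<bar> * \<bar>z $ 2\<bar>)" using that by simp
  ultimately have "norm (K z) <= 1 / sqrt (\<bar>z $ 1\<bar> * \<bar>z $ 2\<bar>)" by (intro norm_K_le)
  also have "... = \<bar>z $ 1\<bar> powr (-1/2) * \<bar>z $ 2\<bar> powr (-1/2)"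
   using that by (simp add: real_sqrt_mult powr_minus_divide powr_half_sqrt)
  finally show ?thesis using True c by (simp add: nearK_def f_def)
 next
  case False then show ?thesis using f0 by (simp add: nearK_def)
 qed
 have half: "(nnint s. if 0 <= s \<and> s <= 1 then s powr (-1/2) else 0) = ennreal 2"
 proof -
  have "((%s. s powr (-1/2)) has_integral (1 powr (-1/2 + 1) / (-1/2 + 1))) {0..1 :: real}"
   by (rule has_integral_powr_from_0) auto
  then have "((%s. s powr (-1/2)) has_integral 2) {0..1 :: real}" by simp
  then have "((%s. if s \<in> {0..1} then s powr (-1/2) else 0) has_integral (2 :: real)) UNIV"
   by (simp only: has_integral_restrict_UNIV)
  then show ?thesis by (intro nn_integral_has_integral_lborel) auto
 qed
 have "(nnint s. f s) <=
   (\<integral>\<^sup>+ s. ennreal (if 0 <= s \<and> s <= 1 then s powr (-1/2) else 0) +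
    ennreal (if 0 <= -s \<and> -s <= 1 then (-s) powr (-1/2) else 0) \<partial>lborel)"
  by (intro nn_integral_mono) (auto simp: f_def abs_if)
 also have "... = ennreal 2 + (nnint s. if 0 <= -s \<and> -s <= 1 then (-s) powr (-1/2) else 0)"
  by (subst nn_integral_add) (use half in auto)
 also have "(nnint s. if 0 <= -s \<and> -s <= 1 then (-s) powr (-1/2) else 0) = ennreal 2"
  using nn_integral_real_affine[of "%s. ennreal (if 0 <= s \<and> s <= 1 then s powr (-1/2) else 0)" "-1" 0] half
  by (simp cong: if_cong)
 finally have fin: "(nnint s. f s) < \<infinity>" by (simp add: le_less_trans)
 have AEc: "AE z in lborel. (z :: plane) $ i ~= 0" for i
 proof -
  have "negligible {z :: plane. axis i 1 \<bullet> z = 0}"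
   by (rule negligible_hyperplane) (simp add: axis_eq_0_iff)
  then have "AE z in lebesgue. \<not> (axis i 1 \<bullet> (z :: plane) = 0)"
   by (simp add: negligible_iff_null_sets eventually_ae_filter) blast
  then have "AE z in lborel. \<not> (axis i 1 \<bullet> (z :: plane) = 0)"
   by (subst (asm) AE_completion_iff) auto
  then show ?thesis by (simp add: inner_axis')
 qed
 have "(nnint z. nearK 1 z) <= (\<integral>\<^sup>+ z. ennreal (f (z $ 1) * f (z $ 2)) \<partial>(lborel :: plane measure))"
 proof (rule nn_integral_mono_AE)
  show "AE z in lborel. ennreal (nearK 1 z) <= ennreal (f (z $ 1) * f (z $ 2))"
   using AEc[of 1] AEc[of 2] by eventually_elim (intro ennreal_leI le)
 qed
 also have "... < \<infinity>" using fin f0 by (subst nn_integral_plane_prod) (auto simp: power_less_top_ennreal)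
 finally show ?thesis .
qed

text \<open>The square of \<open>K (x - y) - K (- y)\<close> is of order \<open>\<bar>x\<bar>\<^sup>2 / \<bar>y\<bar>\<^sup>4\<close> at infinity. The cube trades one power of \<open>\<bar>y\<bar>\<close>
 for a bound that is uniform in \<open>x\<close> up to a linear factor.\<close>

definition decay3 :: "plane => real" where
 "decay3 z = 1 / (1 + norm z) ^ 3"

lemma decay3_pos: "0 < decay3 z"
 unfolding decay3_def by (intro divide_pos_pos zero_less_power add_pos_nonneg) auto

lemma measurable_decay3 [measurable]: "decay3 \<in> Borel"
 unfolding decay3_def[abs_def] by measurable

lemma decay3_integrable: "integrable lborel decay3"
proof -
 define f :: "real => real" where "f s = (1 + \<bar>s\<bar>) powr (-3/2)" for s
 have [measurable]: "f \<in> Borel" unfolding f_def[abs_def] by measurable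
 have f0: "0 <= f s" for s by (simp add: f_def)
 have le: "decay3 z <= f (z $ 1) * f (z $ 2)" for z :: plane
 proof -
  have "(1 + \<bar>z $ 1\<bar>) * (1 + \<bar>z $ 2\<bar>) <= (1 + norm z) * (1 + norm z)"
   by (intro mult_mono) (auto simp: component_le_norm_cart)
  then have "((1 + norm z) * (1 + norm z)) powr (-3/2) <= ((1 + \<bar>z $ 1\<bar>) * (1 + \<bar>z $ 2\<bar>)) powr (-3/2)"
   by (intro powr_mono2') (auto intro!: mult_pos_pos add_pos_nonneg)
  also have "... = f (z $ 1) * f (z $ 2)" by (simp add: f_def powr_mult)
  finally have 1: "((1 + norm z) * (1 + norm z)) powr (-3/2) <= f (z $ 1) * f (z $ 2)" .
  have p: "1 + norm z > 0" by (simp add: add_pos_nonneg)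
  have "((1 + norm z) * (1 + norm z)) powr (-3/2) = (1 + norm z) powr (-3)"
   using p by (simp add: powr_mult flip: powr_add)
  also have "... = decay3 z" using p by (simp add: decay3_def powr_minus_divide)
  finally show ?thesis using 1 by simp
 qed
 have half: "(\<integral>\<^sup>+ s. ennreal ((1 + s) powr (-3/2)) * indicator {0..} s \<partial>lborel) = ennreal (0 - (- 2))"
 proof (rule nn_integral_FTC_atLeast[where F = "%s. - 2 * (1 + s) powr (-1/2)", THEN trans])
  show "((%s :: real. - 2 * (1 + s) powr (-1/2)) \<longlongrightarrow> 0) at_top"
  proof -
   have "((%s :: real. (1 + s) powr (-1/2)) \<longlongrightarrow> 0) at_top"
    by (intro tendsto_neg_powr filterlim_tendsto_add_at_top[OF tendsto_const] filterlim_ident) auto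
   from tendsto_mult_left[OF this, of "-2"] show ?thesis by simp
  qed
  show "DERIV (%s. - 2 * (1 + s) powr (-1/2)) s :> (1 + s) powr (-3/2)" if "0 <= s" for s :: real
   using that by (auto intro!: derivative_eq_intros)
 qed auto
 have "(nnint s. f s) <=
   (\<integral>\<^sup>+ s. ennreal ((1 + s) powr (-3/2)) * indicator {0..} s +
    ennreal ((1 + (-s)) powr (-3/2)) * indicator {0..} (-s) \<partial>lborel)"
  by (intro nn_integral_mono) (auto simp: f_def abs_if indicator_def)
 also have "... = ennreal 2 + (\<integral>\<^sup>+ s. ennreal ((1 + (-s)) powr (-3/2)) * indicator {0..} (-s) \<partial>lborel)"
  by (subst nn_integral_add) (use half in auto)
 also have "(\<integral>\<^sup>+ s. ennreal ((1 + (-s)) powr (-3/2)) * indicator {0..} (-s) \<partial>lborel) = ennreal 2"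
  using nn_integral_real_affine[of "%s. ennreal ((1 + s) powr (-3/2)) * indicator {0..} s" "-1" 0] half
  by simp
 finally have fin: "(nnint s. f s) < \<infinity>" by (simp add: le_less_trans)
 have "(nnint z. decay3 z) <= (\<integral>\<^sup>+ z. ennreal (f (z $ 1) * f (z $ 2)) \<partial>(lborel :: plane measure))"
  by (intro nn_integral_mono ennreal_leI le)
 also have "... < \<infinity>" using fin f0 by (subst nn_integral_plane_prod) (auto simp: power_less_top_ennreal)
 finally show ?thesis using decay3_pos by (intro integrableI_nonneg) (auto intro: less_imp_le)
qed

text \<open>Schur's test in bilinear form.\<close>

lemma Schur_bound:
 fixes a b \<kappa> :: "plane => real"
 assumes [measurable]: "a \<in> Borel" "b \<in> Borel" "\<kappa> \<in> Borel"
  and \<kappa>0: "!!z. 0 <= \<kappa> z"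
 shows "(\<integral>\<^sup>+ x. (nnint y. \<bar>a x\<bar> * \<bar>b y\<bar> * \<kappa> (x - y)) \<partial>lborel)
  <= (nnint z. \<kappa> z) * ((nnint x. (a x)^2) + (nnint y. (b y)^2))"
proof -
 have "(\<integral>\<^sup>+ x. (nnint y. \<bar>a x\<bar> * \<bar>b y\<bar> * \<kappa> (x - y)) \<partial>lborel)
  <= (\<integral>\<^sup>+ x. (\<integral>\<^sup>+ y. ennreal ((a x)^2) * ennreal (\<kappa> (x - y)) + ennreal ((b y)^2) * ennreal (\<kappa> (x - y)) \<partial>lborel) \<partial>lborel)"
 proof (intro nn_integral_mono)
  fix x y
  have "0 <= (\<bar>a x\<bar> - \<bar>b y\<bar>)^2" by simp
  then have "2 * (\<bar>a x\<bar> * \<bar>b y\<bar>) <= (a x)^2 + (b y)^2" by (simp add: power2_diff mult.assoc)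
  then have "\<bar>a x\<bar> * \<bar>b y\<bar> <= (a x)^2 + (b y)^2"
   using mult_nonneg_nonneg[OF abs_ge_zero[of "a x"] abs_ge_zero[of "b y"]] by linarith
  then have "\<bar>a x\<bar> * \<bar>b y\<bar> * \<kappa> (x - y) <= ((a x)^2 + (b y)^2) * \<kappa> (x - y)"
   by (rule mult_right_mono[OF _ \<kappa>0])
  then show "ennreal (\<bar>a x\<bar> * \<bar>b y\<bar> * \<kappa> (x - y)) <=
    ennreal ((a x)^2) * ennreal (\<kappa> (x - y)) + ennreal ((b y)^2) * ennreal (\<kappa> (x - y))"
   using \<kappa>0[of "x - y"] by (simp add: ennreal_leI distrib_right flip: ennreal_mult ennreal_plus)
 qed
 also have "... = (\<integral>\<^sup>+ x. (\<integral>\<^sup>+ y. ennreal ((a x)^2) * ennreal (\<kappa> (x - y)) \<partial>lborel) \<partial>lborel)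
   + (\<integral>\<^sup>+ x. (\<integral>\<^sup>+ y. ennreal ((b y)^2) * ennreal (\<kappa> (x - y)) \<partial>lborel) \<partial>lborel)"
  by (subst nn_integral_add[symmetric]) (auto intro!: nn_integral_cong nn_integral_add)
 also have "(\<integral>\<^sup>+ x. (\<integral>\<^sup>+ y. ennreal ((a x)^2) * ennreal (\<kappa> (x - y)) \<partial>lborel) \<partial>lborel)
   = (nnint z. \<kappa> z) * (nnint x. (a x)^2)"
  by (simp add: nn_integral_cmult nn_integral_multc nn_integral_reflect[of "%z. ennreal (\<kappa> z)"] mult.commute)
 also have "(\<integral>\<^sup>+ x. (\<integral>\<^sup>+ y. ennreal ((b y)^2) * ennreal (\<kappa> (x - y)) \<partial>lborel) \<partial>lborel)
   = (\<integral>\<^sup>+ y. (\<integral>\<^sup>+ x. ennreal ((b y)^2) * ennreal (\<kappa> (x - y)) \<partial>lborel) \<partial>lborel)"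
  by (rule lborel_pair.Fubini') simp
 also have "... = (nnint z. \<kappa> z) * (nnint y. (b y)^2)"
 proof -
  have "(nnint x. \<kappa> (x - y)) = (nnint z. \<kappa> z)" for y
   by (subst lborel_distr_plus[of y, symmetric], subst nn_integral_distr) auto
  then show ?thesis by (simp add: nn_integral_cmult nn_integral_multc mult.commute)
 qed
 finally show ?thesis by (simp add: distrib_left)
qed

subsection \<open>The renormalised velocity\<close>

text \<open>Subtracting the far field at the origin turns the kernel into \<open>K (x - y) - Khat (- y)\<close>, which is
 square integrable in \<open>y\<close> away from \<open>x\<close>; the singularity at \<open>x\<close> is cut off at the scale \<open>\<delta>\<close>.\<close>

definition farK :: "real => plane => plane => plane" where
 "farK \<delta> x y = (if norm (x - y) > \<delta> then K (x - y) else 0) - Khat (- y)"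

lemma measurable_farK [measurable]:
 "(%(x, y). farK \<delta> x y $ i) \<in> borel_measurable (borel \<Otimes>\<^sub>M borel)"
proof -
 have eq: "(%(x, y). farK \<delta> x y $ i) = (%p. (if norm (fst p - snd p) > \<delta> then K (fst p - snd p) $ i else 0) - Khat (- snd p) $ i)"
  by (auto simp: farK_def)
 show ?thesis unfolding eq by measurable
qed

lemma measurable_farK' [measurable]: "(%y. farK \<delta> x y $ i) \<in> Borel"
proof -
 have eq: "(%y. farK \<delta> x y $ i) = (%y. (if norm (x - y) > \<delta> then K (x - y) $ i else 0) - Khat (- y) $ i)"
  by (auto simp: farK_def)
 show ?thesis unfolding eq by measurable
qed

lemma cube_inverse_le:
 assumes "(A :: real) >= 1"
 shows "1 / A^3 <= 8 / (1 + A)^3"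
proof -
 have "(1 + A)^3 <= (2 * A)^3" using assms by (intro power_mono) auto
 then show ?thesis using assms by (simp add: divide_simps power_mult_distrib)
qed

lemma farK_1_bound: "(norm (farK 1 x y))^2 <= 16 * (1 + norm x) * (decay3 (x - y) + decay3 y)"
proof -
 define A where "A = norm (x - y)"
 define B where "B = norm y"
 have AB0: "0 <= A" "0 <= B" by (auto simp: A_def B_def)
 have dA: "decay3 (x - y) = 1 / (1 + A)^3" and dB: "decay3 y = 1 / (1 + B)^3" by (auto simp: decay3_def A_def B_def)
 have dpos: "0 < decay3 (x - y)" "0 < decay3 y" by (rule decay3_pos)+
 have small: "1 <= 16 * (1 + norm x) * (1 / (1 + t)^3)" if "0 <= t" "t <= 1" for t :: real
 proof -
  have "(1 + t)^3 <= 2^3" using that by (intro power_mono) auto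
  then have "1 <= 16 * (1 / (1 + t)^3)" using that by (simp add: divide_simps)
  also have "... <= 16 * (1 + norm x) * (1 / (1 + t)^3)" using that by (intro mult_right_mono) auto
  finally show ?thesis .
 qed
 have mono: "16 * (1 + norm x) * decay3 y <= 16 * (1 + norm x) * (decay3 (x - y) + decay3 y)"
  "16 * (1 + norm x) * decay3 (x - y) <= 16 * (1 + norm x) * (decay3 (x - y) + decay3 y)"
  using dpos by (auto intro!: mult_left_mono)
 have K1: "(norm (K z))^2 <= 1" if "norm z > 1" for z
  using norm_K_le[of 1 z] that power_le_one[of "norm (K z)" 2] by auto
 consider "A > 1" "B > 1" | "A > 1" "B <= 1" | "A <= 1" "B > 1" | "A <= 1" "B <= 1" by linarith
 then show ?thesis
 proof cases
  case 1
  have nz: "x - y ~= 0" "- y ~= 0" using 1 by (auto simp: A_def B_def)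
  have "farK 1 x y = K (x - y) - K (- y)" using 1 by (simp add: farK_def Khat_def A_def B_def)
  then have "norm (farK 1 x y) = norm x / (2 * pi * A * B)"
   using norm_K_diff[OF nz] by (simp add: A_def B_def)
  also have "... <= norm x / (A * B)"
  proof (rule divide_left_mono)
   have "1 * (A * B) <= (2 * pi) * (A * B)" using pi_ge_two AB0 by (intro mult_right_mono) auto
   then show "A * B <= 2 * pi * A * B" by (simp add: mult.assoc)
  qed (use 1 in auto)
  finally have "(norm (farK 1 x y))^2 <= (norm x / (A * B))^2" by (intro power_mono) auto
  also have "... = norm x * (norm x / (A * B)^2)" by (simp add: power2_eq_square)
  also have "... <= norm x * ((A + B) / (A * B)^2)"
  proof -
   have "norm x <= A + B" using norm_triangle_ineq[of "x - y" y] by (simp add: A_def B_def)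
   then show ?thesis by (intro mult_left_mono divide_right_mono) auto
  qed
  also have "(A + B) / (A * B)^2 = 1 / (A * B^2) + 1 / (A^2 * B)"
   using 1 by (simp add: divide_simps power2_eq_square) 
  also have "... <= 2 * (1 / A^3 + 1 / B^3)"
  proof -
   have m: "1 / (p * q * r) <= 1 / A^3 + 1 / B^3" if "p = A \<or> p = B" "q = A \<or> q = B" "r = A \<or> r = B" for p q r
   proof -
    define m where "m = min A B"
    have m: "1 < m" "m <= p" "m <= q" "m <= r" using that 1 by (auto simp: m_def)
    have "m * m * m <= p * q * r" using m by (intro mult_mono) auto
    then have "1 / (p * q * r) <= 1 / m^3"
     using m by (intro divide_left_mono) (auto simp: power3_eq_cube intro!: mult_pos_pos)
    also have "... <= 1 / A^3 + 1 / B^3" using 1 by (auto simp: m_def min_def)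
    finally show ?thesis .
   qed
   show ?thesis using m[of A B B] m[of A A B] by (simp add: power2_eq_square mult.assoc)
  qed
  also have "... <= 2 * (8 / (1 + A)^3 + 8 / (1 + B)^3)"
   using cube_inverse_le[of A] cube_inverse_le[of B] 1 by simp
  also have "... = 16 * (decay3 (x - y) + decay3 y)" by (simp add: dA dB)
  finally have "(norm (farK 1 x y))^2 <= norm x * (16 * (decay3 (x - y) + decay3 y))"
   by (simp add: mult_left_mono)
  also have "... <= (1 + norm x) * (16 * (decay3 (x - y) + decay3 y))"
   using dpos by (intro mult_right_mono) auto
  finally show ?thesis by (simp add: algebra_simps)
 next
  case 2
  then have "farK 1 x y = K (x - y)" by (simp add: farK_def Khat_def A_def B_def)
  then have "(norm (farK 1 x y))^2 <= 1" using K1 2 by (simp add: A_def)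
  with small[OF AB0(2) 2(2)] mono(1) show ?thesis unfolding dB[symmetric] by linarith
 next
  case 3
  then have "farK 1 x y = - K (- y)" by (simp add: farK_def Khat_def A_def B_def)
  then have "(norm (farK 1 x y))^2 <= 1" using K1[of "- y"] 3 by (simp add: B_def)
  with small[OF AB0(1) 3(1)] mono(2) show ?thesis unfolding dA[symmetric] by linarith
 next
  case 4
  then have "farK 1 x y = 0" by (simp add: farK_def Khat_def A_def B_def)
  then show ?thesis using dpos by simp
 qed
qed

lemma integral_decay3_shift:
 "integrable lborel (%y. decay3 (x - y))" "(LINT y|lborel. decay3 (x - y)) = (LINT y|lborel. decay3 y)"
proof -
 show "(LINT y|lborel. decay3 (x - y)) = (LINT y|lborel. decay3 y)" by (rule integral_reflect) simp
 have "integrable (distr lborel borel (%y. x - y)) decay3" using decay3_integrable by (simp add: lborel_distr_reflect)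
 then show "integrable lborel (%y. decay3 (x - y))" by (subst (asm) integrable_distr_eq) auto
qed

definition far_const :: real where
 "far_const = 32 * (LINT z|lborel. decay3 z)"

lemma far_const_nonneg: "0 <= far_const"
 unfolding far_const_def using decay3_pos by (simp add: less_imp_le integral_nonneg_AE)

lemma farK_sq_integrable_1:
 "sq_integrable (%y. farK 1 x y $ i)" "(norm (abs_l2 (%y. farK 1 x y $ i)))^2 <= far_const * (1 + norm x)"
proof -
 have le: "(farK 1 x y $ i)^2 <= 16 * (1 + norm x) * (decay3 (x - y) + decay3 y)" for y
  using farK_1_bound[of x y] power_mono[OF component_le_norm_cart[of "farK 1 x y" i] abs_ge_zero, of 2]
  by simp
 have int: "integrable lborel (%y. 16 * (1 + norm x) * (decay3 (x - y) + decay3 y))"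
  using integral_decay3_shift(1)[of x] decay3_integrable by (intro integrable_mult_right Bochner_Integration.integrable_add)
 have i2: "integrable lborel (%y. (farK 1 x y $ i)^2)"
 proof (rule integrable_dominated[OF int])
  show "norm ((farK 1 x y $ i)^2) <= norm (16 * (1 + norm x) * (decay3 (x - y) + decay3 y))" for y
    using order_trans[OF le[of y] abs_ge_self] by (simp only: real_norm_def abs_of_nonneg[OF zero_le_power2])
 qed measurable
 then show s: "sq_integrable (%y. farK 1 x y $ i)" by (simp add: sq_integrable_def)
 have "(norm (abs_l2 (%y. farK 1 x y $ i)))^2 <= (LINT y|lborel. 16 * (1 + norm x) * (decay3 (x - y) + decay3 y))"
  unfolding norm_abs_l2_sq[OF s] by (rule integral_mono[OF i2 int le])
 also have "... = far_const * (1 + norm x)"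
  using integral_decay3_shift[of x] decay3_integrable by (simp add: far_const_def)
 finally show "(norm (abs_l2 (%y. farK 1 x y $ i)))^2 <= far_const * (1 + norm x)" .
qed

lemma integral_disc_sq_bound:
 fixes h :: "plane => real"
 assumes [measurable]: "h \<in> Borel" and r: "0 <= r" and M: "!!y. \<bar>h y\<bar> <= M"
  and z: "!!y. norm (y - a) > r ==> h y = 0"
 shows "sq_integrable h" "(norm (abs_l2 h))^2 <= pi * r^2 * M^2"
proof -
 have nz: "h y = 0" if "norm y > r + norm a" for y
  using z[of y] that norm_triangle_ineq[of "y - a" a] by simp
 show s: "sq_integrable h" by (rule sq_integrable_bounded_support[OF _ M nz]) auto
 have c: "measure lborel (cball a r) = pi * r^2"
  using content_cball[OF r, of a] by (simp add: unit_ball_vol_2)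
 have "(norm (abs_l2 h))^2 <= (LINT y|lborel. M^2 * indicator (cball a r) y)"
  unfolding norm_abs_l2_sq[OF s]
 proof (rule integral_mono)
  show "integrable lborel (%y. (h y)^2)" using s by (simp add: sq_integrable_def)
  show "integrable lborel (%y. M^2 * indicator (cball a r) y :: real)"
   using emeasure_cball_plane_finite[of a r] by simp
  show "(h y)^2 <= M^2 * indicator (cball a r) y" for y
   using z[of y] power_mono[OF M[of y] abs_ge_zero, of 2]
   by (cases "y \<in> cball a r") (auto simp: dist_norm norm_minus_commute)
 qed
 also have "... = pi * r^2 * M^2" using c emeasure_cball_plane_finite[of a r] by simp
 finally show "(norm (abs_l2 h))^2 <= pi * r^2 * M^2" .
qed

lemma farK_sq_integrable:
 assumes d: "0 < \<delta>" "\<delta> <= 1"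
 shows "sq_integrable (%y. farK \<delta> x y $ i)"
  and "norm (abs_l2 (%y. farK \<delta> x y $ i)) <= sqrt (far_const * (1 + norm x)) + sqrt (pi * (1/\<delta>)^2)"
proof -
 define m where "m y = (if norm (x - y) > \<delta> \<and> norm (x - y) <= 1 then K (x - y) $ i else 0)" for y
 have [measurable]: "m \<in> Borel" unfolding m_def[abs_def] by measurable
 have mb: "\<bar>m y\<bar> <= 1 / \<delta>" for y
  using norm_K_le[OF d(1), of "x - y"] K_nth_le[of "x - y" i] d by (auto simp: m_def)
 have mz: "m y = 0" if "norm (y - x) > 1" for y using that by (simp add: m_def norm_minus_commute)
 note M = integral_disc_sq_bound[of m 1 "1/\<delta>" x, OF _ _ mb mz, simplified]
 have eq: "(%y. farK \<delta> x y $ i) = (%y. farK 1 x y $ i + m y)" using d by (auto simp: farK_def m_def)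
 note F = farK_sq_integrable_1[of x i]
 show "sq_integrable (%y. farK \<delta> x y $ i)" unfolding eq by (rule sq_integrable_add[OF F(1) M(1)])
 have "norm (abs_l2 (%y. farK \<delta> x y $ i)) <= norm (abs_l2 (%y. farK 1 x y $ i)) + norm (abs_l2 m)"
  unfolding eq abs_l2_add[OF F(1) M(1)] by (rule norm_triangle_ineq)
 also have "... <= sqrt (far_const * (1 + norm x)) + sqrt (pi * (1/\<delta>)^2)"
  using F(2) M(2) by (intro add_mono real_le_rsqrt) (auto simp: power_divide)
 finally show "norm (abs_l2 (%y. farK \<delta> x y $ i)) <= sqrt (far_const * (1 + norm x)) + sqrt (pi * (1/\<delta>)^2)" .
qed

definition near_vel :: "real => l2 => 2 => plane => real" where
 "near_vel \<delta> W i x = (LINT y|lborel. rep_l2 W y * (if norm (x - y) <= \<delta> then K (x - y) $ i else 0))"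

definition far_vel :: "real => l2 => 2 => plane => real" where
 "far_vel \<delta> W i x = (LINT y|lborel. rep_l2 W y * farK \<delta> x y $ i)"

definition ren_vel :: "l2 => 2 => plane => real" where
 "ren_vel W i x = (LINT y|lborel. rep_l2 W y * (K (x - y) $ i - Khat (- y) $ i))"

definition near_int :: "real => l2 => plane => ennreal" where
 "near_int \<delta> W x = (nnint y. \<bar>rep_l2 W y\<bar> * nearK \<delta> (x - y))"

lemma measurable_near_int [measurable]: "near_int \<delta> W \<in> Borel"
 unfolding near_int_def[abs_def] by measurable

lemma measurable_near_vel [measurable]: "near_vel \<delta> W i \<in> Borel"
 unfolding near_vel_def[abs_def] by measurable

lemma measurable_far_vel [measurable]: "far_vel \<delta> W i \<in> Borel"
 unfolding far_vel_def[abs_def] by measurable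

lemma measurable_ren_vel [measurable]: "ren_vel W i \<in> Borel"
 unfolding ren_vel_def[abs_def] by measurable

lemma far_vel_inner: "0 < \<delta> ==> \<delta> <= 1 ==> far_vel \<delta> W i x = inner W (abs_l2 (%y. farK \<delta> x y $ i))"
 unfolding far_vel_def using pairing_eq_inner[OF farK_sq_integrable(1), of \<delta> W x i] by (simp add: pairing_def)

lemma far_vel_bound:
 assumes "0 < \<delta>" "\<delta> <= 1"
 shows "\<bar>far_vel \<delta> W i x\<bar> <= norm W * (sqrt (far_const * (1 + norm x)) + sqrt (pi * (1/\<delta>)^2))"
 unfolding far_vel_inner[OF assms]
 using Cauchy_Schwarz_ineq2[of W "abs_l2 (%y. farK \<delta> x y $ i)"]
  mult_left_mono[OF farK_sq_integrable(2)[OF assms, of x i] norm_ge_zero[of W]] by linarith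

lemma far_vel_bound_1: "\<bar>far_vel 1 W i x\<bar> <= norm W * sqrt (far_const * (1 + norm x))"
proof -
 have "norm (abs_l2 (%y. farK 1 x y $ i)) <= sqrt (far_const * (1 + norm x))"
  by (rule real_le_rsqrt[OF farK_sq_integrable_1(2)])
 from mult_left_mono[OF this norm_ge_zero[of W]] show ?thesis
  using far_vel_inner[of 1 W i x] Cauchy_Schwarz_ineq2[of W "abs_l2 (%y. farK 1 x y $ i)"] by simp
qed

lemma near_vel_le: "ennreal \<bar>near_vel \<delta> W i x\<bar> <= near_int \<delta> W x"
proof (cases "integrable lborel (%y. rep_l2 W y * (if norm (x - y) <= \<delta> then K (x - y) $ i else 0))")
 case True
 have "ennreal \<bar>near_vel \<delta> W i x\<bar> <= (nnint y. norm (rep_l2 W y * (if norm (x - y) <= \<delta> then K (x - y) $ i else 0)))"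
  unfolding near_vel_def using integral_norm_bound_ennreal[OF True] by simp
 also have "... <= near_int \<delta> W x"
  unfolding near_int_def
  by (intro nn_integral_mono ennreal_leI) (auto simp: nearK_def abs_mult K_nth_le intro!: mult_left_mono)
 finally show ?thesis .
qed (simp add: near_vel_def not_integrable_integral_eq)

lemma near_integrable:
 assumes fin: "near_int \<delta> W x < \<infinity>"
 shows "integrable lborel (%y. rep_l2 W y * (if norm (x - y) <= \<delta> then K (x - y) $ i else 0))"
proof (rule integrableI_bounded)
 have "(nnint y. norm (rep_l2 W y * (if norm (x - y) <= \<delta> then K (x - y) $ i else 0))) <= near_int \<delta> W x"
  unfolding near_int_def
  by (intro nn_integral_mono ennreal_leI) (auto simp: nearK_def abs_mult K_nth_le intro!: mult_left_mono)
 then show "(nnint y. norm (rep_l2 W y * (if norm (x - y) <= \<delta> then K (x - y) $ i else 0))) < \<infinity>"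
  using fin by (rule le_less_trans)
qed measurable

lemma near_int_mono: "\<delta> <= 1 ==> near_int \<delta> W x <= near_int 1 W x"
 unfolding near_int_def by (intro nn_integral_mono ennreal_leI) (auto simp: nearK_def intro!: mult_left_mono)

text \<open>Off a null set depending on \<open>W\<close>, the singular integral converges absolutely near \<open>x\<close>.\<close>

definition good :: "l2 => plane set" where
 "good W = {x. near_int 1 W x < \<infinity>}"

lemma good_borel [measurable]: "good W \<in> sets borel"
 unfolding good_def by measurable

lemma AE_good: "AE x in lborel. x \<in> good W"
proof -
 have "AE x in lborel. x \<in> cball 0 (real n) --> x \<in> good W" for n
 proof -
  let ?a = "indicator (cball 0 (real n)) :: plane => real"
  have sa: "sq_integrable ?a"
   by (rule sq_integrable_bounded_support[of _ 1 "real n"]) (auto simp: indicator_def)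
  have "(\<integral>\<^sup>+ x. (nnint y. \<bar>?a x\<bar> * \<bar>rep_l2 W y\<bar> * nearK 1 (x - y)) \<partial>lborel)
   <= (nnint z. nearK 1 z) * ((nnint x. (?a x)^2) + (nnint y. (rep_l2 W y)^2))"
   by (rule Schur_bound) (auto simp: nearK_nonneg)
  also have "... < \<infinity>"
   using nn_integral_nearK_finite unfolding nn_integral_sq_rep nn_integral_sq_abs_l2[OF sa]
   by (simp add: ennreal_mult_less_top flip: ennreal_plus)
  finally have "AE x in lborel. (nnint y. \<bar>?a x\<bar> * \<bar>rep_l2 W y\<bar> * nearK 1 (x - y)) ~= \<infinity>"
   by (intro nn_integral_PInf_AE) auto
  then show ?thesis
  proof eventually_elim
   case (elim x)
   then show ?case
    by (cases "x \<in> cball 0 (real n)") (simp_all add: good_def near_int_def less_top)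
  qed
 qed
 then have "AE x in lborel. \<forall>n :: nat. x \<in> cball 0 (real n) --> x \<in> good W"
  by (subst AE_all_countable) auto
 then show ?thesis
 proof eventually_elim
  case (elim x)
  obtain n :: nat where "norm x <= real n" using real_arch_simple by blast
  with elim show ?case by (metis mem_cball_0)
 qed
qed

lemma ren_vel_split:
 assumes d: "0 < \<delta>" "\<delta> <= 1" and x: "x \<in> good W"
 shows "integrable lborel (%y. rep_l2 W y * (K (x - y) $ i - Khat (- y) $ i))"
  and "ren_vel W i x = near_vel \<delta> W i x + far_vel \<delta> W i x"
proof -
 have eq: "(%y. rep_l2 W y * (K (x - y) $ i - Khat (- y) $ i))
  = (%y. rep_l2 W y * (if norm (x - y) <= \<delta> then K (x - y) $ i else 0) + rep_l2 W y * farK \<delta> x y $ i)"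
  by (auto simp: farK_def algebra_simps)
 have 1: "integrable lborel (%y. rep_l2 W y * (if norm (x - y) <= \<delta> then K (x - y) $ i else 0))"
  by (rule near_integrable) (use near_int_mono[OF d(2), of W x] x in \<open>auto simp: good_def\<close>)
 have 2: "integrable lborel (%y. rep_l2 W y * farK \<delta> x y $ i)"
  by (rule integrable_rep_mult[OF farK_sq_integrable(1)[OF d]])
 show "integrable lborel (%y. rep_l2 W y * (K (x - y) $ i - Khat (- y) $ i))"
  unfolding eq using 1 2 by simp
 show "ren_vel W i x = near_vel \<delta> W i x + far_vel \<delta> W i x"
  unfolding ren_vel_def near_vel_def far_vel_def eq using 1 2 by simp
qed

subsection \<open>Tails\<close>

definition tail_sq :: "l2 => real => real" where
 "tail_sq W r = (LINT y|lborel. (rep_l2 W y)^2 * indicator {y. norm y >= r} y)"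

lemma tail_sq_tendsto: "(tail_sq W \<longlongrightarrow> 0) at_top"
proof -
 have i: "integrable lborel (%y. (rep_l2 W y)^2)" using sq_integrable_rep[of W] by (simp add: sq_integrable_def)
 have "((%r. LINT y|lborel. (rep_l2 W y)^2 * indicator {y. norm y >= r} y) \<longlongrightarrow> (LINT y|(lborel :: plane measure). 0)) at_top"
 proof (rule integral_dominated_convergence_at_top[where w = "%y. (rep_l2 W y)^2"])
  show "AE y in lborel. ((%r. (rep_l2 W y)^2 * indicator {y. norm y >= r} y) \<longlongrightarrow> 0) at_top"
  proof (rule AE_I2)
   fix y
   have "\<forall>\<^sub>F r in at_top. (rep_l2 W y)^2 * indicator {y. norm y >= r} y = 0"
    using eventually_gt_at_top[of "norm y"] by eventually_elim (simp add: indicator_def)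
   then show "((%r. (rep_l2 W y)^2 * indicator {y. norm y >= r} y) \<longlongrightarrow> 0) at_top" by (rule tendsto_eventually)
  qed
  show "\<forall>\<^sub>F r in at_top. AE y in lborel. norm ((rep_l2 W y)^2 * indicator {y. norm y >= r} y) <= (rep_l2 W y)^2"
   by (auto simp: indicator_def)
 qed (use i in measurable)
 then show ?thesis by (simp add: tail_sq_def[abs_def])
qed

text \<open>The kernel has a finite amount of square norm in every dyadic annulus, uniformly in the
 scale. Hence all ways of cutting it off at the scale \<open>R\<close> agree up to a tail of \<open>W\<close>.\<close>

lemma annulus_pairing_bound:
 fixes h :: "plane => real"
 assumes [measurable]: "h \<in> Borel" and R: "0 < R" and b: "!!y. \<bar>h y\<bar> <= C / R"
  and z: "!!y. norm y < R / 2 \<or> norm y > 4 * R ==> h y = 0"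
 shows "sq_integrable h" "\<bar>LINT y|lborel. rep_l2 W y * h y\<bar> <= sqrt (tail_sq W (R / 2)) * sqrt (16 * pi * C^2)"
proof -
 note H = integral_disc_sq_bound[of h "4 * R" "C / R" 0, OF _ _ b]
 show sh: "sq_integrable h" by (rule H(1)) (use R z in auto)
 have nh: "norm (abs_l2 h) <= sqrt (16 * pi * C^2)"
 proof (rule real_le_rsqrt)
  have "(norm (abs_l2 h))^2 <= pi * (4 * R)^2 * (C / R)^2" by (rule H(2)) (use R z in auto)
  then show "(norm (abs_l2 h))^2 <= 16 * pi * C^2" using R by (simp add: power_mult_distrib power_divide)
 qed
 let ?t = "%y. rep_l2 W y * indicator {y. norm y >= R / 2} y"
 have t2: "(?t y)^2 = (rep_l2 W y)^2 * indicator {y. norm y >= R / 2} y" for y by (simp add: indicator_def)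
 have it: "integrable lborel (%y. (rep_l2 W y)^2)" using sq_integrable_rep[of W] by (simp add: sq_integrable_def)
 have st: "sq_integrable ?t"
  unfolding sq_integrable_def
 proof
  show "?t \<in> borel_measurable lborel" by measurable
  show "integrable lborel (%y. (?t y)^2)"
   unfolding t2 by (rule integrable_real_mult_indicator[OF _ it]) measurable
 qed
 have "(LINT y|lborel. rep_l2 W y * h y) = (LINT y|lborel. ?t y * h y)"
  by (intro Bochner_Integration.integral_cong) (use z in \<open>auto simp: indicator_def not_le\<close>)
 also have "... = inner (abs_l2 ?t) (abs_l2 h)" by (rule inner_abs_l2[OF st sh, symmetric])
 also have "\<bar>...\<bar> <= norm (abs_l2 ?t) * norm (abs_l2 h)" by (rule Cauchy_Schwarz_ineq2)
 also have "norm (abs_l2 ?t) = sqrt (tail_sq W (R / 2))"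
  unfolding tail_sq_def t2[symmetric] norm_abs_l2_sq[OF st, symmetric] by simp
 also have "sqrt (tail_sq W (R / 2)) * norm (abs_l2 h) <= sqrt (tail_sq W (R / 2)) * sqrt (16 * pi * C^2)"
  by (rule mult_left_mono[OF nh]) (simp add: tail_sq_def integral_nonneg_AE)
 finally show "\<bar>LINT y|lborel. rep_l2 W y * h y\<bar> <= sqrt (tail_sq W (R / 2)) * sqrt (16 * pi * C^2)" .
qed

lemma tail_bound_tendsto: "((%R. sqrt (tail_sq W (R / 2)) * C) \<longlongrightarrow> 0) at_top"
proof -
 have "filterlim (%R :: real. R / 2) at_top at_top"
  unfolding filterlim_at_top
 proof
  fix Z show "\<forall>\<^sub>F R :: real in at_top. Z <= R / 2"
   using eventually_ge_at_top[of "2 * Z"] by eventually_elim simp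
 qed
 then have "((%R. tail_sq W (R / 2)) \<longlongrightarrow> 0) at_top"
  by (rule filterlim_compose[OF tail_sq_tendsto])
 from tendsto_mult_right[OF tendsto_real_sqrt[OF this], of C] show ?thesis by simp
qed

lemma annulus_pairing_tendsto:
 assumes m: "!!R. h R \<in> Borel" and R0: "0 < R0"
  and b: "!!R y. R >= R0 ==> \<bar>h R y\<bar> <= C / R"
  and z: "!!R y. R >= R0 ==> norm y < R / 2 \<or> norm y > 4 * R ==> h R y = 0"
 shows "((%R. LINT y|lborel. rep_l2 W y * h R y) \<longlongrightarrow> 0) at_top"
proof (rule Lim_null_comparison)
 show "\<forall>\<^sub>F R in at_top. norm (LINT y|lborel. rep_l2 W y * h R y) <= sqrt (tail_sq W (R / 2)) * sqrt (16 * pi * C^2)"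
  using eventually_ge_at_top[of R0]
 proof eventually_elim
  case (elim R)
  show ?case unfolding real_norm_def
   by (rule annulus_pairing_bound(2)[OF m _ b z]) (use elim R0 in auto)
 qed
 show "((%R. sqrt (tail_sq W (R / 2)) * sqrt (16 * pi * C^2)) \<longlongrightarrow> 0) at_top" by (rule tail_bound_tendsto)
qed

subsection \<open>The velocity as renormalised velocity plus drift\<close>

lemma integral_plane_nth:
 fixes F :: "'a => plane"
 shows "integrable M F ==> (LINT y|M. F y) $ i = (LINT y|M. F y $ i)"
 using integral_bounded_linear[OF bounded_linear_vec_nth, of M F i] by simp

lemma far_field_nth:
 "far_field R W $ i = (LINT y|lborel. rep_l2 W y * (if norm y <= R then Khat (- y) $ i else 0))"
proof -
 let ?F = "%y. indicat_real (cball 0 R - cball 0 1) y *\<^sub>R (rep_l2 W y *\<^sub>R K (- y))"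
 have c: "\<bar>if norm y <= R then Khat (- y) $ i else 0\<bar> <= 1" for i y
  using norm_K_le[of 1 "- y"] K_nth_le[of "- y" i] by (auto simp: Khat_def)
 have e: "?F y $ i = rep_l2 W y * (if norm y <= R then Khat (- y) $ i else 0)" for i y
  by (auto simp: indicator_def Khat_def)
 have [measurable]: "(%y. if norm y <= R then Khat (- y) $ i else 0) \<in> Borel" for i
  by measurable
 have s: "sq_integrable (%y. if norm y <= R then Khat (- y) $ i else 0)" for i
  by (rule sq_integrable_bounded_support[OF _ c, where r = R]) auto
 have "integrable lborel ?F"
 proof (rule Bochner_Integration.integrable_bound)
  show "integrable lborel (%y. \<Sum>i\<in>UNIV. \<bar>rep_l2 W y * (if norm y <= R then Khat (- y) $ i else 0)\<bar>)"
   using integrable_rep_mult[OF s] by (intro Bochner_Integration.integrable_sum integrable_abs) 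
  show "AE y in lborel. norm (?F y) <= norm (\<Sum>i\<in>UNIV. \<bar>rep_l2 W y * (if norm y <= R then Khat (- y) $ i else 0)\<bar>)"
  proof (rule AE_I2)
   fix y
   have "norm (?F y) <= (\<Sum>i\<in>UNIV. \<bar>?F y $ i\<bar>)" by (rule norm_le_l1_cart)
   then show "norm (?F y) <= norm (\<Sum>i\<in>UNIV. \<bar>rep_l2 W y * (if norm y <= R then Khat (- y) $ i else 0)\<bar>)"
    unfolding e by (simp add: sum_nonneg del: abs_mult)
  qed
 qed measurable
 then show ?thesis
  unfolding far_field_def set_lebesgue_integral_def by (simp add: integral_plane_nth flip: e)
qed

definition far_conv :: "l2 => bool" where
 "far_conv W \<longleftrightarrow> (\<exists>l. ((%R. far_field R W) \<longlongrightarrow> l) at_top)"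

text \<open>The value \<open>0\<close> in the divergent case matches the velocity, from which the far field is then
 subtracted before the limit is taken.\<close>

definition drift :: "l2 => plane" where
 "drift W = (if far_conv W then Lim at_top (%R. far_field R W) else 0)"

lemma far_field_tendsto_drift: "far_conv W ==> ((%R. far_field R W) \<longlongrightarrow> drift W) at_top"
 unfolding far_conv_def drift_def using tendsto_Lim[OF trivial_limit_at_top_linorder] by (auto simp: far_conv_def)

lemma truncated_integrable:
 assumes x: "x \<in> good W"
 shows "set_integrable lborel (cball x R) (%y. rep_l2 W y *\<^sub>R K (x - y))"
  and "integrable lborel (%y. rep_l2 W y * (if norm (x - y) <= R then K (x - y) $ i else 0))"
proof -
 have int: "integrable lborel (%y. rep_l2 W y * (if norm (x - y) <= R then K (x - y) $ i else 0))" for i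
 proof -
  have c: "\<bar>if norm (x - y) <= R \<and> norm (x - y) > 1 then K (x - y) $ i else 0\<bar> <= 1" for y
   using norm_K_le[of 1 "x - y"] K_nth_le[of "x - y" i] by auto
  have [measurable]: "(%y. if norm (x - y) <= R \<and> norm (x - y) > 1 then K (x - y) $ i else 0) \<in> Borel"
   by measurable
  have s: "sq_integrable (%y. if norm (x - y) <= R \<and> norm (x - y) > 1 then K (x - y) $ i else 0)"
  proof (rule sq_integrable_bounded_support[OF _ c, where r = "norm x + R"])
   fix y :: plane assume "norm x + R < norm y"
   then have "norm (x - y) > R" using norm_triangle_ineq2[of y x] by (simp add: norm_minus_commute)
   then show "(if norm (x - y) <= R \<and> norm (x - y) > 1 then K (x - y) $ i else 0) = 0" by simp
  qed measurable
  have n: "integrable lborel (%y. rep_l2 W y * (if norm (x - y) <= 1 then K (x - y) $ i else 0))"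
   by (rule near_integrable) (use x in \<open>simp add: good_def\<close>)
  have "integrable lborel (%y. \<bar>rep_l2 W y * (if norm (x - y) <= 1 then K (x - y) $ i else 0)\<bar>
    + \<bar>rep_l2 W y * (if norm (x - y) <= R \<and> norm (x - y) > 1 then K (x - y) $ i else 0)\<bar>)"
   using n integrable_rep_mult[OF s] by (intro Bochner_Integration.integrable_add integrable_abs)
  then show ?thesis
   by (rule Bochner_Integration.integrable_bound) (auto intro!: AE_I2)
 qed
 show "integrable lborel (%y. rep_l2 W y * (if norm (x - y) <= R then K (x - y) $ i else 0))" by (rule int)
 show "set_integrable lborel (cball x R) (%y. rep_l2 W y *\<^sub>R K (x - y))"
  unfolding set_integrable_def
 proof (rule Bochner_Integration.integrable_bound)
  show "integrable lborel (%y. \<Sum>i\<in>UNIV. \<bar>rep_l2 W y * (if norm (x - y) <= R then K (x - y) $ i else 0)\<bar>)"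
   using int by (intro Bochner_Integration.integrable_sum integrable_abs)
  show "AE y in lborel. norm (indicat_real (cball x R) y *\<^sub>R (rep_l2 W y *\<^sub>R K (x - y)))
   <= norm (\<Sum>i\<in>UNIV. \<bar>rep_l2 W y * (if norm (x - y) <= R then K (x - y) $ i else 0)\<bar>)"
  proof (rule AE_I2)
   fix y
   let ?v = "indicat_real (cball x R) y *\<^sub>R (rep_l2 W y *\<^sub>R K (x - y))"
   have "norm ?v <= (\<Sum>i\<in>UNIV. \<bar>?v $ i\<bar>)" by (rule norm_le_l1_cart)
   also have "(\<Sum>i\<in>UNIV. \<bar>?v $ i\<bar>) = (\<Sum>i\<in>UNIV. \<bar>rep_l2 W y * (if norm (x - y) <= R then K (x - y) $ i else 0)\<bar>)"
    by (intro sum.cong) (auto simp: indicator_def dist_norm)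
   finally show "norm ?v <= norm (\<Sum>i\<in>UNIV. \<bar>rep_l2 W y * (if norm (x - y) <= R then K (x - y) $ i else 0)\<bar>)"
    by (simp add: sum_nonneg del: abs_mult)
  qed
 qed measurable
qed

lemma truncated_nth:
 assumes "x \<in> good W"
 shows "truncated_biot_savart R W x $ i = (LINT y|lborel. rep_l2 W y * (if norm (x - y) <= R then K (x - y) $ i else 0))"
proof -
 have "truncated_biot_savart R W x $ i = (LINT y|lborel. (indicat_real (cball x R) y *\<^sub>R (rep_l2 W y *\<^sub>R K (x - y))) $ i)"
  unfolding truncated_biot_savart_def set_lebesgue_integral_def
  using truncated_integrable(1)[OF assms, of R] unfolding set_integrable_def by (rule integral_plane_nth)
 also have "... = (LINT y|lborel. rep_l2 W y * (if norm (x - y) <= R then K (x - y) $ i else 0))"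
  by (intro Bochner_Integration.integral_cong) (auto simp: indicator_def dist_norm)
 finally show ?thesis .
qed

lemma truncated_bad:
 assumes "x \<notin> good W" "1 <= R"
 shows "truncated_biot_savart R W x = 0"
proof -
 have "\<not> integrable lborel (%y. indicat_real (cball x R) y *\<^sub>R (rep_l2 W y *\<^sub>R K (x - y)))"
 proof
  assume i: "integrable lborel (%y. indicat_real (cball x R) y *\<^sub>R (rep_l2 W y *\<^sub>R K (x - y)))"
  have "near_int 1 W x <= (nnint y. norm (indicat_real (cball x R) y *\<^sub>R (rep_l2 W y *\<^sub>R K (x - y))))"
   unfolding near_int_def using assms(2)
   by (intro nn_integral_mono ennreal_leI) (auto simp: nearK_def indicator_def dist_norm)
  also have "... < \<infinity>" using i by (simp add: integrable_iff_bounded)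
  finally show False using assms(1) by (simp add: good_def)
 qed
 then show ?thesis
  unfolding truncated_biot_savart_def set_lebesgue_integral_def by (rule not_integrable_integral_eq)
qed

text \<open>Truncating around \<open>x\<close> and around the origin differs by an annulus and by the tail of the
 square integrable kernel \<open>farK 1 x\<close>.\<close>

lemma truncated_minus_far_field:
 assumes x: "x \<in> good W"
 shows "((%R. truncated_biot_savart R W x $ i - far_field R W $ i) \<longlongrightarrow> ren_vel W i x) at_top"
proof -
 define R0 where "R0 = 2 * norm x + 2"
 have R0pos: "0 < R0" using norm_ge_zero[of x] unfolding R0_def by linarith
 define h where "h R y = (if norm (x - y) > R \<and> norm y <= R then - K (x - y) $ i
  else if norm (x - y) <= R \<and> norm y > R then Khat (- y) $ i else 0)" for R y
 define t where "t R y = (if norm (x - y) > R \<and> norm y > R then farK 1 x y $ i else 0)" for R y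
 have hm: "h R \<in> Borel" for R unfolding h_def by measurable
 have tm: "t R \<in> Borel" for R unfolding t_def by measurable
 have hb: "\<bar>h R y\<bar> <= 1 / R" if "R >= R0" for R y
 proof -
  have "R > 0" using that norm_ge_zero[of x] unfolding R0_def by linarith
  then show ?thesis
   using norm_K_le[of R "x - y"] K_nth_le[of "x - y" i] norm_K_le[of R "- y"] K_nth_le[of "- y" i]
   by (auto simp: h_def Khat_def)
 qed
 have hz: "h R y = 0" if R: "R >= R0" and y: "norm y < R / 2 \<or> norm y > 4 * R" for R y
 proof -
  have "norm x <= R / 2" "R >= 2" using R norm_ge_zero[of x] unfolding R0_def by linarith+
  moreover have "norm (x - y) <= norm x + norm y" "norm y <= norm (x - y) + norm x"
   using norm_triangle_ineq4[of x y] norm_triangle_ineq2[of y x] by (auto simp: norm_minus_commute)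
  ultimately show ?thesis using y unfolding h_def by (elim disjE) auto
 qed
 have 1: "((%R. LINT y|lborel. rep_l2 W y * h R y) \<longlongrightarrow> 0) at_top"
  by (rule annulus_pairing_tendsto[OF hm _ hb hz]) (auto simp: R0_def intro: add_nonneg_pos)
 have ft: "integrable lborel (%y. \<bar>rep_l2 W y * farK 1 x y $ i\<bar>)"
  using integrable_rep_mult[OF farK_sq_integrable_1(1)] by (rule integrable_abs)
 have it: "integrable lborel (%y. rep_l2 W y * t R y)" for R
  by (rule Bochner_Integration.integrable_bound[OF ft]) (use tm in \<open>auto simp: t_def intro!: AE_I2\<close>)
 have ih: "integrable lborel (%y. rep_l2 W y * h R y)" if "R >= R0" for R
  by (rule integrable_rep_mult, rule annulus_pairing_bound(1)[OF hm _ hb hz])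
   (use that less_le_trans[OF R0pos that] in auto)
 have 2: "((%R. LINT y|lborel. rep_l2 W y * t R y) \<longlongrightarrow> (LINT y|(lborel :: plane measure). 0)) at_top"
 proof (rule integral_dominated_convergence_at_top[OF _ _ ft])
  show "(%y. rep_l2 W y * t R y) \<in> borel_measurable lborel" for R using tm[of R] by measurable
  show "AE y in lborel. ((%R. rep_l2 W y * t R y) \<longlongrightarrow> 0) at_top"
  proof (rule AE_I2)
   fix y
   have "\<forall>\<^sub>F R in at_top. rep_l2 W y * t R y = 0"
    using eventually_gt_at_top[of "norm y"] by eventually_elim (simp add: t_def)
   then show "((%R. rep_l2 W y * t R y) \<longlongrightarrow> 0) at_top" by (rule tendsto_eventually)
  qed
  show "\<forall>\<^sub>F R in at_top. AE y in lborel. norm (rep_l2 W y * t R y) <= \<bar>rep_l2 W y * farK 1 x y $ i\<bar>"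
   by (auto simp: t_def)
 qed measurable
 have eq: "truncated_biot_savart R W x $ i - far_field R W $ i
   = ren_vel W i x + (LINT y|lborel. rep_l2 W y * h R y) - (LINT y|lborel. rep_l2 W y * t R y)" if R: "R >= R0" for R
 proof -
  have R1: "R >= 2" using R norm_ge_zero[of x] unfolding R0_def by linarith
  have c: "\<bar>if norm y <= R then Khat (- y) $ i else 0\<bar> <= 1" for y
   using norm_K_le[of 1 "- y"] K_nth_le[of "- y" i] by (auto simp: Khat_def)
  have s: "integrable lborel (%y. rep_l2 W y * (if norm y <= R then Khat (- y) $ i else 0))"
   by (rule integrable_rep_mult, rule sq_integrable_bounded_support[OF _ c, where r = R]) auto
  have pw: "rep_l2 W y * (if norm (x - y) <= R then K (x - y) $ i else 0) - rep_l2 W y * (if norm y <= R then Khat (- y) $ i else 0)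
   = rep_l2 W y * (K (x - y) $ i - Khat (- y) $ i) + rep_l2 W y * h R y - rep_l2 W y * t R y" for y
   using R1 by (auto simp: h_def t_def farK_def algebra_simps)
  have "truncated_biot_savart R W x $ i - far_field R W $ i
   = (LINT y|lborel. rep_l2 W y * (if norm (x - y) <= R then K (x - y) $ i else 0) - rep_l2 W y * (if norm y <= R then Khat (- y) $ i else 0))"
   unfolding truncated_nth[OF x] far_field_nth
   by (rule Bochner_Integration.integral_diff[symmetric, OF truncated_integrable(2)[OF x] s])
  also have "... = ren_vel W i x + (LINT y|lborel. rep_l2 W y * h R y) - (LINT y|lborel. rep_l2 W y * t R y)"
   unfolding pw ren_vel_def using ren_vel_split(1)[of 1 x W i] x ih[OF R] it[of R] by simp
  finally show ?thesis .
 qed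
 have "((%R. ren_vel W i x + (LINT y|lborel. rep_l2 W y * h R y) - (LINT y|lborel. rep_l2 W y * t R y))
   \<longlongrightarrow> ren_vel W i x + 0 - 0) at_top"
  using 1 2 by (intro tendsto_intros) auto
 moreover have "\<forall>\<^sub>F R in at_top. truncated_biot_savart R W x $ i - far_field R W $ i
   = ren_vel W i x + (LINT y|lborel. rep_l2 W y * h R y) - (LINT y|lborel. rep_l2 W y * t R y)"
  using eventually_ge_at_top[of R0] by eventually_elim (rule eq)
 ultimately show ?thesis by (simp add: tendsto_cong)
qed

lemma velocity_good:
 assumes x: "x \<in> good W"
 shows "velocity W x $ i = ren_vel W i x + drift W $ i"
proof -
 let ?v = "\<chi> i. ren_vel W i x"
 have d: "((%R. truncated_biot_savart R W x - far_field R W) \<longlongrightarrow> ?v) at_top"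
  by (rule vec_tendstoI) (use truncated_minus_far_field[OF x] in simp)
 show ?thesis
 proof (cases "far_conv W")
  case True
  have "((%R. truncated_biot_savart R W x - far_field R W + far_field R W) \<longlongrightarrow> ?v + drift W) at_top"
   by (rule tendsto_add[OF d far_field_tendsto_drift[OF True]])
  then have "Lim at_top (%R. truncated_biot_savart R W x) = ?v + drift W"
   by (intro tendsto_Lim) auto
  then show ?thesis using True by (simp add: velocity_def far_conv_def)
 next
  case False
  have "Lim at_top (%R. truncated_biot_savart R W x - far_field R W) = ?v"
   by (rule tendsto_Lim[OF _ d]) simp
  then show ?thesis using False by (simp add: velocity_def drift_def far_conv_def)
 qed
qed

text \<open>On the exceptional null set all truncated integrals vanish, so that the velocity is constant
 there; this makes it Borel measurable.\<close>

lemma velocity_bad: "\<exists>d. \<forall>x. x \<notin> good W --> velocity W x = d"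
proof -
 have ev: "\<forall>\<^sub>F R in at_top. truncated_biot_savart R W x = 0" if "x \<notin> good W" for x
  using eventually_ge_at_top[of 1] by eventually_elim (rule truncated_bad[OF that])
 have "velocity W x = (if far_conv W then 0 else Lim at_top (%R. - far_field R W))" if x: "x \<notin> good W" for x
 proof (cases "far_conv W")
  case True
  have "Lim at_top (%R. truncated_biot_savart R W x) = 0"
   by (rule tendsto_Lim[OF _ tendsto_eventually[OF ev[OF x]]]) simp
  then show ?thesis using True by (simp add: velocity_def far_conv_def)
 next
  case False
  have "((%R. truncated_biot_savart R W x - far_field R W) \<longlongrightarrow> l) at_top \<longleftrightarrow> ((%R. - far_field R W) \<longlongrightarrow> l) at_top" for l
   by (rule tendsto_cong) (use ev[OF x] in eventually_elim, simp)
  then have "Lim at_top (%R. truncated_biot_savart R W x - far_field R W) = Lim at_top (%R. - far_field R W)"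
   by (simp add: Topological_Spaces.Lim_def)
  then show ?thesis using False by (simp add: velocity_def far_conv_def)
 qed
 then show ?thesis by blast
qed

lemma measurable_velocity [measurable]: "(%x. velocity W x $ i) \<in> Borel"
proof -
 obtain d where d: "!!x. x \<notin> good W ==> velocity W x = d" using velocity_bad by blast
 have eq: "(%x. velocity W x $ i) = (%x. if x \<in> good W then ren_vel W i x + drift W $ i else d $ i)"
  using d velocity_good by auto
 show ?thesis unfolding eq by measurable
qed

subsection \<open>The transport form\<close>

definition transport :: "l2 => (2 => plane => real) => real" where
 "transport W q = (LINT x|lborel. (\<Sum>i\<in>UNIV. ren_vel W i x * q i x) * rep_l2 W x)"

definition near_mass :: "real => real" where
 "near_mass \<delta> = (LINT z|lborel. nearK \<delta> z)"

lemma nearK_integrable: "\<delta> <= 1 ==> integrable lborel (nearK \<delta>)"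
proof -
 assume d: "\<delta> <= 1"
 have "integrable lborel (nearK 1)"
  by (rule integrableI_nonneg) (use nn_integral_nearK_finite nearK_nonneg in auto)
 then show ?thesis
  by (rule Bochner_Integration.integrable_bound) (use d in \<open>auto simp: nearK_def intro!: AE_I2\<close>)
qed

lemma nn_integral_nearK: "\<delta> <= 1 ==> (nnint z. nearK \<delta> z) = ennreal (near_mass \<delta>)"
 unfolding near_mass_def by (rule nn_integral_eq_integral[OF nearK_integrable]) (auto simp: nearK_nonneg)

lemma near_mass_nonneg: "0 <= near_mass \<delta>"
 by (simp add: near_mass_def nearK_nonneg integral_nonneg_AE)

lemma near_mass_tendsto: "(%n. near_mass (1 / real (Suc n))) ----> 0"
proof -
 have "(%n. LINT z|lborel. nearK (1 / real (Suc n)) z) ----> (LINT z|(lborel :: plane measure). 0)"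
 proof (rule integral_dominated_convergence[where w = "nearK 1"])
  show "integrable lborel (nearK 1)" by (rule nearK_integrable) simp
  show "AE z in lborel. (%n. nearK (1 / real (Suc n)) z) ----> 0"
  proof (rule AE_I2)
   fix z :: plane
   show "(%n. nearK (1 / real (Suc n)) z) ----> 0"
   proof (cases "z = 0")
    case True then show ?thesis by (simp add: nearK_def norm_K)
   next
    case False
    then have "\<forall>\<^sub>F n in sequentially. 1 / real (Suc n) < norm z"
     using order_tendstoD(2)[OF LIMSEQ_inverse_real_of_nat, of "norm z"] by (simp add: inverse_eq_divide)
    then have "\<forall>\<^sub>F n in sequentially. nearK (1 / real (Suc n)) z = 0"
     by eventually_elim (simp add: nearK_def)
    then show ?thesis by (rule tendsto_eventually)
   qed
  qed
  show "AE z in lborel. norm (nearK (1 / real (Suc n)) z) <= nearK 1 z" for n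
  proof (rule AE_I2)
   fix z :: plane
   have "norm (nearK \<delta> z) <= nearK 1 z" if "\<delta> <= 1" for \<delta>
    using that by (auto simp: nearK_def)
   then show "norm (nearK (1 / real (Suc n)) z) <= nearK 1 z" by simp
  qed
 qed measurable
 then show ?thesis by (simp add: near_mass_def)
qed

text \<open>Schur's test for the kernel cut off at distance \<open>\<delta>\<close>: the bound vanishes with \<open>\<delta>\<close>.\<close>

lemma near_form:
 assumes [measurable]: "q \<in> Borel" and q: "!!x. \<bar>q x\<bar> <= M" and d: "\<delta> <= 1"
 shows "integrable lborel (%x. near_vel \<delta> W i x * q x * rep_l2 W x)"
  and "\<bar>LINT x|lborel. near_vel \<delta> W i x * q x * rep_l2 W x\<bar> <= 2 * M * near_mass \<delta> * (norm W)^2"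
proof -
 have M0: "0 <= M" using q[of 0] by linarith
 have B: "(nnint x. norm (near_vel \<delta> W i x * q x * rep_l2 W x))
   <= ennreal (2 * M * near_mass \<delta> * (norm W)^2)"
 proof -
  have "ennreal (norm (near_vel \<delta> W i x * q x * rep_l2 W x)) <=
   ennreal M * (nnint y. \<bar>rep_l2 W x\<bar> * \<bar>rep_l2 W y\<bar> * nearK \<delta> (x - y))" for x
  proof -
   have "norm (near_vel \<delta> W i x * q x * rep_l2 W x) <= M * (\<bar>rep_l2 W x\<bar> * \<bar>near_vel \<delta> W i x\<bar>)"
    using mult_right_mono[OF q[of x], of "\<bar>rep_l2 W x\<bar> * \<bar>near_vel \<delta> W i x\<bar>"] by (simp add: abs_mult mult_ac)
   then have "ennreal (norm (near_vel \<delta> W i x * q x * rep_l2 W x)) <= ennreal M * (ennreal \<bar>rep_l2 W x\<bar> * ennreal \<bar>near_vel \<delta> W i x\<bar>)"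
    using M0 by (simp add: ennreal_leI flip: ennreal_mult)
   also have "... <= ennreal M * (ennreal \<bar>rep_l2 W x\<bar> * near_int \<delta> W x)"
    by (intro mult_left_mono near_vel_le) auto
   also have "ennreal \<bar>rep_l2 W x\<bar> * near_int \<delta> W x = (nnint y. \<bar>rep_l2 W x\<bar> * \<bar>rep_l2 W y\<bar> * nearK \<delta> (x - y))"
    unfolding near_int_def
    by (subst nn_integral_cmult[symmetric]) (auto simp: ennreal_mult nearK_nonneg mult_ac intro!: nn_integral_cong)
   finally show ?thesis .
  qed
  then have "(nnint x. norm (near_vel \<delta> W i x * q x * rep_l2 W x))
   <= (\<integral>\<^sup>+ x. ennreal M * (nnint y. \<bar>rep_l2 W x\<bar> * \<bar>rep_l2 W y\<bar> * nearK \<delta> (x - y)) \<partial>lborel)"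
   by (rule nn_integral_mono)
  also have "... = ennreal M * (\<integral>\<^sup>+ x. (nnint y. \<bar>rep_l2 W x\<bar> * \<bar>rep_l2 W y\<bar> * nearK \<delta> (x - y)) \<partial>lborel)"
   by (rule nn_integral_cmult) measurable
  also have "... <= ennreal M * (ennreal (near_mass \<delta>) * (ennreal ((norm W)^2) + ennreal ((norm W)^2)))"
   unfolding nn_integral_nearK[OF d, symmetric] nn_integral_sq_rep[symmetric]
   by (intro mult_left_mono Schur_bound) (auto simp: nearK_nonneg)
  also have "... = ennreal (2 * M * near_mass \<delta> * (norm W)^2)"
   using M0 near_mass_nonneg[of \<delta>] by (simp add: mult_ac flip: ennreal_mult ennreal_plus)
  finally show ?thesis .
 qed
 show i: "integrable lborel (%x. near_vel \<delta> W i x * q x * rep_l2 W x)"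
  by (rule integrableI_bounded) (use B in \<open>auto intro: le_less_trans\<close>)
 have "ennreal \<bar>LINT x|lborel. near_vel \<delta> W i x * q x * rep_l2 W x\<bar> <= ennreal (2 * M * near_mass \<delta> * (norm W)^2)"
  using integral_norm_bound_ennreal[OF i] B by (auto intro: order_trans)
 then show "\<bar>LINT x|lborel. near_vel \<delta> W i x * q x * rep_l2 W x\<bar> <= 2 * M * near_mass \<delta> * (norm W)^2"
  using M0 near_mass_nonneg[of \<delta>] by (simp add: ennreal_le_iff)
qed

definition test_field :: "real => real => (2 => plane => real) => bool" where
 "test_field \<rho> M q \<longleftrightarrow> 0 <= \<rho> \<and> (\<forall>i. q i \<in> Borel \<and> (\<forall>x. \<bar>q i x\<bar> <= M) \<and> (\<forall>x. norm x > \<rho> --> q i x = 0))"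

definition far_const_on :: "real => real => real" where
 "far_const_on \<delta> \<rho> = sqrt (far_const * (1 + \<rho>)) + sqrt (pi * (1/\<delta>)^2)"

lemma far_times_test:
 assumes q: "test_field \<rho> M q" and d: "0 < \<delta>" "\<delta> <= 1" and R: "norm W <= R"
 shows "\<bar>far_vel \<delta> W i x * q i x\<bar> <= R * far_const_on \<delta> \<rho> * M"
  and "norm x > \<rho> ==> far_vel \<delta> W i x * q i x = 0"
  and "sq_integrable (%x. far_vel \<delta> W i x * q i x)"
proof -
 have [measurable]: "q i \<in> Borel" using q by (simp add: test_field_def)
 have M0: "0 <= M" using q abs_ge_zero order_trans unfolding test_field_def by meson
 have R0: "0 <= R" using R norm_ge_zero order_trans by blast
 show z: "far_vel \<delta> W i x * q i x = 0" if "norm x > \<rho>" for x using q that by (simp add: test_field_def)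
 show b: "\<bar>far_vel \<delta> W i x * q i x\<bar> <= R * far_const_on \<delta> \<rho> * M" for x
 proof (cases "norm x <= \<rho>")
  case True
  have "\<bar>far_vel \<delta> W i x\<bar> <= norm W * (sqrt (far_const * (1 + norm x)) + sqrt (pi * (1/\<delta>)^2))"
   by (rule far_vel_bound[OF d])
  also have "... <= R * far_const_on \<delta> \<rho>"
   unfolding far_const_on_def
   by (intro mult_mono R add_mono real_sqrt_le_mono mult_left_mono far_const_nonneg order_refl)
    (use True R0 far_const_nonneg in auto)
  finally have 1: "\<bar>far_vel \<delta> W i x\<bar> <= R * far_const_on \<delta> \<rho>" .
  show ?thesis unfolding abs_mult
   by (rule mult_mono[OF 1]) (use q 1 in \<open>auto simp: test_field_def intro: order_trans[OF abs_ge_zero]\<close>)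
 next
  case False
  have "0 <= far_const_on \<delta> \<rho>" using q far_const_nonneg by (auto simp: far_const_on_def test_field_def)
  then have "0 <= R * far_const_on \<delta> \<rho> * M" using R0 M0 by simp
  then show ?thesis using z[of x] False by (metis abs_zero not_le)
 qed
 show "sq_integrable (%x. far_vel \<delta> W i x * q i x)"
  by (rule sq_integrable_bounded_support[OF _ b z]) measurable
qed

lemma transport_split:
 assumes q: "test_field \<rho> M q" and d: "0 < \<delta>" "\<delta> <= 1"
 shows "integrable lborel (%x. (\<Sum>i\<in>UNIV. ren_vel W i x * q i x) * rep_l2 W x)"
  and "transport W q = (\<Sum>i\<in>UNIV. LINT x|lborel. near_vel \<delta> W i x * q i x * rep_l2 W x)
   + (\<Sum>i\<in>UNIV. inner W (abs_l2 (%x. far_vel \<delta> W i x * q i x)))"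
proof -
 have [measurable]: "q i \<in> Borel" for i using q by (simp add: test_field_def)
 have qM: "\<bar>q i x\<bar> <= M" for i x using q by (simp add: test_field_def)
 note s = far_times_test(3)[OF q d order_refl, of W]
 have n: "integrable lborel (%x. near_vel \<delta> W i x * q i x * rep_l2 W x)" for i
  by (rule near_form(1)[OF _ qM d(2)]) measurable
 have f: "integrable lborel (%x. rep_l2 W x * (far_vel \<delta> W i x * q i x))" for i
  by (rule integrable_rep_mult[OF s])
 let ?S = "%x. (\<Sum>i\<in>UNIV. near_vel \<delta> W i x * q i x * rep_l2 W x) + (\<Sum>i\<in>UNIV. rep_l2 W x * (far_vel \<delta> W i x * q i x))"
 have iS: "integrable lborel ?S" using n f by simp
 have ae: "AE x in lborel. ?S x = (\<Sum>i\<in>UNIV. ren_vel W i x * q i x) * rep_l2 W x"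
  using AE_good[of W]
 proof eventually_elim
  case (elim x)
  show ?case using ren_vel_split(2)[OF d elim]
   by (simp add: sum_distrib_right sum_distrib_left sum.distrib[symmetric] algebra_simps)
 qed
 show "integrable lborel (%x. (\<Sum>i\<in>UNIV. ren_vel W i x * q i x) * rep_l2 W x)"
  using iS by (rule integrable_cong_AE_imp) (use ae in auto)
 have "transport W q = (LINT x|lborel. ?S x)"
  unfolding transport_def by (rule integral_cong_AE) (use ae in auto)
 also have "... = (\<Sum>i\<in>UNIV. LINT x|lborel. near_vel \<delta> W i x * q i x * rep_l2 W x)
   + (\<Sum>i\<in>UNIV. LINT x|lborel. rep_l2 W x * (far_vel \<delta> W i x * q i x))"
  using n f by simp
 also have "... = (\<Sum>i\<in>UNIV. LINT x|lborel. near_vel \<delta> W i x * q i x * rep_l2 W x)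
   + (\<Sum>i\<in>UNIV. inner W (abs_l2 (%x. far_vel \<delta> W i x * q i x)))"
  using pairing_eq_inner[OF s, of W] by (simp add: pairing_def)
 finally show "transport W q = (\<Sum>i\<in>UNIV. LINT x|lborel. near_vel \<delta> W i x * q i x * rep_l2 W x)
   + (\<Sum>i\<in>UNIV. inner W (abs_l2 (%x. far_vel \<delta> W i x * q i x)))" .
qed

lemma near_sum_bound:
 assumes q: "test_field \<rho> M q" and d: "\<delta> <= 1"
 shows "\<bar>\<Sum>i\<in>UNIV. LINT x|lborel. near_vel \<delta> W i x * q i x * rep_l2 W x\<bar> <= 4 * M * near_mass \<delta> * (norm W)^2"
proof -
 have "\<bar>\<Sum>i\<in>UNIV. LINT x|lborel. near_vel \<delta> W i x * q i x * rep_l2 W x\<bar>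
  <= (\<Sum>i\<in>UNIV. \<bar>LINT x|lborel. near_vel \<delta> W i x * q i x * rep_l2 W x\<bar>)" by (rule sum_abs)
 also have "... <= (\<Sum>i\<in>(UNIV :: 2 set). 2 * M * near_mass \<delta> * (norm W)^2)"
  by (intro sum_mono near_form(2)) (use q d in \<open>auto simp: test_field_def\<close>)
 finally show ?thesis by simp
qed

lemma abs_l2_pointwise_limit:
 assumes m[measurable]: "!!n. h n \<in> Borel" and b: "!!n x. \<bar>h n x\<bar> <= B"
  and z: "!!n x. norm x > \<rho> ==> h n x = 0" and lim: "!!x. (%n. h n x) ----> h' x"
 shows "sq_integrable h'" "(%n. abs_l2 (h n)) ----> abs_l2 h'"
proof -
 have [measurable]: "h' \<in> Borel" by (rule borel_measurable_LIMSEQ_metric[OF m lim])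
 have b': "\<bar>h' x\<bar> <= B" for x by (rule LIMSEQ_le_const2[OF tendsto_rabs[OF lim]]) (use b in auto)
 have z': "h' x = 0" if "norm x > \<rho>" for x
  using lim[of x] z[OF that] by (simp add: LIMSEQ_const_iff)
 show s': "sq_integrable h'" by (rule sq_integrable_bounded_support[OF _ b' z']) measurable
 have s: "sq_integrable (h n)" for n by (rule sq_integrable_bounded_support[OF m b z])
 have "(%n. LINT x|lborel. (h n x - h' x)^2) ----> (LINT x|(lborel :: plane measure). 0)"
 proof (rule integral_dominated_convergence[where w = "%x. (2 * B)^2 * indicator (cball 0 \<rho>) x"])
  show "integrable lborel (%x. (2 * B)^2 * indicator (cball (0 :: plane) \<rho>) x :: real)"
   using emeasure_cball_plane_finite[of 0 \<rho>] by simp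
  show "AE x in lborel. (%n. (h n x - h' x)^2) ----> 0"
  proof (rule AE_I2)
   fix x
   from tendsto_power[OF tendsto_diff[OF lim[of x] tendsto_const[of "h' x"]], of 2]
   show "(%n. (h n x - h' x)^2) ----> 0" by simp
  qed
  show "AE x in lborel. norm ((h n x - h' x)^2) <= (2 * B)^2 * indicator (cball 0 \<rho>) x" for n
  proof (rule AE_I2)
   fix x
   have "\<bar>h n x - h' x\<bar> <= 2 * B" using b[of n x] b'[of x] by linarith
   then have "(h n x - h' x)^2 <= (2 * B)^2" using power_mono[of "\<bar>h n x - h' x\<bar>" "2 * B" 2] by simp
   then show "norm ((h n x - h' x)^2) <= (2 * B)^2 * indicator (cball 0 \<rho>) x"
    using z[of x n] z'[of x] by (cases "norm x <= \<rho>") (auto simp: indicator_def)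
  qed
 qed measurable
 then have "(%n. (norm (abs_l2 (h n) - abs_l2 h'))^2) ----> 0"
  by (simp add: abs_l2_diff[OF s s', symmetric] norm_abs_l2_sq[OF sq_integrable_diff[OF s s']])
 then have "(%n. sqrt ((norm (abs_l2 (h n) - abs_l2 h'))^2)) ----> sqrt 0" by (rule tendsto_real_sqrt)
 then have "(%n. norm (abs_l2 (h n) - abs_l2 h')) ----> 0" by simp
 then show "(%n. abs_l2 (h n)) ----> abs_l2 h'" by (simp add: tendsto_norm_zero_iff LIM_zero_iff)
qed

lemma inner_wconv_tendsto:
 fixes X :: "nat => l2"
 assumes X: "wconv X x" and R: "!!n. norm (X n) <= R" and V: "V ----> v"
 shows "(%n. inner (X n) (V n)) ----> inner x v"
proof -
 have "(%n. inner (X n) (V n - v)) ----> 0"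
 proof (rule Lim_null_comparison)
  show "\<forall>\<^sub>F n in sequentially. norm (inner (X n) (V n - v)) <= R * norm (V n - v)"
  proof (rule always_eventually, rule allI)
   fix n show "norm (inner (X n) (V n - v)) <= R * norm (V n - v)"
    using Cauchy_Schwarz_ineq2[of "X n" "V n - v"] mult_right_mono[OF R[of n], of "norm (V n - v)"] by simp
  qed
  have "(%n. norm (V n - v)) ----> 0" using V by (simp add: tendsto_norm_zero_iff LIM_zero_iff)
  from tendsto_mult_left[OF this, of R] show "(%n. R * norm (V n - v)) ----> 0" by simp
 qed
 from tendsto_add[OF this wconvD[OF X, of v]] show ?thesis by (simp add: inner_diff_right)
qed

text \<open>The far part of the velocity converges strongly on discs, since its value at each point is a
 continuous linear functional; the near part is uniformly small in the quadratic form.\<close>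

lemma transport_wconv:
 fixes X :: "nat => l2"
 assumes X: "wconv X x" and R: "!!n. norm (X n) <= R"
  and q: "!!n. test_field \<rho> M (q n)" and lim: "!!i y. (%n. q n i y) ----> q' i y"
 shows "test_field \<rho> M q'" "(%n. transport (X n) (q n)) ----> transport x q'"
proof -
 have qm: "q n i \<in> Borel" and qM: "\<bar>q n i y\<bar> <= M" and qz: "norm y > \<rho> ==> q n i y = 0" for n i y
  using q[of n] by (auto simp: test_field_def)
 show q': "test_field \<rho> M q'"
  unfolding test_field_def
 proof (intro allI conjI impI)
  show "0 <= \<rho>" using q[of 0] by (simp add: test_field_def)
  fix i
  show "q' i \<in> Borel" by (rule borel_measurable_LIMSEQ_metric[OF qm lim])
  show "\<bar>q' i y\<bar> <= M" for y by (rule LIMSEQ_le_const2[OF tendsto_rabs[OF lim]]) (use qM in auto)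
  show "q' i y = 0" if "norm y > \<rho>" for y
   using lim[of i y] qz[OF that] by (simp add: LIMSEQ_const_iff)
 qed
 have M0: "0 <= M" using qM[of 0 1 0] by linarith
 have R': "norm x <= R" by (rule wconv_norm_le[OF X R])
 show "(%n. transport (X n) (q n)) ----> transport x q'"
 proof (rule LIMSEQ_I)
  fix e :: real assume e: "0 < e"
  have "(%n. 4 * M * near_mass (1 / real (Suc n)) * R^2) ----> 4 * M * 0 * R^2"
   by (intro tendsto_mult tendsto_const near_mass_tendsto)
  then have "\<forall>\<^sub>F n in sequentially. 4 * M * near_mass (1 / real (Suc n)) * R^2 < e / 3"
   by (rule order_tendstoD(2)) (use e in simp)
  then obtain k where k: "4 * M * near_mass (1 / real (Suc k)) * R^2 < e / 3"
   by (auto simp: eventually_sequentially)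
  define \<delta> where "\<delta> = 1 / real (Suc k)"
  have d: "0 < \<delta>" "\<delta> <= 1" by (auto simp: \<delta>_def)
  have small: "\<bar>\<Sum>i\<in>UNIV. LINT y|lborel. near_vel \<delta> v i y * p i y * rep_l2 v y\<bar> < e / 3"
   if "test_field \<rho> M p" "norm v <= R" for p v
  proof -
   have "4 * M * near_mass \<delta> * (norm v)^2 <= 4 * M * near_mass \<delta> * R^2"
    using M0 near_mass_nonneg that(2) by (intro mult_left_mono power_mono) auto
   then show ?thesis using near_sum_bound[OF that(1) d(2), of v] k by (simp add: \<delta>_def)
  qed
  have "(%n. \<Sum>i\<in>UNIV. inner (X n) (abs_l2 (%y. far_vel \<delta> (X n) i y * q n i y)))
    ----> (\<Sum>i\<in>UNIV. inner x (abs_l2 (%y. far_vel \<delta> x i y * q' i y)))"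
  proof (intro tendsto_sum inner_wconv_tendsto[OF X R])
   fix i
   show "(%n. abs_l2 (%y. far_vel \<delta> (X n) i y * q n i y)) ----> abs_l2 (%y. far_vel \<delta> x i y * q' i y)"
   proof (rule abs_l2_pointwise_limit(2))
    show "(%y. far_vel \<delta> (X n) i y * q n i y) \<in> Borel" for n
     using qm[of n i] by measurable
    show "\<bar>far_vel \<delta> (X n) i y * q n i y\<bar> <= R * far_const_on \<delta> \<rho> * M" for n y
     by (rule far_times_test(1)[OF q d R])
    show "far_vel \<delta> (X n) i y * q n i y = 0" if "norm y > \<rho>" for n y
     by (rule far_times_test(2)[OF q d R that])
    show "(%n. far_vel \<delta> (X n) i y * q n i y) ----> far_vel \<delta> x i y * q' i y" for y
     unfolding far_vel_inner[OF d] by (intro tendsto_mult lim wconvD[OF X])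
   qed
  qed
  from LIMSEQ_D[OF this, of "e / 3"] e obtain N where N: "!!n. n >= N ==>
   \<bar>(\<Sum>i\<in>UNIV. inner (X n) (abs_l2 (%y. far_vel \<delta> (X n) i y * q n i y)))
    - (\<Sum>i\<in>UNIV. inner x (abs_l2 (%y. far_vel \<delta> x i y * q' i y)))\<bar> < e / 3" by auto
  have "norm (transport (X n) (q n) - transport x q') < e" if "n >= N" for n
   using N[OF that] small[OF q R, of n n] small[OF q' R']
   unfolding transport_split(2)[OF q d] transport_split(2)[OF q' d] real_norm_def by linarith
  then show "\<exists>N. \<forall>n\<ge>N. norm (transport (X n) (q n) - transport x q') < e" by blast
 qed
qed

subsection \<open>Transport against slowly decaying fields\<close>

text \<open>The size of the gradients of smoothly truncated kernels. It is square integrable, although the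
 kernel itself is not.\<close>

definition wt :: "plane => real" where
 "wt x = min 1 (1 / (norm x)^2)"

definition tail_const :: "real => real" where
 "tail_const L = 4 * near_mass 1 / L^2 + 2 * sqrt (16 * far_const * (LINT x|lborel. decay3 x * indicator {x. norm x >= L} x))"

lemma tail_const_tendsto: "(%n. tail_const (real n)) ----> 0"
proof -
 have "(%n. LINT x|lborel. decay3 x * indicator {x. norm x >= real n} x) ----> (LINT x|(lborel :: plane measure). 0)"
 proof (rule integral_dominated_convergence[OF _ _ decay3_integrable])
  show "AE x in lborel. (%n. decay3 x * indicator {x. norm x >= real n} x) ----> 0"
  proof (rule AE_I2)
   fix x :: plane
   obtain N :: nat where "norm x < real N" using reals_Archimedean2 by blast
   then have "\<forall>\<^sub>F n in sequentially. decay3 x * indicator {x. norm x >= real n} x = 0"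
    by (auto simp: eventually_sequentially indicator_def intro!: exI[of _ N])
   then show "(%n. decay3 x * indicator {x. norm x >= real n} x) ----> 0" by (rule tendsto_eventually)
  qed
  show "AE x in lborel. norm (decay3 x * indicator {x. norm x >= real n} x) <= decay3 x" for n
   using decay3_pos by (auto simp: indicator_def less_imp_le)
 qed measurable
 then have 1: "(%n. LINT x|lborel. decay3 x * indicator {x. norm x >= real n} x) ----> 0" by simp
 have "(%n. 1 / real n) ----> 0" by (rule lim_1_over_n)
 then have 2: "(%n. (1 / real n)^2) ----> 0^2" by (rule tendsto_power)
 have "(%n. 4 * near_mass 1 * (1 / real n)^2 + 2 * sqrt (16 * far_const * (LINT x|lborel. decay3 x * indicator {x. norm x >= real n} x)))
  ----> 4 * near_mass 1 * 0^2 + 2 * sqrt (16 * far_const * 0)"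
  by (intro tendsto_add tendsto_mult tendsto_const tendsto_real_sqrt 1 2)
 then show ?thesis by (simp add: tail_const_def[abs_def] power_divide)
qed

text \<open>At a point \<open>x\<close> the far velocity is of order \<open>(1 + \<bar>x\<bar>)\<^sup>1\<^sup>/\<^sup>2\<close>, so that its product with a field decaying like
 \<open>\<bar>x\<bar>\<^sup>-\<^sup>2\<close> remains square integrable, with a small norm if the field vanishes for \<open>\<bar>x\<bar> < L\<close>.\<close>

lemma transport_decay:
 assumes q: "test_field \<rho> M q" and L: "1 <= L" and M': "0 <= M'"
  and dec: "!!i x. \<bar>q i x\<bar> <= M' * wt x" and z: "!!i x. norm x < L ==> q i x = 0"
 shows "\<bar>transport W q\<bar> <= M' * tail_const L * (norm W)^2"
proof -
 have [measurable]: "q i \<in> Borel" for i using q by (simp add: test_field_def)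
 have qL: "\<bar>q i x\<bar> <= M' / L^2" for i x
 proof (cases "norm x < L")
  case True then show ?thesis using z M' by simp
 next
  case False
  then have "L^2 <= (norm x)^2" using L by (intro power_mono) auto
  then have "wt x <= 1 / L^2" using L unfolding wt_def
   by (intro min.coboundedI2 divide_left_mono mult_pos_pos zero_less_power) auto
  then have "M' * wt x <= M' * (1 / L^2)" by (rule mult_left_mono[OF _ M'])
  then show ?thesis using dec[of i x] by simp
 qed
 then have qt: "test_field \<rho> (M' / L^2) q" using q by (simp add: test_field_def)
 have near: "\<bar>\<Sum>i\<in>UNIV. LINT x|lborel. near_vel 1 W i x * q i x * rep_l2 W x\<bar> <= M' * (4 * near_mass 1 / L^2) * (norm W)^2"
  using near_sum_bound[OF qt order_refl, of W] by (simp add: mult_ac)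
 let ?D = "LINT x|lborel. decay3 x * indicator {x. norm x >= L} x"
 have far: "\<bar>inner W (abs_l2 (%x. far_vel 1 W i x * q i x))\<bar> <= (norm W)^2 * (M' * sqrt (16 * far_const * ?D))" for i
 proof -
  have d: "(0 :: real) < 1" "(1 :: real) <= 1" by auto
  note s = far_times_test(3)[OF q d order_refl, of W i]
  have pw: "(far_vel 1 W i x * q i x)^2 <= ((norm W)^2 * M'^2 * (16 * far_const)) * (decay3 x * indicator {x. norm x >= L} x)" for x
  proof (cases "norm x < L")
   case True then show ?thesis using z by simp
  next
   case False
   have "(far_vel 1 W i x)^2 <= (norm W * sqrt (far_const * (1 + norm x)))^2"
    using power_mono[OF far_vel_bound_1[of W i x] abs_ge_zero, of 2] by simp
   also have "... = (norm W)^2 * (far_const * (1 + norm x))"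
    using far_const_nonneg by (simp add: power_mult_distrib)
   finally have a: "(far_vel 1 W i x)^2 <= (norm W)^2 * (far_const * (1 + norm x))" .
   have w0: "0 <= wt x" by (simp add: wt_def)
   have b: "(q i x)^2 <= M'^2 * (wt x)^2"
    using power_mono[OF dec[of i x] abs_ge_zero, of 2] by (simp add: power_mult_distrib)
   have x1: "1 <= norm x" using False L by simp
   have w: "(1 + norm x) * (wt x)^2 <= 16 * decay3 x"
   proof -
    have "wt x <= 1 / (norm x)^2" by (simp add: wt_def)
    then have "(wt x)^2 <= (1 / (norm x)^2)^2" by (rule power_mono[OF _ w0])
    also have "... = 1 / (norm x) ^ 4" by (simp add: power_divide flip: power_mult)
    also have "... <= 16 / (1 + norm x) ^ 4"
    proof -
     have "(1 + norm x) ^ 4 <= (2 * norm x) ^ 4" using x1 by (intro power_mono) auto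
     then show ?thesis using x1 by (simp add: divide_simps power_mult_distrib)
    qed
    finally have "(1 + norm x) * (wt x)^2 <= (1 + norm x) * (16 / (1 + norm x) ^ 4)"
     by (rule mult_left_mono) simp
    also have "... = 16 * decay3 x"
     using x1 by (simp add: decay3_def divide_simps power_numeral_reduce)
    finally show ?thesis .
   qed
   have "(far_vel 1 W i x * q i x)^2 <= ((norm W)^2 * (far_const * (1 + norm x))) * (M'^2 * (wt x)^2)"
    unfolding power_mult_distrib by (rule mult_mono[OF a b]) (use far_const_nonneg in auto)
   also have "... = ((norm W)^2 * M'^2 * far_const) * ((1 + norm x) * (wt x)^2)" by (simp add: mult_ac)
   also have "... <= ((norm W)^2 * M'^2 * far_const) * (16 * decay3 x)"
    by (rule mult_left_mono[OF w]) (use far_const_nonneg in auto)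
   finally show ?thesis using False by (simp add: indicator_def mult_ac)
  qed
  have iD: "integrable lborel (%x. decay3 x * indicator {x. norm x >= L} x)"
   by (rule integrable_real_mult_indicator[OF _ decay3_integrable]) measurable
  have "(norm (abs_l2 (%x. far_vel 1 W i x * q i x)))^2 <= (LINT x|lborel. ((norm W)^2 * M'^2 * (16 * far_const)) * (decay3 x * indicator {x. norm x >= L} x))"
   unfolding norm_abs_l2_sq[OF s]
   by (rule integral_mono[OF _ _ pw]) (use s iD in \<open>auto simp: sq_integrable_def\<close>)
  also have "... = (norm W * M' * sqrt (16 * far_const * ?D))^2"
   using far_const_nonneg decay3_pos by (simp add: power_mult_distrib integral_nonneg_AE less_imp_le)
  finally have "norm (abs_l2 (%x. far_vel 1 W i x * q i x)) <= norm W * M' * sqrt (16 * far_const * ?D)"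
   by (rule power2_le_imp_le)
    (use M' far_const_nonneg decay3_pos in \<open>auto intro!: mult_nonneg_nonneg integral_nonneg_AE simp: less_imp_le\<close>)
  from mult_left_mono[OF this norm_ge_zero[of W]]
  show ?thesis using Cauchy_Schwarz_ineq2[of W "abs_l2 (%x. far_vel 1 W i x * q i x)"]
   by (simp add: power2_eq_square mult_ac)
 qed
 have "\<bar>\<Sum>i\<in>UNIV. inner W (abs_l2 (%x. far_vel 1 W i x * q i x))\<bar> <= (\<Sum>i\<in>(UNIV :: 2 set). (norm W)^2 * (M' * sqrt (16 * far_const * ?D)))"
  by (rule order_trans[OF sum_abs sum_mono]) (rule far)
 then have "\<bar>transport W q\<bar> <= M' * (4 * near_mass 1 / L^2) * (norm W)^2 + 2 * ((norm W)^2 * (M' * sqrt (16 * far_const * ?D)))"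
  using near unfolding transport_split(2)[OF q zero_less_one order_refl] by simp
 also have "... = M' * tail_const L * (norm W)^2" by (simp add: tail_const_def algebra_simps)
 finally show ?thesis .
qed

section \<open>Gradients of test functionals\<close>

lemma tendsto_fun_iff:
 fixes f :: "'a => nat => real"
 shows "(f \<longlongrightarrow> l) F \<longleftrightarrow> (\<forall>i. ((%x. f x i) \<longlongrightarrow> l i) F)"
 using limitin_componentwise[of "%_. euclidean" UNIV f l F]
 by (simp add: euclidean_product_topology limitin_canonical_iff)

lemma mean_value_between:
 fixes \<phi> :: "real => real"
 assumes "!!t. (\<phi> has_real_derivative \<phi>' t) (at t)"
 shows "\<exists>\<xi>. \<bar>\<xi> - a\<bar> <= \<bar>b - a\<bar> \<and> \<phi> b - \<phi> a = \<phi>' \<xi> * (b - a)"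
proof -
 consider "a < b" | "b < a" | "a = b" by linarith
 then show ?thesis
 proof cases
  case 1
  then obtain z where "a < z" "z < b" "\<phi> b - \<phi> a = (b - a) * \<phi>' z" using MVT2[OF 1 assms] by blast
  then show ?thesis by (intro exI[of _ z]) (auto simp: mult.commute)
 next
  case 2
  then obtain z where "b < z" "z < a" "\<phi> a - \<phi> b = (a - b) * \<phi>' z" using MVT2[OF 2 assms] by blast
  then show ?thesis by (intro exI[of _ z]) (auto simp: algebra_simps)
 qed auto
qed

text \<open>The mean value theorem presents an increment as a slope at an intermediate point times the
 increment of a differentiable function, and the slope is only known to be continuous.\<close>

lemma has_derivative_variable_slope:
 fixes l c :: "'a :: real_normed_vector => real"
 assumes l: "(l has_derivative l') (at x)" and c: "(c \<longlongrightarrow> c0) (at x)"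
  and G: "!!y. G y = c y * (l y - l x)"
 shows "(G has_derivative (%v. c0 * l' v)) (at x)"
proof -
 have bl: "bounded_linear l'" by (rule has_derivative_bounded_linear[OF l])
 obtain B where B: "!!v. norm (l' v) <= norm v * B" using bounded_linear.bounded[OF bl] by blast
 let ?r = "%y. norm (l y - l x - l' (y - x)) / norm (y - x)"
 have r: "(?r \<longlongrightarrow> 0) (at x)" using l unfolding has_derivative_iff_norm by blast
 have e: "((%y. (c y - c0) * (l y - l x)) has_derivative (%_. 0)) (at x)"
  unfolding has_derivative_iff_norm
 proof (intro conjI bounded_linear_zero)
  show "((%y. norm ((c y - c0) * (l y - l x) - (c x - c0) * (l x - l x) - 0) / norm (y - x)) \<longlongrightarrow> 0) (at x)"
  proof (rule Lim_null_comparison)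
   have "((%y. \<bar>c y - c0\<bar> * (?r y + \<bar>B\<bar>)) \<longlongrightarrow> \<bar>c0 - c0\<bar> * (0 + \<bar>B\<bar>)) (at x)"
    by (intro tendsto_mult tendsto_rabs tendsto_diff tendsto_add c r tendsto_const)
   then show "((%y. \<bar>c y - c0\<bar> * (?r y + \<bar>B\<bar>)) \<longlongrightarrow> 0) (at x)" by simp
   show "\<forall>\<^sub>F y in at x. norm (norm ((c y - c0) * (l y - l x) - (c x - c0) * (l x - l x) - 0) / norm (y - x)) <= \<bar>c y - c0\<bar> * (?r y + \<bar>B\<bar>)"
   proof (rule always_eventually, rule allI)
    fix y
    show "norm (norm ((c y - c0) * (l y - l x) - (c x - c0) * (l x - l x) - 0) / norm (y - x)) <= \<bar>c y - c0\<bar> * (?r y + \<bar>B\<bar>)"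
    proof (cases "y = x")
     case False
     then have p: "norm (y - x) > 0" by simp
     have "\<bar>l y - l x\<bar> <= \<bar>l y - l x - l' (y - x)\<bar> + \<bar>l' (y - x)\<bar>" by linarith
     also have "... <= \<bar>l y - l x - l' (y - x)\<bar> + \<bar>B\<bar> * norm (y - x)"
      using B[of "y - x"] mult_right_mono[OF abs_ge_self[of B], of "norm (y - x)"] by (simp add: mult.commute)
     finally have "\<bar>l y - l x\<bar> / norm (y - x) <= ?r y + \<bar>B\<bar>" using p by (simp add: field_simps)
     then have "\<bar>c y - c0\<bar> * (\<bar>l y - l x\<bar> / norm (y - x)) <= \<bar>c y - c0\<bar> * (?r y + \<bar>B\<bar>)" by (rule mult_left_mono) simp
     then show ?thesis by (simp add: abs_mult)
    qed simp
   qed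
  qed
 qed
 have "((%y. c0 * (l y - l x) + (c y - c0) * (l y - l x)) has_derivative (%v. c0 * (l' v - 0) + 0)) (at x)"
  by (intro has_derivative_add e has_derivative_mult_right has_derivative_diff l has_derivative_const)
 moreover have "(%y. c0 * (l y - l x) + (c y - c0) * (l y - l x)) = G" by (rule ext) (simp add: G algebra_simps)
 ultimately show ?thesis by simp
qed

definition Rm_vec :: "nat => (nat => 'a => real) => 'a => nat => real" where
 "Rm_vec m L w = (%k. if k < m then L k w else 0)"

definition C1_partials :: "nat => ((nat => real) => real) => (nat => (nat => real) => real) => bool" where
 "C1_partials m \<psi> D \<longleftrightarrow> (\<forall>k<m. continuous_on (Rm m) (D k) \<and>
  (\<forall>p\<in>Rm m. ((%t. \<psi> (p(k := t))) has_real_derivative D k p) (at (p k))))"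

lemma C1_Rm_iff: "C1_Rm m \<psi> \<longleftrightarrow> (\<exists>D. C1_partials m \<psi> D)"
 by (simp add: C1_Rm_def C1_partials_def)

text \<open>Changing one coordinate at a time reduces total differentiability to the mean value theorem and
 the continuity of the partial derivatives.\<close>

lemma C1_chain_rule:
 fixes L :: "nat => 'a :: real_normed_vector => real"
 assumes \<psi>: "C1_partials m \<psi> D" and L: "!!k. k < m ==> (L k has_derivative L' k) (at x)"
 shows "((%w. \<psi> (Rm_vec m L w)) has_derivative (%v. \<Sum>k<m. D k (Rm_vec m L x) * L' k v)) (at x)"
proof -
 define p where "p = Rm_vec m L x"
 define r where "r i w = (%k. if k < i then Rm_vec m L w k else p k)" for i w
 define G where "G i w = \<psi> (r (Suc i) w) - \<psi> (r i w)" for i w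
 have rRm: "(r i w)(j := t) \<in> Rm m" if "j < m" for i w j t
  using that by (auto simp: Rm_def r_def p_def Rm_vec_def)
 have dG: "(G i has_derivative (%v. D i p * L' i v)) (at x)" if i: "i < m" for i
 proof -
  have "\<exists>\<xi>. \<bar>\<xi> - L i x\<bar> <= \<bar>L i w - L i x\<bar> \<and> G i w = D i ((r i w)(i := \<xi>)) * (L i w - L i x)" for w
  proof -
   have "((%t. \<psi> ((r i w)(i := t))) has_real_derivative D i ((r i w)(i := t))) (at t)" for t
    using \<psi> i rRm[OF i, of i w t] unfolding C1_partials_def by fastforce
   from mean_value_between[of "%t. \<psi> ((r i w)(i := t))" "%t. D i ((r i w)(i := t))", OF this, of "L i x" "L i w"]
   obtain \<xi> where "\<bar>\<xi> - L i x\<bar> <= \<bar>L i w - L i x\<bar>"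
    "\<psi> ((r i w)(i := L i w)) - \<psi> ((r i w)(i := L i x)) = D i ((r i w)(i := \<xi>)) * (L i w - L i x)" by blast
   moreover have "(r i w)(i := L i w) = r (Suc i) w" "(r i w)(i := L i x) = r i w"
    using i by (auto simp: r_def p_def Rm_vec_def fun_eq_iff)
   ultimately show ?thesis by (auto simp: G_def)
  qed
  then obtain \<xi> where \<xi>: "!!w. \<bar>\<xi> w - L i x\<bar> <= \<bar>L i w - L i x\<bar>"
   "!!w. G i w = D i ((r i w)(i := \<xi> w)) * (L i w - L i x)" by metis
  have Lc: "(L k \<longlongrightarrow> L k x) (at x)" if "k < m" for k
   using has_derivative_continuous[OF L[OF that]] by (simp add: isCont_def)
  have \<xi>lim: "(\<xi> \<longlongrightarrow> L i x) (at x)"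
  proof (rule LIM_zero_cancel, rule Lim_null_comparison)
   show "\<forall>\<^sub>F w in at x. norm (\<xi> w - L i x) <= \<bar>L i w - L i x\<bar>" using \<xi>(1) by simp
   show "((%w. \<bar>L i w - L i x\<bar>) \<longlongrightarrow> 0) (at x)"
    using tendsto_rabs[OF tendsto_diff[OF Lc[OF i] tendsto_const[of "L i x"]]] by simp
  qed
  have "((%w. (r i w)(i := \<xi> w)) \<longlongrightarrow> p) (at x)"
   unfolding tendsto_fun_iff
  proof
   fix k
   show "((%w. ((r i w)(i := \<xi> w)) k) \<longlongrightarrow> p k) (at x)"
   proof (cases "k = i")
    case True then show ?thesis using \<xi>lim i by (simp add: p_def Rm_vec_def)
   next
    case False
    then show ?thesis using Lc[of k] i by (cases "k < i") (simp_all add: r_def p_def Rm_vec_def)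
   qed
  qed
  then have "((%w. D i ((r i w)(i := \<xi> w))) \<longlongrightarrow> D i p) (at x)"
   using \<psi> i by (intro continuous_on_tendsto_compose[of "Rm m" "D i"] always_eventually allI rRm)
    (auto simp: C1_partials_def Rm_def p_def Rm_vec_def)
  from has_derivative_variable_slope[OF L[OF i] this \<xi>(2)] show ?thesis .
 qed
 have "\<psi> (r n w) = \<psi> p + (\<Sum>i<n. G i w)" for n w
  by (induction n) (auto simp: G_def r_def)
 moreover have "r m w = Rm_vec m L w" for w by (auto simp: r_def p_def Rm_vec_def)
 ultimately have eq: "(%w. \<psi> (Rm_vec m L w)) = (%w. \<psi> p + (\<Sum>i<m. G i w))" by metis
 have "((%w. \<psi> p + (\<Sum>i<m. G i w)) has_derivative (%v. 0 + (\<Sum>i<m. D i p * L' i v))) (at x)"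
  by (intro has_derivative_add has_derivative_const has_derivative_sum dG) auto
 then show ?thesis unfolding eq p_def by simp
qed

subsection \<open>Uniqueness of the gradient\<close>

lemma pairing_rep_right: "sq_integrable p ==> pairing p (rep_l2 v) = inner (abs_l2 p) v"
 using pairing_eq_inner[of p v] by (simp add: pairing_commute inner_commute)

lemma abs_l2_eq_continuous:
 assumes p: "sq_integrable p" "continuous_on UNIV p" and q: "sq_integrable q" "continuous_on UNIV q"
  and eq: "abs_l2 p = abs_l2 q"
 shows "p = q"
proof -
 have "AE x in lborel. rep_l2 (abs_l2 p) x = p x" "AE x in lborel. rep_l2 (abs_l2 p) x = q x"
  using rep_abs_l2[OF p(1)] rep_abs_l2[OF q(1)] eq by auto
 then have ae: "AE x in lborel. p x = q x" by eventually_elim simp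
 let ?S = "{x. p x ~= q x}"
 have o: "open ?S" by (rule open_Collect_neq[OF p(2) q(2)])
 have "?S \<in> null_sets lborel" using AE_iff_null_sets[of ?S lborel] ae o by simp
 then have "negligible ?S" by (simp add: negligible_iff_null_sets null_sets_completionI)
 then have "?S = {}" using open_not_negligible[OF o] by blast
 then show ?thesis by auto
qed

text \<open>The derivative determines the class of its representative in \<open>L\<^sup>2\<close>, and continuity singles out one function.\<close>

lemma func_derivI:
 assumes p: "C2_0 p" and d: "(\<Psi> has_derivative (%v. pairing p (rep_l2 v))) (at W)"
 shows "func_deriv \<Psi> W = p"
 unfolding func_deriv_def
proof (rule the_equality)
 show "C2_0 p \<and> (\<Psi> has_derivative (%v. pairing p (rep_l2 v))) (at W)" using p d by simp
 fix q assume q: "C2_0 q \<and> (\<Psi> has_derivative (%v. pairing q (rep_l2 v))) (at W)"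
 note sp = C2_0_sq_integrable(1)[OF p] and sq = C2_0_sq_integrable(1)[of q]
 have "(%v. pairing q (rep_l2 v)) = (%v. pairing p (rep_l2 v))"
  using q d has_derivative_unique by blast
 then have "inner (abs_l2 q) v = inner (abs_l2 p) v" for v
  using pairing_rep_right[OF sp, of v] pairing_rep_right[OF sq, of v] q by (metis (full_types))
 then have "abs_l2 q = abs_l2 p" by (metis vector_eq_rdot)
 then show "q = p"
  using abs_l2_eq_continuous[OF sq C2_0_cont(1) sp C2_0_cont(1)[OF p]] q by blast
qed

subsection \<open>Gradient families\<close>

text \<open>The properties of the gradients that survive weak limits: uniform \<open>C\<^sup>2\<close> bounds and supports on
 balls of the Hilbert space, and pointwise weak continuity of all derivatives.\<close>

definition gradient_family_on :: "real => (l2 => plane => real) => bool" where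
 "gradient_family_on R P \<longleftrightarrow> (\<exists>\<rho> M. 0 <= \<rho> \<and> (\<forall>W. norm W <= R --> C2_bounds \<rho> M (P W))) \<and>
  (\<forall>X x. (\<forall>n. norm (X n) <= R) \<and> wconv X x -->
    (\<forall>y. (%n. P (X n) y) ----> P x y) \<and> (\<forall>i y. (%n. pd i (P (X n)) y) ----> pd i (P x) y) \<and>
    (\<forall>i k y. (%n. pd k (pd i (P (X n))) y) ----> pd k (pd i (P x)) y))"

lemma gradient_family_on_const:
 assumes "C2_0 w"
 shows "gradient_family_on R (%W. w)"
proof -
 obtain r M where "0 <= r" "C2_bounds r M w" using C2_0_bounds[OF assms] by blast
 then show ?thesis unfolding gradient_family_on_def by auto
qed

lemma gradient_family_on_lincomb:
 fixes m :: nat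
 assumes a: "!!k. k < m ==> wcont_on_ball R (a k)" and B: "!!k. k < m ==> gradient_family_on R (B k)"
  and C: "!!k W. k < m ==> C2_0 (B k W)"
 shows "gradient_family_on R (%W x. \<Sum>k<m. a k W * B k W x)"
proof -
 let ?P = "%W x. \<Sum>k<m. a k W * B k W x"
 have "\<exists>\<rho> M K. 0 <= \<rho> \<and> 0 <= K \<and> (\<forall>W. norm W <= R --> C2_bounds \<rho> M (B k W) \<and> \<bar>a k W\<bar> <= K)" if "k < m" for k
  using B[OF that] wcont_on_ball_bounded[OF a[OF that]] unfolding gradient_family_on_def by meson
 then obtain \<rho> M K where b: "!!k. k < m ==> 0 <= \<rho> k" "!!k. k < m ==> 0 <= K k"
  "!!k W. k < m ==> norm W <= R ==> C2_bounds (\<rho> k) (M k) (B k W)"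
  "!!k W. k < m ==> norm W <= R ==> \<bar>a k W\<bar> <= K k" by metis
 define \<rho>' where "\<rho>' = (\<Sum>k<m. \<rho> k)"
 define M' where "M' = (\<Sum>k<m. K k * M k)"
 have \<rho>': "\<rho> k <= \<rho>'" if "k < m" for k unfolding \<rho>'_def by (rule member_le_sum) (use that b in auto)
 have \<rho>0: "0 <= \<rho>'" unfolding \<rho>'_def by (intro sum_nonneg) (use b in auto)
 have lc: "C2_0 (?P W)" "pd i (?P W) = (%x. \<Sum>k<m. a k W * pd i (B k W) x)"
  "pd l (pd i (?P W)) = (%x. \<Sum>k<m. a k W * pd l (pd i (B k W)) x)" for W i l
  using C2_0_lincomb[where a = "%k. a k W" and w = "%k. B k W" and m = m] C by auto
 have lc3: "pd l (%x. \<Sum>k<m. a k W * pd i (B k W) x) = (%x. \<Sum>k<m. a k W * pd l (pd i (B k W)) x)" for W i l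
  using lc(3)[of l i W] unfolding lc(2) .
 have sumb: "\<bar>\<Sum>k<m. a k W * c k\<bar> <= M'" if "norm W <= R" "!!k. k < m ==> \<bar>c k\<bar> <= M k" for W c
 proof -
  have "\<bar>\<Sum>k<m. a k W * c k\<bar> <= (\<Sum>k<m. \<bar>a k W * c k\<bar>)" by (rule sum_abs)
  also have "... <= M'" unfolding M'_def abs_mult
   by (intro sum_mono mult_mono b(4) that) (use b that in auto)
  finally show ?thesis .
 qed
 have bounds: "C2_bounds \<rho>' M' (?P W)" if R: "norm W <= R" for W
  unfolding C2_bounds_def lc(2) lc3
 proof (intro conjI allI impI)
  show "C2_0 (?P W)" by (rule lc)
  fix x i l
  show "\<bar>\<Sum>k<m. a k W * B k W x\<bar> <= M'" "\<bar>\<Sum>k<m. a k W * pd i (B k W) x\<bar> <= M'"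
   "\<bar>\<Sum>k<m. a k W * pd l (pd i (B k W)) x\<bar> <= M'"
   using C2_boundsD[OF b(3)[OF _ R]] by (auto intro!: sumb[OF R])
  assume "\<rho>' < norm x"
  then have "\<rho> k < norm x" if "k < m" for k using \<rho>'[OF that] by simp
  then show "(\<Sum>k<m. a k W * B k W x) = 0" "(\<Sum>k<m. a k W * pd i (B k W) x) = 0"
   "(\<Sum>k<m. a k W * pd l (pd i (B k W)) x) = 0"
   using C2_boundsD[OF b(3)[OF _ R]] by (auto intro!: sum.neutral)
 qed
 show ?thesis
  unfolding gradient_family_on_def lc(2) lc3
 proof (intro conjI allI impI)
  show "\<exists>\<rho> M. 0 <= \<rho> \<and> (\<forall>W. norm W <= R --> C2_bounds \<rho> M (?P W))"
   using \<rho>0 bounds by blast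
  fix X x y i l assume X: "(\<forall>n. norm (X n) <= R) \<and> wconv X x"
  have al: "(%n. a k (X n)) ----> a k x" if "k < m" for k using wcont_on_ballD[OF a[OF that]] X by blast
  show "(%n. \<Sum>k<m. a k (X n) * B k (X n) y) ----> (\<Sum>k<m. a k x * B k x y)"
   "(%n. \<Sum>k<m. a k (X n) * pd i (B k (X n)) y) ----> (\<Sum>k<m. a k x * pd i (B k x) y)"
   "(%n. \<Sum>k<m. a k (X n) * pd l (pd i (B k (X n))) y) ----> (\<Sum>k<m. a k x * pd l (pd i (B k x)) y)"
   using B X by (auto intro!: tendsto_sum tendsto_mult al simp: gradient_family_on_def)
 qed
qed

lemma wcont_Rm_vec:
 assumes \<psi>: "C1_partials m \<psi> D" and L: "!!k. k < m ==> wcont_on_ball R (L k)" and k: "k < m"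
 shows "wcont_on_ball R (%W. D k (Rm_vec m L W))"
 unfolding wcont_on_ball_def
proof (intro allI impI)
 fix X x assume X: "(\<forall>n. norm (X n) <= R) \<and> wconv X x"
 have "(%n. Rm_vec m L (X n)) ----> Rm_vec m L x"
  unfolding tendsto_fun_iff
 proof
  fix i show "(%n. Rm_vec m L (X n) i) ----> Rm_vec m L x i"
   using wcont_on_ballD[OF L[of i]] X by (cases "i < m") (auto simp: Rm_vec_def)
 qed
 then show "(%n. D k (Rm_vec m L (X n))) ----> D k (Rm_vec m L x)"
  using \<psi> k by (intro continuous_on_tendsto_compose[of "Rm m" "D k"] always_eventually allI)
   (auto simp: C1_partials_def Rm_def Rm_vec_def)
qed

subsection \<open>Cylindrical functionals\<close>

lemma wcont_pairing: "sq_integrable w ==> wcont_on_ball R (%W. pairing (rep_l2 W) w)"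
 by (simp add: wcont_on_ball_def pairing_eq_inner wconvD)

lemma pairing_has_derivative:
 assumes "sq_integrable w"
 shows "((%W. pairing (rep_l2 W) w) has_derivative (%v. pairing w (rep_l2 v))) (at W)"
 unfolding pairing_eq_inner[OF assms] pairing_rep_right[OF assms]
 by (auto intro!: derivative_eq_intros simp: inner_commute)

lemma pairing_lincomb:
 fixes m :: nat
 assumes "!!k. k < m ==> sq_integrable (w k)"
 shows "sq_integrable (%x. \<Sum>k<m. c k * w k x)"
  and "pairing (%x. \<Sum>k<m. c k * w k x) (rep_l2 v) = (\<Sum>k<m. c k * pairing (w k) (rep_l2 v))"
proof -
 show "sq_integrable (%x. \<Sum>k<m. c k * w k x)"
  using assms
 proof (induction m)
  case 0 show ?case by (simp add: sq_integrable_zero)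
 next
  case (Suc m) then show ?case by (simp add: sq_integrable_add sq_integrable_cmult)
 qed
 have "integrable lborel (%x. w k x * rep_l2 v x)" if "k < m" for k
  by (rule sq_integrable_mult[OF assms[OF that] sq_integrable_rep])
 then show "pairing (%x. \<Sum>k<m. c k * w k x) (rep_l2 v) = (\<Sum>k<m. c k * pairing (w k) (rep_l2 v))"
  unfolding pairing_def sum_distrib_right mult.assoc by (subst Bochner_Integration.integral_sum) auto
qed

lemma func_deriv_chain:
 assumes \<psi>: "C1_partials m \<psi> D" and B: "!!k. k < m ==> C2_0 (B k)"
  and L: "!!k. k < m ==> (L k has_derivative (%v. pairing (B k) (rep_l2 v))) (at W)"
 shows "func_deriv (%W. \<psi> (Rm_vec m L W)) W = (%x. \<Sum>k<m. D k (Rm_vec m L W) * B k x)"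
proof (rule func_derivI)
 show "C2_0 (%x. \<Sum>k<m. D k (Rm_vec m L W) * B k x)" by (rule C2_0_lincomb(1)[OF B])
 show "((%W. \<psi> (Rm_vec m L W)) has_derivative
   (%v. pairing (%x. \<Sum>k<m. D k (Rm_vec m L W) * B k x) (rep_l2 v))) (at W)"
 proof -
  have eq: "pairing (%x. \<Sum>k<m. D k (Rm_vec m L W) * B k x) (rep_l2 v)
    = (\<Sum>k<m. D k (Rm_vec m L W) * pairing (B k) (rep_l2 v))" for v
   by (rule pairing_lincomb(2)) (rule C2_0_sq_integrable(1)[OF B])
  show ?thesis unfolding eq by (rule C1_chain_rule[OF \<psi> L])
 qed
qed

lemma func_deriv_cylindrical:
 assumes \<psi>: "C1_partials m \<psi> D" and w: "!!k. k < m ==> C2_0 (w k)"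
 shows "func_deriv (%W. \<psi> (pairings m w (rep_l2 W))) W
   = (%x. \<Sum>k<m. D k (pairings m w (rep_l2 W)) * w k x)"
proof -
 have e: "pairings m w (rep_l2 W) = Rm_vec m (%k W. pairing (rep_l2 W) (w k)) W" for W
  by (auto simp: pairings_def Rm_vec_def)
 show ?thesis unfolding e
  by (rule func_deriv_chain[OF \<psi> w pairing_has_derivative[OF C2_0_sq_integrable(1)[OF w]]])
qed

lemma gradient_family_cylindrical:
 assumes \<psi>: "C1_partials m \<psi> D" and w: "!!k. k < m ==> C2_0 (w k)"
 shows "gradient_family_on R (func_deriv (%W. \<psi> (pairings m w (rep_l2 W))))"
proof -
 have e: "pairings m w (rep_l2 W) = Rm_vec m (%k W. pairing (rep_l2 W) (w k)) W" for W
  by (auto simp: pairings_def Rm_vec_def)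
 have "gradient_family_on R (%W x. \<Sum>k<m. D k (Rm_vec m (%k W. pairing (rep_l2 W) (w k)) W) * w k x)"
  by (intro gradient_family_on_lincomb wcont_Rm_vec[OF \<psi>] wcont_pairing gradient_family_on_const w C2_0_sq_integrable(1))
 moreover have "func_deriv (%W. \<psi> (pairings m w (rep_l2 W))) =
   (%W x. \<Sum>k<m. D k (Rm_vec m (%k W. pairing (rep_l2 W) (w k)) W) * w k x)"
  unfolding e[symmetric] by (rule ext) (rule func_deriv_cylindrical[OF \<psi> w])
 ultimately show ?thesis by simp
qed

subsection \<open>Renormalised functionals\<close>

lemma Ck_real_Suc:
 fixes h :: "real => real"
 assumes "Ck (Suc n) h"
 shows "\<exists>h1. (\<forall>x. (h has_real_derivative h1 x) (at x)) \<and> Ck n h1"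
proof (intro exI conjI allI)
 let ?h1 = "%x. frechet_derivative h (at x) 1"
 show "Ck n ?h1" using assms by simp
 fix x
 have D: "(h has_derivative frechet_derivative h (at x)) (at x)"
  using assms frechet_derivative_works by auto
 then have lin: "linear (frechet_derivative h (at x))" by (rule has_derivative_linear)
 have "frechet_derivative h (at x) = (*) (?h1 x)"
 proof
  fix v show "frechet_derivative h (at x) v = ?h1 x * v"
   using linear_cmul[OF lin, of v 1] by (simp add: mult.commute)
 qed
 with D show "(h has_real_derivative ?h1 x) (at x)" by (simp add: has_field_derivative_def)
qed

text \<open>The value at the origin of a renormalising function \<open>\<beta>\<close> may be nonzero, so that only
 boundedness, and no integrability, of \<open>\<beta> (J W)\<close> is available.\<close>

lemma renormaliser_bounds:
 assumes "Ck 3 \<beta>" "compactly_supported \<beta>"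
 shows "\<exists>\<beta>1 M. 0 <= M \<and> continuous_on UNIV \<beta> \<and> continuous_on UNIV \<beta>1 \<and> (\<forall>s. \<bar>\<beta> s\<bar> <= M \<and> \<bar>\<beta>1 s\<bar> <= M) \<and>
  (\<forall>s t. \<bar>\<beta> (s + t) - \<beta> s - \<beta>1 s * t\<bar> <= M * t^2)"
proof -
 obtain b1 where b1: "!!x. (\<beta> has_real_derivative b1 x) (at x)" "Ck 2 b1"
  using Ck_real_Suc[of 2 \<beta>] assms(1) by (auto simp: numeral_3_eq_3 numeral_2_eq_2 simp del: Ck.simps)
 obtain b2 where b2: "!!x. (b1 has_real_derivative b2 x) (at x)" "Ck 1 b2"
  using Ck_real_Suc[of 1 b1] b1(2) by (auto simp: numeral_2_eq_2 simp del: Ck.simps)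
 obtain b3 where b3: "!!x. (b2 has_real_derivative b3 x) (at x)"
  using Ck_real_Suc[of 0 b2] b2(2) by (auto simp: numeral_2_eq_2 simp del: Ck.simps)
 have c: "continuous_on UNIV \<beta>" "continuous_on UNIV b1" "continuous_on UNIV b2"
  using b1(1) b2(1) b3 by (meson DERIV_isCont continuous_at_imp_continuous_on)+
 obtain r where r: "!!s. norm s > r ==> \<beta> s = 0" using assms(2) by (auto simp: compactly_supported_iff)
 have zero: "f1 s = 0" if f: "!!x. (f has_real_derivative f1 x) (at x)" "!!s. norm s > r ==> f s = 0" and s: "norm s > r"
  for f f1 :: "real => real" and s
 proof -
  have "open {s :: real. norm s > r}" by (intro open_Collect_less continuous_intros)
  from has_field_derivative_transform_within_open[OF DERIV_const this, of s 0 f]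
  have "(f has_real_derivative 0) (at s)" using f(2) s by simp
  then show ?thesis using DERIV_unique f(1) by blast
 qed
 have z1: "b1 s = 0" if "norm s > r" for s by (rule zero[OF b1(1) r that])
 have z2: "b2 s = 0" if "norm s > r" for s by (rule zero[OF b2(1) z1 that])
 obtain M0 M1 M2 where M: "!!s. \<bar>\<beta> s\<bar> <= M0" "M0 >= 0" "!!s. \<bar>b1 s\<bar> <= M1" "M1 >= 0" "!!s. \<bar>b2 s\<bar> <= M2" "M2 >= 0"
  using continuous_bounded_support[OF c(1) r] continuous_bounded_support[OF c(2) z1]
   continuous_bounded_support[OF c(3) z2] by blast
 have "\<bar>\<beta> (s + t) - \<beta> s - b1 s * t\<bar> <= M2 * t^2" for s t
 proof -
  obtain u where u: "\<bar>u - s\<bar> <= \<bar>(s + t) - s\<bar>" "\<beta> (s + t) - \<beta> s = b1 u * ((s + t) - s)"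
   using mean_value_between[of \<beta> b1 s "s + t", OF b1(1)] by blast
  obtain v where v: "b1 u - b1 s = b2 v * (u - s)"
   using mean_value_between[of b1 b2 s u, OF b2(1)] by blast
  have "\<beta> (s + t) - \<beta> s - b1 s * t = (b1 u - b1 s) * t" using u(2) by (simp add: left_diff_distrib)
  also have "... = b2 v * (u - s) * t" by (simp add: v)
  also have "\<bar>...\<bar> <= M2 * \<bar>t\<bar> * \<bar>t\<bar>"
   unfolding abs_mult using u(1) M(5)[of v] M(6) by (intro mult_mono) auto
  finally show ?thesis by (simp add: power2_eq_square mult.assoc)
 qed
 then show ?thesis
  using c M by (intro exI[of _ b1] exI[of _ "M0 + M1 + M2"])
   (smt (verit) mult_right_mono zero_le_power2)
qed

context
 fixes j :: "plane => real" and \<epsilon> :: real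
 assumes j: "is_mollifier j" and \<epsilon>: "0 < \<epsilon>"
begin

abbreviation (input) "k0 \<equiv> mker j \<epsilon>"

lemma C2_0_mker: "C2_0 (mker j \<epsilon>)"
 by (rule smooth_cs_C2_0[OF mker_smooth[OF j \<epsilon>]])

lemma measurable_mker [measurable]: "mker j \<epsilon> \<in> Borel"
 by (rule C2_0_measurable(1)[OF C2_0_mker])

lemma mker_bounded: "\<exists>M\<ge>0. \<forall>x. \<bar>mker j \<epsilon> x\<bar> <= M"
 using C2_0_bounds[OF C2_0_mker] by (metis C2_boundsD(2))

lemma mker_shift_sq: "sq_integrable (%y. mker j \<epsilon> (x - y))"
proof -
 obtain M where M: "!!x. \<bar>mker j \<epsilon> x\<bar> <= M" using mker_bounded by blast
 show ?thesis
 proof (rule sq_integrable_bounded_support[OF _ M])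
  show "mker j \<epsilon> (x - y) = 0" if "norm y > \<epsilon> + norm x" for y
   using that norm_triangle_ineq2[of y x] by (intro mker_zero[OF j \<epsilon>]) (simp add: norm_minus_commute)
 qed measurable
qed

lemma mollify_inner: "mollify j \<epsilon> (rep_l2 W) x = inner W (abs_l2 (%y. mker j \<epsilon> (x - y)))"
 using pairing_eq_inner[OF mker_shift_sq, of W x] by (simp add: mollify_conv conv_def pairing_def mult.commute)

lemma mker_shift_norm: "\<exists>C\<ge>0. \<forall>x. norm (abs_l2 (%y. mker j \<epsilon> (x - y))) <= C"
proof -
 have "(norm (abs_l2 (%y. mker j \<epsilon> (x - y))))^2 = (LINT y|lborel. (mker j \<epsilon> y)^2)" for x
  unfolding norm_abs_l2_sq[OF mker_shift_sq] by (rule integral_reflect[of "%y. (mker j \<epsilon> y)^2"]) measurable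
 then have "norm (abs_l2 (%y. mker j \<epsilon> (x - y))) <= sqrt (LINT y|lborel. (mker j \<epsilon> y)^2)" for x
  by (intro real_le_rsqrt) simp
 then show ?thesis by (intro exI[of _ "sqrt (LINT y|lborel. (mker j \<epsilon> y)^2)"]) (simp add: integral_nonneg_AE)
qed

lemma measurable_mollify [measurable]: "mollify j \<epsilon> h \<in> Borel" if [measurable]: "h \<in> Borel"
proof -
 have "mollify j \<epsilon> h = (%x. LINT y|lborel. mker j \<epsilon> (x - y) * h y)" by (auto simp: mollify_conv conv_def)
 then show ?thesis by simp
qed

text \<open>Evenness of the mollifier makes convolution symmetric.\<close>

lemma conv_mker_symmetric:
 assumes a[measurable]: "a \<in> Borel" and al: "!!s. integrable lborel (%y. a y * indicator (cball 0 s) y)"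
  and [measurable]: "b \<in> Borel" and bb: "!!x. \<bar>b x\<bar> <= B" and bz: "!!x. norm x > r ==> b x = 0"
 shows "pairing (conv (mker j \<epsilon>) a) b = pairing a (conv (mker j \<epsilon>) b)"
proof -
 obtain M where M: "!!x. \<bar>mker j \<epsilon> x\<bar> <= M" "M >= 0" using mker_bounded by blast
 have B0: "0 <= B" using bb[of 0] by linarith
 let ?f = "%x y. mker j \<epsilon> (x - y) * a y * b x"
 define A where "A y = \<bar>a y * indicator (cball 0 (r + \<epsilon>)) y\<bar>" for y
 define c where "c x = M * B * indicator (cball 0 r) x" for x :: plane
 have [measurable]: "A \<in> Borel" "c \<in> Borel"
  unfolding A_def[abs_def] c_def[abs_def] by measurable
 have c0: "0 <= c x" and A0: "0 <= A x" for x using M(2) B0 by (auto simp: c_def A_def)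
 have le: "norm (?f x y) <= c x * A y" for x y
 proof (cases "norm x <= r \<and> norm (x - y) <= \<epsilon>")
  case True
  then have "norm y <= r + \<epsilon>" using norm_triangle_ineq2[of y x] by (simp add: norm_minus_commute)
  then show ?thesis
   using True mult_right_mono[OF mult_mono[OF M(1)[of "x - y"] bb[of x] M(2) abs_ge_zero] abs_ge_zero[of "a y"]]
   by (simp add: abs_mult mult_ac c_def A_def)
 next
  case False
  then have "?f x y = 0" using bz[of x] mker_zero[OF j \<epsilon>, of "x - y"] by auto
  then have "norm (?f x y) = 0" by simp
  also have "0 <= c x * A y" by (intro mult_nonneg_nonneg c0 A0)
  finally show ?thesis .
 qed
 have "integrable (lborel \<Otimes>\<^sub>M lborel) (%(x, y). ?f x y)"
 proof (rule Bochner_Integration.integrable_bound)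
  have 1: "integrable lborel c" unfolding c_def[abs_def] using emeasure_cball_plane_finite[of 0 r] by simp
  have 2: "integrable lborel A" unfolding A_def[abs_def] using al by (rule integrable_abs)
  show "integrable (lborel \<Otimes>\<^sub>M lborel) (%(x, y). c x * A y)"
  proof (rule integrableI_bounded)
   show "(%(x, y). c x * A y) \<in> borel_measurable (lborel \<Otimes>\<^sub>M lborel)" by measurable
   have "(\<integral>\<^sup>+ p. ennreal (norm (case p of (x, y) => c x * A y)) \<partial>(lborel \<Otimes>\<^sub>M lborel))
    = (\<integral>\<^sup>+ x. (nnint y. norm (c x * A y)) \<partial>lborel)"
    by (subst lborel.nn_integral_fst[symmetric]) (auto simp: case_prod_beta)
   also have "... = (\<integral>\<^sup>+ x. ennreal (c x) * (nnint y. A y) \<partial>lborel)"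
    using c0 A0 by (intro nn_integral_cong) (simp add: nn_integral_cmult[symmetric] ennreal_mult abs_mult)
   also have "... = (nnint x. c x) * (nnint y. A y)"
    by (rule nn_integral_multc) measurable
   also have "... < \<infinity>"
    using 1 2 c0 A0 by (simp add: integrable_iff_bounded ennreal_mult_less_top)
   finally show "(\<integral>\<^sup>+ p. ennreal (norm (case p of (x, y) => c x * A y)) \<partial>(lborel \<Otimes>\<^sub>M lborel)) < \<infinity>" .
  qed
  show "AE p in lborel \<Otimes>\<^sub>M lborel. norm (case p of (x, y) => ?f x y) <= norm (case p of (x, y) => c x * A y)"
  proof (rule AE_I2)
   fix p :: "plane \<times> plane"
   show "norm (case p of (x, y) => ?f x y) <= norm (case p of (x, y) => c x * A y)"
    using order_trans[OF le[of "fst p" "snd p"] abs_ge_self] by (simp only: case_prod_beta real_norm_def)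
  qed
 qed measurable
 from lborel_pair.Fubini_integral[OF this]
 have F: "(LINT y|lborel. LINT x|lborel. ?f x y) = (LINT x|lborel. LINT y|lborel. ?f x y)" .
 have "pairing (conv (mker j \<epsilon>) a) b = (LINT x|lborel. LINT y|lborel. ?f x y)"
  unfolding pairing_def conv_def by simp
 also have "... = (LINT y|lborel. LINT x|lborel. ?f x y)" by (rule F[symmetric])
 also have "... = (LINT y|lborel. a y * (LINT x|lborel. mker j \<epsilon> (y - x) * b x))"
 proof (intro Bochner_Integration.integral_cong refl)
  fix y
  have "(LINT x|lborel. ?f x y) = (LINT x|lborel. a y * (mker j \<epsilon> (y - x) * b x))"
   using mker_even[OF j \<epsilon>] by (intro Bochner_Integration.integral_cong refl) (metis minus_diff_eq mult.assoc mult.left_commute)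
  then show "(LINT x|lborel. ?f x y) = a y * (LINT x|lborel. mker j \<epsilon> (y - x) * b x)" by simp
 qed
 finally show ?thesis by (simp add: pairing_def conv_def)
qed

lemma integrable_rep_disc: "integrable lborel (%y. rep_l2 v y * indicator (cball 0 s) y)"
 by (rule integrable_rep_mult, rule sq_integrable_bounded_support[of _ 1 s]) (auto simp: indicator_def)

context
 fixes \<beta> \<beta>1 :: "real => real" and M :: real and w :: "plane => real"
 assumes M0: "0 <= M" and \<beta>c: "continuous_on UNIV \<beta>" "continuous_on UNIV \<beta>1" and \<beta>b: "!!s. \<bar>\<beta> s\<bar> <= M" "!!s. \<bar>\<beta>1 s\<bar> <= M"
  and \<beta>T: "!!s t. \<bar>\<beta> (s + t) - \<beta> s - \<beta>1 s * t\<bar> <= M * t^2" and w: "C2_0 w"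
begin

lemma measurable_renormalisers [measurable]: "\<beta> \<in> Borel" "\<beta>1 \<in> Borel"
 using \<beta>c by (auto intro: borel_measurable_continuous_onI)

abbreviation "JW W \<equiv> mollify j \<epsilon> (rep_l2 W)"
abbreviation "Jw \<equiv> conv (mker j \<epsilon>) w"

definition "renorm_density W y = \<beta>1 (JW W y) * Jw y"

definition "renorm_grad W = conv (mker j \<epsilon>) (renorm_density W)"

lemma w_integrable: "integrable lborel w"
proof -
 obtain r K where b: "C2_bounds r K w" using C2_0_bounds[OF w] by blast
 show ?thesis
  by (rule integrable_bounded_support[of _ K r]) (use C2_boundsD[OF b] C2_0_measurable[OF w] in auto)
qed

lemma measurable_w [measurable]: "w \<in> Borel"
 by (rule C2_0_measurable[OF w])

lemma measurable_Jw [measurable]: "Jw \<in> Borel"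
 unfolding conv_def[abs_def] by measurable

lemma Jw_bounds: "\<exists>r K. 0 <= r \<and> 0 <= K \<and> (\<forall>x. \<bar>Jw x\<bar> <= K) \<and> (\<forall>x. norm x > r --> Jw x = 0)"
proof -
 obtain r K where b: "C2_bounds r K w" "0 <= r" using C2_0_bounds[OF w] by blast
 have g: "has_grad Jw (%i. conv (pd i (mker j \<epsilon>)) w)" by (rule conv_C2_has_grad[OF C2_0_mker w_integrable])
 have z: "Jw x = 0" if "norm x > \<epsilon> + r" for x
  by (rule conv_support[OF mker_zero[OF j \<epsilon>] C2_boundsD(5)[OF b(1)] that])
 obtain K' where "0 <= K'" "\<forall>x. \<bar>Jw x\<bar> <= K'"
  using continuous_bounded_support[OF has_grad_continuous[OF g] z] by blast
 then show ?thesis using z b(2) \<epsilon> by (intro exI[of _ "\<epsilon> + r"] exI[of _ K']) auto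
qed

lemma measurable_renorm_density [measurable]: "renorm_density W \<in> Borel"
 unfolding renorm_density_def[abs_def] by measurable

lemma renorm_density_bounds:
 "\<exists>r K. 0 <= r \<and> 0 <= K \<and> (\<forall>W x. \<bar>renorm_density W x\<bar> <= K) \<and> (\<forall>W x. norm x > r --> renorm_density W x = 0)"
proof -
 obtain r K where b: "0 <= r" "0 <= K" "!!x. \<bar>Jw x\<bar> <= K" "!!x. norm x > r ==> Jw x = 0" using Jw_bounds by blast
 have "\<bar>renorm_density W x\<bar> <= M * K" for W x
  unfolding renorm_density_def abs_mult by (intro mult_mono \<beta>b b) (use M0 in auto)
 then show ?thesis using b M0 by (intro exI[of _ r] exI[of _ "M * K"]) (auto simp: renorm_density_def)
qed

lemma renorm_density_integrable: "integrable lborel (renorm_density W)"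
proof -
 obtain r K where "!!W x. \<bar>renorm_density W x\<bar> <= K" "!!W x. norm x > r ==> renorm_density W x = 0"
  using renorm_density_bounds by blast
 then show ?thesis by (intro integrable_bounded_support[of _ K r]) auto
qed

lemma smooth_pds:
 "smooth_cs (mker j \<epsilon>)" "smooth_cs (pd i (mker j \<epsilon>))" "smooth_cs (pd k (pd i (mker j \<epsilon>)))"
 using mker_smooth[OF j \<epsilon>] smooth_cs_pd by auto

lemma renorm_grad_pd:
 "pd i (renorm_grad W) = conv (pd i (mker j \<epsilon>)) (renorm_density W)"
 "pd k (pd i (renorm_grad W)) = conv (pd k (pd i (mker j \<epsilon>))) (renorm_density W)"
 "C2_0 (renorm_grad W)"
proof -
 note g = conv_C2_has_grad[OF smooth_cs_C2_0 renorm_density_integrable]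
 obtain r K where b: "!!W x. norm x > r ==> renorm_density W x = 0" using renorm_density_bounds by blast
 have z: "conv (mker j \<epsilon>) (renorm_density W) x = 0" if "norm x > \<epsilon> + r" for x
  by (rule conv_support[OF mker_zero[OF j \<epsilon>] b that])
 have c: "continuous_on UNIV (conv (pd k (pd i (mker j \<epsilon>))) (renorm_density W))" for i k
  by (rule has_grad_continuous[OF g[OF smooth_pds(3)]])
 show "pd i (renorm_grad W) = conv (pd i (mker j \<epsilon>)) (renorm_density W)"
  "pd k (pd i (renorm_grad W)) = conv (pd k (pd i (mker j \<epsilon>))) (renorm_density W)"
  "C2_0 (renorm_grad W)"
  unfolding renorm_grad_def using C2_0I[OF g[OF smooth_pds(1)] g[OF smooth_pds(2)] c z] by auto
qed

lemma renorm_grad_pd_pd: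
 "pd k (conv (pd i (mker j \<epsilon>)) (renorm_density W)) = conv (pd k (pd i (mker j \<epsilon>))) (renorm_density W)"
 using renorm_grad_pd(2)[of k i W] unfolding renorm_grad_pd(1) .

lemma renorm_density_wconv:
 assumes "wconv X x"
 shows "(%n. renorm_density (X n) y) ----> renorm_density x y"
proof -
 have "(%n. JW (X n) y) ----> JW x y" unfolding mollify_inner by (rule wconvD[OF assms])
 then have "(%n. \<beta>1 (JW (X n) y)) ----> \<beta>1 (JW x y)"
  by (rule continuous_on_tendsto_compose[OF \<beta>c(2)]) auto
 then show ?thesis unfolding renorm_density_def by (rule tendsto_mult_right)
qed

lemma renorm_grad_family: "gradient_family_on R renorm_grad"
proof -
 obtain r K where b: "0 <= r" "0 <= K" "!!W x. \<bar>renorm_density W x\<bar> <= K" "!!W x. norm x > r ==> renorm_density W x = 0"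
  using renorm_density_bounds by blast
 obtain r' L where k: "C2_bounds r' L (mker j \<epsilon>)" "0 <= r'" "0 <= L" using C2_0_bounds[OF C2_0_mker] by blast
 have mk[measurable]: "pd i (mker j \<epsilon>) \<in> Borel" "pd k (pd i (mker j \<epsilon>)) \<in> Borel" for i k
  using C2_0_measurable[OF C2_0_mker] by auto
 define I where "I = (LINT y|lborel. K * indicator (cball (0 :: plane) r) y)"
 have iI: "integrable lborel (%y :: plane. K * indicator (cball 0 r) y)"
  using emeasure_cball_plane_finite[of 0 r] by simp
 have rle: "\<bar>renorm_density W y\<bar> <= K * indicator (cball 0 r) y" for W y
  using b(3)[of W y] b(4)[of y W] by (cases "norm y <= r") auto
 have cb: "\<bar>conv l (renorm_density W) x\<bar> <= L * I" if [measurable]: "l \<in> Borel" and l: "!!x. \<bar>l x\<bar> <= L" for l W x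
 proof -
  have "\<bar>conv l (renorm_density W) x\<bar> <= (LINT y|lborel. L * (K * indicator (cball (0 :: plane) r) y))"
   unfolding conv_def
  proof (rule order_trans[OF integral_abs_bound], rule integral_mono)
   show "integrable lborel (%y. \<bar>l (x - y) * renorm_density W y\<bar>)"
    by (rule integrable_abs, rule integrable_conv[OF _ l renorm_density_integrable]) measurable
   show "integrable lborel (%y :: plane. L * (K * indicator (cball 0 r) y))" using iI by simp
   show "\<bar>l (x - y) * renorm_density W y\<bar> <= L * (K * indicator (cball 0 r) y)" for y
    unfolding abs_mult by (intro mult_mono l rle k) auto
  qed
  also have "... = L * I" unfolding I_def by (rule integral_mult_right_zero)
  finally show ?thesis .
 qed
 have cl: "(%n. conv l (renorm_density (X n)) y) ----> conv l (renorm_density x) y"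
  if [measurable]: "l \<in> Borel" and l: "!!x. \<bar>l x\<bar> <= L" and X: "wconv X x" for l X x y
  unfolding conv_def
 proof (rule integral_dominated_convergence)
  show "integrable lborel (%y :: plane. L * (K * indicator (cball 0 r) y))" using iI by simp
  show "AE z in lborel. (%n. l (y - z) * renorm_density (X n) z) ----> l (y - z) * renorm_density x z"
   by (intro AE_I2 tendsto_mult_left renorm_density_wconv X)
  show "AE z in lborel. norm (l (y - z) * renorm_density (X n) z) <= L * (K * indicator (cball 0 r) z)" for n
   unfolding real_norm_def abs_mult by (intro AE_I2 mult_mono l rle k) auto
 qed measurable
 have z: "conv l (renorm_density W) x = 0" if "!!x. norm x > r' ==> l x = 0" "norm x > r' + r" for l W x
  by (rule conv_support[OF that(1) b(4) that(2)])
 note kb = C2_boundsD[OF k(1)]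
 show ?thesis
  unfolding gradient_family_on_def
 proof (intro conjI allI impI)
  have "C2_bounds (r' + r) (L * I) (renorm_grad W)" for W
   unfolding C2_bounds_def renorm_grad_pd(1) renorm_grad_pd_pd unfolding renorm_grad_def
   using renorm_grad_pd(3)[of W] unfolding renorm_grad_def
   by (auto intro!: cb z kb(2,3,4,5,6,7))
  then show "\<exists>\<rho> M. 0 <= \<rho> \<and> (\<forall>W. norm W <= R --> C2_bounds \<rho> M (renorm_grad W))"
   using b(1) k(2) by (intro exI[of _ "r' + r"] exI[of _ "L * I"]) auto
  fix X x y i l assume X: "(\<forall>n. norm (X n) <= R) \<and> wconv X x"
  show "(%n. renorm_grad (X n) y) ----> renorm_grad x y" "(%n. pd i (renorm_grad (X n)) y) ----> pd i (renorm_grad x) y"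
   "(%n. pd l (pd i (renorm_grad (X n))) y) ----> pd l (pd i (renorm_grad x)) y"
   unfolding renorm_grad_pd(1) renorm_grad_pd_pd unfolding renorm_grad_def using X kb by (auto intro!: cl)
 qed
qed

lemma alpha_pairing: "pairing (alpha j \<epsilon> \<beta> W) w = (LINT y|lborel. \<beta> (JW W y) * Jw y)"
proof -
 obtain r K where b: "C2_bounds r K w" using C2_0_bounds[OF w] by blast
 have "integrable lborel (%y. \<beta> (JW W y) * indicator (cball 0 s) y)" for s
 proof (rule integrable_bounded_support[of _ M s])
  show "norm (\<beta> (JW W y) * indicator (cball 0 s) y) <= M" for y
   using \<beta>b(1)[of "JW W y"] M0 by (auto simp: indicator_def)
 qed auto
 then have "pairing (conv (mker j \<epsilon>) (%y. \<beta> (JW W y))) w = pairing (%y. \<beta> (JW W y)) Jw"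
  by (intro conv_mker_symmetric[OF _ _ _ C2_boundsD(2)[OF b] C2_boundsD(5)[OF b]]) auto
 then show ?thesis by (simp add: alpha_def mollify_conv pairing_def)
qed

lemma alpha_pairing_wcont: "wcont_on_ball R (%W. pairing (alpha j \<epsilon> \<beta> W) w)"
 unfolding wcont_on_ball_def alpha_pairing
proof (intro allI impI, elim conjE)
 fix X x assume X: "wconv X x"
 obtain r K where b: "0 <= r" "0 <= K" "!!x. \<bar>Jw x\<bar> <= K" "!!x. norm x > r ==> Jw x = 0" using Jw_bounds by blast
 show "(%n. LINT y|lborel. \<beta> (JW (X n) y) * Jw y) ----> (LINT y|lborel. \<beta> (JW x y) * Jw y)"
 proof (rule integral_dominated_convergence)
  show "integrable lborel (%y :: plane. M * K * indicator (cball 0 r) y)"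
   using emeasure_cball_plane_finite[of 0 r] by simp
  show "AE y in lborel. (%n. \<beta> (JW (X n) y) * Jw y) ----> \<beta> (JW x y) * Jw y"
  proof (rule AE_I2)
   fix y
   have "(%n. JW (X n) y) ----> JW x y" unfolding mollify_inner by (rule wconvD[OF X])
   then have "(%n. \<beta> (JW (X n) y)) ----> \<beta> (JW x y)"
    by (rule continuous_on_tendsto_compose[OF \<beta>c(1)]) auto
   then show "(%n. \<beta> (JW (X n) y) * Jw y) ----> \<beta> (JW x y) * Jw y" by (rule tendsto_mult_right)
  qed
  show "AE y in lborel. norm (\<beta> (JW (X n) y) * Jw y) <= M * K * indicator (cball 0 r) y" for n
  proof (rule AE_I2)
   fix y
   have "norm (\<beta> (JW (X n) y) * Jw y) <= M * K" unfolding real_norm_def abs_mult by (intro mult_mono \<beta>b b M0) auto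
   then show "norm (\<beta> (JW (X n) y) * Jw y) <= M * K * indicator (cball 0 r) y"
    using b(4)[of y] by (cases "norm y <= r") auto
  qed
 qed measurable
qed

lemma mollify_add: "JW (W + v) x = JW W x + JW v x"
 by (simp add: mollify_inner inner_add_left)

text \<open>The pairing is the integral of \<open>\<beta> (J W)\<close> against the compactly supported function \<open>J w\<close>. The Taylor
 remainder of \<open>\<beta>\<close> is quadratic in \<open>J v\<close>, which is bounded by a multiple of the norm of \<open>v\<close>, and the linear
 term is brought to the form of a pairing with \<open>v\<close> by moving \<open>J\<close> to the other factor.\<close>

lemma alpha_pairing_has_derivative:
 "((%W. pairing (alpha j \<epsilon> \<beta> W) w) has_derivative (%v. pairing (renorm_grad W) (rep_l2 v))) (at W)"
proof -
 obtain r K where b: "0 <= r" "0 <= K" "!!x. \<bar>Jw x\<bar> <= K" "!!x. norm x > r ==> Jw x = 0" using Jw_bounds by blast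
 obtain r1 K1 where b1: "!!W x. \<bar>renorm_density W x\<bar> <= K1" "!!W x. norm x > r1 ==> renorm_density W x = 0"
  using renorm_density_bounds by blast
 obtain C where C: "0 <= C" "!!x. norm (abs_l2 (%y. mker j \<epsilon> (x - y))) <= C" using mker_shift_norm by blast
 have JC: "\<bar>JW v x\<bar> <= norm v * C" for v x
  unfolding mollify_inner using Cauchy_Schwarz_ineq2[of v "abs_l2 (%y. mker j \<epsilon> (x - y))"]
   mult_left_mono[OF C(2)[of x] norm_ge_zero[of v]] by linarith
 have lin: "pairing (renorm_grad W) (rep_l2 v) = (LINT y|lborel. \<beta>1 (JW W y) * JW v y * Jw y)" for v
 proof -
  have "pairing (renorm_grad W) (rep_l2 v) = pairing (rep_l2 v) (conv (mker j \<epsilon>) (renorm_density W))"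
   unfolding renorm_grad_def by (rule pairing_commute)
  also have "... = pairing (conv (mker j \<epsilon>) (rep_l2 v)) (renorm_density W)"
   by (rule conv_mker_symmetric[symmetric, OF _ integrable_rep_disc _ b1]) auto
  also have "... = (LINT y|lborel. \<beta>1 (JW W y) * JW v y * Jw y)"
   unfolding pairing_def by (intro Bochner_Integration.integral_cong) (auto simp: mollify_conv renorm_density_def mult_ac)
  finally show ?thesis .
 qed
 have int: "integrable lborel (%y. F y * Jw y)" if [measurable]: "F \<in> Borel" and F: "!!y. \<bar>F y\<bar> <= B" for F B
 proof (rule integrable_bounded_support[of _ "B * K" r])
  show "norm (F y * Jw y) <= B * K" for y
   unfolding real_norm_def abs_mult by (rule mult_mono[OF F b(3)]) (use F[of y] in auto)
 qed (use b(4) in auto)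
 show ?thesis
 proof (rule has_derivative_quadratic)
  have s: "sq_integrable (renorm_grad W)" by (rule C2_0_sq_integrable(1)[OF renorm_grad_pd(3)])
  show "bounded_linear (%v. pairing (renorm_grad W) (rep_l2 v))"
   unfolding pairing_rep_right[OF s] by (rule bounded_linear_inner_right)
  fix v :: l2
  have pull: "(LINT y|lborel. c * (K * indicator (cball (0 :: plane) r) y)) = c * (LINT y|lborel. K * indicator (cball (0 :: plane) r) y)" for c :: real
   by (rule integral_mult_right_zero)
  have const_out: "(LINT y|lborel. M * (norm v * C)^2 * (K * indicator (cball (0 :: plane) r) y))
    = (M * C^2 * (LINT y|lborel. K * indicator (cball (0 :: plane) r) y)) * (norm v)^2"
   unfolding pull power_mult_distrib by (simp only: mult_ac)
  have i1: "integrable lborel (%y. \<beta> (JW u y) * Jw y)" for u by (rule int[OF _ \<beta>b(1)]) measurable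
  have i2: "integrable lborel (%y. (\<beta>1 (JW W y) * JW v y) * Jw y)"
   by (rule int[of _ "M * (norm v * C)"]) (auto simp: abs_mult intro!: mult_mono \<beta>b JC M0)
  have diff: "pairing (alpha j \<epsilon> \<beta> (W + v)) w - pairing (alpha j \<epsilon> \<beta> W) w - pairing (renorm_grad W) (rep_l2 v)
   = (LINT y|lborel. \<beta> (JW (W + v) y) * Jw y - \<beta> (JW W y) * Jw y - \<beta>1 (JW W y) * JW v y * Jw y)"
   unfolding alpha_pairing lin using i1 i2 by simp
  have bound: "\<bar>LINT y|lborel. \<beta> (JW (W + v) y) * Jw y - \<beta> (JW W y) * Jw y - \<beta>1 (JW W y) * JW v y * Jw y\<bar>
   <= (LINT y|lborel. M * (norm v * C)^2 * (K * indicator (cball (0 :: plane) r) y))"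
  proof (rule order_trans[OF integral_abs_bound], rule integral_mono)
   show "integrable lborel (%y. \<bar>\<beta> (JW (W + v) y) * Jw y - \<beta> (JW W y) * Jw y - \<beta>1 (JW W y) * JW v y * Jw y\<bar>)"
    using i1 i2 by simp
   show "integrable lborel (%y :: plane. M * (norm v * C)^2 * (K * indicator (cball 0 r) y))"
    using emeasure_cball_plane_finite[of 0 r] by simp
   fix y
   have "\<bar>\<beta> (JW (W + v) y) - \<beta> (JW W y) - \<beta>1 (JW W y) * JW v y\<bar> <= M * (JW v y)^2"
    unfolding mollify_add by (rule \<beta>T)
   also have "... <= M * (norm v * C)^2"
    using power_mono[OF JC[of v y] abs_ge_zero, of 2] M0 by (intro mult_left_mono) auto
   finally have "\<bar>\<beta> (JW (W + v) y) - \<beta> (JW W y) - \<beta>1 (JW W y) * JW v y\<bar> * \<bar>Jw y\<bar> <= M * (norm v * C)^2 * (K * indicator (cball 0 r) y)"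
   proof (rule mult_mono)
    show "\<bar>Jw y\<bar> <= K * indicator (cball 0 r) y" using b(3)[of y] b(4)[of y] by (cases "norm y <= r") auto
   qed (use M0 in auto)
   moreover have eq: "\<beta> (JW (W + v) y) * Jw y - \<beta> (JW W y) * Jw y - \<beta>1 (JW W y) * JW v y * Jw y
    = (\<beta> (JW (W + v) y) - \<beta> (JW W y) - \<beta>1 (JW W y) * JW v y) * Jw y" by (simp add: algebra_simps)
   ultimately show "\<bar>\<beta> (JW (W + v) y) * Jw y - \<beta> (JW W y) * Jw y - \<beta>1 (JW W y) * JW v y * Jw y\<bar>
     <= M * (norm v * C)^2 * (K * indicator (cball 0 r) y)" unfolding eq abs_mult by blast
  qed
  show "\<bar>pairing (alpha j \<epsilon> \<beta> (W + v)) w - pairing (alpha j \<epsilon> \<beta> W) w - pairing (renorm_grad W) (rep_l2 v)\<bar>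
   <= (M * C^2 * (LINT y|lborel. K * indicator (cball (0 :: plane) r) y)) * (norm v)^2"
   unfolding diff using bound unfolding const_out .
 qed
qed

end

end

text \<open>In both kinds of test functionals the gradient is a combination of fixed shapes with weakly
 continuous coefficients; mollification turns weak convergence into pointwise convergence.\<close>

theorem gradient_family_test_functional:
 assumes j: "is_mollifier j" and \<Psi>: "\<Psi> \<in> test_functionals j"
 shows "gradient_family_on R (func_deriv \<Psi>)"
proof -
 obtain m \<psi> w where \<psi>: "C1_Rm m \<psi>" and w: "!!k. k < m ==> C2_0 (w k)"
  and cases: "\<Psi> = (%W. \<psi> (pairings m w (rep_l2 W))) \<or>
   (\<exists>\<epsilon> \<beta>. 0 < \<epsilon> \<and> Ck 3 \<beta> \<and> compactly_supported \<beta> \<and> \<Psi> = (%W. \<psi> (pairings m w (alpha j \<epsilon> \<beta> W))))"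
  using \<Psi> unfolding test_functionals_def by blast
 obtain D where D: "C1_partials m \<psi> D" using \<psi> by (auto simp: C1_Rm_iff)
 show ?thesis using cases
 proof (elim disjE exE conjE)
  assume "\<Psi> = (%W. \<psi> (pairings m w (rep_l2 W)))"
  then show ?thesis using gradient_family_cylindrical[OF D w] by simp
 next
  fix \<epsilon> \<beta> assume \<epsilon>: "0 < \<epsilon>" and \<beta>: "Ck 3 \<beta>" "compactly_supported \<beta>"
   and e: "\<Psi> = (%W. \<psi> (pairings m w (alpha j \<epsilon> \<beta> W)))"
  obtain \<beta>1 M where b: "0 <= M" "continuous_on UNIV \<beta>" "continuous_on UNIV \<beta>1" "!!s. \<bar>\<beta> s\<bar> <= M" "!!s. \<bar>\<beta>1 s\<bar> <= M"
   "!!s t. \<bar>\<beta> (s + t) - \<beta> s - \<beta>1 s * t\<bar> <= M * t^2"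
   using renormaliser_bounds[OF \<beta>] by blast
  note R = renorm_grad_pd(3)[OF j \<epsilon> b] renorm_grad_family[OF j \<epsilon> b] alpha_pairing_wcont[OF j \<epsilon> b]
   alpha_pairing_has_derivative[OF j \<epsilon> b]
  let ?L = "%k W. pairing (alpha j \<epsilon> \<beta> W) (w k)"
  let ?B = "%k. renorm_grad j \<epsilon> \<beta>1 (w k)"
  have P: "pairings m w (alpha j \<epsilon> \<beta> W) = Rm_vec m ?L W" for W
   by (auto simp: pairings_def Rm_vec_def)
  have fd: "func_deriv \<Psi> = (%W x. \<Sum>k<m. D k (Rm_vec m ?L W) * ?B k W x)"
   unfolding e P by (rule ext, rule func_deriv_chain[OF D R(1)[OF w] R(4)[OF w]])
  show ?thesis unfolding fd
   by (intro gradient_family_on_lincomb wcont_Rm_vec[OF D] R(3)[OF w] R(2)[OF w] R(1)[OF w])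
 qed
qed

section \<open>Smooth truncations of the kernel\<close>

lemma DERIV_max0_sq: "((%x :: real. (max 0 x)^2) has_real_derivative 2 * max 0 x) (at x)"
 unfolding has_field_derivative_def
proof (rule has_derivative_quadratic)
 show "bounded_linear ((*) (2 * max 0 x))" by (rule bounded_linear_mult_right)
 show "\<bar>(max 0 (x + v))\<^sup>2 - (max 0 x)\<^sup>2 - 2 * max 0 x * v\<bar> <= 1 * (norm v)^2" for v
 proof -
  consider "x >= 0" "x + v >= 0" | "x >= 0" "x + v < 0" | "x < 0" "x + v >= 0" | "x < 0" "x + v < 0" by linarith
  then show ?thesis
  proof cases
   case 1 then show ?thesis by (simp add: max_def power2_eq_square algebra_simps)
  next
   case 2
   have "(max 0 (x + v))^2 - (max 0 x)\<^sup>2 - 2 * max 0 x * v = x * (- x - 2 * v)"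
    using 2 by (simp add: max_def power2_eq_square algebra_simps)
   moreover have "0 <= x * (- x - 2 * v)" using 2 by (intro mult_nonneg_nonneg) auto
   moreover have "v^2 - x * (- x - 2 * v) = (x + v)^2" by (simp add: power2_eq_square algebra_simps)
   ultimately show ?thesis using zero_le_power2[of "x + v"] unfolding real_norm_def power2_abs by linarith
  next
   case 3
   then have "(x + v)^2 <= v^2" by (intro power_mono) auto
   then show ?thesis using 3 by (simp add: max_def)
  next
   case 4 then show ?thesis by (simp add: max_def)
  qed
 qed
qed

lemma DERIV_max0_cube: "((%x :: real. (max 0 x)^3) has_real_derivative 3 * (max 0 x)^2) (at x)"
proof -
 have e: "(%x :: real. (max 0 x)^3) = (%x. x * (max 0 x)^2)"
  by (auto simp: fun_eq_iff max_def power3_eq_cube power2_eq_square)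
 have "((%x. x * (max 0 x)^2) has_real_derivative (1 * (max 0 x)^2 + (2 * max 0 x) * x)) (at x)"
  by (rule DERIV_mult[OF DERIV_ident DERIV_max0_sq])
 then show ?thesis unfolding e
  by (rule DERIV_cong) (auto simp: max_def power2_eq_square)
qed

text \<open>A twice continuously differentiable step from \<open>0\<close> (for \<open>t \<le> 1\<close>) to \<open>1\<close> (for \<open>t \<ge> 2\<close>), made of two one-sided cubes.\<close>

definition step :: "real => real" where
 "step t = 1 - (max 0 (1 - (max 0 (t - 1))^3))^3"

definition step1 :: "real => real" where
 "step1 t = 3 * (max 0 (1 - (max 0 (t - 1))^3))^2 * (3 * (max 0 (t - 1))^2)"

definition step2 :: "real => real" where
 "step2 t = - (6 * max 0 (1 - (max 0 (t - 1))^3)) * (3 * (max 0 (t - 1))^2)^2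
  + 3 * (max 0 (1 - (max 0 (t - 1))^3))^2 * (6 * max 0 (t - 1))"

lemma DERIV_step: "(step has_real_derivative step1 t) (at t)"
proof -
 have i: "((%t. t - 1) has_real_derivative 1) (at t)" by (auto intro!: derivative_eq_intros)
 have c: "((%t. (max 0 (t - 1))^3) has_real_derivative 3 * (max 0 (t - 1))^2) (at t)"
  using DERIV_chain2[OF DERIV_max0_cube i] by simp
 have "((%t. 1 - (max 0 (t - 1))^3) has_real_derivative - (3 * (max 0 (t - 1))^2)) (at t)"
  using DERIV_diff[OF DERIV_const c, of 1] by simp
 from DERIV_diff[OF DERIV_const DERIV_chain2[OF DERIV_max0_cube this], of 1]
 show ?thesis unfolding step_def[abs_def] step1_def by simp
qed

lemma DERIV_step1: "(step1 has_real_derivative step2 t) (at t)"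
proof -
 have i: "((%t. t - 1) has_real_derivative 1) (at t)" by (auto intro!: derivative_eq_intros)
 have c: "((%t. (max 0 (t - 1))^3) has_real_derivative 3 * (max 0 (t - 1))^2) (at t)"
  using DERIV_chain2[OF DERIV_max0_cube i] by simp
 have d: "((%t. 1 - (max 0 (t - 1))^3) has_real_derivative - (3 * (max 0 (t - 1))^2)) (at t)"
  using DERIV_diff[OF DERIV_const c, of 1] by simp
 have a: "((%t. 3 * (max 0 (1 - (max 0 (t - 1))^3))^2) has_real_derivative
   3 * (2 * max 0 (1 - (max 0 (t - 1))^3) * - (3 * (max 0 (t - 1))^2))) (at t)"
  by (rule DERIV_cmult[OF DERIV_chain2[OF DERIV_max0_sq d]])
 have b: "((%t. 3 * (max 0 (t - 1))^2) has_real_derivative 3 * (2 * max 0 (t - 1) * 1)) (at t)"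
  by (rule DERIV_cmult[OF DERIV_chain2[OF DERIV_max0_sq i]])
 show ?thesis
  unfolding step1_def[abs_def] step2_def
  by (rule DERIV_cong[OF DERIV_mult[OF a b]]) (simp add: power2_eq_square algebra_simps)
qed

lemma continuous_step2: "continuous_on A step2"
 unfolding step2_def[abs_def] by (intro continuous_intros)

lemma step_low: "t <= 1 ==> step t = 0" "t <= 1 ==> step1 t = 0" "t <= 1 ==> step2 t = 0"
 by (auto simp: step_def step1_def step2_def max_def)

lemma step_high: "t >= 2 ==> step t = 1" "t >= 2 ==> step1 t = 0" "t >= 2 ==> step2 t = 0"
proof -
 have "max 0 (1 - (max 0 (t - 1))^3) = 0" if "t >= 2"
 proof -
  have 1: "1 <= (t - 1)^3" using that by (intro one_le_power) simp
  have m: "max 0 (t - 1) = t - 1" using that by simp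
  show ?thesis unfolding m by (rule max_absorb1) (use 1 in linarith)
 qed
 then show "t >= 2 ==> step t = 1" "t >= 2 ==> step1 t = 0" "t >= 2 ==> step2 t = 0"
  by (auto simp: step_def step1_def step2_def)
qed

lemma step_bounds: "0 <= step t" "step t <= 1" "\<bar>step1 t\<bar> <= 9" "\<bar>step2 t\<bar> <= 72"
proof -
 define a where "a = max 0 (1 - (max 0 (t - 1))^3)"
 define b where "b = max 0 (t - 1)"
 have a: "0 <= a" "a <= 1" by (auto simp: a_def)
 have p: "x^n <= 1" if "0 <= x" "x <= 1" for x :: real and n using that by (rule power_le_one)
 show "0 <= step t" "step t <= 1" using a p[of a 3] by (auto simp: step_def a_def[symmetric])
 have "\<bar>step1 t\<bar> <= 9 \<and> \<bar>step2 t\<bar> <= 72"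
 proof (cases "t >= 2")
  case True then show ?thesis by (simp add: step_high)
 next
  case False
  then have b: "0 <= b" "b <= 1" by (auto simp: b_def)
  have a2: "0 <= a^2" "a^2 <= 1" and b2: "0 <= b^2" "b^2 <= 1" using a b p by auto
  have s1: "step1 t = 9 * (a^2 * b^2)" by (simp add: step1_def a_def b_def)
  have s2: "step2 t = - (54 * (a * (b^2)^2)) + 18 * (a^2 * b)"
   by (simp add: step2_def a_def b_def power_mult_distrib)
  have "a^2 * b^2 <= 1" "a * (b^2)^2 <= 1" "a^2 * b <= 1"
   using a b a2 b2 by (auto intro!: mult_le_one p)
  moreover have "0 <= a^2 * b^2" "0 <= a * (b^2)^2" "0 <= a^2 * b" using a b by auto
  ultimately show ?thesis unfolding s1 s2 by linarith
 qed
 then show "\<bar>step1 t\<bar> <= 9" "\<bar>step2 t\<bar> <= 72" by auto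
qed

text \<open>\<open>cut t = step t / t\<close> and its derivatives: the profile of a kernel truncated near the origin, as a
 function of the squared radius.\<close>

definition cut :: "real => real" where
 "cut t = (if t <= 1/2 then 0 else step t / t)"

definition cut1 :: "real => real" where
 "cut1 t = (if t <= 1/2 then 0 else (step1 t * t - step t) / t^2)"

definition cut2 :: "real => real" where
 "cut2 t = (if t <= 1/2 then 0 else (step2 t * t^2 - 2 * (step1 t * t - step t)) / t^3)"

lemma cut_low: "t <= 1 ==> cut t = 0" "t <= 1 ==> cut1 t = 0" "t <= 1 ==> cut2 t = 0"
 by (auto simp: cut_def cut1_def cut2_def step_low)

lemma DERIV_local:
 assumes hi: "!!t. t > 1/2 ==> (F has_real_derivative F1 t) (at t)"
  and eq: "!!t. t > 1/2 ==> f t = F t" and low: "!!t. t <= 1 ==> f t = 0" "!!t. t <= 1 ==> f1 t = 0"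
  and f1: "!!t. t > 1/2 ==> f1 t = F1 t"
 shows "(f has_real_derivative f1 t) (at t)"
proof (cases "t > 1/2")
 case True
 show ?thesis unfolding f1[OF True]
  by (rule has_field_derivative_transform_within_open[OF hi[OF True], of "{1/2<..}"]) (use True eq in auto)
next
 case False
 have "(f has_real_derivative 0) (at t)"
  by (rule has_field_derivative_transform_within_open[OF DERIV_const, of "{..<1}" t 0]) (use False low in auto)
 then show ?thesis using low(2)[of t] False by simp
qed

lemma DERIV_cut: "(cut has_real_derivative cut1 t) (at t)"
proof (rule DERIV_local[where F = "%t. step t / t" and ?F1.0 = "%t. (step1 t * t - step t) / t^2"])
 fix t :: real assume "t > 1/2"
 then show "((%t. step t / t) has_real_derivative (step1 t * t - step t) / t^2) (at t)"
  using DERIV_divide[OF DERIV_step DERIV_ident, of t] by (simp add: power2_eq_square)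
qed (auto simp: cut_def cut1_def step_low)

lemma DERIV_cut1: "(cut1 has_real_derivative cut2 t) (at t)"
proof (rule DERIV_local[where F = "%t. (step1 t * t - step t) / t^2" and ?F1.0 = "%t. (step2 t * t^2 - 2 * (step1 t * t - step t)) / t^3"])
 fix t :: real assume t: "t > 1/2"
 have n: "((%t. step1 t * t - step t) has_real_derivative (step2 t * t + 1 * step1 t - step1 t)) (at t)"
  by (rule DERIV_diff[OF DERIV_mult[OF DERIV_step1 DERIV_ident] DERIV_step])
 have d: "((%t. t^2) has_real_derivative 2 * t) (at t)" by (auto intro!: derivative_eq_intros)
 show "((%t. (step1 t * t - step t) / t^2) has_real_derivative (step2 t * t^2 - 2 * (step1 t * t - step t)) / t^3) (at t)"
  by (rule DERIV_cong[OF DERIV_divide[OF n d]])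
   (use t in \<open>auto simp: field_simps power2_eq_square power3_eq_cube\<close>)
qed (auto simp: cut1_def cut2_def step_low)

lemma continuous_cut2: "continuous_on UNIV cut2"
proof (rule continuous_at_imp_continuous_on, rule ballI)
 fix t :: real
 show "isCont cut2 t"
 proof (cases "t > 1/2")
  case True
  have c: "continuous_on {1/2<..} (%t. (step2 t * t^2 - 2 * (step1 t * t - step t)) / t^3)"
   by (intro continuous_intros continuous_step2 DERIV_continuous_on[OF has_field_derivative_at_within[OF DERIV_step1]]
     DERIV_continuous_on[OF has_field_derivative_at_within[OF DERIV_step]]) auto
  have "continuous_on {1/2<..} cut2"
   by (rule continuous_on_cong[THEN iffD1, OF refl _ c]) (auto simp: cut2_def)
  then show ?thesis using True by (simp add: continuous_on_eq_continuous_at)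
 next
  case False
  have "continuous_on {..<1} cut2"
   by (rule continuous_on_cong[THEN iffD1, OF refl _ continuous_on_const[of _ 0]]) (auto simp: cut_low)
  then show ?thesis using False by (simp add: continuous_on_eq_continuous_at)
 qed
qed

lemma cut_bounds:
 assumes t: "t > 0"
 shows "\<bar>cut t\<bar> <= 400 / t" "\<bar>cut1 t\<bar> <= 400 / t^2" "\<bar>cut2 t\<bar> <= 400 / t^3"
proof -
 have s: "\<bar>step1 t * t\<bar> <= 18" "\<bar>step2 t * t\<^sup>2\<bar> <= 288"
 proof -
  have "\<bar>step1 t * t\<bar> <= 9 * 2 \<and> \<bar>step2 t * t\<^sup>2\<bar> <= 72 * 2^2"
  proof (cases "t >= 2")
   case True then show ?thesis by (simp add: step_high)
  next
   case False
   have 1: "\<bar>step1 t * t\<bar> <= 9 * 2" unfolding abs_mult by (intro mult_mono step_bounds) (use t False in auto)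
   have "t^2 <= 2^2" using t False by (intro power_mono) auto
   then have "\<bar>step2 t * t\<^sup>2\<bar> <= 72 * 2^2" unfolding abs_mult by (intro mult_mono step_bounds) auto
   with 1 show ?thesis by blast
  qed
  then show "\<bar>step1 t * t\<bar> <= 18" "\<bar>step2 t * t\<^sup>2\<bar> <= 288" by auto
 qed
 show "\<bar>cut t\<bar> <= 400 / t" using step_bounds[of t] t by (auto simp: cut_def divide_right_mono)
 have "\<bar>step1 t * t - step t\<bar> <= 400" using s step_bounds(1,2)[of t] by linarith
 then show "\<bar>cut1 t\<bar> <= 400 / t^2" using t by (auto simp: cut1_def divide_right_mono)
 have "\<bar>u - 2 * (v - z)\<bar> <= 400" if "\<bar>u\<bar> <= 288" "\<bar>v\<bar> <= 18" "0 <= z" "z <= 1" for u v z :: real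
  using that by (auto simp: abs_le_iff)
 from this[OF s(2,1) step_bounds(1,2)]
 have "\<bar>step2 t * t^2 - 2 * (step1 t * t - step t)\<bar> <= 400" .
 then show "\<bar>cut2 t\<bar> <= 400 / t^3" using t by (auto simp: cut2_def divide_right_mono)
qed

subsection \<open>Derivatives of radial multiples of the coordinates\<close>

lemma has_grad_mult:
 assumes a: "has_grad a A" and b: "has_grad b B"
 shows "has_grad (%x. a x * b x) (%i x. A i x * b x + a x * B i x)"
 unfolding has_grad_def
proof
 fix x
 show "((%x. a x * b x) has_derivative (%v. \<Sum>i\<in>UNIV. v $ i * (A i x * b x + a x * B i x))) (at x)"
  by (rule has_derivative_eq_rhs[OF has_derivative_mult[OF has_gradD[OF a] has_gradD[OF b]]])
   (auto simp: sum_distrib_left sum_distrib_right distrib_left sum.distrib[symmetric] mult_ac intro!: sum.cong)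
qed

lemma has_grad_coord: "has_grad (%x. x $ k) (%i x. if i = k then 1 else 0)"
proof -
 have "((%x :: plane. x $ k) has_derivative (%v. v $ k)) (at x)" for x
  by (rule bounded_linear_imp_has_derivative[OF bounded_linear_vec_nth])
 then show ?thesis by (simp add: has_grad_def if_distrib cong: if_cong)
qed

lemma has_grad_radial:
 assumes q: "!!s. (q has_real_derivative q1 s) (at s)"
 shows "has_grad (%x. q (inner x x)) (%i x. 2 * x $ i * q1 (inner x x))"
 unfolding has_grad_def
proof
 fix x :: plane
 have i: "((%x :: plane. inner x x) has_derivative (%v. 2 * inner x v)) (at x)"
  by (auto intro!: derivative_eq_intros simp: inner_commute)
 have "((%x. q (inner x x)) has_derivative (%v. q1 (inner x x) * (2 * inner x v))) (at x)"
  using has_derivative_compose[OF i q[of "inner x x", unfolded has_field_derivative_def]] .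
 then show "((%x. q (inner x x)) has_derivative (%v. \<Sum>i\<in>UNIV. v $ i * (2 * x $ i * q1 (inner x x)))) (at x)"
  by (rule has_derivative_eq_rhs) (auto simp: inner_vec_def sum_distrib_left mult_ac)
qed

text \<open>If \<open>q\<close> and its derivatives decay like those of \<open>1 / s\<close>, then \<open>x\<^sub>k q(\<bar>x\<bar>\<^sup>2)\<close> is of order \<open>1 / \<bar>x\<bar>\<close>, and each
 derivative gains a factor \<open>1 / \<bar>x\<bar>\<close>.\<close>

lemma radial_C2:
 fixes q q1 q2 :: "real => real"
 assumes q: "!!s. (q has_real_derivative q1 s) (at s)" "!!s. (q1 has_real_derivative q2 s) (at s)"
  and c: "continuous_on UNIV q2" and L: "1 <= L" and C: "0 <= C"
  and low: "!!s. s <= L^2 ==> q s = 0 \<and> q1 s = 0 \<and> q2 s = 0"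
  and high: "!!s. s >= r^2 ==> q s = 0" and r: "0 <= r"
  and b: "!!s. s > 0 ==> \<bar>q s\<bar> <= C / s \<and> \<bar>q1 s\<bar> <= C / s^2 \<and> \<bar>q2 s\<bar> <= C / s^3"
 shows "C2_0 (%x. x $ k * q (inner x x))"
  and "\<bar>pd i (%x. x $ k * q (inner x x)) x\<bar> <= 10 * C * wt x"
  and "\<bar>pd l (pd i (%x. x $ k * q (inner x x))) x\<bar> <= 10 * C * wt x"
  and "norm x < L ==> pd i (%x. x $ k * q (inner x x)) x = 0"
  and "norm x < L ==> pd l (pd i (%x. x $ k * q (inner x x))) x = 0"
proof -
 let ?d = "%i k :: 2. if i = k then 1 else (0 :: real)"
 let ?G = "%i x. ?d i k * q (inner x x) + x $ k * (2 * x $ i * q1 (inner x x))"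
 let ?H = "%i l x. ?d i k * (2 * x $ l * q1 (inner x x)) +
  (?d l k * (2 * x $ i * q1 (inner x x)) + x $ k * (2 * ?d l i * q1 (inner x x) + 2 * x $ i * (2 * x $ l * q2 (inner x x))))"
 have g: "has_grad (%x. x $ k * q (inner x x)) ?G"
  by (rule has_grad_mult[OF has_grad_coord has_grad_radial[OF q(1)]])
 have h: "has_grad (?G i) (?H i)" for i
  by (intro has_grad_add has_grad_cmult has_grad_radial q has_grad_mult[OF has_grad_coord]
    has_grad_mult[OF has_grad_cmult[OF has_grad_coord]])
 have cq: "continuous_on UNIV q1" by (rule DERIV_continuous_on[OF has_field_derivative_at_within[OF q(2)]])
 have cx: "continuous_on UNIV (%x :: plane. q1 (inner x x))" "continuous_on UNIV (%x :: plane. q2 (inner x x))"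
  by (rule continuous_on_compose2[OF cq] continuous_on_compose2[OF c]; auto intro!: continuous_intros)+
 have ch: "continuous_on UNIV (?H i l)" for i l by (intro continuous_intros cx)
 have z: "x $ k * q (inner x x) = 0" if "norm x > r" for x :: plane
 proof -
  have "r^2 <= inner x x" unfolding power2_norm_eq_inner[symmetric] using that r by (intro power_mono) auto
  then show ?thesis using high by simp
 qed
 show "C2_0 (%x. x $ k * q (inner x x))" by (rule C2_0I(1)[OF g h ch z])
 have P1: "pd i (%x. x $ k * q (inner x x)) = ?G i" for i by (rule C2_0I(2)[OF g h ch z])
 have P2: "pd l (pd i (%x. x $ k * q (inner x x))) = ?H i l" for i l by (rule C2_0I(3)[OF g h ch z])
 have inn: "inner x x = (norm x)^2" for x :: plane by (simp add: power2_norm_eq_inner)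
 have w0: "0 <= wt x" for x by (simp add: wt_def)
 have low': "?G i x = 0" "?H i l x = 0" if "norm x <= L" for i l x
 proof -
  have "inner x x <= L^2" unfolding inn using that by (intro power_mono) auto
  then show "?G i x = 0" "?H i l x = 0" using low by simp_all
 qed
 show "norm x < L ==> pd i (%x. x $ k * q (inner x x)) x = 0" unfolding P1 by (rule low'(1)) simp
 show "norm x < L ==> pd l (pd i (%x. x $ k * q (inner x x))) x = 0" unfolding P2 by (rule low'(2)) simp
 have key: "\<bar>?G i x\<bar> <= 10 * C * wt x \<and> \<bar>?H i l x\<bar> <= 10 * C * wt x" for i l x
 proof (cases "norm x <= L")
  case True
  have "0 <= 10 * C * wt x" using w0 C by simp
  then show ?thesis unfolding low'[OF True] by simp
 next
  case False
  define n where "n = norm x"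
  have n: "1 <= n" "0 < n" using False L by (auto simp: n_def)
  have "1 <= n^2" using n by (intro one_le_power)
  then have wt: "wt x = 1 / n^2" unfolding wt_def n_def[symmetric]
   by (intro min_absorb2) (use n in \<open>simp add: divide_le_eq_1\<close>)
  have xk: "\<bar>x $ k\<bar> <= n" for k unfolding n_def by (rule component_le_norm_cart)
  have i: "inner x x = n^2" by (simp add: inn n_def)
  have B: "\<bar>q (n^2)\<bar> <= C / n^2" "\<bar>q1 (n^2)\<bar> <= C / (n^2)^2" "\<bar>q2 (n^2)\<bar> <= C / (n^2)^3"
   using b[of "n^2"] n by auto
  have d1: "\<bar>?d a c * t\<bar> <= \<bar>t\<bar>" for a c t by simp
  have x2: "\<bar>x $ k * (2 * x $ i * q1 (n^2))\<bar> <= 2 * (C / n^2)" for k i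
  proof -
   have "\<bar>x $ k * (2 * x $ i * q1 (n^2))\<bar> <= n * (2 * n * (C / (n^2)^2))"
    unfolding abs_mult using n C by (intro mult_mono xk B) auto
   also have "... = 2 * (C / n^2)" using n by (simp add: field_simps power2_eq_square)
   finally show ?thesis .
  qed
  have G: "\<bar>?G i x\<bar> <= 3 * (C / n^2)"
   unfolding i using d1[of i k "q (n^2)"] B(1) x2[of k i] by linarith
  have x1: "\<bar>2 * x $ l * q1 (n^2)\<bar> <= 2 * (C / n^3)" for l
  proof -
   have "\<bar>2 * x $ l * q1 (n^2)\<bar> <= 2 * n * (C / (n^2)^2)"
    unfolding abs_mult using n C by (intro mult_mono xk B) auto
   also have "... = 2 * (C / n^3)" using n by (simp add: field_simps power2_eq_square power3_eq_cube)
   finally show ?thesis .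
  qed
  have x1': "\<bar>x $ k * (2 * ?d l i * q1 (n^2))\<bar> <= 2 * (C / n^3)"
  proof -
   have "x $ k * (2 * ?d l i * q1 (n^2)) = ?d l i * (2 * x $ k * q1 (n^2))" by simp
   then show ?thesis using d1[of l i "2 * x $ k * q1 (n^2)"] x1[of k] by linarith
  qed
  have x3: "\<bar>x $ k * (2 * x $ i * (2 * x $ l * q2 (n^2)))\<bar> <= 4 * (C / n^3)"
  proof -
   have "\<bar>x $ k * (2 * x $ i * (2 * x $ l * q2 (n^2)))\<bar> <= n * (2 * n * (2 * n * (C / (n^2)^3)))"
    unfolding abs_mult using n C by (intro mult_mono xk B) auto
   also have "... = 4 * (C / n^3)" using n by (simp add: field_simps power2_eq_square power3_eq_cube)
   finally show ?thesis .
  qed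
  have "\<bar>?H i l x\<bar> <= 10 * (C / n^3)"
   unfolding i distrib_left[of "x $ k"]
   using d1[of i k "2 * x $ l * q1 (n^2)"] d1[of l k "2 * x $ i * q1 (n^2)"] x1[of l] x1[of i] x1' x3 by linarith
  also have "... <= 10 * (C / n^2)"
  proof -
   have "n^2 <= n^3" using n by (intro power_increasing) auto
   then show ?thesis using n C by (intro mult_left_mono divide_left_mono) auto
  qed
  finally have H: "\<bar>?H i l x\<bar> <= 10 * C * wt x" by (simp add: wt)
  have "3 * (C / n^2) <= 10 * C * wt x" using C n by (simp add: wt divide_right_mono)
  with G H show ?thesis by linarith
 qed
 show "\<bar>pd i (%x. x $ k * q (inner x x)) x\<bar> <= 10 * C * wt x" unfolding P1 using key by blast
 show "\<bar>pd l (pd i (%x. x $ k * q (inner x x))) x\<bar> <= 10 * C * wt x" unfolding P2 using key by blast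
qed

subsection \<open>The truncated far field\<close>

text \<open>The pairing of \<open>vcut R\<close> with the vorticity is the far field, cut off smoothly at the radius \<open>R\<close>. The
 differences \<open>annulus L R\<close> avoid the discontinuity of the truncated kernel at the unit circle, and
 are admissible test functions.\<close>

definition vcut :: "real => 2 => plane => real" where
 "vcut R i y = Khat (- y) $ i * (1 - step (inner y y / R^2))"

definition annulus :: "real => real => 2 => plane => real" where
 "annulus L R i y = vcut R i y - vcut L i y"

lemma measurable_step [measurable]: "step \<in> Borel"
 by (intro borel_measurable_continuous_onI DERIV_continuous_on[OF has_field_derivative_at_within[OF DERIV_step]])

lemma measurable_vcut [measurable]: "vcut R i \<in> Borel"
 unfolding vcut_def[abs_def] by measurable

lemma step_scaled:
 assumes R: "0 < R"
 shows "norm y <= R ==> step (inner y y / R^2) = 0" "norm y >= 2 * R ==> step (inner y y / R^2) = 1"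
proof -
 have e: "inner y y / R^2 = (norm y / R)^2" by (simp add: power_divide power2_norm_eq_inner)
 show "step (inner y y / R^2) = 0" if "norm y <= R"
  unfolding e using that R power_le_one[of "norm y / R" 2] by (intro step_low) auto
 show "step (inner y y / R^2) = 1" if "norm y >= 2 * R"
 proof -
  have "2 <= norm y / R" using that R by (simp add: field_simps)
  then have "2^2 <= (norm y / R)^2" by (intro power_mono) auto
  then show ?thesis unfolding e by (intro step_high) simp
 qed
qed

lemma Khat_bound: "\<bar>Khat (- y) $ i\<bar> <= 1" "0 < r ==> norm y >= r ==> \<bar>Khat (- y) $ i\<bar> <= 1 / r"
 using norm_K_le[of 1 "- y"] norm_K_le[of r "- y"] K_nth_le[of "- y" i] by (auto simp: Khat_def)

lemma vcut_sq_integrable: "0 < R ==> sq_integrable (vcut R i)"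
proof (rule sq_integrable_bounded_support[of _ 1 "2 * R"])
 show "\<bar>vcut R i y\<bar> <= 1" for y
  unfolding vcut_def abs_mult using step_bounds(1,2)[of "inner y y / R^2"] Khat_bound(1)[of y i]
  by (intro mult_le_one) auto
 show "vcut R i y = 0" if "0 < R" "2 * R < norm y" for y using step_scaled(2)[of R y] that by (simp add: vcut_def)
qed auto

definition vvec :: "nat => 2 => l2" where
 "vvec n i = abs_l2 (vcut (real n) i)"

text \<open>All truncations of the far field converge or diverge together.\<close>

lemma far_field_vcut:
 "((%R. far_field R W $ i - inner W (abs_l2 (vcut R i))) \<longlongrightarrow> 0) at_top"
proof -
 define h where "h R y = (if norm y <= R then Khat (- y) $ i else 0) - vcut R i y" for R and y :: plane
 have hm: "h R \<in> Borel" for R unfolding h_def[abs_def] by measurable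
 have hz: "h R y = 0" if "norm y <= R \<or> norm y >= 2 * R" "0 < R" for R y
  using that step_scaled[of R y] by (auto simp: h_def vcut_def)
 have hb: "\<bar>h R y\<bar> <= 1 / R" if "1 <= R" for R y
 proof (cases "norm y <= R")
  case True then show ?thesis using hz[of y R] that by simp
 next
  case False
  then have "\<bar>h R y\<bar> = \<bar>Khat (- y) $ i\<bar> * \<bar>1 - step (inner y y / R^2)\<bar>"
   by (simp add: h_def vcut_def abs_mult)
  also have "... <= (1 / R) * 1"
   using step_bounds(1,2)[of "inner y y / R^2"] False that by (intro mult_mono Khat_bound(2)) auto
  finally show ?thesis by simp
 qed
 have "((%R. LINT y|lborel. rep_l2 W y * h R y) \<longlongrightarrow> 0) at_top"
  by (rule annulus_pairing_tendsto[OF hm zero_less_one hb]) (use hz in \<open>auto intro!: hz\<close>)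
 moreover have "\<forall>\<^sub>F R in at_top. (LINT y|lborel. rep_l2 W y * h R y) = far_field R W $ i - inner W (abs_l2 (vcut R i))"
  using eventually_ge_at_top[of 1]
 proof eventually_elim
  case (elim R)
  have s: "sq_integrable (%y. if norm y <= R then Khat (- y) $ i else 0)"
   by (rule sq_integrable_bounded_support[of _ 1 R]) (auto simp: Khat_bound(1))
  note v = vcut_sq_integrable[of R i]
  show ?case
   unfolding far_field_nth h_def right_diff_distrib
   using elim v integrable_rep_mult[OF s] integrable_rep_mult[OF v] pairing_eq_inner[OF v, of W] by (simp add: pairing_def)
 qed
 ultimately show ?thesis by (simp add: tendsto_cong)
qed

text \<open>Integer radii suffice, which makes the convergence of the far field a Borel condition.\<close>

lemma vcut_floor:
 "((%R. inner W (abs_l2 (vcut R i)) - inner W (vvec (nat \<lfloor>R\<rfloor>) i)) \<longlongrightarrow> 0) at_top"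
proof -
 define f where "f R = real (nat \<lfloor>R\<rfloor>)" for R :: real
 have f: "f R <= R" "R / 2 <= f R" "1 <= f R" if "2 <= R" for R
  using that unfolding f_def by linarith+
 define h where "h R y = vcut R i y - vcut (f R) i y" for R and y :: plane
 have hm: "h R \<in> Borel" for R unfolding h_def[abs_def] by measurable
 have hz: "h R y = 0" if "norm y <= R / 2 \<or> norm y >= 2 * R" "2 <= R" for R y
 proof -
  have "norm y <= f R \<and> norm y <= R \<or> norm y >= 2 * f R \<and> norm y >= 2 * R" using that f[OF that(2)] by auto
  then show ?thesis using step_scaled[of R y] step_scaled[of "f R" y] that f[OF that(2)] by (auto simp: h_def vcut_def)
 qed
 have hb: "\<bar>h R y\<bar> <= 2 / R" if R: "2 <= R" for R y
 proof (cases "norm y <= R / 2")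
  case True then show ?thesis using hz[of y R] that by simp
 next
  case False
  have "h R y = Khat (- y) $ i * (step (inner y y / (f R)^2) - step (inner y y / R^2))"
   by (simp add: h_def vcut_def algebra_simps)
  also have "\<bar>...\<bar> <= (1 / (R / 2)) * 1"
   unfolding abs_mult
   using step_bounds(1,2)[of "inner y y / R^2"] step_bounds(1,2)[of "inner y y / (f R)^2"] False R
   by (intro mult_mono Khat_bound(2)) auto
  finally show ?thesis by simp
 qed
 have "((%R. LINT y|lborel. rep_l2 W y * h R y) \<longlongrightarrow> 0) at_top"
  by (rule annulus_pairing_tendsto[OF hm zero_less_numeral hb]) (use hz in auto)
 moreover have "\<forall>\<^sub>F R in at_top. (LINT y|lborel. rep_l2 W y * h R y) = inner W (abs_l2 (vcut R i)) - inner W (vvec (nat \<lfloor>R\<rfloor>) i)"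
  using eventually_ge_at_top[of 2]
 proof eventually_elim
  case (elim R)
  note v = vcut_sq_integrable[of R i] and v' = vcut_sq_integrable[of "f R" i]
  show ?case
   unfolding h_def right_diff_distrib vvec_def f_def[symmetric]
   using elim v v' f[OF elim] integrable_rep_mult[OF v] integrable_rep_mult[OF v'] pairing_eq_inner[OF v, of W]
    pairing_eq_inner[OF v', of W] by (simp add: pairing_def)
 qed
 ultimately show ?thesis by (simp add: tendsto_cong)
qed

lemma far_conv_drift_iff:
 "far_conv W \<and> drift W = l \<longleftrightarrow> (\<forall>i. (%n. inner W (vvec n i)) ----> l $ i)"
proof
 assume a: "far_conv W \<and> drift W = l"
 show "\<forall>i. (%n. inner W (vvec n i)) ----> l $ i"
 proof
  fix i
  have "((%R. far_field R W $ i) \<longlongrightarrow> l $ i) at_top"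
   using tendsto_vec_nth[OF far_field_tendsto_drift[of W], of i] a by simp
  from tendsto_diff[OF this far_field_vcut[of W i]]
  have "((%R. inner W (abs_l2 (vcut R i))) \<longlongrightarrow> l $ i) at_top" by simp
  from filterlim_compose[OF this filterlim_real_sequentially]
  show "(%n. inner W (vvec n i)) ----> l $ i" by (simp add: vvec_def)
 qed
next
 assume a: "\<forall>i. (%n. inner W (vvec n i)) ----> l $ i"
 have fl: "filterlim (%R :: real. nat \<lfloor>R\<rfloor>) sequentially at_top"
  unfolding filterlim_at_top
 proof
  fix Z :: nat show "\<forall>\<^sub>F R :: real in at_top. Z <= nat \<lfloor>R\<rfloor>"
   using eventually_ge_at_top[of "real Z"] by eventually_elim (simp add: le_nat_iff le_floor_iff)
 qed
 have "((%R. far_field R W) \<longlongrightarrow> l) at_top"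
 proof (rule vec_tendstoI)
  fix i
  have "((%R :: real. inner W (vvec (nat \<lfloor>R\<rfloor>) i)) \<longlongrightarrow> l $ i) at_top"
   by (rule filterlim_compose[OF spec[OF a, of i] fl])
  from tendsto_add[OF tendsto_add[OF far_field_vcut[of W i] vcut_floor[of W i]] this]
  show "((%R. far_field R W $ i) \<longlongrightarrow> l $ i) at_top" by simp
 qed
 then show "far_conv W \<and> drift W = l"
  using far_field_tendsto_drift[of W] tendsto_unique[OF trivial_limit_at_top_linorder] by (auto simp: far_conv_def)
qed

lemma far_conv_iff: "far_conv W \<longleftrightarrow> (\<forall>i. convergent (%n. inner W (vvec n i)))"
proof
 assume "far_conv W" then show "\<forall>i. convergent (%n. inner W (vvec n i))"
  using far_conv_drift_iff[of W "drift W"] by (auto simp: convergent_def)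
next
 assume "\<forall>i. convergent (%n. inner W (vvec n i))"
 then have "\<forall>i. (%n. inner W (vvec n i)) ----> (\<chi> i. lim (%n. inner W (vvec n i))) $ i"
  by (simp add: convergent_LIMSEQ_iff)
 then show "far_conv W" using far_conv_drift_iff by blast
qed

lemma drift_lim: "far_conv W ==> (%n. inner W (vvec n i)) ----> drift W $ i"
 using far_conv_drift_iff[of W "drift W"] by simp

lemma measurable_far_conv [measurable]: "Measurable.pred borel far_conv"
proof -
 have eq: "far_conv = (%W. \<forall>i. Cauchy (%n. inner W (vvec n i)))"
  by (simp add: far_conv_iff fun_eq_iff Cauchy_convergent_iff)
 have "Measurable.pred borel (%W. Cauchy (%n. inner W (vvec n i)))" for i
  unfolding pred_def by (rule sets_Collect_Cauchy) measurable
 then show ?thesis unfolding eq by measurable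
qed

lemma measurable_drift [measurable]: "(%W. drift W $ i) \<in> Borel"
proof -
 have "(%W. drift W $ i) = (%W. if far_conv W then lim (%n. inner W (vvec n i)) else 0)"
  using drift_lim[THEN limI] by (auto simp: fun_eq_iff drift_def)
 then show ?thesis by simp
qed

subsection \<open>Annular test functions\<close>

lemma annulus_eq:
 assumes L: "1 <= L" "L <= R"
 defines "q \<equiv> %s. (1 / (2 * pi)) * (cut (s / L^2) / L^2 - cut (s / R^2) / R^2)"
 shows "annulus L R 1 y = y $ 2 * q (inner y y)" "annulus L R 2 y = - (y $ 1 * q (inner y y))"
proof -
 have A: "annulus L R i y = K (- y) $ i * (step (inner y y / L^2) - step (inner y y / R^2))" for i
 proof (cases "norm y > 1")
  case True then show ?thesis by (simp add: annulus_def vcut_def Khat_def algebra_simps)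
 next
  case False
  then have "step (inner y y / L^2) = 0" "step (inner y y / R^2) = 0" using L by (auto intro!: step_scaled(1))
  then show ?thesis using False by (simp add: annulus_def vcut_def Khat_def)
 qed
 have B: "(step (inner y y / L^2) - step (inner y y / R^2)) / (2 * pi * (norm y)^2) = q (inner y y)"
 proof (cases "y = 0")
  case True then show ?thesis by (simp add: q_def step_low cut_low)
 next
  case False
  have c: "cut (inner y y / r^2) / r^2 = step (inner y y / r^2) / (norm y)^2" if "1 <= r" for r
  proof (cases "inner y y / r^2 <= 1/2")
   case True
   have "step (inner y y / r^2) = 0" by (rule step_low(1)) (use True in linarith)
   then show ?thesis using True by (simp add: cut_def)
  next
   case h: False
   have "r ~= 0" using that by simp
   then show ?thesis using h False by (simp add: cut_def power2_norm_eq_inner)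
  qed
  have p: "(a - b) / (u * v) = 1 / u * (a / v - b / v)" for a b u v :: real
   by (simp add: diff_divide_distrib mult.commute)
  show ?thesis unfolding q_def c[OF L(1)] c[OF order_trans[OF L]] by (rule p)
 qed
 show "annulus L R 1 y = y $ 2 * q (inner y y)" "annulus L R 2 y = - (y $ 1 * q (inner y y))"
  unfolding A B[symmetric] K_nth by simp_all
qed

text \<open>The constant is far from optimal; what matters is that it depends neither on \<open>L\<close> nor on \<open>R\<close>.\<close>

lemma annulus_C2:
 assumes L: "1 <= L" "L <= R"
 shows "C2_0 (annulus L R a)"
  and "\<bar>pd i (annulus L R a) x\<bar> <= 10000 * wt x"
  and "\<bar>pd l (pd i (annulus L R a)) x\<bar> <= 10000 * wt x"
  and "norm x < L ==> pd i (annulus L R a) x = 0"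
  and "norm x < L ==> pd l (pd i (annulus L R a)) x = 0"
proof -
 define c where "c = 1 / (2 * pi)"
 have c: "0 <= c" "c <= 1" using pi_ge_two by (auto simp: c_def divide_simps)
 define q where "q s = c * (cut (s / L^2) / L^2 - cut (s / R^2) / R^2)" for s
 define q1 where "q1 s = c * (cut1 (s / L^2) / L^4 - cut1 (s / R^2) / R^4)" for s
 define q2 where "q2 s = c * (cut2 (s / L^2) / L^6 - cut2 (s / R^2) / R^6)" for s
 have R: "1 <= R" using L by simp
 have sc: "((%s. f (s / r^2) / r^k) has_real_derivative f1 (s / r^2) / r^(k + 2)) (at s)"
  if f: "!!t. (f has_real_derivative f1 t) (at t)" and r: "1 <= r" for f f1 :: "real => real" and r s :: real and k :: nat
 proof -
  have "((%s. s / r^2) has_real_derivative 1 / r^2) (at s)" by (rule DERIV_cdivide[OF DERIV_ident])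
  from DERIV_cdivide[OF DERIV_chain2[OF f this], of "r^k"]
  have "((%s. f (s / r^2) / r^k) has_real_derivative f1 (s / r^2) * (1 / r^2) / r^k) (at s)" .
  moreover have "r ~= 0" using r by simp
  ultimately show ?thesis by (elim DERIV_cong) (simp add: power_add power2_eq_square field_simps)
 qed
 have dq: "(q has_real_derivative q1 s) (at s)" for s
  unfolding q_def[abs_def] q1_def
  using DERIV_cmult[OF DERIV_diff[OF sc[OF DERIV_cut L(1), of 2] sc[OF DERIV_cut R, of 2]], of c s] by simp
 have dq1: "(q1 has_real_derivative q2 s) (at s)" for s
  unfolding q1_def[abs_def] q2_def
  using DERIV_cmult[OF DERIV_diff[OF sc[OF DERIV_cut1 L(1), of 4] sc[OF DERIV_cut1 R, of 4]], of c s] by simp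
 have cq: "continuous_on UNIV q2"
  unfolding q2_def by (intro continuous_intros continuous_on_compose2[OF continuous_cut2]) (use L R in auto)
 have low: "q s = 0 \<and> q1 s = 0 \<and> q2 s = 0" if "s <= L^2" for s
 proof -
  have "L^2 <= R^2" using L by (intro power_mono) auto
  then have "s / L^2 <= 1" "s / R^2 <= 1" using that order_trans[OF that, of "R^2"] L R by (auto simp: divide_simps)
  then show ?thesis by (simp add: q_def q1_def q2_def cut_low)
 qed
 have high: "q s = 0" if "s >= (2 * R)^2" for s
 proof -
  have "L^2 <= R^2" using L by (intro power_mono) auto
  moreover have "4 * R^2 <= s" using that by (simp add: power_mult_distrib)
  ultimately have "2 * L^2 <= s" "2 * R^2 <= s" using zero_le_power2[of R] by linarith+
  then have g: "s / L^2 >= 2" "s / R^2 >= 2" using L R by (auto simp: pos_le_divide_eq)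
  have ct: "cut t = 1 / t" if "2 <= t" for t using that by (simp add: cut_def step_high)
  have "cut (s / L^2) = 1 / (s / L^2)" "cut (s / R^2) = 1 / (s / R^2)" by (rule ct, rule g)+
  then show ?thesis using L R by (simp add: q_def)
 qed
 have b: "\<bar>q s\<bar> <= 800 / s \<and> \<bar>q1 s\<bar> <= 800 / s^2 \<and> \<bar>q2 s\<bar> <= 800 / s^3" if s: "s > 0" for s
 proof -
  have B: "\<bar>cut (s / r^2) / r\<^sup>2\<bar> <= 400 / s \<and> \<bar>cut1 (s / r^2) / r^4\<bar> <= 400 / s^2 \<and> \<bar>cut2 (s / r^2) / r^6\<bar> <= 400 / s^3"
   if r: "1 <= r" for r
  proof -
   have t: "s / r^2 > 0" using s r by simp
   have "\<bar>cut (s / r^2)\<bar> / r^2 <= (400 / (s / r^2)) / r^2" "\<bar>cut1 (s / r^2)\<bar> / r^4 <= (400 / (s / r^2)^2) / r^4"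
    "\<bar>cut2 (s / r^2)\<bar> / r^6 <= (400 / (s / r^2)^3) / r^6"
    by (rule divide_right_mono[OF cut_bounds(1)[OF t]] divide_right_mono[OF cut_bounds(2)[OF t]]
      divide_right_mono[OF cut_bounds(3)[OF t]]; simp)+
   moreover have "(400 / (s / r^2)) / r^2 = 400 / s" "(400 / (s / r^2)^2) / r^4 = 400 / s^2" "(400 / (s / r^2)^3) / r^6 = 400 / s^3"
   proof -
    have "r ~= 0" using r by simp
    moreover have "(s / r^2)^2 = s^2 / r^4" "(s / r^2)^3 = s^3 / r^6" by (simp_all add: power_divide flip: power_mult)
    ultimately show "(400 / (s / r^2)) / r^2 = 400 / s" "(400 / (s / r^2)^2) / r^4 = 400 / s^2" "(400 / (s / r^2)^3) / r^6 = 400 / s^3"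
     by simp_all
   qed
   ultimately show ?thesis using r by (simp add: abs_divide)
  qed
  have c': "\<bar>c * (u - v)\<bar> <= 2 * M" if "\<bar>u\<bar> <= M" "\<bar>v\<bar> <= M" for u v M
  proof -
   have "\<bar>c * (u - v)\<bar> <= 1 * (2 * M)" unfolding abs_mult by (intro mult_mono) (use c that in auto)
   then show ?thesis by simp
  qed
  have "\<bar>q s\<bar> <= 2 * (400 / s)" "\<bar>q1 s\<bar> <= 2 * (400 / s^2)" "\<bar>q2 s\<bar> <= 2 * (400 / s^3)"
   unfolding q_def q1_def q2_def using B[OF L(1)] B[OF R] by (blast intro!: c')+
  then show ?thesis by simp
 qed
 have pos: "0 <= 2 * R" using R by simp
 have C8: "(0 :: real) <= 800" by simp
 note Q = radial_C2[OF dq dq1 cq L(1) C8 low high pos b]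
 have w0: "0 <= wt x" by (simp add: wt_def)
 have neg: "C2_0 (%x. - p x) \<and> pd i (%x. - p x) = (%x. - pd i p x) \<and> pd l (pd i (%x. - p x)) = (%x. - pd l (pd i p) x)"
  if "C2_0 p" for p i l
  using C2_0_lincomb[where m = 1 and w = "%_. p" and a = "%_. -1"] that by simp
 have e1: "annulus L R 1 = (%y. y $ 2 * q (inner y y))" and e2: "annulus L R 2 = (%y. - (y $ 1 * q (inner y y)))"
  using annulus_eq[OF L] by (simp_all add: fun_eq_iff q_def c_def)
 have "C2_0 (annulus L R a) \<and> \<bar>pd i (annulus L R a) x\<bar> <= 10000 * wt x \<and> \<bar>pd l (pd i (annulus L R a)) x\<bar> <= 10000 * wt x \<and>
  (norm x < L --> pd i (annulus L R a) x = 0 \<and> pd l (pd i (annulus L R a)) x = 0)"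
 proof (rule forall_2_cases[of _ a])
  show "C2_0 (annulus L R 1) \<and> \<bar>pd i (annulus L R 1) x\<bar> <= 10000 * wt x \<and> \<bar>pd l (pd i (annulus L R 1)) x\<bar> <= 10000 * wt x \<and>
   (norm x < L --> pd i (annulus L R 1) x = 0 \<and> pd l (pd i (annulus L R 1)) x = 0)"
   unfolding e1 using Q(1)[of 2] Q(2)[of i 2 x] Q(3)[of l i 2 x] Q(4)[of x i 2] Q(5)[of x l i 2] w0 by auto
  show "C2_0 (annulus L R 2) \<and> \<bar>pd i (annulus L R 2) x\<bar> <= 10000 * wt x \<and> \<bar>pd l (pd i (annulus L R 2)) x\<bar> <= 10000 * wt x \<and>
   (norm x < L --> pd i (annulus L R 2) x = 0 \<and> pd l (pd i (annulus L R 2)) x = 0)"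
   unfolding e2 using neg[OF Q(1)[of 1], of i l] Q(2)[of i 1 x] Q(3)[of l i 1 x] Q(4)[of x i 1] Q(5)[of x l i 1] w0 by auto
 qed
 then show "C2_0 (annulus L R a)" "\<bar>pd i (annulus L R a) x\<bar> <= 10000 * wt x" "\<bar>pd l (pd i (annulus L R a)) x\<bar> <= 10000 * wt x"
  "norm x < L ==> pd i (annulus L R a) x = 0" "norm x < L ==> pd l (pd i (annulus L R a)) x = 0" by auto
qed

subsection \<open>Smallness of the annular test functions\<close>

definition wt_tail :: "real => real" where
 "wt_tail L = sqrt (LINT x|lborel. (wt x)^2 * indicator {x. norm x >= L} x)"

lemma measurable_wt [measurable]: "wt \<in> Borel"
 unfolding wt_def[abs_def] by measurable

lemma wt_sq_integrable: "integrable lborel (%x. (wt x)^2)"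
proof (rule Bochner_Integration.integrable_bound)
 show "integrable lborel (%x. 16 * decay3 x)" using decay3_integrable by simp
 show "AE x in lborel. norm ((wt x)^2) <= norm (16 * decay3 x)"
 proof (rule AE_I2)
  fix x :: plane
  define n where "n = norm x"
  have n: "0 <= n" by (simp add: n_def)
  have w0: "0 <= wt x" by (simp add: wt_def)
  have d: "decay3 x = 1 / (1 + n)^3" by (simp add: decay3_def n_def)
  have "(wt x)^2 <= 16 * decay3 x"
  proof (cases "n <= 1")
   case True
   have "(wt x)^2 <= 1" using w0 by (intro power_le_one) (auto simp: wt_def)
   moreover have "(1 + n)^3 <= 2^3" using True n by (intro power_mono) auto
   then have "1 <= 16 * decay3 x" using n by (simp add: d divide_simps)
   ultimately show ?thesis by linarith
  next
   case False
   have "wt x <= 1 / n^2" by (simp add: wt_def n_def)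
   then have "(wt x)^2 <= (1 / n^2)^2" using w0 by (intro power_mono) auto
   also have "... = 1 / n^4" by (simp add: power_divide flip: power_mult)
   also have "... <= 1 / n^3" using False by (intro divide_left_mono power_increasing) auto
   also have "... <= 8 / (1 + n)^3" using False by (intro cube_inverse_le) simp
   also have "... <= 16 * decay3 x" using n by (simp add: d divide_right_mono)
   finally show ?thesis .
  qed
  then show "norm ((wt x)^2) <= norm (16 * decay3 x)" by simp
 qed
qed measurable

lemma wt_tail_tendsto: "(%n. wt_tail (real n)) ----> 0"
proof -
 have "(%n. LINT x|lborel. (wt x)^2 * indicator {x. norm x >= real n} x) ----> (LINT x|(lborel :: plane measure). 0)"
 proof (rule integral_dominated_convergence[OF _ _ wt_sq_integrable])
  show "AE x in lborel. (%n. (wt x)^2 * indicator {x. norm x >= real n} x) ----> 0"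
  proof (rule AE_I2)
   fix x :: plane
   obtain N :: nat where "norm x < real N" using reals_Archimedean2 by blast
   then have "\<forall>\<^sub>F n in sequentially. (wt x)^2 * indicator {x. norm x >= real n} x = 0"
    by (auto simp: eventually_sequentially indicator_def intro!: exI[of _ N])
   then show "(%n. (wt x)^2 * indicator {x. norm x >= real n} x) ----> 0" by (rule tendsto_eventually)
  qed
  show "AE x in lborel. norm ((wt x)^2 * indicator {x. norm x >= real n} x) <= (wt x)^2" for n
   by (auto simp: indicator_def)
 qed measurable
 from tendsto_real_sqrt[OF this] show ?thesis by (simp add: wt_tail_def)
qed

lemma wt_tail_nonneg: "0 <= wt_tail L"
 by (simp add: wt_tail_def integral_nonneg_AE)

lemma wt_dominated_norm:
 assumes s: "sq_integrable p" and C: "0 <= C" and b: "!!x. \<bar>p x\<bar> <= C * wt x" and z: "!!x. norm x < L ==> p x = 0"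
 shows "norm (abs_l2 p) <= C * wt_tail L"
proof (rule power2_le_imp_le)
 have i: "integrable lborel (%x. (wt x)^2 * indicator {x. norm x >= L} x)"
  by (rule integrable_real_mult_indicator[OF _ wt_sq_integrable]) measurable
 have "(norm (abs_l2 p))^2 <= (LINT x|lborel. C^2 * ((wt x)^2 * indicator {x. norm x >= L} x))"
  unfolding norm_abs_l2_sq[OF s]
 proof (rule integral_mono)
  show "integrable lborel (%x. (p x)^2)" using s by (simp add: sq_integrable_def)
  show "integrable lborel (%x. C^2 * ((wt x)^2 * indicator {x. norm x >= L} x))" using i by simp
  show "(p x)^2 <= C^2 * ((wt x)^2 * indicator {x. norm x >= L} x)" for x
   using power_mono[OF b[of x] abs_ge_zero, of 2] z[of x]
   by (cases "norm x < L") (auto simp: power_mult_distrib)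
 qed
 also have "... = (C * wt_tail L)^2"
  by (simp add: wt_tail_def power_mult_distrib integral_nonneg_AE)
 finally show "(norm (abs_l2 p))^2 <= (C * wt_tail L)^2" .
 show "0 <= C * wt_tail L" using C wt_tail_nonneg by simp
qed

lemma annulus_norms:
 assumes L: "1 <= L" "L <= R"
 shows "norm (abs_l2 (pd i (annulus L R a))) <= 10000 * wt_tail L"
  and "norm (abs_l2 (laplacian (annulus L R a))) <= 20000 * wt_tail L"
proof -
 note A = annulus_C2[OF L]
 note S = C2_0_sq_integrable[OF A(1)]
 show "norm (abs_l2 (pd i (annulus L R a))) <= 10000 * wt_tail L"
  by (rule wt_dominated_norm[OF S(2) _ A(2) A(4)]) auto
 have e: "laplacian (annulus L R a) = (%x. pd 1 (pd 1 (annulus L R a)) x + pd 2 (pd 2 (annulus L R a)) x)"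
  by (simp add: laplacian_def[abs_def] UNIV_2)
 show "norm (abs_l2 (laplacian (annulus L R a))) <= 20000 * wt_tail L"
 proof (rule wt_dominated_norm[OF S(4)])
  show "\<bar>laplacian (annulus L R a) x\<bar> <= 20000 * wt x" for x
   unfolding e using A(3)[of 1 1 a x] A(3)[of 2 2 a x] by linarith
  show "laplacian (annulus L R a) x = 0" if "norm x < L" for x
   unfolding e using A(5)[OF that] by simp
 qed simp
qed

lemma annulus_abs: "1 <= L ==> 1 <= n ==> abs_l2 (annulus (real L) (real n) i) = vvec n i - vvec L i"
 unfolding annulus_def[abs_def] vvec_def by (intro abs_l2_diff vcut_sq_integrable) auto

lemma annulus_transport:
 assumes L: "1 <= L" "L <= R"
 shows "\<bar>transport W (%i. pd i (annulus L R a))\<bar> <= 10000 * tail_const L * (norm W)^2"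
proof -
 note A = annulus_C2[OF L]
 obtain r M where b: "C2_bounds r M (annulus L R a)" "0 <= r" using C2_0_bounds[OF A(1)] by blast
 have "test_field r M (%i. pd i (annulus L R a))"
  unfolding test_field_def using b C2_boundsD[OF b(1)] C2_0_measurable[OF A(1)] by auto
 then show ?thesis
  by (rule transport_decay[OF _ L(1) _ A(2) A(4)]) simp_all
qed

text \<open>The forcing is the curl of a square integrable field, so pairing it with a test function costs only the
 gradient of the latter. This is what makes its far field converge.\<close>

lemma curl_pairing_bound:
 assumes j: "is_mollifier j" and f: "!!i. H1 (%x. f x $ i)" and g: "is_curl f g" and w: "C2_0 w"
  and B: "!!i. norm (abs_l2 (pd i w)) <= B"
 shows "\<bar>inner g (abs_l2 w)\<bar> <= (\<Sum>i\<in>UNIV. norm (abs_l2 (%x. f x $ i))) * B"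
proof -
 obtain d1 d2 where d: "weak_pd 1 (%x. f x $ 2) d1" "weak_pd 2 (%x. f x $ 1) d2"
  and ae: "AE x in lborel. rep_l2 g x = d1 x - d2 x" using g by (auto simp: is_curl_def)
 have sf: "sq_integrable (%x. f x $ i)" for i using f by (simp add: H1_def)
 have ld: "locally_integrable d1" "locally_integrable d2" using d by (auto simp: weak_pd_def)
 note S = C2_0_sq_integrable[OF w]
 obtain r M where b: "C2_bounds r M w" using C2_0_bounds[OF w] by blast
 note [measurable] = C2_0_measurable(1)[OF w]
 have int: "integrable lborel (%x. e x * w x)" if e: "locally_integrable e" for e
 proof (rule integrable_dominated)
  have [measurable]: "e \<in> Borel" using e by (simp add: locally_integrable_def)
  have "set_integrable lborel (cball 0 r) e" using e by (simp add: locally_integrable_def)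
  then show "integrable lborel (%x. M * (indicator (cball 0 r) x *\<^sub>R e x))" by (simp add: set_integrable_def)
  show "(%x. e x * w x) \<in> borel_measurable lborel" by measurable
  show "norm (e x * w x) <= norm (M * (indicator (cball 0 r) x *\<^sub>R e x))" for x
    using C2_boundsD(2)[OF b, of x] C2_boundsD(5)[OF b, of x]
    by (cases "norm x <= r") (auto simp: abs_mult mult.commute[of "\<bar>e x\<bar>"] intro!: mult_right_mono)
 qed
 have [measurable]: "d1 \<in> Borel" "d2 \<in> Borel" using ld by (auto simp: locally_integrable_def)
 have "inner g (abs_l2 w) = (LINT x|lborel. rep_l2 g x * w x)"
  using pairing_eq_inner[OF S(1), of g] by (simp add: pairing_def)
 also have "... = (LINT x|lborel. d1 x * w x - d2 x * w x)"
  by (rule integral_cong_AE) (use ae in \<open>auto simp: left_diff_distrib\<close>)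
 also have "... = pairing d1 w - pairing d2 w"
  using int[OF ld(1)] int[OF ld(2)] by (simp add: pairing_def)
 also have "... = - pairing (%x. f x $ 2) (pd 1 w) + pairing (%x. f x $ 1) (pd 2 w)"
  using weak_pd_C2_0[OF j d(1) w sf ld(1)] weak_pd_C2_0[OF j d(2) w sf ld(2)] by simp
 also have "... = - inner (abs_l2 (%x. f x $ 2)) (abs_l2 (pd 1 w)) + inner (abs_l2 (%x. f x $ 1)) (abs_l2 (pd 2 w))"
  unfolding inner_abs_l2[OF sf S(2)] pairing_def by simp
 finally have e: "inner g (abs_l2 w) = - inner (abs_l2 (%x. f x $ 2)) (abs_l2 (pd 1 w)) + inner (abs_l2 (%x. f x $ 1)) (abs_l2 (pd 2 w))" .
 have c: "\<bar>inner (abs_l2 (%x. f x $ a)) (abs_l2 (pd i w))\<bar> <= norm (abs_l2 (%x. f x $ a)) * B" for a i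
  by (rule order_trans[OF Cauchy_Schwarz_ineq2 mult_left_mono[OF B norm_ge_zero]])
 show ?thesis unfolding e sum_2 using c[of 2 1] c[of 1 2] by (simp add: distrib_right)
qed

section \<open>Weakly continuous functions of the vorticity\<close>

lemma borel_measurable_wcont:
 assumes F: "!!R. wcont_on_ball R F"
 shows "F \<in> Borel"
proof (rule borel_measurable_continuous_onI)
 show "continuous_on UNIV F"
  unfolding continuous_on_sequentially
 proof (intro allI ballI impI)
  fix X :: "nat => l2" and x :: l2
  assume X: "(\<forall>n. X n \<in> UNIV) \<and> X ----> x"
  then have "Bseq X" by (auto intro!: convergent_imp_Bseq convergentI)
  then obtain K where "!!n. norm (X n) <= K" by (auto simp: Bseq_def)
  from wcont_on_ballD[OF F this wconv_of_tendsto[OF conjunct2[OF X]]]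
  show "(F \<circ> X) ----> F x" by (simp add: comp_def)
 qed
qed

lemma topspace_weak_topology_l2: "topspace weak_topology_l2 = UNIV"
proof -
 have "UNIV \<in> {F -` U | (F :: l2 => real) U. bounded_linear F \<and> open U}"
  using bounded_linear_zero open_UNIV by (auto intro!: exI[of _ "%_. 0"] exI[of _ UNIV])
 then show ?thesis
  unfolding weak_topology_l2_def topology_generated_by_topspace by blast
qed

text \<open>A subbasic weakly open set is the preimage of an open set under a functional, and by Riesz'
 theorem functionals are inner products.\<close>

lemma wconv_limitin:
 assumes X: "wconv X x"
 shows "limitin weak_topology_l2 X x sequentially"
 unfolding limitin_def
proof (intro conjI allI impI)
 show "x \<in> topspace weak_topology_l2" by (simp add: topspace_weak_topology_l2)
 fix U assume U: "openin weak_topology_l2 U \<and> x \<in> U"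
 then have g: "generate_topology_on {F -` U | (F :: l2 => real) U. bounded_linear F \<and> open U} U"
  unfolding weak_topology_l2_def by (simp add: openin_topology_generated_by)
 have "x \<in> U ==> \<forall>\<^sub>F n in sequentially. X n \<in> U"
  using g
 proof (induction U)
  case Empty then show ?case by simp
 next
  case (Int a b) then show ?case by (auto intro: eventually_conj)
 next
  case (UN A)
  then obtain a where a: "a \<in> A" "x \<in> a" by blast
  then have "\<forall>\<^sub>F n in sequentially. X n \<in> a" using UN by blast
  then show ?case by (rule eventually_mono) (use a in blast)
 next
  case (Basis s)
  then obtain F :: "l2 => real" and V where s: "s = F -` V" and F: "bounded_linear F" and V: "open V"
   unfolding mem_Collect_eq by (elim exE conjE) metis
  obtain z where z: "!!v. F v = inner z v" using l2_Riesz_representation[OF F] by blast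
  have "(%n. F (X n)) ----> F x"
   using wconvD[OF X, of z] by (simp add: z inner_commute)
  from topological_tendstoD[OF this V] show ?case using Basis s by simp
 qed
 with U show "\<forall>\<^sub>F n in sequentially. X n \<in> U" by blast
qed

lemma weakly_continuous_wcont:
 assumes "weakly_continuous \<Phi>"
 shows "wcont_on_ball R \<Phi>"
 unfolding wcont_on_ball_def
proof (intro allI impI)
 fix X x assume X: "(\<forall>n. norm (X n) <= R) \<and> wconv X x"
 have "limitin euclideanreal (\<Phi> \<circ> X) (\<Phi> x) sequentially"
  by (rule continuous_map_limit[OF assms[unfolded weakly_continuous_def] wconv_limitin]) (use X in simp)
 then show "(%n. \<Phi> (X n)) ----> \<Phi> x" by (simp add: comp_def)
qed

section \<open>Splitting off the far field\<close>

text \<open>The pairing of the equation with \<open>p\<close>, without the contribution of the drift, which is a vector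
 multiplied with \<open>dpart W p\<close>.\<close>

definition regpart :: "real => l2 => real => l2 => (plane => real) => real" where
 "regpart \<gamma> g \<nu> W p = - transport W (%i. pd i p) + \<gamma> * inner W (abs_l2 p) - inner g (abs_l2 p)
  - \<nu> * inner W (abs_l2 (laplacian p))"

definition dpart :: "l2 => (plane => real) => 2 => real" where
 "dpart W p i = inner W (abs_l2 (pd i p))"

definition ns_term :: "real => l2 => real => l2 => (plane => real) => real" where
 "ns_term \<gamma> g \<nu> W p = regpart \<gamma> g \<nu> W p - (\<Sum>i\<in>UNIV. drift W $ i * dpart W p i)"

lemma C2_bounds_test_field:
 assumes "C2_bounds \<rho> M p" "0 <= \<rho>"
 shows "test_field \<rho> M (%i. pd i p)"
 using assms C2_boundsD[OF assms(1)] C2_0_measurable(2)[of p] by (auto simp: test_field_def)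

lemma transport_integrable:
 assumes "C2_0 p"
 shows "integrable lborel (%x. (\<Sum>i\<in>UNIV. ren_vel W i x * pd i p x) * rep_l2 W x)"
proof -
 obtain \<rho> M where "\<rho> >= 0" "C2_bounds \<rho> M p" using C2_0_bounds[OF assms] by blast
 from transport_split(1)[OF C2_bounds_test_field[OF this(2,1)], of 1] show ?thesis by simp
qed

lemma ns_term_eq:
 assumes p: "C2_0 p"
 shows "euler_pairing \<gamma> g W p + \<nu> * (- pairing (laplacian p) (rep_l2 W)) = ns_term \<gamma> g \<nu> W p"
proof -
 note [measurable] = C2_0_measurable[OF p]
 note ti = transport_integrable[OF p, of W]
 have di: "integrable lborel (%x. rep_l2 W x * pd i p x)" for i
  by (rule integrable_rep_mult[OF C2_0_sq_integrable(2)[OF p]])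
 have "(LINT x|lborel. (\<Sum>i\<in>UNIV. velocity W x $ i * pd i p x) * rep_l2 W x)
   = (LINT x|lborel. (\<Sum>i\<in>UNIV. ren_vel W i x * pd i p x) * rep_l2 W x
     + (\<Sum>i\<in>UNIV. drift W $ i * (rep_l2 W x * pd i p x)))"
 proof (rule integral_cong_AE)
  show "AE x in lborel. (\<Sum>i\<in>UNIV. velocity W x $ i * pd i p x) * rep_l2 W x
   = (\<Sum>i\<in>UNIV. ren_vel W i x * pd i p x) * rep_l2 W x
     + (\<Sum>i\<in>UNIV. drift W $ i * (rep_l2 W x * pd i p x))"
   using AE_good[of W]
  proof eventually_elim
   case (elim x)
   show ?case unfolding velocity_good[OF elim] by (simp add: sum_2 algebra_simps)
  qed
 qed measurable
 also have "... = transport W (%i. pd i p) + (\<Sum>i\<in>UNIV. drift W $ i * dpart W p i)"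
  unfolding transport_def dpart_def pairing_eq_inner[OF C2_0_sq_integrable(2)[OF p], symmetric] pairing_def
  by (subst Bochner_Integration.integral_add[OF ti])
   (auto simp: sum_2 Bochner_Integration.integral_add di intro!: Bochner_Integration.integrable_add di integrable_mult_right)
 finally show ?thesis
  unfolding euler_pairing_def ns_term_def regpart_def pairing_commute[of "laplacian p"]
   pairing_eq_inner[OF C2_0_sq_integrable(1)[OF p]] pairing_eq_inner[OF C2_0_sq_integrable(4)[OF p]]
  by simp
qed

lemma abs_l2_zero: "abs_l2 (%x. 0) = 0"
 by (simp add: zero_l2_def)

lemma abs_l2_lincomb:
 fixes m :: nat
 assumes "!!k. k < m ==> sq_integrable (w k)"
 shows "abs_l2 (%x. \<Sum>k<m. a k * w k x) = (\<Sum>k<m. a k *\<^sub>R abs_l2 (w k))"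
 using assms
proof (induction m)
 case 0 show ?case by (simp add: abs_l2_zero)
next
 case (Suc m)
 have "sq_integrable (%x. \<Sum>k<m. a k * w k x)" by (rule pairing_lincomb(1)) (use Suc in simp)
 then show ?case using Suc by (simp add: abs_l2_add abs_l2_cmult sq_integrable_cmult)
qed

lemma dpart_lincomb:
 fixes m :: nat
 assumes w: "!!k. k < m ==> C2_0 (w k)"
 shows "dpart W (%x. \<Sum>k<m. a k * w k x) i = (\<Sum>k<m. a k * dpart W (w k) i)"
proof -
 have "pd i (%x. \<Sum>k<m. a k * w k x) = (%x. \<Sum>k<m. a k * pd i (w k) x)"
  by (rule C2_0_lincomb(2)) (rule w)
 then show ?thesis
  unfolding dpart_def by (simp add: abs_l2_lincomb C2_0_sq_integrable(2) w inner_sum_right)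
qed

lemma laplacian_lincomb:
 fixes m :: nat
 assumes w: "!!k. k < m ==> C2_0 (w k)"
 shows "laplacian (%x. \<Sum>k<m. a k * w k x) = (%x. \<Sum>k<m. a k * laplacian (w k) x)"
proof -
 have "pd l (pd i (%x. \<Sum>k<m. a k * w k x)) = (%x. \<Sum>k<m. a k * pd l (pd i (w k)) x)" for l i
  by (rule C2_0_lincomb(3)) (rule w)
 then show ?thesis
  unfolding laplacian_def by (simp add: sum_2 sum.distrib distrib_left)
qed

lemma transport_lincomb:
 fixes m :: nat
 assumes w: "!!k. k < m ==> C2_0 (w k)"
 shows "transport W (%i. pd i (%x. \<Sum>k<m. a k * w k x)) = (\<Sum>k<m. a k * transport W (%i. pd i (w k)))"
proof -
 have d: "pd i (%x. \<Sum>k<m. a k * w k x) = (%x. \<Sum>k<m. a k * pd i (w k) x)" for i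
  by (rule C2_0_lincomb(2)) (rule w)
 have e: "(\<Sum>i\<in>UNIV. ren_vel W i x * (\<Sum>k<m. a k * pd i (w k) x)) * rep_l2 W x
  = (\<Sum>k<m. a k * ((\<Sum>i\<in>UNIV. ren_vel W i x * pd i (w k) x) * rep_l2 W x))" for x
  by (simp add: sum_2 sum_distrib_left sum_distrib_right sum.distrib[symmetric] algebra_simps)
 show ?thesis
  unfolding transport_def d e
  by (subst Bochner_Integration.integral_sum) (auto intro!: integrable_mult_right transport_integrable w)
qed

lemma ns_term_lincomb:
 fixes m :: nat
 assumes w: "!!k. k < m ==> C2_0 (w k)"
 shows "ns_term \<gamma> g \<nu> W (%x. \<Sum>k<m. a k * w k x) = (\<Sum>k<m. a k * ns_term \<gamma> g \<nu> W (w k))"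
proof -
 have "ns_term \<gamma> g \<nu> W (%x. \<Sum>k<m. a k * w k x)
  = - (\<Sum>k<m. a k * transport W (%i. pd i (w k))) + \<gamma> * (\<Sum>k<m. a k * inner W (abs_l2 (w k)))
   - (\<Sum>k<m. a k * inner g (abs_l2 (w k))) - \<nu> * (\<Sum>k<m. a k * inner W (abs_l2 (laplacian (w k))))
   - (\<Sum>i\<in>UNIV. drift W $ i * (\<Sum>k<m. a k * dpart W (w k) i))"
  unfolding ns_term_def regpart_def
  by (simp add: dpart_lincomb transport_lincomb laplacian_lincomb abs_l2_lincomb w C2_0_sq_integrable inner_sum_right)
 also have "... = (\<Sum>k<m. a k * ns_term \<gamma> g \<nu> W (w k))"
  unfolding ns_term_def regpart_def
  by (simp add: sum_2 sum_distrib_left sum.distrib sum_subtractf sum_negf algebra_simps)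
 finally show ?thesis .
qed

text \<open>Unlike the drift, the remaining terms are continuous for weak convergence of bounded sequences,
 uniformly enough to let the test function depend on the vorticity.\<close>

lemma wcont_gradient_family:
 assumes P: "gradient_family_on R P"
 shows "wcont_on_ball R (%W. regpart \<gamma> g \<nu> W (P W))"
  and "wcont_on_ball R (%W. dpart W (P W) i)"
  and "wcont_on_ball R (%W. inner W (abs_l2 (laplacian (P W))))"
proof -
 obtain \<rho> M where \<rho>: "0 <= \<rho>" and b: "!!W. norm W <= R ==> C2_bounds \<rho> M (P W)"
  using P by (auto simp: gradient_family_on_def)
 have main: "(%n. regpart \<gamma> g \<nu> (X n) (P (X n))) ----> regpart \<gamma> g \<nu> x (P x)
   \<and> (%n. dpart (X n) (P (X n)) i) ----> dpart x (P x) i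
   \<and> (%n. inner (X n) (abs_l2 (laplacian (P (X n))))) ----> inner x (abs_l2 (laplacian (P x)))"
  if X: "!!n. norm (X n) <= R" "wconv X x" for X x
 proof -
  have l: "(%n. P (X n) y) ----> P x y" "(%n. pd i (P (X n)) y) ----> pd i (P x) y"
   "(%n. pd k (pd i (P (X n))) y) ----> pd k (pd i (P x)) y" for y i k
   using P X by (auto simp: gradient_family_on_def)
  have bn: "C2_bounds \<rho> M (P (X n))" for n by (rule b[OF X(1)])
  note cb = C2_boundsD[OF bn]
  note cm = C2_0_measurable[OF cb(1)]
  have lapM: "laplacian (P (X n)) \<in> Borel" for n
   unfolding laplacian_def using cm(3) by (auto intro!: borel_measurable_sum)
  have lapB: "\<bar>laplacian (P (X n)) y\<bar> <= 2 * M" for n y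
   unfolding laplacian_def sum_2 using cb(4)[of 1 1 n y] cb(4)[of 2 2 n y] by linarith
  have lapZ: "laplacian (P (X n)) y = 0" if "norm y > \<rho>" for n y
   unfolding laplacian_def using cb(7)[OF that] by simp
  have lapL: "(%n. laplacian (P (X n)) y) ----> laplacian (P x) y" for y
   unfolding laplacian_def by (rule tendsto_sum) (rule l(3))
  have t: "(%n. transport (X n) (%i. pd i (P (X n)))) ----> transport x (%i. pd i (P x))"
   by (rule transport_wconv(2)[OF X(2,1) C2_bounds_test_field[OF bn \<rho>] l(2)])
  have V0: "(%n. abs_l2 (P (X n))) ----> abs_l2 (P x)"
   by (rule abs_l2_pointwise_limit(2)[OF cm(1) cb(2) cb(5) l(1)])
  have V1: "(%n. abs_l2 (pd i (P (X n)))) ----> abs_l2 (pd i (P x))" for i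
   by (rule abs_l2_pointwise_limit(2)[OF cm(2) cb(3) cb(6) l(2)])
  have V2: "(%n. abs_l2 (laplacian (P (X n)))) ----> abs_l2 (laplacian (P x))"
   by (rule abs_l2_pointwise_limit(2)[OF lapM lapB lapZ lapL])
  note iw = inner_wconv_tendsto[OF X(2,1)]
  have ig: "(%n. inner g (abs_l2 (P (X n)))) ----> inner g (abs_l2 (P x))"
   by (rule tendsto_inner[OF tendsto_const V0])
  have r: "(%n. regpart \<gamma> g \<nu> (X n) (P (X n))) ----> regpart \<gamma> g \<nu> x (P x)"
   unfolding regpart_def
   by (rule tendsto_diff[OF tendsto_diff[OF tendsto_add[OF tendsto_minus[OF t]
      tendsto_mult[OF tendsto_const iw[OF V0]]] ig] tendsto_mult[OF tendsto_const iw[OF V2]]])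
  have d: "(%n. dpart (X n) (P (X n)) i) ----> dpart x (P x) i"
   unfolding dpart_def by (rule iw[OF V1])
  show ?thesis using r d iw[OF V2] by simp
 qed
 show "wcont_on_ball R (%W. regpart \<gamma> g \<nu> W (P W))"
  unfolding wcont_on_ball_def using main by simp
 show "wcont_on_ball R (%W. dpart W (P W) i)"
  unfolding wcont_on_ball_def using main by simp
 show "wcont_on_ball R (%W. inner W (abs_l2 (laplacian (P W))))"
  unfolding wcont_on_ball_def using main by simp
qed

lemma measurable_gradient_family:
 assumes "!!R. gradient_family_on R P"
 shows "(%W. regpart \<gamma> g \<nu> W (P W)) \<in> Borel"
  and "(%W. dpart W (P W) i) \<in> Borel"
 using wcont_gradient_family[OF assms] by (auto intro!: borel_measurable_wcont)

lemma measurable_ns_term: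
 assumes "!!R. gradient_family_on R P"
 shows "(%W. ns_term \<gamma> g \<nu> W (P W)) \<in> Borel"
proof -
 note [measurable] = measurable_gradient_family[OF assms]
 show ?thesis unfolding ns_term_def by measurable
qed

section \<open>Energy bounds\<close>

lemma weak_pd_wconv:
 assumes X: "wconv X x" and D: "wconv D d" and p: "!!n. weak_pd i (rep_l2 (X n)) (rep_l2 (D n))"
 shows "weak_pd i (rep_l2 x) (rep_l2 d)"
 unfolding weak_pd_def
proof (intro conjI allI impI)
 show "locally_integrable (rep_l2 x)" "locally_integrable (rep_l2 d)"
  by (simp_all add: sq_integrable_locally_integrable sq_integrable_rep)
 fix \<phi> :: "plane => real" assume \<phi>: "smooth \<phi> \<and> compactly_supported \<phi>"
 then have c: "C2_0 \<phi>" using smooth_cs_C2_0 smooth_cs_def by blast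
 note s = C2_0_sq_integrable(1,2)[OF c]
 have "inner (X n) (abs_l2 (pd i \<phi>)) = - inner (D n) (abs_l2 \<phi>)" for n
 proof -
  have "pairing (rep_l2 (X n)) (pd i \<phi>) = - pairing (rep_l2 (D n)) \<phi>"
   using p[of n] \<phi> unfolding weak_pd_def by simp
  then show ?thesis by (simp only: pairing_eq_inner[OF s(1)] pairing_eq_inner[OF s(2)])
 qed
 moreover have "(%n. - inner (D n) (abs_l2 \<phi>)) ----> - inner d (abs_l2 \<phi>)"
  by (rule tendsto_minus[OF wconvD[OF D]])
 ultimately have "inner x (abs_l2 (pd i \<phi>)) = - inner d (abs_l2 \<phi>)"
  using LIMSEQ_unique[OF wconvD[OF X, of "abs_l2 (pd i \<phi>)"]] by simp
 then show "pairing (rep_l2 x) (pd i \<phi>) = - pairing (rep_l2 d) \<phi>"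
  by (simp add: pairing_eq_inner s)
qed

text \<open>Nearly optimal gradients of a convergent sequence are bounded, so they have a weak limit, which
 is a gradient of the limit and has no larger norm.\<close>

lemma grad_norm_sq_closed:
 assumes c: "0 <= c"
 shows "closed {W. grad_norm_sq W <= ennreal c}"
 unfolding closed_sequential_limits
proof (intro allI impI)
 fix X :: "nat => l2" and x :: l2
 assume X: "(\<forall>n. X n \<in> {W. grad_norm_sq W <= ennreal c}) \<and> X ----> x"
 have "grad_norm_sq x <= ennreal c + ennreal \<epsilon>" if \<epsilon>: "0 < \<epsilon>" for \<epsilon>
 proof -
  have "\<exists>D :: 2 => l2. (\<forall>i. weak_pd i (rep_l2 (X n)) (rep_l2 (D i))) \<and> (\<Sum>i\<in>UNIV. (norm (D i))^2) <= c + \<epsilon>" for n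
  proof -
   have "grad_norm_sq (X n) < ennreal (c + \<epsilon>)"
   proof (rule le_less_trans)
    show "grad_norm_sq (X n) <= ennreal c" using X by simp
    show "ennreal c < ennreal (c + \<epsilon>)" by (rule ennreal_lessI) (use c \<epsilon> in simp_all)
   qed
   then obtain D :: "2 => l2" where "\<forall>i. weak_pd i (rep_l2 (X n)) (rep_l2 (D i))"
    "ennreal (\<Sum>i\<in>UNIV. (norm (D i))^2) < ennreal (c + \<epsilon>)"
    unfolding grad_norm_sq_def INF_less_iff by auto
   moreover from this(2) have "(\<Sum>i\<in>UNIV. (norm (D i))^2) < c + \<epsilon>"
    by (subst (asm) ennreal_less_iff) (simp_all add: sum_nonneg)
   ultimately show ?thesis by (intro exI[of _ D]) simp
  qed
  then obtain D :: "nat => 2 => l2" where D: "!!n i. weak_pd i (rep_l2 (X n)) (rep_l2 (D n i))"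
   and Dn: "!!n. (\<Sum>i\<in>UNIV. (norm (D n i))^2) <= c + \<epsilon>" by metis
  have nD: "norm (D n i) <= sqrt (c + \<epsilon>)" for n i
   by (rule real_le_rsqrt) (rule order_trans[OF member_le_sum Dn], auto)
  obtain r1 d1 where r1: "strict_mono r1" "wconv ((%n. D n 1) \<circ> r1) d1"
   using bounded_wconv_subseq[of "%n. D n 1", OF nD] by blast
  obtain r2 d2 where r2: "strict_mono r2" "wconv ((%n. D (r1 n) 2) \<circ> r2) d2"
   using bounded_wconv_subseq[of "%n. D (r1 n) 2", OF nD] by blast
  define s where "s n = r1 (r2 n)" for n
  define E where "E i = (if i = 1 then d1 else d2)" for i :: 2
  have w: "wconv (%n. D (s n) i) (E i)" for i
   by (rule forall_2_cases) (use wconv_subseq[OF r1(2) r2(1)] r2(2) in \<open>simp_all add: E_def s_def comp_def\<close>)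
  have sm: "strict_mono s" using strict_mono_o[OF r1(1) r2(1)] by (simp add: s_def[abs_def] comp_def)
  have ws: "wconv (%n. X (s n)) x"
   using wconv_subseq[OF wconv_of_tendsto[OF conjunct2[OF X]] sm] by (simp add: comp_def)
  have wp: "weak_pd i (rep_l2 x) (rep_l2 (E i))" for i by (rule weak_pd_wconv[OF ws w D])
  have "(%n. \<Sum>i\<in>UNIV. inner (D (s n) i) (E i)) ----> (\<Sum>i\<in>UNIV. inner (E i) (E i))"
   by (rule tendsto_sum) (rule wconvD[OF w])
  moreover have "(\<Sum>i\<in>UNIV. inner (D (s n) i) (E i)) <= (c + \<epsilon> + (\<Sum>i\<in>UNIV. inner (E i) (E i))) / 2" for n
  proof -
   have "inner (D (s n) i) (E i) <= ((norm (D (s n) i))^2 + inner (E i) (E i)) / 2" for i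
   proof -
    have "0 <= inner (D (s n) i - E i) (D (s n) i - E i)" by simp
    then show ?thesis by (simp add: inner_diff_left inner_diff_right inner_commute power2_norm_eq_inner)
   qed
   then have "(\<Sum>i\<in>UNIV. inner (D (s n) i) (E i)) <= (\<Sum>i\<in>UNIV. ((norm (D (s n) i))^2 + inner (E i) (E i)) / 2)"
    by (rule sum_mono)
   also have "... = ((\<Sum>i\<in>UNIV. (norm (D (s n) i))^2) + (\<Sum>i\<in>UNIV. inner (E i) (E i))) / 2"
    by (simp add: sum_2 field_simps)
   also have "... <= (c + \<epsilon> + (\<Sum>i\<in>UNIV. inner (E i) (E i))) / 2" using Dn[of "s n"] by simp
   finally show ?thesis .
  qed
  ultimately have "(\<Sum>i\<in>UNIV. inner (E i) (E i)) <= (c + \<epsilon> + (\<Sum>i\<in>UNIV. inner (E i) (E i))) / 2"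
   by (meson LIMSEQ_le_const2)
  then have le: "(\<Sum>i\<in>UNIV. (norm (E i))^2) <= c + \<epsilon>" by (simp add: power2_norm_eq_inner)
  have "grad_norm_sq x <= ennreal (\<Sum>i\<in>UNIV. (norm (E i))^2)"
   unfolding grad_norm_sq_def by (rule INF_lower) (use wp in simp)
  also have "... <= ennreal c + ennreal \<epsilon>" using le c \<epsilon> by (simp flip: ennreal_plus)
  finally show ?thesis .
 qed
 then show "x \<in> {W. grad_norm_sq W <= ennreal c}" by (auto intro: ennreal_le_epsilon)
qed

lemma measurable_grad_norm_sq [measurable]: "grad_norm_sq \<in> Borel"
proof (rule borel_measurableI_le)
 fix y :: ennreal
 show "{x \<in> space borel. grad_norm_sq x <= y} \<in> sets borel"
 proof (cases y)
  case (real c)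
  then show ?thesis using borel_closed[OF grad_norm_sq_closed[of c]] by simp
 next
  case top then show ?thesis by simp
 qed
qed

text \<open>Above the radius \<open>\<parallel>g\<parallel> / \<gamma>\<close> the damping beats the forcing, so the energy inequality on a shell
 beyond it has a positive integrand.\<close>

lemma energy_support:
 assumes sol: "stat_sol_NS j \<gamma> g \<nu> \<mu>" and \<gamma>: "0 < \<gamma>" and \<nu>: "0 < \<nu>"
 shows "AE W in \<mu>. norm W <= norm g / \<gamma>"
proof -
 have bp: "prob_space \<mu>" and [measurable_cong]: "sets \<mu> = sets borel" and H: "(\<integral>\<^sup>+ W. H1_norm_sq W \<partial>\<mu>) < \<infinity>"
  and E: "!!E1 E2. 0 <= E1 ==> 0 <= E2 ==> (LINT W:{W. E1 <= norm W \<and> norm W <= E2}|\<mu>.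
     \<gamma> * (norm W)^2 + \<nu> * enn2real (grad_norm_sq W) - inner g W) <= 0"
  using sol by (auto simp: stat_sol_NS_def borel_probability_def)
 interpret prob_space \<mu> by (rule bp)
 have [measurable]: "(%W. inner g W) \<in> Borel"
  using measurable_inner_l2[of g] by (simp add: inner_commute)
 define R where "R = norm g / \<gamma>"
 have R0: "0 <= R" using \<gamma> by (simp add: R_def)
 have gi: "(\<integral>\<^sup>+ W. grad_norm_sq W \<partial>\<mu>) < \<infinity>"
 proof (rule le_less_trans[OF _ H], rule nn_integral_mono)
  show "grad_norm_sq W <= H1_norm_sq W" for W
   unfolding H1_norm_sq_def by simp
 qed
 have ei: "integrable \<mu> (%W. enn2real (grad_norm_sq W))"
 proof (rule integrableI_nonneg)
  have "(\<integral>\<^sup>+ W. ennreal (enn2real (grad_norm_sq W)) \<partial>\<mu>) <= (\<integral>\<^sup>+ W. grad_norm_sq W \<partial>\<mu>)"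
   by (rule nn_integral_mono) (simp add: ennreal_enn2real_if)
  then show "(\<integral>\<^sup>+ W. ennreal (enn2real (grad_norm_sq W)) \<partial>\<mu>) < \<infinity>" using gi by (rule le_less_trans)
 qed auto
 have shell: "AE W in \<mu>. \<not> (E1 <= norm W \<and> norm W <= E2)" if E1: "R < E1" and E2: "0 <= E2" for E1 E2
 proof -
  define S where "S = {W :: l2. E1 <= norm W \<and> norm W <= E2}"
  define F where "F W = \<gamma> * (norm W)^2 + \<nu> * enn2real (grad_norm_sq W) - inner g W" for W
  define \<delta> where "\<delta> = \<gamma> * E1 * (E1 - R)"
  have [measurable]: "S \<in> sets borel" unfolding S_def by measurable
  have \<delta>: "0 < \<delta>" using E1 R0 \<gamma> by (simp add: \<delta>_def)
  have F: "\<delta> <= F W" if "W \<in> S" for W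
  proof -
   have n: "E1 <= norm W" using that by (simp add: S_def)
   have "inner g W <= norm g * norm W" by (rule norm_cauchy_schwarz)
   also have "norm g = \<gamma> * R" using \<gamma> by (simp add: R_def)
   finally have "inner g W <= \<gamma> * R * norm W" .
   moreover have "0 <= \<nu> * enn2real (grad_norm_sq W)" using \<nu> by simp
   moreover have "E1 * (E1 - R) <= norm W * (norm W - R)" by (rule mult_mono) (use n E1 R0 in auto)
   then have "\<gamma> * (E1 * (E1 - R)) <= \<gamma> * (norm W * (norm W - R))" using \<gamma> by (intro mult_left_mono) auto
   then have "\<delta> <= \<gamma> * (norm W)^2 - \<gamma> * R * norm W" by (simp add: \<delta>_def power2_eq_square algebra_simps)
   ultimately show ?thesis unfolding F_def by linarith
  qed
  have i1: "integrable \<mu> (%W. indicator S W * F W)"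
  proof (rule Bochner_Integration.integrable_bound)
   show "integrable \<mu> (%W. \<gamma> * E2^2 + norm g * E2 + \<nu> * enn2real (grad_norm_sq W))"
    using ei by auto
   show "(%W. indicator S W * F W) \<in> borel_measurable \<mu>" unfolding F_def by measurable
   have "norm (indicator S W * F W) <= norm (\<gamma> * E2^2 + norm g * E2 + \<nu> * enn2real (grad_norm_sq W))" for W
   proof (cases "W \<in> S")
    case True
    then have n: "norm W <= E2" by (simp add: S_def)
    have a: "0 <= \<gamma> * (norm W)^2" "\<gamma> * (norm W)^2 <= \<gamma> * E2^2"
     using \<gamma> n by (auto intro!: mult_left_mono power_mono)
    have b: "\<bar>inner g W\<bar> <= norm g * E2"
     by (rule order_trans[OF Cauchy_Schwarz_ineq2]) (use n in \<open>simp add: mult_left_mono\<close>)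
    have c: "0 <= \<nu> * enn2real (grad_norm_sq W)" using \<nu> by simp
    show ?thesis using True a b c unfolding F_def by (simp add: abs_le_iff)
   next
    case False then show ?thesis by simp
   qed
   then show "AE W in \<mu>. norm (indicator S W * F W) <= norm (\<gamma> * E2^2 + norm g * E2 + \<nu> * enn2real (grad_norm_sq W))"
    by simp
  qed
  have "\<delta> * measure \<mu> S = (LINT W|\<mu>. indicator S W * \<delta>)" by simp
  also have "... <= (LINT W|\<mu>. indicator S W * F W)"
  proof (rule integral_mono[OF _ i1])
   show "integrable \<mu> (%W. indicator S W * \<delta>)"
    by (rule integrable_const_bound[of _ \<delta>]) (use \<delta> in \<open>auto simp: indicator_def\<close>)
   show "indicator S W * \<delta> <= indicator S W * F W" for W
    using F[of W] by (simp add: indicator_def)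
  qed
  also have "... <= 0"
   using E[of E1 E2] E1 R0 E2 by (simp add: set_lebesgue_integral_def S_def F_def)
  finally have "measure \<mu> S = 0" using \<delta> by (simp add: mult_le_0_iff measure_le_0_iff)
  then have "emeasure \<mu> S = 0" by (simp add: emeasure_eq_measure)
  then have "AE W in \<mu>. W \<notin> S" by (intro AE_not_in) (auto simp: null_sets_def)
  then show ?thesis by (simp add: S_def)
 qed
 have "AE W in \<mu>. \<forall>k. \<not> (R + 1 / real (Suc k) <= norm W \<and> norm W <= real k)"
  unfolding AE_all_countable by (intro allI shell) auto
 then show ?thesis
 proof eventually_elim
  case (elim W)
  show ?case
  proof (rule ccontr)
   assume "\<not> norm W <= norm g / \<gamma>"
   then have "0 < norm W - R" by (simp add: R_def)
   then obtain k where k: "1 / real (Suc k) < norm W - R" using nat_approx_posE by (metis of_nat_Suc)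
   obtain l where l: "norm W <= real l" using real_arch_simple by blast
   have "1 / real (Suc (max k l)) <= 1 / real (Suc k)" by (simp add: frac_le)
   then show False using elim[rule_format, of "max k l"] k l by auto
  qed
 qed
qed

section \<open>Consequences of the cylindrical equations\<close>

lemma pairings_inner:
 assumes "!!k. k < m ==> C2_0 (w k)"
 shows "pairings m w (rep_l2 W) = (%k. if k < m then inner W (abs_l2 (w k)) else 0)"
 using assms by (auto simp: pairings_def pairing_eq_inner C2_0_sq_integrable)

text \<open>For a cylindrical functional the equation decouples into the equations for its finitely many
 test functions, weighted with the partial derivatives of \<open>\<psi>\<close>.\<close>

lemma cylindrical_equation:
 assumes sol: "stat_sol_NS j \<gamma> g \<nu> \<mu>" and \<psi>: "C1_partials m \<psi> D" and w: "!!k. k < m ==> C2_0 (w k)"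
 shows "has_bochner_integral \<mu>
  (%W. \<Sum>k<m. D k (%k. if k < m then inner W (abs_l2 (w k)) else 0) * ns_term \<gamma> g \<nu> W (w k)) 0"
proof -
 let ?\<Psi> = "%W. \<psi> (pairings m w (rep_l2 W))"
 have "?\<Psi> \<in> test_functionals j"
  unfolding test_functionals_def C1_Rm_iff using \<psi> w by blast
 then have b: "has_bochner_integral \<mu> (%W. euler_pairing \<gamma> g W (func_deriv ?\<Psi> W)
      + \<nu> * (- pairing (laplacian (func_deriv ?\<Psi> W)) (rep_l2 W))) 0"
  using sol unfolding stat_sol_NS_def by blast
 have fd: "func_deriv ?\<Psi> W = (%x. \<Sum>k<m. D k (pairings m w (rep_l2 W)) * w k x)" for W
  by (rule func_deriv_cylindrical[OF \<psi> w])
 have c: "C2_0 (%x. \<Sum>k<m. D k (pairings m w (rep_l2 W)) * w k x)" for W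
  by (rule C2_0_lincomb(1)) (rule w)
 have "ns_term \<gamma> g \<nu> W (%x. \<Sum>k<m. D k (pairings m w (rep_l2 W)) * w k x)
  = (\<Sum>k<m. D k (pairings m w (rep_l2 W)) * ns_term \<gamma> g \<nu> W (w k))" for W
  by (rule ns_term_lincomb) (rule w)
 then show ?thesis
  using b unfolding fd ns_term_eq[OF c] by (simp add: pairings_inner[of m w, OF w])
qed

lemma ns_term_integrable:
 assumes sol: "stat_sol_NS j \<gamma> g \<nu> \<mu>" and w: "C2_0 w"
 shows "integrable \<mu> (%W. ns_term \<gamma> g \<nu> W w)"
proof -
 have "C1_partials 1 (%p. p 0) (%k p. 1)"
  unfolding C1_partials_def by (auto intro!: derivative_eq_intros)
 from cylindrical_equation[OF sol this, of "%k. w"] w show ?thesis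
  by (simp add: has_bochner_integral_iff)
qed

lemma wcont_bounded_integrable:
 assumes \<mu>: "borel_probability \<mu>" and R: "AE W in \<mu>. norm W <= R" and F: "!!R. wcont_on_ball R F"
 shows "integrable \<mu> F"
proof -
 interpret prob_space \<mu> using \<mu> by (simp add: borel_probability_def)
 have [measurable_cong]: "sets \<mu> = sets borel" using \<mu> by (simp add: borel_probability_def)
 have [measurable]: "F \<in> Borel" by (rule borel_measurable_wcont[OF F])
 obtain K where "!!x. norm x <= R ==> \<bar>F x\<bar> <= K" using wcont_on_ball_bounded[OF F[of R]] by blast
 then have "AE W in \<mu>. norm (F W) <= K" using R by auto
 then show ?thesis by (rule integrable_const_bound) measurable
qed

text \<open>The equation for a linear functional contains the drift as its only term that is not bounded almost
 surely; as integrability is part of the equation, this term is integrable too.\<close>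

lemma drift_dpart_integrable:
 assumes sol: "stat_sol_NS j \<gamma> g \<nu> \<mu>" and R: "AE W in \<mu>. norm W <= R" and w: "C2_0 w"
 shows "integrable \<mu> (%W. \<Sum>i\<in>UNIV. drift W $ i * dpart W w i)"
proof -
 have \<mu>: "borel_probability \<mu>" using sol by (simp add: stat_sol_NS_def)
 have "integrable \<mu> (%W. regpart \<gamma> g \<nu> W w)"
  by (rule wcont_bounded_integrable[OF \<mu> R wcont_gradient_family(1)[OF gradient_family_on_const[OF w]]])
 from Bochner_Integration.integrable_diff[OF this ns_term_integrable[OF sol w]]
 show ?thesis by (simp add: ns_term_def)
qed

section \<open>Integrability of the drift\<close>

lemma disc_norm_bound:
 fixes h :: "plane => real"
 assumes h: "h \<in> Borel" and r: "0 <= r" and M: "!!y. \<bar>h y\<bar> <= M"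
  and z: "!!y. norm (y - a) > r ==> h y = 0"
 shows "norm (abs_l2 h) <= 2 * r * M"
proof (rule power2_le_imp_le)
 have "(norm (abs_l2 h))^2 <= pi * r^2 * M^2" by (rule integral_disc_sq_bound(2)[OF h r M z])
 also have "... <= 4 * r^2 * M^2"
  by (intro mult_right_mono) (use pi_less_4 in auto)
 finally show "(norm (abs_l2 h))^2 <= (2 * r * M)^2" by (simp add: power_mult_distrib)
 have "0 <= M" using M[of 0] by linarith
 then show "0 <= 2 * r * M" using r by simp
qed

lemma translate_has_derivative:
 fixes u :: plane
 assumes w: "C2_0 w" and u: "norm u = 1"
 shows "((%t. inner W (abs_l2 (%x. w (x + t *\<^sub>R u)))) has_real_derivative
  (\<Sum>i\<in>UNIV. u $ i * dpart W (%x. w (x + t *\<^sub>R u)) i)) (at t)"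
proof -
 obtain \<rho> M where \<rho>: "0 <= \<rho>" "0 <= M" and b: "C2_bounds \<rho> M w" using C2_0_bounds[OF w] by blast
 show ?thesis
 unfolding has_field_derivative_def
 proof (rule has_derivative_quadratic)
 let ?d = "\<Sum>i\<in>UNIV. u $ i * dpart W (%x. w (x + t *\<^sub>R u)) i"
 show "bounded_linear ((*) ?d)" by (rule bounded_linear_mult_right)
 fix v :: real assume v: "norm v <= 1"
 define q where "q x = w (x + (t + v) *\<^sub>R u) - w (x + t *\<^sub>R u) - v * (u $ 1 * pd 1 w (x + t *\<^sub>R u) + u $ 2 * pd 2 w (x + t *\<^sub>R u))" for x
 have sh: "C2_0 (%x. w (x + z))" "pd i (%x. w (x + z)) = (%x. pd i w (x + z))" for z i
  by (rule C2_0_shift[OF w])+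
 have s0: "sq_integrable (%x. w (x + z))" for z by (rule C2_0_sq_integrable(1)[OF sh(1)])
 have s1: "sq_integrable (%x. pd i w (x + z))" for z i
  using C2_0_sq_integrable(2)[OF sh(1)[of z], of i] by (simp add: sh(2))
 note [measurable] = C2_0_measurable(1,2)[OF w]
 have "q x = w (x + t *\<^sub>R u + v *\<^sub>R u) - w (x + t *\<^sub>R u) - (\<Sum>i\<in>UNIV. (v *\<^sub>R u) $ i * pd i w (x + t *\<^sub>R u))" for x
  by (simp add: q_def sum_2 algebra_simps)
 moreover have "\<bar>w (x + t *\<^sub>R u + v *\<^sub>R u) - w (x + t *\<^sub>R u) - (\<Sum>i\<in>UNIV. (v *\<^sub>R u) $ i * pd i w (x + t *\<^sub>R u))\<bar>
  <= 4 * M * (norm (v *\<^sub>R u))^2" for x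
  by (rule grad_Taylor[OF C2_0D(1,2)[OF w] C2_boundsD(4)[OF b]])
 ultimately have qb: "\<bar>q x\<bar> <= 4 * M * v^2" for x using u by simp
 have qz: "q x = 0" if "norm (x - 0) > \<rho> + \<bar>t\<bar> + 1" for x
 proof -
  have "norm (s *\<^sub>R u) = \<bar>s\<bar>" for s using u by simp
  moreover have "norm x <= norm (x + s *\<^sub>R u) + norm (s *\<^sub>R u)" for s
   using norm_triangle_ineq4[of "x + s *\<^sub>R u" "s *\<^sub>R u"] by simp
  ultimately have n: "norm (x + s *\<^sub>R u) >= norm x - \<bar>s\<bar>" for s by (metis diff_le_eq)
  have "\<rho> < norm (x + t *\<^sub>R u)" "\<rho> < norm (x + (t + v) *\<^sub>R u)"
   using n[of t] n[of "t + v"] that v by auto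
  then show ?thesis unfolding q_def using C2_boundsD(5,6)[OF b] by simp
 qed
 have [measurable]: "q \<in> Borel" unfolding q_def[abs_def] by measurable
 have "norm (abs_l2 q) <= 2 * (\<rho> + \<bar>t\<bar> + 1) * (4 * M * v^2)"
  by (rule disc_norm_bound[of q _ _ 0]) (use \<rho> qb qz in auto)
 then have "\<bar>inner W (abs_l2 q)\<bar> <= norm W * (2 * (\<rho> + \<bar>t\<bar> + 1) * (4 * M * v^2))"
  by (intro order_trans[OF Cauchy_Schwarz_ineq2] mult_left_mono) auto
 moreover have "abs_l2 q = abs_l2 (%x. w (x + (t + v) *\<^sub>R u)) - abs_l2 (%x. w (x + t *\<^sub>R u))
  - v *\<^sub>R (u $ 1 *\<^sub>R abs_l2 (%x. pd 1 w (x + t *\<^sub>R u)) + u $ 2 *\<^sub>R abs_l2 (%x. pd 2 w (x + t *\<^sub>R u)))"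
  unfolding q_def[abs_def]
  by (simp add: abs_l2_diff abs_l2_cmult abs_l2_add s0 s1 sq_integrable_diff sq_integrable_cmult sq_integrable_add)
 ultimately show "\<bar>inner W (abs_l2 (%x. w (x + (t + v) *\<^sub>R u))) - inner W (abs_l2 (%x. w (x + t *\<^sub>R u))) - ?d * v\<bar>
   <= (norm W * (2 * (\<rho> + \<bar>t\<bar> + 1) * (4 * M))) * (norm v)^2"
  unfolding dpart_def sh(2) sum_2
  by (simp add: inner_diff_right inner_add_right algebra_simps)
 qed
qed

text \<open>Far translates of a test function in one direction are orthogonal, so \<open>W\<close> cannot correlate
 with all of them. If it correlates with the test function itself, the correlation must vary
 along the way.\<close>

lemma translate_derivative_large:
 fixes w :: "plane => real"
 assumes w: "C2_0 w" and \<kappa>: "0 < \<kappa>"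
 shows "\<exists>T c. 0 <= T \<and> 0 < c \<and> (\<forall>W u. norm W <= R \<and> \<kappa> <= \<bar>inner W (abs_l2 w)\<bar> \<and> norm u = 1 -->
  (\<exists>a. norm a <= T \<and> c <= \<bar>\<Sum>i\<in>UNIV. u $ i * dpart W (%x. w (x + a)) i\<bar>))"
proof -
 obtain \<rho> M where \<rho>: "0 <= \<rho>" "0 <= M" and b: "C2_bounds \<rho> M w" using C2_0_bounds[OF w] by blast
 define Q where "Q = 2 * \<rho> * M"
 \<comment> \<open>more translates than can have a correlation of \<open>\<kappa> / 2\<close> each with a vector of norm \<open>R\<close>\<close>
 obtain N :: nat where N: "4 * (R * Q)^2 / \<kappa>^2 < real N" using reals_Archimedean2 by blast
 then have N0: "0 < N" by (metis divide_nonneg_nonneg gr0I mult_nonneg_nonneg of_nat_0 zero_le_numeral zero_le_power2 linorder_not_less)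
 \<comment> \<open>distinct translates by multiples of \<open>d\<close> in one direction have disjoint supports\<close>
 define d where "d = 2 * \<rho> + 1"
 define T where "T = real N * d"
 have d: "0 < d" using \<rho> by (simp add: d_def)
 have T: "0 < T" using N0 d by (simp add: T_def)
 define c where "c = \<kappa> / (2 * T)"
 have "\<exists>a. norm a <= T \<and> c <= \<bar>\<Sum>i\<in>UNIV. u $ i * dpart W (%x. w (x + a)) i\<bar>"
  if W: "norm W <= R" "\<kappa> <= \<bar>inner W (abs_l2 w)\<bar>" and u: "norm u = 1" for W u
 proof -
  define V where "V t = abs_l2 (%x. w (x + t *\<^sub>R u))" for t
  define h where "h t = inner W (V t)" for t
  note [measurable] = C2_0_measurable(1)[OF w]
  have sq: "sq_integrable (%x. w (x + z))" for z by (rule C2_0_sq_integrable(1)[OF C2_0_shift(1)[OF w]])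
  have VW: "norm (V t) <= Q" for t
   unfolding V_def Q_def
   by (rule disc_norm_bound[where a = "- t *\<^sub>R u"]) (use \<rho> C2_boundsD(2,5)[OF b] in auto)
  have VV: "orthogonal (V s) (V t)" if "\<bar>s - t\<bar> > 2 * \<rho>" for s t
  proof -
   have "w (x + s *\<^sub>R u) * w (x + t *\<^sub>R u) = 0" for x
   proof (rule ccontr)
    assume "w (x + s *\<^sub>R u) * w (x + t *\<^sub>R u) ~= 0"
    then have "norm (x + s *\<^sub>R u) <= \<rho>" "norm (x + t *\<^sub>R u) <= \<rho>"
     using C2_boundsD(5)[OF b] by (auto simp: not_le[symmetric])
    moreover have "norm ((x + s *\<^sub>R u) - (x + t *\<^sub>R u)) = \<bar>s - t\<bar>"
     using u by (simp flip: scaleR_diff_left)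
    ultimately show False
     using norm_triangle_ineq4[of "x + s *\<^sub>R u" "x + t *\<^sub>R u"] that by linarith
   qed
   then have "(%x. w (x + s *\<^sub>R u) * w (x + t *\<^sub>R u)) = (%x. 0)" by (rule ext)
   then show ?thesis unfolding orthogonal_def V_def inner_abs_l2[OF sq sq] by (simp only: Bochner_Integration.integral_zero)
  qed
  have "\<exists>k<N. \<bar>h (real k * d)\<bar> < \<kappa> / 2"
  proof (rule ccontr)
   assume "\<not> ?thesis"
   then have big: "\<kappa> / 2 <= \<bar>h (real k * d)\<bar>" if "k < N" for k using that by (meson not_le)
   define s where "s k = sgn (h (real k * d))" for k
   define Y where "Y = (\<Sum>k<N. s k *\<^sub>R V (real k * d))"
   have "(norm Y)^2 = (\<Sum>k<N. (norm (s k *\<^sub>R V (real k * d)))^2)"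
    unfolding Y_def
   proof (rule norm_sum_Pythagorean)
    show "pairwise (%i k. orthogonal (s i *\<^sub>R V (real i * d)) (s k *\<^sub>R V (real k * d))) {..<N}"
    proof (rule pairwiseI)
     fix i k :: nat assume "i ~= k"
     then have "1 <= \<bar>real i - real k\<bar>" by linarith
     then have "1 * d <= \<bar>real i - real k\<bar> * d" by (rule mult_right_mono) (use d in simp)
     also have "... = \<bar>real i * d - real k * d\<bar>"
      using d by (simp add: abs_mult left_diff_distrib[symmetric])
     finally have "2 * \<rho> < \<bar>real i * d - real k * d\<bar>" by (simp add: d_def)
     from VV[OF this] show "orthogonal (s i *\<^sub>R V (real i * d)) (s k *\<^sub>R V (real k * d))"
      by (simp add: orthogonal_clauses)
    qed
   qed simp
   also have "... <= (\<Sum>k<N. Q^2)"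
   proof (rule sum_mono)
    fix k
    have "norm (s k *\<^sub>R V (real k * d)) <= norm (V (real k * d))"
     by (simp add: s_def sgn_if)
    then have "norm (s k *\<^sub>R V (real k * d)) <= Q" using VW order_trans by blast
    then show "(norm (s k *\<^sub>R V (real k * d)))^2 <= Q^2" by (intro power_mono) auto
   qed
   finally have Y: "(norm Y)^2 <= real N * Q^2" by simp
   have "real N * (\<kappa> / 2) = (\<Sum>k<N. \<kappa> / 2)" by simp
   also have "... <= (\<Sum>k<N. \<bar>h (real k * d)\<bar>)" by (rule sum_mono) (use big in simp)
   also have "... = inner W Y"
    unfolding Y_def s_def h_def by (simp add: inner_sum_right abs_sgn mult.commute)
   also have "... <= R * norm Y"
    by (rule order_trans[OF norm_cauchy_schwarz mult_right_mono]) (use W in auto)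
   finally have "(real N * (\<kappa> / 2))^2 <= (R * norm Y)^2" by (rule power_mono) (use \<kappa> in simp)
   also have "... <= R^2 * (real N * Q^2)"
    unfolding power_mult_distrib by (rule mult_left_mono[OF Y]) simp
   finally have "real N * (real N * \<kappa>^2) <= real N * (4 * (R * Q)^2)"
    by (simp add: power2_eq_square algebra_simps)
   then have "real N * \<kappa>^2 <= 4 * (R * Q)^2" using N0 by simp
   then show False using N \<kappa> by (simp add: field_simps)
  qed
  then obtain k where k: "k < N" "\<bar>h (real k * d)\<bar> < \<kappa> / 2" by blast
  define t where "t = real k * d"
  have h0: "\<kappa> <= \<bar>h 0\<bar>" using W by (simp add: h_def V_def)
  have t: "0 < t" "t <= T"
  proof -
   have "k ~= 0" using h0 k \<kappa> by (intro notI) simp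
   then show "0 < t" using d by (simp add: t_def)
   show "t <= T" unfolding t_def T_def using k d by simp
  qed
  let ?D = "%s. \<Sum>i\<in>UNIV. u $ i * dpart W (%x. w (x + s *\<^sub>R u)) i"
  have der: "(h has_real_derivative ?D s) (at s)" for s
   unfolding h_def V_def by (rule translate_has_derivative[OF w u])
  obtain s where s: "0 < s" "s < t" "h t - h 0 = (t - 0) * ?D s"
   using MVT2[OF t(1) der] by blast
  have "\<kappa> / 2 <= \<bar>h t - h 0\<bar>" using h0 k unfolding t_def by linarith
  also have "... = t * \<bar>?D s\<bar>" using s t by (simp add: abs_mult)
  also have "... <= T * \<bar>?D s\<bar>" using t by (simp add: mult_right_mono)
  finally have "c <= \<bar>?D s\<bar>" using T by (simp add: c_def field_simps)
  moreover have "norm (s *\<^sub>R u) <= T" using s t u by simp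
  ultimately show ?thesis by blast
 qed
 moreover have "0 < c" using \<kappa> T by (simp add: c_def)
 ultimately show ?thesis using T less_imp_le by blast
qed

lemma dpart_translate_Lipschitz:
 assumes w: "C2_0 w"
 shows "\<exists>C\<ge>0. \<forall>W a b i. norm a <= T \<and> norm b <= T -->
  \<bar>dpart W (%x. w (x + a)) i - dpart W (%x. w (x + b)) i\<bar> <= norm W * (C * norm (a - b))"
proof -
 obtain \<rho> M where \<rho>: "0 <= \<rho>" "0 <= M" and b: "C2_bounds \<rho> M w" using C2_0_bounds[OF w] by blast
 have main: "\<bar>dpart W (%x. w (x + a)) i - dpart W (%x. w (x + z)) i\<bar> <= norm W * ((2 * (\<rho> + T) * (2 * M)) * norm (a - z))"
  if n: "norm a <= T" "norm z <= T" for W a z i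
 proof -
  have T: "0 <= T" using n norm_ge_zero[of a] by linarith
  have sh: "C2_0 (%x. w (x + y))" "pd i (%x. w (x + y)) = (%x. pd i w (x + y))" for y
   by (rule C2_0_shift[OF w])+
  have s1: "sq_integrable (%x. pd i w (x + y))" for y
   using C2_0_sq_integrable(2)[OF sh(1)[of y], of i] by (simp add: sh(2))
  note [measurable] = C2_0_measurable(2)[OF w]
  have "\<bar>pd i w ((x + z) + (a - z)) - pd i w (x + z)\<bar> <= 2 * M * norm (a - z)" for x
   by (rule grad_Lipschitz[OF C2_0D(2)[OF w] C2_boundsD(4)[OF b]])
  then have L: "\<bar>pd i w (x + a) - pd i w (x + z)\<bar> <= 2 * M * norm (a - z)" for x by simp
  have "norm (abs_l2 (%x. pd i w (x + a) - pd i w (x + z))) <= 2 * (\<rho> + T) * (2 * M * norm (a - z))"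
  proof (rule disc_norm_bound[where a = 0])
   fix y :: plane assume y: "norm (y - 0) > \<rho> + T"
   have "norm (y + v) >= norm y - norm v" for v using norm_triangle_ineq4[of "y + v" v] by simp
   from this[of a] this[of z] have "\<rho> < norm (y + a)" "\<rho> < norm (y + z)" using y n by auto
   then show "pd i w (y + a) - pd i w (y + z) = 0" using C2_boundsD(6)[OF b] by simp
  qed (use L \<rho> T in auto)
  then have "\<bar>inner W (abs_l2 (%x. pd i w (x + a) - pd i w (x + z)))\<bar> <= norm W * (2 * (\<rho> + T) * (2 * M * norm (a - z)))"
   by (intro order_trans[OF Cauchy_Schwarz_ineq2] mult_left_mono) auto
  then show ?thesis
   unfolding dpart_def sh(2) by (simp add: abs_l2_diff s1 inner_diff_right mult.assoc)
 qed
 then show ?thesis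
 proof (cases "0 <= T")
  case True
  then have "0 <= 2 * (\<rho> + T) * (2 * M)" using \<rho> by simp
  with main show ?thesis by (intro exI[of _ "2 * (\<rho> + T) * (2 * M)"]) simp
 next
  case False
  then have "\<not> norm a <= T" for a :: plane using norm_ge_zero[of a] by linarith
  then show ?thesis by (intro exI[of _ 0]) simp
 qed
qed

text \<open>Finitely many translates of a test function therefore control the drift wherever the vorticity
 correlates with that test function.\<close>

lemma drift_controlled:
 fixes w :: "plane => real"
 assumes w: "C2_0 w" and \<kappa>: "0 < \<kappa>" and R: "0 <= R"
 shows "\<exists>A C. finite A \<and> 0 <= C \<and> (\<forall>W. norm W <= R \<and> \<kappa> <= \<bar>inner W (abs_l2 w)\<bar> -->
  (\<forall>e :: plane. norm e <= C * (\<Sum>a\<in>A. \<bar>\<Sum>i\<in>UNIV. e $ i * dpart W (%x. w (x + a)) i\<bar>)))"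
proof -
 obtain T c where T: "0 <= T" and c: "0 < c" and large: "!!W u. norm W <= R ==> \<kappa> <= \<bar>inner W (abs_l2 w)\<bar> ==> norm u = 1 ==>
  (\<exists>a. norm a <= T \<and> c <= \<bar>\<Sum>i\<in>UNIV. u $ i * dpart W (%x. w (x + a)) i\<bar>)"
  using translate_derivative_large[OF w \<kappa>, of R] by blast
 obtain C where C: "0 <= C" and Lip: "!!W a b i. norm a <= T ==> norm b <= T ==>
  \<bar>dpart W (%x. w (x + a)) i - dpart W (%x. w (x + b)) i\<bar> <= norm W * (C * norm (a - b))"
  using dpart_translate_Lipschitz[OF w, of T] by blast
 define \<eta> where "\<eta> = c / (4 * (R * C + 1))"
 have RC: "0 <= R * C" using R C by simp
 have \<eta>: "0 < \<eta>" using c RC by (simp add: \<eta>_def)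
 have "seq_compact (cball (0 :: plane) T)" by (simp add: compact_imp_seq_compact)
 from seq_compact_imp_totally_bounded[OF this, THEN spec, THEN mp, OF \<eta>]
 obtain A :: "plane set" where A: "finite A" "A \<subseteq> cball 0 T" "cball 0 T \<subseteq> (\<Union>x\<in>A. ball x \<eta>)"
  by (elim exE conjE) (rule that)
 have "norm e <= 2 / c * (\<Sum>a\<in>A. \<bar>\<Sum>i\<in>UNIV. e $ i * dpart W (%x. w (x + a)) i\<bar>)"
  if W: "norm W <= R" "\<kappa> <= \<bar>inner W (abs_l2 w)\<bar>" for W and e :: plane
 proof (cases "e = 0")
  case False
  define u where "u = (1 / norm e) *\<^sub>R e"
  have u: "norm u = 1" using False by (simp add: u_def)
  let ?S = "%u a. \<Sum>i\<in>UNIV. u $ i * dpart W (%x. w (x + a)) i"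
  obtain b where b: "norm b <= T" "c <= \<bar>?S u b\<bar>" using large[OF W u] by blast
  obtain a where a: "a \<in> A" "dist a b < \<eta>" using A(3) b(1) by (auto simp: subset_iff)
  have aT: "norm a <= T" using a(1) A(2) by auto
  have L: "\<bar>dpart W (%x. w (x + a)) i - dpart W (%x. w (x + b)) i\<bar> <= c / 4" for i
  proof -
   have "norm W * (C * norm (a - b)) <= R * (C * \<eta>)"
    by (intro mult_mono) (use W R C a in \<open>auto simp: dist_norm\<close>)
   also have "R * (C * \<eta>) = (c / 4) * ((R * C) / (R * C + 1))" by (simp add: \<eta>_def)
   also have "... <= (c / 4) * 1"
    by (intro mult_left_mono) (use RC c in \<open>simp_all add: divide_le_eq\<close>)
   finally show ?thesis using Lip[OF aT b(1), of W i] by simp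
  qed
  have "\<bar>\<Sum>i\<in>UNIV. u $ i * (dpart W (%x. w (x + a)) i - dpart W (%x. w (x + b)) i)\<bar> <= 2 * (c / 4) * norm u"
   by (rule sum_coord_le[OF L])
  then have "\<bar>?S u a - ?S u b\<bar> <= c / 2"
   using u by (simp add: sum_2 algebra_simps)
  then have "c / 2 <= \<bar>?S u a\<bar>" using b(2) by linarith
  moreover have "?S u a = ?S e a / norm e" by (simp add: u_def sum_2 add_divide_distrib)
  ultimately have "c / 2 * norm e <= \<bar>?S e a\<bar>" using False by (simp add: field_simps)
  also have "... <= (\<Sum>a\<in>A. \<bar>?S e a\<bar>)"
   by (rule member_le_sum[OF a(1)]) (use A in auto)
  finally show ?thesis using c by (simp add: field_simps)
 qed (use c in \<open>simp add: sum_nonneg\<close>)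
 moreover have "0 <= 2 / c" using c by simp
 ultimately show ?thesis using A(1) by blast
qed

lemma measurable_drift_vec [measurable]: "drift \<in> Borel"
 by (rule borel_measurable_planeI) measurable

lemma drift_integrable_where_correlated:
 assumes sol: "stat_sol_NS j \<gamma> g \<nu> \<mu>" and R: "AE W in \<mu>. norm W <= R" "0 <= R" and w: "C2_0 w" and \<kappa>: "0 < \<kappa>"
 shows "integrable \<mu> (%W. norm (drift W) * indicator {W. \<kappa> <= \<bar>inner W (abs_l2 w)\<bar>} W)"
proof -
 have [measurable_cong]: "sets \<mu> = sets borel" using sol by (simp add: stat_sol_NS_def borel_probability_def)
 obtain A :: "plane set" and C :: real where A: "finite A" and C: "0 <= C" and b: "!!W e. norm W <= R ==> \<kappa> <= \<bar>inner W (abs_l2 w)\<bar> ==>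
  norm (e :: plane) <= C * (\<Sum>a\<in>A. \<bar>\<Sum>i\<in>UNIV. e $ i * dpart W (%x. w (x + a)) i\<bar>)"
  using drift_controlled[OF w \<kappa> R(2)] by blast
 show ?thesis
 proof (rule Bochner_Integration.integrable_bound)
  show "integrable \<mu> (%W. C * (\<Sum>a\<in>A. \<bar>\<Sum>i\<in>UNIV. drift W $ i * dpart W (%x. w (x + a)) i\<bar>))"
   by (intro integrable_mult_right Bochner_Integration.integrable_sum integrable_abs
     drift_dpart_integrable[OF sol R(1)] C2_0_shift(1)[OF w])
  show "(%W. norm (drift W) * indicator {W. \<kappa> <= \<bar>inner W (abs_l2 w)\<bar>} W) \<in> borel_measurable \<mu>"
   by measurable
  show "AE W in \<mu>. norm (norm (drift W) * indicator {W. \<kappa> <= \<bar>inner W (abs_l2 w)\<bar>} W)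
    <= norm (C * (\<Sum>a\<in>A. \<bar>\<Sum>i\<in>UNIV. drift W $ i * dpart W (%x. w (x + a)) i\<bar>))"
   using R(1)
  proof eventually_elim
   case (elim W)
   show ?case
   proof (cases "\<kappa> <= \<bar>inner W (abs_l2 w)\<bar>")
    case True
    from b[OF elim True, of "drift W"] True show ?thesis by simp
   qed simp
  qed
 qed
qed

section \<open>Control of the far field\<close>

text \<open>The parts of the far field between the radii \<open>L\<close> and \<open>n\<close>, and inside the radius \<open>L\<close>.\<close>

definition zfar :: "nat => nat => l2 => plane" where
 "zfar L n W = (\<chi> i. inner W (vvec n i - vvec L i))"

definition nearpart :: "nat => l2 => plane" where
 "nearpart L W = (\<chi> i. inner W (vvec L i))"

text \<open>In the equation for \<open>annulus L n i\<close> all terms except the damping are bounded by \<open>offset + slope * \<bar>drift\<bar>\<close>. The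
 bound \<open>F\<close> comes from the forcing and \<open>B\<close> from the viscosity.\<close>

definition slope :: "real => nat => real" where
 "slope R L = 20000 * R * wt_tail (real L)"

definition offset :: "real => real => real => nat => real" where
 "offset R F B L = 10000 * tail_const (real L) * R^2 + F * (10000 * wt_tail (real L)) + B * (R * (20000 * wt_tail (real L)))"

lemma tail_const_nonneg: "0 <= tail_const L"
proof -
 have "0 <= (LINT x|(lborel :: plane measure). decay3 x * indicator {x. norm x >= L} x)"
  by (rule Bochner_Integration.integral_nonneg) (use decay3_pos less_imp_le in \<open>auto simp: indicator_def\<close>)
 then show ?thesis
  unfolding tail_const_def using near_mass_nonneg[of 1] far_const_nonneg by simp
qed

lemma slope_nonneg: "0 <= R ==> 0 <= slope R L"
 by (simp add: slope_def wt_tail_nonneg)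

lemma offset_nonneg: "0 <= R ==> 0 <= F ==> 0 <= B ==> 0 <= offset R F B L"
 by (simp add: offset_def wt_tail_nonneg tail_const_nonneg)

lemma slope_tendsto: "slope R ----> 0"
 unfolding slope_def[abs_def] using tendsto_mult_right_zero[OF wt_tail_tendsto] by simp

lemma offset_tendsto: "offset R F B ----> 0"
proof -
 have "(%L. 10000 * tail_const (real L) * R^2 + F * (10000 * wt_tail (real L)) + B * (R * (20000 * wt_tail (real L)))) ---->
  10000 * 0 * R^2 + F * (10000 * 0) + B * (R * (20000 * 0))"
  by (intro tendsto_intros wt_tail_tendsto tail_const_tendsto)
 then show ?thesis by (simp add: offset_def[abs_def])
qed

lemma measurable_zfar [measurable]: "zfar L n \<in> Borel"
 by (rule borel_measurable_planeI) (simp add: zfar_def)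

lemma measurable_nearpart [measurable]: "nearpart L \<in> Borel"
 by (rule borel_measurable_planeI) (simp add: nearpart_def)

lemma zfar_tendsto:
 assumes "far_conv W"
 shows "(%n. zfar L n W) ----> drift W - nearpart L W"
proof (rule vec_tendstoI)
 fix i
 show "(%n. zfar L n W $ i) ----> (drift W - nearpart L W) $ i"
  using tendsto_diff[OF drift_lim[OF assms] tendsto_const[of "inner W (vvec L i)"]]
  by (simp add: zfar_def nearpart_def inner_diff_right)
qed

lemma nearpart_bound:
 assumes "norm W <= R"
 shows "norm (nearpart L W) <= R * (\<Sum>i\<in>UNIV. norm (vvec L i))"
proof -
 have "norm (nearpart L W) <= (\<Sum>i\<in>UNIV. \<bar>nearpart L W $ i\<bar>)" by (rule norm_le_l1_cart)
 also have "... <= (\<Sum>i\<in>UNIV. R * norm (vvec L i))"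
 proof (rule sum_mono)
  fix i
  have "\<bar>nearpart L W $ i\<bar> <= norm W * norm (vvec L i)"
   by (simp add: nearpart_def Cauchy_Schwarz_ineq2)
  also have "... <= R * norm (vvec L i)" by (rule mult_right_mono[OF assms]) simp
  finally show "\<bar>nearpart L W $ i\<bar> <= R * norm (vvec L i)" .
 qed
 finally show ?thesis by (simp add: sum_distrib_left)
qed

subsection \<open>Radial test functionals at two scales\<close>

definition C1_pair :: "(real => real) => (real => real) => bool" where
 "C1_pair \<Phi> \<Phi>1 \<longleftrightarrow> (\<forall>x\<ge>0. (\<Phi> has_real_derivative \<Phi>1 x) (at x)) \<and> continuous_on {0..} \<Phi>1"

lemma C1_pair_sq:
 assumes "C1_pair \<Phi> \<Phi>1" and c: "0 <= c"
 shows "((%t. \<Phi> (t^2 + c)) has_real_derivative 2 * x * \<Phi>1 (x^2 + c)) (at x)"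
  and "((%t. \<Phi> (c + t^2)) has_real_derivative 2 * x * \<Phi>1 (c + x^2)) (at x)"
proof -
 have "(\<Phi> has_real_derivative \<Phi>1 (x^2 + c)) (at (x^2 + c))" using assms by (simp add: C1_pair_def)
 moreover have "((%t :: real. t^2 + c) has_real_derivative 2 * x) (at x)" by (auto intro!: derivative_eq_intros)
 ultimately show 1: "((%t. \<Phi> (t^2 + c)) has_real_derivative 2 * x * \<Phi>1 (x^2 + c)) (at x)"
  using DERIV_chain2 by (metis mult.commute)
 then show "((%t. \<Phi> (c + t^2)) has_real_derivative 2 * x * \<Phi>1 (c + x^2)) (at x)"
  by (simp add: add.commute)
qed

lemma C1_pair_continuous: "C1_pair \<Phi> \<Phi>1 ==> continuous_on {0..} \<Phi>"
 unfolding C1_pair_def by (auto intro!: continuous_at_imp_continuous_on DERIV_isCont)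

definition radial_partial :: "(real => real) => (real => real) => (real => real) => (real => real) => nat => (nat => real) => real" where
 "radial_partial \<Phi> \<Phi>1 \<zeta> \<zeta>1 k p =
  (if k < 2 then 2 * p k * \<Phi>1 ((p 0)^2 + (p 1)^2) * \<zeta> ((p 2)^2 + (p 3)^2)
   else 2 * p k * \<zeta>1 ((p 2)^2 + (p 3)^2) * \<Phi> ((p 0)^2 + (p 1)^2))"

lemma C1_partials_radial:
 assumes \<Phi>: "C1_pair \<Phi> \<Phi>1" and \<zeta>: "C1_pair \<zeta> \<zeta>1"
 shows "C1_partials 4 (%p. \<Phi> ((p 0)^2 + (p 1)^2) * \<zeta> ((p 2)^2 + (p 3)^2)) (radial_partial \<Phi> \<Phi>1 \<zeta> \<zeta>1)"
 unfolding C1_partials_def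
proof (intro allI impI conjI ballI)
 fix k :: nat assume k: "k < 4"
 have co: "continuous_on (Rm 4) (%p. p i :: real)" for i :: nat
  by (rule continuous_on_subset[OF continuous_on_product_coordinates]) simp
 have sq: "continuous_on (Rm 4) (%p. q ((p i)^2 + (p l)^2))" if "continuous_on {0..} q" for q :: "real => real" and i l :: nat
  by (rule continuous_on_compose2[OF that]) (auto intro!: continuous_intros co)
 show "continuous_on (Rm 4) (radial_partial \<Phi> \<Phi>1 \<zeta> \<zeta>1 k)"
  unfolding radial_partial_def
  using \<Phi> \<zeta> C1_pair_continuous[OF \<Phi>] C1_pair_continuous[OF \<zeta>]
  by (cases "k < 2") (auto intro!: continuous_intros co sq simp: C1_pair_def)
 fix p :: "nat => real"
 consider "k = 0" | "k = 1" | "k = 2" | "k = 3" using k by linarith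
 then show "((%t. \<Phi> (((p(k := t)) 0)^2 + ((p(k := t)) 1)^2) * \<zeta> (((p(k := t)) 2)^2 + ((p(k := t)) 3)^2))
   has_real_derivative radial_partial \<Phi> \<Phi>1 \<zeta> \<zeta>1 k p) (at (p k))"
 proof cases
  case 1
  then show ?thesis
   using DERIV_cmult_right[OF C1_pair_sq(1)[OF \<Phi>, of "(p 1)^2" "p 0"], of "\<zeta> ((p 2)^2 + (p 3)^2)"]
   by (simp add: radial_partial_def)
 next
  case 2
  then show ?thesis
   using DERIV_cmult_right[OF C1_pair_sq(2)[OF \<Phi>, of "(p 0)^2" "p 1"], of "\<zeta> ((p 2)^2 + (p 3)^2)"]
   by (simp add: radial_partial_def)
 next
  case 3
  then show ?thesis
   using DERIV_cmult_right[OF C1_pair_sq(1)[OF \<zeta>, of "(p 3)^2" "p 2"], of "\<Phi> ((p 0)^2 + (p 1)^2)"]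
   by (simp add: radial_partial_def mult.commute)
 next
  case 4
  then show ?thesis
   using DERIV_cmult_right[OF C1_pair_sq(2)[OF \<zeta>, of "(p 2)^2" "p 3"], of "\<Phi> ((p 0)^2 + (p 1)^2)"]
   by (simp add: radial_partial_def mult.commute)
 qed
qed

definition radial_flux :: "real => l2 => real => nat => nat => l2 => real" where
 "radial_flux \<gamma> g \<nu> L n W = (\<Sum>i\<in>UNIV. zfar L n W $ i * ns_term \<gamma> g \<nu> W (annulus (real L) (real n) i))"

lemma zfar_annulus:
 assumes "1 <= L" "L <= n"
 shows "inner W (abs_l2 (annulus (real L) (real n) i)) = zfar L n W $ i"
 using annulus_abs[of L n i] assms by (simp add: zfar_def)

text \<open>The functional is \<open>\<Phi> (\<bar>z\<bar>\<^sup>2) \<zeta> (\<bar>z'\<bar>\<^sup>2)\<close> for the far fields \<open>z\<close>, \<open>z'\<close> up to the radii \<open>n\<close>, \<open>n'\<close>.\<close>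

lemma two_scale_equation:
 assumes sol: "stat_sol_NS j \<gamma> g \<nu> \<mu>" and \<Phi>: "C1_pair \<Phi> \<Phi>1" and \<zeta>: "C1_pair \<zeta> \<zeta>1"
  and L: "1 <= L" "L <= n" "L <= n'"
 shows "has_bochner_integral \<mu> (%W.
   2 * \<Phi>1 ((norm (zfar L n W))^2) * \<zeta> ((norm (zfar L n' W))^2) * radial_flux \<gamma> g \<nu> L n W
  + 2 * \<Phi> ((norm (zfar L n W))^2) * \<zeta>1 ((norm (zfar L n' W))^2) * radial_flux \<gamma> g \<nu> L n' W) 0"
proof -
 \<comment> \<open>the coordinates \<open>0, 1\<close> are the far field up to \<open>n\<close>, the coordinates \<open>2, 3\<close> that up to \<open>n'\<close>\<close>
 define w where "w k = annulus (real L) (real (if k < 2 then n else n')) (if even k then 1 else 2)" for k :: nat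
 have w: "C2_0 (w k)" for k unfolding w_def by (rule annulus_C2(1)) (use L in auto)
 have iw: "inner W (abs_l2 (w k)) = zfar L (if k < 2 then n else n') W $ (if even k then 1 else 2)" for k W
  unfolding w_def by (rule zfar_annulus) (use L in auto)
 have four: "{..<4 :: nat} = {0, 1, 2, 3}" by auto
 have "has_bochner_integral \<mu> (%W. \<Sum>k<4. radial_partial \<Phi> \<Phi>1 \<zeta> \<zeta>1 k (%k. if k < 4 then inner W (abs_l2 (w k)) else 0)
   * ns_term \<gamma> g \<nu> W (w k)) 0"
  by (rule cylindrical_equation[OF sol C1_partials_radial[OF \<Phi> \<zeta>] w])
 also have "(%W. \<Sum>k<4. radial_partial \<Phi> \<Phi>1 \<zeta> \<zeta>1 k (%k. if k < 4 then inner W (abs_l2 (w k)) else 0) * ns_term \<gamma> g \<nu> W (w k))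
  = (%W. 2 * \<Phi>1 ((norm (zfar L n W))^2) * \<zeta> ((norm (zfar L n' W))^2) * radial_flux \<gamma> g \<nu> L n W
  + 2 * \<Phi> ((norm (zfar L n W))^2) * \<zeta>1 ((norm (zfar L n' W))^2) * radial_flux \<gamma> g \<nu> L n' W)"
  unfolding four radial_partial_def iw radial_flux_def norm_plane_sq sum_2
  by (simp add: w_def algebra_simps)
 finally show ?thesis .
qed

subsection \<open>Profiles\<close>

text \<open>Bounded, vanishing up to \<open>c\<close>, strictly increasing afterwards, with a derivative of order \<open>1 / x\<close>.\<close>

definition bump :: "real => real => real" where
 "bump c x = 1 - inverse (1 + (max 0 (x - c))^2)"

definition bump1 :: "real => real => real" where
 "bump1 c x = 2 * max 0 (x - c) * (inverse (1 + (max 0 (x - c))^2))^2"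

lemma bump_pair: "C1_pair (bump c) (bump1 c)"
 unfolding C1_pair_def
proof (intro conjI allI impI)
 have ne: "1 + (max 0 (x - c))^2 ~= 0" for x by (metis add_nonneg_eq_0_iff zero_le_one zero_le_power2 zero_neq_one)
 fix x :: real
 have "((%x. max 0 (x - c) ^ 2) has_real_derivative 2 * max 0 (x - c) * 1) (at x)"
  by (rule DERIV_chain2[OF DERIV_max0_sq]) (auto intro!: derivative_eq_intros)
 from DERIV_diff[OF DERIV_const DERIV_inverse'[OF DERIV_add[OF DERIV_const this] ne], of 1]
 show "(bump c has_real_derivative bump1 c x) (at x)"
  unfolding bump_def[abs_def] bump1_def by (simp add: power2_eq_square algebra_simps)
 show "continuous_on {0..} (bump1 c)"
  unfolding bump1_def[abs_def] by (intro continuous_intros ballI ne)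
qed

lemma bump_range: "0 <= bump c x" "bump c x <= 1" "x <= c ==> bump c x = 0"
proof -
 have 1: "1 <= 1 + (max 0 (x - c))^2" by simp
 show "0 <= bump c x" unfolding bump_def using le_imp_inverse_le[OF 1] by simp
 show "bump c x <= 1" unfolding bump_def by simp
 show "x <= c ==> bump c x = 0" by (simp add: bump_def)
qed

lemma bump1_range: "0 <= bump1 c x" "x <= c ==> bump1 c x = 0" "c < x ==> 0 < bump1 c x"
proof -
 show "0 <= bump1 c x" "x <= c ==> bump1 c x = 0" by (simp_all add: bump1_def)
 assume "c < x"
 moreover from this have "0 < 1 + (max 0 (x - c))^2" by (intro add_pos_nonneg) auto
 ultimately show "0 < bump1 c x" unfolding bump1_def by (intro mult_pos_pos zero_less_power) auto
qed

lemma bump1_decay: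
 assumes c: "0 <= c" and x: "0 <= x"
 shows "bump1 c x * (1 + x) <= 4 + 2 * c"
proof (cases "x <= c")
 case False
 define t where "t = x - c"
 have t: "0 < t" using False by (simp add: t_def)
 have p: "0 < (1 + t^2)^2" by (rule zero_less_power) (simp add: add_pos_nonneg)
 have b: "2 * t <= 1 + t^2" using zero_le_power2[of "t - 1"] by (simp add: power2_diff)
 have sq: "1 + t^2 <= (1 + t^2)^2" by (simp add: power2_eq_square distrib_left)
 have "2 * t * (1 + c + t) = 2 * t * (1 + c) + 2 * t^2" by (simp add: power2_eq_square algebra_simps)
 also have "... <= (1 + t^2) * (1 + c) + 2 * (1 + t^2)"
  by (intro add_mono mult_right_mono b) (use c in auto)
 also have "... = (1 + t^2) * (3 + c)" by (simp add: algebra_simps)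
 also have "... <= (1 + t^2)^2 * (4 + 2 * c)" by (intro mult_mono sq) (use c in auto)
 finally have "2 * t * (1 + c + t) <= (1 + t^2)^2 * (4 + 2 * c)" .
 moreover have "bump1 c x * (1 + x) = 2 * t * (1 + c + t) / (1 + t^2)^2"
  using t by (simp add: bump1_def t_def[symmetric] power_inverse divide_inverse) (simp add: t_def)
 ultimately show ?thesis using p by (simp add: divide_le_eq mult.commute)
qed (use c bump1_range(2) in simp)

text \<open>A cutoff at exponentially large distance, whose logarithmic profile makes
 \<open>(1 + x) \<bar>\<zeta>' x\<bar>\<close> uniformly small.\<close>

definition logcut :: "real => real => real" where
 "logcut \<epsilon> x = (max 0 (1 - \<epsilon> * ln (1 + x)))^2"

definition logcut1 :: "real => real => real" where
 "logcut1 \<epsilon> x = - (2 * max 0 (1 - \<epsilon> * ln (1 + x)) * (\<epsilon> / (1 + x)))"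

lemma logcut_pair: "C1_pair (logcut \<epsilon>) (logcut1 \<epsilon>)"
 unfolding C1_pair_def
proof (intro conjI allI impI)
 fix x :: real assume x: "0 <= x"
 have "((%x. 1 - \<epsilon> * ln (1 + x)) has_real_derivative - (\<epsilon> / (1 + x))) (at x)"
  using x by (auto intro!: derivative_eq_intros)
 from DERIV_chain2[OF DERIV_max0_sq this]
 show "(logcut \<epsilon> has_real_derivative logcut1 \<epsilon> x) (at x)"
  by (simp add: logcut_def[abs_def] logcut1_def)
next
 show "continuous_on {0..} (logcut1 \<epsilon>)"
  unfolding logcut1_def[abs_def] by (intro continuous_intros) auto
qed

lemma logcut_range:
 assumes \<epsilon>: "0 < \<epsilon>" and x: "0 <= x"
 shows "0 <= logcut \<epsilon> x" "logcut \<epsilon> x <= 1" "\<bar>logcut1 \<epsilon> x\<bar> * (1 + x) <= 2 * \<epsilon>"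
  "logcut \<epsilon> x ~= 0 ==> x <= exp (1 / \<epsilon>)" "\<epsilon> * ln (1 + x) <= 1/2 ==> 1/4 <= logcut \<epsilon> x"
proof -
 have l: "0 <= ln (1 + x)" using x by simp
 have m: "0 <= max 0 (1 - \<epsilon> * ln (1 + x))" "max 0 (1 - \<epsilon> * ln (1 + x)) <= 1" using l \<epsilon> by auto
 show "0 <= logcut \<epsilon> x" by (simp add: logcut_def)
 show "logcut \<epsilon> x <= 1" unfolding logcut_def using power_mono[OF m(2,1), of 2] by simp
 have "\<bar>logcut1 \<epsilon> x\<bar> * (1 + x) = 2 * max 0 (1 - \<epsilon> * ln (1 + x)) * \<epsilon>"
  using x \<epsilon> m(1) by (simp add: logcut1_def abs_mult)
 also have "... <= 2 * 1 * \<epsilon>" by (intro mult_right_mono mult_left_mono m) (use \<epsilon> in auto)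
 finally show "\<bar>logcut1 \<epsilon> x\<bar> * (1 + x) <= 2 * \<epsilon>" by simp
 show "x <= exp (1 / \<epsilon>)" if "logcut \<epsilon> x ~= 0"
 proof -
  have "\<epsilon> * ln (1 + x) < 1" using that by (auto simp: logcut_def max_def split: if_splits)
  then have "ln (1 + x) < 1 / \<epsilon>" using \<epsilon> by (simp add: field_simps)
  then have "1 + x < exp (1 / \<epsilon>)" using x by (metis add_pos_nonneg exp_less_cancel_iff exp_ln zero_less_one)
  then show ?thesis by simp
 qed
 show "1/4 <= logcut \<epsilon> x" if "\<epsilon> * ln (1 + x) <= 1/2"
 proof -
  have "1/2 <= max 0 (1 - \<epsilon> * ln (1 + x))" using that by simp
  from power_mono[OF this, of 2] show ?thesis by (simp add: logcut_def power2_eq_square)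
 qed
qed

subsection \<open>A bound on the drift\<close>

locale stationary_NS =
 fixes j :: "plane => real" and \<gamma> :: real and g :: l2 and \<nu> :: real and \<mu> :: "l2 measure"
  and R F B :: real
 assumes \<gamma>: "0 < \<gamma>" and \<nu>: "0 < \<nu>" "\<nu> <= B" and F: "0 <= F" and R: "0 <= R"
  and sol: "stat_sol_NS j \<gamma> g \<nu> \<mu>"
  and supp: "AE W in \<mu>. norm W <= R"
  and curl: "!!w C. C2_0 w ==> (!!i. norm (abs_l2 (pd i w)) <= C) ==> \<bar>inner g (abs_l2 w)\<bar> <= F * C"
begin

sublocale prob_space \<mu>
 using sol by (simp add: stat_sol_NS_def borel_probability_def)

lemma sets_\<mu> [measurable_cong]: "sets \<mu> = sets borel"
 using sol by (simp add: stat_sol_NS_def borel_probability_def)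

abbreviation "err L W \<equiv> offset R F B L + slope R L * norm (drift W)"

lemma err_nonneg: "0 <= err L W"
 using slope_nonneg[OF R, of L] offset_nonneg[OF R F, of B L] \<nu> by simp

lemma annulus_term:
 assumes W: "norm W <= R" and L: "1 <= L" "L <= n"
 shows "\<bar>ns_term \<gamma> g \<nu> W (annulus (real L) (real n) i) - \<gamma> * zfar L n W $ i\<bar> <= err L W"
proof -
 let ?p = "annulus (real L) (real n) i"
 have L': "1 <= real L" "real L <= real n" using L by auto
 have t: "\<bar>transport W (%i. pd i ?p)\<bar> <= 10000 * tail_const (real L) * R^2"
  by (rule order_trans[OF annulus_transport[OF L']])
   (use W tail_const_nonneg in \<open>auto intro!: mult_left_mono power_mono\<close>)
 have g: "\<bar>inner g (abs_l2 ?p)\<bar> <= F * (10000 * wt_tail (real L))"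
  by (rule curl[OF annulus_C2(1)[OF L'] annulus_norms(1)[OF L']])
 have l: "\<bar>\<nu> * inner W (abs_l2 (laplacian ?p))\<bar> <= B * (R * (20000 * wt_tail (real L)))"
 proof -
  have "\<bar>inner W (abs_l2 (laplacian ?p))\<bar> <= norm W * norm (abs_l2 (laplacian ?p))" by (rule Cauchy_Schwarz_ineq2)
  also have "... <= R * (20000 * wt_tail (real L))"
   by (rule mult_mono[OF W annulus_norms(2)[OF L']]) (use R in auto)
  finally have "\<bar>inner W (abs_l2 (laplacian ?p))\<bar> <= R * (20000 * wt_tail (real L))" .
  then show ?thesis
   unfolding abs_mult by (intro mult_mono) (use \<nu> in auto)
 qed
 have d: "\<bar>\<Sum>i\<in>UNIV. drift W $ i * dpart W ?p i\<bar> <= 2 * (R * (10000 * wt_tail (real L))) * norm (drift W)"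
 proof (rule sum_coord_le)
  fix i
  have "\<bar>dpart W ?p i\<bar> <= norm W * norm (abs_l2 (pd i ?p))"
   unfolding dpart_def by (rule Cauchy_Schwarz_ineq2)
  also have "... <= R * (10000 * wt_tail (real L))"
   by (rule mult_mono[OF W annulus_norms(1)[OF L']]) (use R in auto)
  finally show "\<bar>dpart W ?p i\<bar> <= R * (10000 * wt_tail (real L))" .
 qed
 have e: "ns_term \<gamma> g \<nu> W ?p - \<gamma> * zfar L n W $ i = - transport W (%i. pd i ?p) - inner g (abs_l2 ?p)
   - \<nu> * inner W (abs_l2 (laplacian ?p)) - (\<Sum>i\<in>UNIV. drift W $ i * dpart W ?p i)"
  unfolding ns_term_def regpart_def zfar_annulus[OF L] by simp
 have o: "err L W = 10000 * tail_const (real L) * R^2 + F * (10000 * wt_tail (real L))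
   + B * (R * (20000 * wt_tail (real L))) + 2 * (R * (10000 * wt_tail (real L))) * norm (drift W)"
  by (simp add: offset_def slope_def)
 show ?thesis unfolding e o using t g l d by linarith
qed

lemma flux_bound:
 assumes W: "norm W <= R" and L: "1 <= L" "L <= n"
 shows "\<bar>radial_flux \<gamma> g \<nu> L n W - \<gamma> * (norm (zfar L n W))\<^sup>2\<bar> <= 2 * err L W * norm (zfar L n W)"
proof -
 have "radial_flux \<gamma> g \<nu> L n W - \<gamma> * (norm (zfar L n W))^2
  = (\<Sum>i\<in>UNIV. zfar L n W $ i * (ns_term \<gamma> g \<nu> W (annulus (real L) (real n) i) - \<gamma> * zfar L n W $ i))"
  unfolding radial_flux_def norm_plane_sq by (simp add: sum_2 power2_eq_square algebra_simps)
 also have "\<bar>...\<bar> <= 2 * err L W * norm (zfar L n W)"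
  by (rule sum_coord_le[OF annulus_term[OF W L]])
 finally show ?thesis .
qed

text \<open>Once the drift is bounded, the damping confines the far field to a ball whose radius is
 proportional to the size of the error terms: outside of it, the radial functional would
 dissipate.\<close>

lemma far_field_confined:
 assumes S: "AE W in \<mu>. norm (drift W) <= S" "0 <= S" and L: "1 <= L" "L <= n"
 shows "AE W in \<mu>. norm (zfar L n W) <= 2 * (offset R F B L + slope R L * S) / \<gamma>"
proof -
 define e where "e = offset R F B L + slope R L * S"
 define \<kappa> where "\<kappa> = 2 * e / \<gamma>"
 have a0: "0 <= slope R L" by (rule slope_nonneg[OF R])
 have "0 <= offset R F B L" by (rule offset_nonneg[OF R F]) (use \<nu> in simp)
 then have e0: "0 <= e" using a0 S(2) by (simp add: e_def)
 then have \<kappa>0: "0 <= \<kappa>" using \<gamma> by (simp add: \<kappa>_def)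
 let ?f = "%W. 2 * bump1 (\<kappa>^2) ((norm (zfar L n W))^2) * radial_flux \<gamma> g \<nu> L n W"
 have one: "C1_pair (%x. 1) (%x. 0)" by (simp add: C1_pair_def)
 have f: "has_bochner_integral \<mu> ?f 0"
  using two_scale_equation[OF sol bump_pair[of "\<kappa>^2"] one L(1) L(2) L(2)] by simp
 have pos: "AE W in \<mu>. 0 <= ?f W \<and> (\<kappa> < norm (zfar L n W) --> 0 < ?f W)"
  using supp S(1)
 proof eventually_elim
  case (elim W)
  let ?r = "norm (zfar L n W)"
  show ?case
  proof (cases "\<kappa> < ?r")
   case True
   then have c: "\<kappa>^2 < ?r^2" using \<kappa>0 by (intro power_strict_mono) auto
   have "err L W <= e" unfolding e_def using mult_left_mono[OF elim(2) a0] by simp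
   then have "2 * err L W * ?r <= 2 * e * ?r" by (intro mult_right_mono) auto
   also have "... = \<gamma> * \<kappa> * ?r" using \<gamma> by (simp add: \<kappa>_def)
   also have "... < \<gamma> * ?r * ?r" using True \<kappa>0 \<gamma> by (intro mult_strict_right_mono mult_strict_left_mono) auto
   finally have "0 < radial_flux \<gamma> g \<nu> L n W"
    using flux_bound[OF elim(1) L] by (simp add: power2_eq_square)
   then have "0 < ?f W" using bump1_range(3)[OF c] by simp
   then show ?thesis by simp
  next
   case False
   then have "?r^2 <= \<kappa>^2" by (intro power_mono) auto
   then show ?thesis using False by (simp add: bump1_range(2))
  qed
 qed
 have "(LINT W|\<mu>. ?f W) = 0" and fi: "integrable \<mu> ?f"
  using f by (simp_all add: has_bochner_integral_iff)
 then have "AE W in \<mu>. ?f W = 0"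
  using integral_nonneg_eq_0_iff_AE[OF fi] pos by auto
 with pos have "AE W in \<mu>. norm (zfar L n W) <= \<kappa>"
  by eventually_elim (metis less_irrefl not_le)
 then show ?thesis by (simp add: \<kappa>_def e_def)
qed

text \<open>A far field of size \<open>\<kappa>\<close> means that the vorticity correlates with one of the two annular functions.\<close>

lemma drift_far_integrable:
 assumes \<kappa>: "0 < \<kappa>" and L: "1 <= L" "L <= n"
 shows "integrable \<mu> (%W. norm (drift W) * indicator {W. \<kappa> <= norm (zfar L n W)} W)"
proof (rule integrable_dominated)
 have L': "1 <= real L" "real L <= real n" using L by auto
 let ?I = "%i W. norm (drift W) * indicator {W. \<kappa> / 2 <= \<bar>inner W (abs_l2 (annulus (real L) (real n) i))\<bar>} W :: real"
 show "integrable \<mu> (%W. \<Sum>i\<in>UNIV. ?I i W)"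
  by (rule Bochner_Integration.integrable_sum, rule drift_integrable_where_correlated[OF sol supp R annulus_C2(1)[OF L']])
   (use \<kappa> in simp)
 show "(%W. norm (drift W) * indicator {W. \<kappa> <= norm (zfar L n W)} W) \<in> borel_measurable \<mu>" by measurable
 show "norm (norm (drift W) * indicator {W. \<kappa> <= norm (zfar L n W)} W) <= norm (\<Sum>i\<in>UNIV. ?I i W)" for W
 proof (cases "\<kappa> <= norm (zfar L n W)")
  case True
  have "norm (zfar L n W) <= (\<Sum>i\<in>UNIV. \<bar>zfar L n W $ i\<bar>)" by (rule norm_le_l1_cart)
  then have "\<kappa> / 2 <= \<bar>zfar L n W $ 1\<bar> \<or> \<kappa> / 2 <= \<bar>zfar L n W $ 2\<bar>" using True by (auto simp: sum_2)
  then have "1 <= (\<Sum>i\<in>UNIV. indicator {W. \<kappa> / 2 <= \<bar>inner W (abs_l2 (annulus (real L) (real n) i))\<bar>} W :: real)"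
   unfolding zfar_annulus[OF L] sum_2 by (auto simp: indicator_def)
  then have "norm (drift W) * 1 <= norm (drift W) * (\<Sum>i\<in>UNIV. indicator {W. \<kappa> / 2 <= \<bar>inner W (abs_l2 (annulus (real L) (real n) i))\<bar>} W)"
   by (rule mult_left_mono) simp
  then show ?thesis using True by (simp add: sum_distrib_left)
 qed simp
qed

end

definition near_bound :: "real => nat => real" where
 "near_bound R L = R * (\<Sum>i\<in>UNIV. norm (vvec L i))"

definition drift_radius :: "real => real => real => real => nat => real" where
 "drift_radius \<gamma> R F B L = 4 * (offset R F B L + slope R L * near_bound R L) / \<gamma> + 1"

lemma quadratic_growth:
 fixes r e c :: real
 assumes "0 <= r" "0 <= e" "0 <= c"
 shows "c * r^2 + 2 * e * r <= (c + 2 * e) * (1 + r^2)"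
proof -
 have "r <= 1 + r^2" using zero_le_power2[of "r - 1"] assms by (simp add: power2_diff)
 then have "2 * e * r <= 2 * e * (1 + r^2)" using assms by (intro mult_left_mono) auto
 then show ?thesis using assms by (simp add: algebra_simps)
qed

locale drift_estimate = stationary_NS +
 fixes L :: nat
 assumes L1: "1 <= L" and small: "4 * slope R L <= \<gamma>"
begin

abbreviation "a \<equiv> slope R L"
abbreviation "b \<equiv> offset R F B L"
abbreviation "C1 \<equiv> near_bound R L"
abbreviation "\<kappa> \<equiv> drift_radius \<gamma> R F B L"
abbreviation "r n W \<equiv> norm (zfar L n W)"
abbreviation "q W \<equiv> norm (drift W - nearpart L W)"
abbreviation "cv W \<equiv> (indicator {W. far_conv W} W :: real)"
abbreviation "K1 \<equiv> 4 + 2 * \<kappa>^2"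

text \<open>The damping of the radial functional, as a lower bound; \<open>loss\<close> bounds the effect of the cutoff at the
 second scale \<open>y\<close>.\<close>

definition gain :: "real => l2 => real" where
 "gain x W = 2 * bump1 (\<kappa>^2) (x^2) * (\<gamma> * x^2 - 2 * err L W * x)"

definition loss :: "real => real => real => l2 => real" where
 "loss \<epsilon> x y W = 2 * bump (\<kappa>^2) (x^2) * (\<bar>logcut1 \<epsilon> (y^2)\<bar> * (\<gamma> * y^2 + 2 * err L W * y))"

lemma const_facts: "0 <= a" "0 <= b" "0 <= C1" "1 <= \<kappa>"
proof -
 show "0 <= a" by (rule slope_nonneg[OF R])
 moreover show "0 <= b" by (rule offset_nonneg[OF R F]) (use \<nu> in simp)
 moreover show "0 <= C1" using R by (simp add: near_bound_def sum_nonneg)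
 ultimately show "1 <= \<kappa>" using \<gamma> by (simp add: drift_radius_def)
qed

lemma measurable_bumps [measurable]:
 "bump c \<in> Borel" "bump1 c \<in> Borel"
 "logcut \<epsilon> \<in> Borel" "logcut1 \<epsilon> \<in> Borel"
 unfolding bump_def[abs_def] bump1_def[abs_def] logcut_def[abs_def] logcut1_def[abs_def] by measurable

lemma gain_bound:
 assumes "0 <= x"
 shows "\<bar>gain x W\<bar> <= 2 * K1 * (\<gamma> + 2 * err L W)" "x <= \<kappa> ==> gain x W = 0"
proof -
 have e: "0 <= err L W" by (rule err_nonneg)
 have g0: "0 <= \<gamma> * x^2" "0 <= 2 * err L W * x" using \<gamma> assms e by auto
 have "\<bar>\<gamma> * x^2 - 2 * err L W * x\<bar> <= \<gamma> * x^2 + 2 * err L W * x" using g0 by linarith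
 also have "... <= (\<gamma> + 2 * err L W) * (1 + x^2)" by (rule quadratic_growth) (use \<gamma> assms e in auto)
 finally have "\<bar>gain x W\<bar> <= 2 * bump1 (\<kappa>^2) (x^2) * ((\<gamma> + 2 * err L W) * (1 + x^2))"
  unfolding gain_def abs_mult using bump1_range(1)[of "\<kappa>^2" "x^2"]
  by (simp add: abs_of_nonneg mult_left_mono)
 also have "... = 2 * (bump1 (\<kappa>^2) (x^2) * (1 + x^2)) * (\<gamma> + 2 * err L W)" by (simp only: mult_ac)
 also have "... <= 2 * K1 * (\<gamma> + 2 * err L W)"
  by (intro mult_right_mono mult_left_mono bump1_decay) (use \<gamma> e in auto)
 finally show "\<bar>gain x W\<bar> <= 2 * K1 * (\<gamma> + 2 * err L W)" .
 show "gain x W = 0" if "x <= \<kappa>"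
 proof -
  have "x^2 <= \<kappa>^2" using that assms by (intro power_mono) auto
  then show ?thesis unfolding gain_def by (simp add: bump1_range(2))
 qed
qed

lemma loss_bound:
 assumes x: "0 <= x" "0 <= y" and \<epsilon>: "0 < \<epsilon>"
 shows "0 <= loss \<epsilon> x y W" "loss \<epsilon> x y W <= 4 * \<epsilon> * (\<gamma> + 2 * err L W)" "x <= \<kappa> ==> loss \<epsilon> x y W = 0"
proof -
 have e: "0 <= err L W" by (rule err_nonneg)
 have g0: "0 <= \<gamma> * y^2 + 2 * err L W * y" using \<gamma> x e by auto
 show "0 <= loss \<epsilon> x y W" unfolding loss_def
  by (intro mult_nonneg_nonneg bump_range abs_ge_zero g0) simp
 have "\<bar>logcut1 \<epsilon> (y^2)\<bar> * (\<gamma> * y^2 + 2 * err L W * y) <= \<bar>logcut1 \<epsilon> (y^2)\<bar> * ((\<gamma> + 2 * err L W) * (1 + y^2))"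
  by (intro mult_left_mono quadratic_growth) (use \<gamma> x e in auto)
 also have "... = (\<bar>logcut1 \<epsilon> (y^2)\<bar> * (1 + y^2)) * (\<gamma> + 2 * err L W)" by (simp only: mult_ac)
 also have "... <= 2 * \<epsilon> * (\<gamma> + 2 * err L W)"
  by (intro mult_right_mono logcut_range(3)[OF \<epsilon>]) (use \<gamma> e in auto)
 finally have l: "\<bar>logcut1 \<epsilon> (y^2)\<bar> * (\<gamma> * y^2 + 2 * err L W * y) <= 2 * \<epsilon> * (\<gamma> + 2 * err L W)" .
 have "loss \<epsilon> x y W <= 2 * 1 * (2 * \<epsilon> * (\<gamma> + 2 * err L W))"
  unfolding loss_def by (rule mult_mono[OF mult_left_mono[OF bump_range(2)] l]) (use g0 in auto)
 then show "loss \<epsilon> x y W <= 4 * \<epsilon> * (\<gamma> + 2 * err L W)" by simp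
 show "loss \<epsilon> x y W = 0" if "x <= \<kappa>"
 proof -
  have "x^2 <= \<kappa>^2" using that x by (intro power_mono) auto
  then show ?thesis unfolding loss_def by (simp add: bump_range(3))
 qed
qed

lemma drift_le:
 assumes "norm W <= R"
 shows "norm (drift W) <= q W + C1"
 using norm_triangle_ineq[of "drift W - nearpart L W" "nearpart L W"] nearpart_bound[OF assms, of L]
 by (simp add: near_bound_def)

text \<open>In the limit \<open>n \<rightarrow> \<infinity>\<close> the drift in the error term is itself the radius up to a bounded
 amount, so for large \<open>L\<close> the damping absorbs it.\<close>

lemma gain_limit_pos:
 assumes W: "norm W <= R"
 shows "0 <= gain (q W) W" "\<kappa> < q W ==> 0 < gain (q W) W"
proof -
 have *: "0 < gain (q W) W" if k: "\<kappa> < q W"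
 proof -
  have "\<kappa>^2 < (q W)^2" using k const_facts(4) by (intro power_strict_mono) auto
  then have b0: "0 < bump1 (\<kappa>^2) ((q W)^2)" by (rule bump1_range(3))
  have q0: "0 < q W" using k const_facts(4) by linarith
  have "a * norm (drift W) <= a * (q W + C1)" by (rule mult_left_mono[OF drift_le[OF W] const_facts(1)])
  then have "2 * err L W <= 2 * (b + a * C1) + 2 * a * q W" by (simp add: algebra_simps)
  also have "2 * a * q W <= \<gamma> / 2 * q W" using small q0 by (intro mult_right_mono) auto
  also have "2 * (b + a * C1) < \<gamma> / 2 * q W"
  proof -
   have "4 * (b + a * C1) / \<gamma> < q W" using k unfolding drift_radius_def by linarith
   then show ?thesis using \<gamma> by (simp add: field_simps)
  qed
  finally have "2 * err L W < \<gamma> * q W" by simp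
  then have "2 * err L W * q W < \<gamma> * q W * q W" using q0 by (rule mult_strict_right_mono)
  then show ?thesis unfolding gain_def using b0 by (simp add: power2_eq_square)
 qed
 show "\<kappa> < q W ==> 0 < gain (q W) W" by (rule *)
 show "0 <= gain (q W) W"
  using * gain_bound(2)[of "q W" W] by (cases "\<kappa> < q W") auto
qed

text \<open>Where the far field diverges, the drift vanishes by convention and the integrand of the gain
 has a sign anyway.\<close>

lemma two_scale_lower_bound:
 assumes W: "norm W <= R" and \<epsilon>: "0 < \<epsilon>" and n: "L <= n" "L <= n'"
 shows "cv W * (logcut \<epsilon> ((r n' W)^2) * gain (r n W) W - loss \<epsilon> (r n W) (r n' W) W)
  <= 2 * bump1 (\<kappa>^2) ((r n W)^2) * logcut \<epsilon> ((r n' W)^2) * radial_flux \<gamma> g \<nu> L n W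
  + 2 * bump (\<kappa>^2) ((r n W)^2) * logcut1 \<epsilon> ((r n' W)^2) * radial_flux \<gamma> g \<nu> L n' W
  + 4 * \<epsilon> * (\<gamma> + 2 * b)"
  (is "?l <= ?T1 + ?T2 + ?c")
proof -
 note fb = flux_bound[OF W L1 n(1)] flux_bound[OF W L1 n(2)]
 have e: "0 <= err L W" by (rule err_nonneg)
 have z: "0 <= logcut \<epsilon> ((r n' W)^2)" by (rule logcut_range(1)[OF \<epsilon>]) simp
 have p1: "0 <= 2 * bump1 (\<kappa>^2) ((r n W)^2) * logcut \<epsilon> ((r n' W)^2)"
  by (intro mult_nonneg_nonneg z bump1_range) simp
 have "\<gamma> * (r n W)^2 - 2 * err L W * r n W <= radial_flux \<gamma> g \<nu> L n W" using fb(1) by linarith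
 from mult_left_mono[OF this p1]
 have T1: "logcut \<epsilon> ((r n' W)^2) * gain (r n W) W <= ?T1" unfolding gain_def by (simp only: mult_ac)
 have "\<bar>radial_flux \<gamma> g \<nu> L n' W\<bar> <= \<gamma> * (r n' W)^2 + 2 * err L W * r n' W"
  using fb(2) \<gamma> by (smt (verit) mult_nonneg_nonneg zero_le_power2)
 then have "\<bar>?T2\<bar> <= loss \<epsilon> (r n W) (r n' W) W"
  unfolding loss_def abs_mult using bump_range(1)[of "\<kappa>^2" "(r n W)^2"]
  by (simp add: abs_of_nonneg mult.assoc mult_left_mono)
 then have T2: "- loss \<epsilon> (r n W) (r n' W) W <= ?T2" by linarith
 have c0: "0 <= ?c" using \<epsilon> \<gamma> const_facts by simp
 show ?thesis
 proof (cases "far_conv W")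
  case True then show ?thesis using T1 T2 c0 by simp
 next
  case False
  then have d: "drift W = 0" by (simp add: drift_def)
  have g0: "0 <= gain (r n W) W"
  proof (cases "r n W <= \<kappa>")
   case True then show ?thesis by (simp add: gain_bound(2))
  next
   case False
   have "2 * b <= \<gamma> * \<kappa>"
    unfolding drift_radius_def using \<gamma> const_facts by (simp add: field_simps)
   also have "... <= \<gamma> * r n W" using False \<gamma> by simp
   finally have "2 * b * r n W <= \<gamma> * r n W * r n W" by (rule mult_right_mono) simp
   then show ?thesis unfolding gain_def d using bump1_range(1)[of "\<kappa>^2" "(r n W)^2"]
    by (simp add: power2_eq_square)
  qed
  have "loss \<epsilon> (r n W) (r n' W) W <= ?c"
   using loss_bound(2)[of "r n W" "r n' W" \<epsilon> W] \<epsilon> d by simp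
  then have "0 <= ?T1 + ?T2 + ?c" using T1 T2 mult_nonneg_nonneg[OF z g0] by linarith
  then show ?thesis using False by simp
 qed
qed

lemma measurable_gain [measurable]: "(%W. gain (h W) W) \<in> Borel"
 if [measurable]: "h \<in> Borel"
 unfolding gain_def by measurable

lemma measurable_loss [measurable]: "(%W. loss \<epsilon> (h W) (k W) W) \<in> Borel"
 if [measurable]: "h \<in> Borel" "k \<in> Borel"
 unfolding loss_def by measurable

lemma profile_continuous:
 "continuous_on {0..} (logcut \<epsilon>)" "continuous_on {0..} (logcut1 \<epsilon>)" "continuous_on {0..} (bump1 c)"
 using C1_pair_continuous[OF logcut_pair] logcut_pair bump_pair by (auto simp: C1_pair_def)

lemma profile_tendsto:
 assumes c: "continuous_on {0 :: real..} h" and x: "x ----> y"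
 shows "(%n. h ((x n)^2) :: real) ----> h (y^2)"
 by (rule continuous_on_tendsto_compose[OF c]) (auto intro!: tendsto_intros x)

lemma r_tendsto:
 assumes "far_conv W"
 shows "(%m. r (m + L) W) ----> q W"
 by (rule tendsto_norm[OF LIMSEQ_ignore_initial_segment[OF zfar_tendsto[OF assms]]])

definition loss_const :: real where
 "loss_const = 4 * (\<gamma> + 2 * b) + 4 * (\<gamma> + 2 * a + 2 * (b + a * C1))"

lemma loss_limit_bound:
 assumes W: "norm W <= R" and \<epsilon>: "0 < \<epsilon>" and x: "0 <= x"
 shows "loss \<epsilon> x (q W) W <= 4 * \<epsilon> * (\<gamma> + 2 * a + 2 * (b + a * C1))"
proof -
 let ?C = "\<gamma> + 2 * a + 2 * (b + a * C1)"
 have C0: "0 <= a * C1" using const_facts by simp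
 have "a * norm (drift W) <= a * (q W + C1)" by (rule mult_left_mono[OF drift_le[OF W] const_facts(1)])
 then have "err L W <= (b + a * C1) + a * q W" by (simp add: algebra_simps)
 then have "2 * err L W * q W <= 2 * ((b + a * C1) + a * q W) * q W" by (intro mult_right_mono) auto
 then have "\<gamma> * (q W)^2 + 2 * err L W * q W <= (\<gamma> + 2 * a) * (q W)^2 + 2 * (b + a * C1) * q W"
  by (simp add: power2_eq_square algebra_simps)
 also have "... <= ?C * (1 + (q W)^2)"
  by (rule quadratic_growth) (use \<gamma> const_facts C0 in auto)
 finally have "\<bar>logcut1 \<epsilon> ((q W)^2)\<bar> * (\<gamma> * (q W)^2 + 2 * err L W * q W)
   <= \<bar>logcut1 \<epsilon> ((q W)^2)\<bar> * (?C * (1 + (q W)^2))" by (rule mult_left_mono) simp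
 also have "... = (\<bar>logcut1 \<epsilon> ((q W)^2)\<bar> * (1 + (q W)^2)) * ?C" by (simp only: mult_ac)
 also have "... <= 2 * \<epsilon> * ?C"
  by (intro mult_right_mono logcut_range(3)[OF \<epsilon>]) (use \<gamma> const_facts C0 in auto)
 finally have l: "\<bar>logcut1 \<epsilon> ((q W)^2)\<bar> * (\<gamma> * (q W)^2 + 2 * err L W * q W) <= 2 * \<epsilon> * ?C" .
 have "loss \<epsilon> x (q W) W <= 2 * 1 * (2 * \<epsilon> * ?C)"
  unfolding loss_def by (rule mult_mono[OF mult_left_mono[OF bump_range(2)] l]) (use \<gamma> err_nonneg[of L W] in auto)
 then show ?thesis by simp
qed

text \<open>The cutoff scale \<open>n'\<close> goes to infinity for fixed \<open>n\<close>, dominated by \<open>drift_far_integrable\<close>. In the limit the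
 cutoff confines the full far field, and with it the drift; its cost is of order \<open>\<epsilon>\<close> because of the
 logarithmic profile.\<close>

lemma gain_average:
 assumes \<epsilon>: "0 < \<epsilon>" and n: "L <= n"
 shows "(LINT W|\<mu>. cv W * (logcut \<epsilon> ((q W)^2) * gain (r n W) W)) <= loss_const * \<epsilon>"
proof -
 define G where "G m W = cv W * (logcut \<epsilon> ((r (m + L) W)^2) * gain (r n W) W - loss \<epsilon> (r n W) (r (m + L) W) W)" for m W
 define G' where "G' W = cv W * (logcut \<epsilon> ((q W)^2) * gain (r n W) W - loss \<epsilon> (r n W) (q W) W)" for W
 define H where "H W = (2 * K1 + 4 * \<epsilon>) * (\<gamma> + 2 * (b + a * (norm (drift W) * indicator {W. \<kappa> <= r n W} W)))" for W
 have [measurable]: "G m \<in> Borel" "G' \<in> Borel" for m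
  unfolding G_def G'_def by measurable
 have "0 < \<kappa>" using const_facts(4) by linarith
 from drift_far_integrable[OF this L1 n] have iH: "integrable \<mu> H"
  unfolding H_def by (intro integrable_mult_right Bochner_Integration.integrable_add integrable_const)
 have K0: "0 <= 2 * K1 + 4 * \<epsilon>" using \<epsilon> by (simp add: add_nonneg_nonneg)
 have dom: "\<bar>cv W * (logcut \<epsilon> (y^2) * gain (r n W) W - loss')\<bar> <= H W"
  if l: "loss' = 0 \<or> loss' = loss \<epsilon> (r n W) y W" and y: "0 <= y" for W y loss'
 proof (cases "r n W <= \<kappa>")
  case True
  then have "cv W * (logcut \<epsilon> (y^2) * gain (r n W) W - loss') = 0"
   using gain_bound(2)[of "r n W" W] loss_bound(3)[of "r n W" y \<epsilon> W] \<epsilon> y l by auto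
  moreover have "0 <= H W" unfolding H_def
   by (rule mult_nonneg_nonneg[OF K0]) (use \<gamma> const_facts in \<open>simp add: add_nonneg_nonneg\<close>)
  ultimately show ?thesis by (metis abs_zero)
 next
  case False
  have e: "0 <= \<gamma> + 2 * err L W" using err_nonneg[of L W] \<gamma> by simp
  have "\<bar>logcut \<epsilon> (y^2) * gain (r n W) W\<bar> <= 1 * (2 * K1 * (\<gamma> + 2 * err L W))"
   unfolding abs_mult using logcut_range(1,2)[OF \<epsilon>, of "y^2"]
   by (intro mult_mono gain_bound(1)) auto
  moreover have "0 <= loss'" "loss' <= 4 * \<epsilon> * (\<gamma> + 2 * err L W)"
   using l loss_bound(1,2)[of "r n W" y \<epsilon> W] y \<epsilon> e by auto
  ultimately have "\<bar>logcut \<epsilon> (y^2) * gain (r n W) W - loss'\<bar> <= 2 * K1 * (\<gamma> + 2 * err L W) + 4 * \<epsilon> * (\<gamma> + 2 * err L W)"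
   by linarith
  also have "... = H W" using False unfolding H_def by (simp add: algebra_simps)
  finally have "\<bar>logcut \<epsilon> (y^2) * gain (r n W) W - loss'\<bar> <= H W" .
  moreover have "\<bar>cv W * z\<bar> <= \<bar>z\<bar>" for z by (simp add: indicator_def)
  ultimately show ?thesis using order_trans by blast
 qed
 have domG: "norm (G m W) <= norm (H W)" and domG': "norm (G' W) <= norm (H W)" for m W
  unfolding G_def G'_def real_norm_def by (rule order_trans[OF dom abs_ge_self]; simp)+
 have lim: "(%m. LINT W|\<mu>. G m W) ----> (LINT W|\<mu>. G' W)"
 proof (rule integral_dominated_convergence[where w = H])
  show "AE W in \<mu>. (%m. G m W) ----> G' W"
  proof (rule AE_I2)
   fix W
   show "(%m. G m W) ----> G' W"
   proof (cases "far_conv W")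
    case True
    note rt = r_tendsto[OF True]
    note pt = profile_tendsto[OF profile_continuous(1) rt] profile_tendsto[OF profile_continuous(2) rt]
    show ?thesis unfolding G_def G'_def loss_def by (intro tendsto_intros rt pt)
   next
    case False then show ?thesis by (simp add: G_def G'_def)
   qed
  qed
  show "AE W in \<mu>. norm (G m W) <= H W" for m
   unfolding G_def by (rule AE_I2) (use dom in simp)
 qed (use iH in measurable)
 have Gm: "(LINT W|\<mu>. G m W) <= 4 * \<epsilon> * (\<gamma> + 2 * b)" for m
 proof -
  have nm: "L <= m + L" by simp
  let ?T = "%W. 2 * bump1 (\<kappa>^2) ((r n W)^2) * logcut \<epsilon> ((r (m + L) W)^2) * radial_flux \<gamma> g \<nu> L n W
  + 2 * bump (\<kappa>^2) ((r n W)^2) * logcut1 \<epsilon> ((r (m + L) W)^2) * radial_flux \<gamma> g \<nu> L (m + L) W"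
  have T: "has_bochner_integral \<mu> ?T 0"
   by (rule two_scale_equation[OF sol bump_pair logcut_pair L1 n nm])
  then have Ti: "integrable \<mu> ?T" "(LINT W|\<mu>. ?T W) = 0" by (simp_all add: has_bochner_integral_iff)
  have "(LINT W|\<mu>. G m W) <= (LINT W|\<mu>. ?T W + 4 * \<epsilon> * (\<gamma> + 2 * b))"
  proof (rule integral_mono_AE)
   show "integrable \<mu> (G m)"
    by (rule Bochner_Integration.integrable_bound[OF iH]) (use domG in auto)
   show "integrable \<mu> (%W. ?T W + 4 * \<epsilon> * (\<gamma> + 2 * b))" by (rule Bochner_Integration.integrable_add[OF Ti(1) integrable_const])
   show "AE W in \<mu>. G m W <= ?T W + 4 * \<epsilon> * (\<gamma> + 2 * b)"
    using supp
   proof eventually_elim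
    case (elim W)
    show ?case unfolding G_def by (rule two_scale_lower_bound[OF elim \<epsilon> n nm])
   qed
  qed
  also have "... = 4 * \<epsilon> * (\<gamma> + 2 * b)"
   using Ti by (simp add: Bochner_Integration.integral_add[OF Ti(1) integrable_const] prob_space)
  finally show ?thesis .
 qed
 have iG': "integrable \<mu> G'"
  by (rule Bochner_Integration.integrable_bound[OF iH]) (use domG' in auto)
 have G': "(LINT W|\<mu>. G' W) <= 4 * \<epsilon> * (\<gamma> + 2 * b)"
  by (rule LIMSEQ_le_const2[OF lim]) (use Gm in auto)
 have "(LINT W|\<mu>. cv W * (logcut \<epsilon> ((q W)^2) * gain (r n W) W))
  <= (LINT W|\<mu>. G' W + 4 * \<epsilon> * (\<gamma> + 2 * a + 2 * (b + a * C1)))"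
 proof (rule integral_mono_AE)
  show "integrable \<mu> (%W. cv W * (logcut \<epsilon> ((q W)^2) * gain (r n W) W))"
  proof (rule Bochner_Integration.integrable_bound[OF iH])
   have "\<bar>cv W * (logcut \<epsilon> ((q W)^2) * gain (r n W) W)\<bar> <= H W" for W
    using dom[of 0 W "q W"] by simp
   then have "norm (cv W * (logcut \<epsilon> ((q W)^2) * gain (r n W) W)) <= norm (H W)" for W
    by (metis abs_ge_self order_trans real_norm_def)
   then show "AE W in \<mu>. norm (cv W * (logcut \<epsilon> ((q W)^2) * gain (r n W) W)) <= norm (H W)" by simp
  qed measurable
  show "integrable \<mu> (%W. G' W + 4 * \<epsilon> * (\<gamma> + 2 * a + 2 * (b + a * C1)))"
   by (rule Bochner_Integration.integrable_add[OF iG' integrable_const])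
  show "AE W in \<mu>. cv W * (logcut \<epsilon> ((q W)^2) * gain (r n W) W) <= G' W + 4 * \<epsilon> * (\<gamma> + 2 * a + 2 * (b + a * C1))"
   using supp
  proof eventually_elim
   case (elim W)
   have "0 <= 4 * \<epsilon> * (\<gamma> + 2 * a + 2 * (b + a * C1))" using \<epsilon> \<gamma> const_facts by simp
   then show ?case
    using loss_limit_bound[OF elim \<epsilon>, of "r n W"] by (simp add: G'_def indicator_def)
  qed
 qed
 also have "... = (LINT W|\<mu>. G' W) + 4 * \<epsilon> * (\<gamma> + 2 * a + 2 * (b + a * C1))"
  by (simp add: Bochner_Integration.integral_add[OF iG' integrable_const] prob_space)
 also have "... <= loss_const * \<epsilon>" using G' by (simp add: loss_const_def algebra_simps)
 finally show ?thesis .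
qed

lemma gain_bounded_region:
 assumes W: "norm W <= R" and x: "0 <= x" and T: "(q W)^2 <= T"
 shows "\<bar>gain x W\<bar> <= 2 * K1 * (\<gamma> + 2 * (b + a * (1 + T + C1)))"
proof -
 have "q W <= 1 + (q W)^2" 
 proof -
  have "0 <= (q W - 1)^2" by simp
  then have "2 * q W <= 1 + (q W)^2" by (simp add: power2_diff)
  then show ?thesis using norm_ge_zero[of "drift W - nearpart L W"] by linarith
 qed
 then have "norm (drift W) <= 1 + T + C1" using drift_le[OF W] T by linarith
 then have "a * norm (drift W) <= a * (1 + T + C1)" by (rule mult_left_mono) (rule const_facts)
 then have "2 * K1 * (\<gamma> + 2 * err L W) <= 2 * K1 * (\<gamma> + 2 * (b + a * (1 + T + C1)))"
  by (intro mult_left_mono) (auto simp: add_nonneg_nonneg)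
 with gain_bound(1)[OF x, of W] show ?thesis by linarith
qed

text \<open>The support of the cutoff now bounds the drift, so dominated convergence applies as \<open>n \<rightarrow> \<infinity>\<close>.\<close>

lemma limit_gain_average:
 assumes \<epsilon>: "0 < \<epsilon>"
 shows "integrable \<mu> (%W. cv W * (logcut \<epsilon> ((q W)^2) * gain (q W) W))"
  and "(LINT W|\<mu>. cv W * (logcut \<epsilon> ((q W)^2) * gain (q W) W)) <= loss_const * \<epsilon>"
proof -
 define M where "M = 2 * K1 * (\<gamma> + 2 * (b + a * (1 + exp (1 / \<epsilon>) + C1)))"
 have M0: "0 <= M" unfolding M_def using \<gamma> const_facts by (intro mult_nonneg_nonneg add_nonneg_nonneg) auto
 have bd: "\<bar>cv W * (logcut \<epsilon> ((q W)^2) * gain x W)\<bar> <= M" if W: "norm W <= R" and x: "0 <= x" for W x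
 proof (cases "logcut \<epsilon> ((q W)^2) = 0")
  case False
  then have "(q W)^2 <= exp (1 / \<epsilon>)" by (rule logcut_range(4)[OF \<epsilon>, rotated]) simp
  from gain_bounded_region[OF W x this]
  have "\<bar>logcut \<epsilon> ((q W)^2) * gain x W\<bar> <= 1 * M"
   unfolding abs_mult M_def using logcut_range(1,2)[OF \<epsilon>, of "(q W)^2"] by (intro mult_mono) auto
  then show ?thesis using M0 by (simp add: indicator_def)
 qed (use M0 in simp)
 show "integrable \<mu> (%W. cv W * (logcut \<epsilon> ((q W)^2) * gain (q W) W))"
  by (rule integrable_const_bound[of _ M]) (use supp bd in auto)
 have "(%m. LINT W|\<mu>. cv W * (logcut \<epsilon> ((q W)^2) * gain (r (m + L) W) W))
   ----> (LINT W|\<mu>. cv W * (logcut \<epsilon> ((q W)^2) * gain (q W) W))"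
 proof (rule integral_dominated_convergence[where w = "%_. M"])
  show "AE W in \<mu>. (%m. cv W * (logcut \<epsilon> ((q W)^2) * gain (r (m + L) W) W))
    ----> cv W * (logcut \<epsilon> ((q W)^2) * gain (q W) W)"
  proof (rule AE_I2)
   fix W
   show "(%m. cv W * (logcut \<epsilon> ((q W)^2) * gain (r (m + L) W) W))
    ----> cv W * (logcut \<epsilon> ((q W)^2) * gain (q W) W)"
   proof (cases "far_conv W")
    case True
    note rt = r_tendsto[OF True]
    show ?thesis unfolding gain_def
     by (intro tendsto_intros rt profile_tendsto[OF profile_continuous(3) rt])
   qed simp
  qed
  show "AE W in \<mu>. norm (cv W * (logcut \<epsilon> ((q W)^2) * gain (r (m + L) W) W)) <= M" for m
   using supp by eventually_elim (use bd in simp)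
 qed (auto intro: integrable_const)
 then show "(LINT W|\<mu>. cv W * (logcut \<epsilon> ((q W)^2) * gain (q W) W)) <= loss_const * \<epsilon>"
  by (rule LIMSEQ_le_const2) (use gain_average[OF \<epsilon>] in auto)
qed

text \<open>The limit integrand is nonnegative and its cutoff average is \<open>O(\<epsilon>)\<close>, while the cutoff stays above \<open>1/4\<close>
 on a fixed ball once \<open>\<epsilon>\<close> is small.\<close>

lemma limit_gain_zero:
 assumes T: "0 <= T"
 shows "AE W in \<mu>. far_conv W \<and> (q W)^2 <= T --> q W <= \<kappa>"
proof -
 define f where "f W = cv W * (indicator {W. (q W)^2 <= T} W * gain (q W) W)" for W
 define M where "M = 2 * K1 * (\<gamma> + 2 * (b + a * (1 + T + C1)))"
 have M0: "0 <= M" unfolding M_def using \<gamma> const_facts T by (intro mult_nonneg_nonneg add_nonneg_nonneg) auto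
 have [measurable]: "f \<in> Borel" unfolding f_def by measurable
 have fi: "integrable \<mu> f"
 proof (rule integrable_const_bound[of _ M])
  show "AE W in \<mu>. norm (f W) <= M"
   using supp
  proof eventually_elim
   case (elim W)
   show ?case
    using gain_bounded_region[OF elim, of "q W" T] M0 by (auto simp: f_def M_def indicator_def)
  qed
 qed measurable
 have f0: "AE W in \<mu>. 0 <= f W"
  using supp by eventually_elim (use gain_limit_pos(1) in \<open>simp add: f_def indicator_def\<close>)
 have le: "(LINT W|\<mu>. f W) <= 4 * (loss_const * \<epsilon>)" if \<epsilon>: "0 < \<epsilon>" "\<epsilon> * ln (1 + T) <= 1/2" for \<epsilon>
 proof -
  have "(LINT W|\<mu>. f W) <= (LINT W|\<mu>. 4 * (cv W * (logcut \<epsilon> ((q W)^2) * gain (q W) W)))"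
  proof (rule integral_mono_AE[OF fi])
   show "integrable \<mu> (%W. 4 * (cv W * (logcut \<epsilon> ((q W)^2) * gain (q W) W)))"
    by (rule integrable_mult_right[OF limit_gain_average(1)[OF \<epsilon>(1)]])
   show "AE W in \<mu>. f W <= 4 * (cv W * (logcut \<epsilon> ((q W)^2) * gain (q W) W))"
    using supp
   proof eventually_elim
    case (elim W)
    have g0: "0 <= gain (q W) W" by (rule gain_limit_pos(1)[OF elim])
    have l0: "0 <= logcut \<epsilon> ((q W)^2)" by (rule logcut_range(1)[OF \<epsilon>(1)]) simp
    show ?case
    proof (cases "far_conv W \<and> (q W)^2 <= T")
     case True
     then have "ln (1 + (q W)^2) <= ln (1 + T)" by (intro ln_mono) (auto simp: add_pos_nonneg)
     then have "\<epsilon> * ln (1 + (q W)^2) <= \<epsilon> * ln (1 + T)" using \<epsilon> by (intro mult_left_mono) auto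
     then have "1/4 <= logcut \<epsilon> ((q W)^2)" using \<epsilon>(2) by (intro logcut_range(5)[OF \<epsilon>(1)]) auto
     from mult_right_mono[OF this g0] show ?thesis using True by (simp add: f_def)
    next
     case False
     then have "f W = 0" by (auto simp: f_def)
     then show ?thesis using g0 l0 by (simp add: indicator_def)
    qed
   qed
  qed
  also have "... <= 4 * (loss_const * \<epsilon>)" using limit_gain_average(2)[OF \<epsilon>(1)] by simp
  finally show ?thesis .
 qed
 have lc: "0 <= loss_const" unfolding loss_const_def using \<gamma> const_facts by simp
 have "(LINT W|\<mu>. f W) <= 0"
 proof (rule ccontr)
  assume I: "\<not> ?thesis"
  define I where "I = (LINT W|\<mu>. f W)"
  have I0: "0 < I" using I by (simp add: I_def)
  \<comment> \<open>the first bound keeps the cutoff above \<open>1/4\<close>, the second makes the cost smaller than \<open>I\<close>\<close>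
  define \<epsilon> where "\<epsilon> = min (1 / (2 * (ln (1 + T) + 1))) (I / (8 * (loss_const + 1)))"
  have lnK: "0 <= ln (1 + T)" using T by simp
  have \<epsilon>: "0 < \<epsilon>" using lnK I0 lc by (simp add: \<epsilon>_def)
  have "\<epsilon> * ln (1 + T) <= 1 / (2 * (ln (1 + T) + 1)) * ln (1 + T)"
   by (rule mult_right_mono[OF _ lnK]) (simp add: \<epsilon>_def)
  also have "... <= 1/2" using lnK by (simp add: field_simps)
  finally have "I <= 4 * (loss_const * \<epsilon>)" unfolding I_def by (rule le[OF \<epsilon>])
  also have "... <= 4 * (loss_const * (I / (8 * (loss_const + 1))))"
   using lc by (intro mult_left_mono) (auto simp: \<epsilon>_def)
  also have "... = I / 2 * (loss_const / (loss_const + 1))" using lc by (simp add: field_simps)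
  also have "... <= I / 2 * 1" by (rule mult_left_mono) (use lc I0 in auto)
  finally show False using I0 by simp
 qed
 moreover have "0 <= (LINT W|\<mu>. f W)" by (rule integral_nonneg_AE[OF f0])
 ultimately have "(LINT W|\<mu>. f W) = 0" by linarith
 then have "AE W in \<mu>. f W = 0" using integral_nonneg_eq_0_iff_AE[OF fi f0] by simp
 with supp show ?thesis
 proof eventually_elim
  case (elim W)
  show ?case
  proof (intro impI)
   assume "far_conv W \<and> (q W)^2 <= T"
   then have "gain (q W) W = 0" using elim(2) by (simp add: f_def)
   then show "q W <= \<kappa>" using gain_limit_pos(2)[OF elim(1)] by (metis less_irrefl not_le)
  qed
 qed
qed

theorem drift_bounded: "AE W in \<mu>. norm (drift W) <= \<kappa> + C1"
proof -
 have "AE W in \<mu>. \<forall>k. far_conv W \<and> (q W)^2 <= real k --> q W <= \<kappa>"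
  unfolding AE_all_countable by (intro allI limit_gain_zero) simp
 with supp show ?thesis
 proof eventually_elim
  case (elim W)
  show ?case
  proof (cases "far_conv W")
   case True
   obtain k where "(q W)^2 <= real k" using real_arch_simple by blast
   then have "q W <= \<kappa>" using elim(2) True by blast
   then show ?thesis using drift_le[OF elim(1)] by linarith
  next
   case False
   then show ?thesis using const_facts by (simp add: drift_def)
  qed
 qed
qed

end

section \<open>Passage to the limit\<close>

text \<open>The far field beyond the radius \<open>L\<close> is at most \<open>t L\<close>, at all outer radii \<open>n\<close>. Apart from the norm, only
 weakly continuous functions of the vorticity occur, so this condition survives weak limits of measures, unlike
 a bound on the drift.\<close>

definition confined :: "real => (nat => real) => l2 => bool" where
 "confined R t W \<longleftrightarrow> norm W <= R \<and> (\<forall>L\<ge>1. \<forall>n\<ge>L. norm (zfar L n W) <= t L)"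

lemma confined_far_conv:
 assumes c: "confined R t W" and t: "t ----> 0"
 shows "far_conv W" and "1 <= L ==> norm (drift W - nearpart L W) <= t L"
proof -
 have "Cauchy (%n. inner W (vvec n i))" for i
 proof (rule metric_CauchyI)
  fix e :: real assume "0 < e"
  then have "\<forall>\<^sub>F L in sequentially. t L < e / 2" by (intro order_tendstoD(2)[OF t]) simp
  then have "\<forall>\<^sub>F L in sequentially. t L < e / 2 \<and> 1 <= L" by (intro eventually_conj eventually_ge_at_top)
  then obtain L where L: "t L < e / 2" "1 <= L" unfolding eventually_sequentially by blast
  have z: "\<bar>inner W (vvec n i) - inner W (vvec L i)\<bar> < e / 2" if "L <= n" for n
  proof -
   have "\<bar>zfar L n W $ i\<bar> <= norm (zfar L n W)" by (rule component_le_norm_cart)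
   also have "... <= t L" using c L(2) that unfolding confined_def by blast
   finally show ?thesis using L(1) by (simp add: zfar_def inner_diff_right)
  qed
  have "\<forall>m\<ge>L. \<forall>n\<ge>L. dist (inner W (vvec m i)) (inner W (vvec n i)) < e"
  proof (intro allI impI)
   fix m n assume "L <= m" "L <= n"
   from z[OF this(1)] z[OF this(2)] show "dist (inner W (vvec m i)) (inner W (vvec n i)) < e"
    unfolding dist_real_def by linarith
  qed
  then show "\<exists>M. \<forall>m\<ge>M. \<forall>n\<ge>M. dist (inner W (vvec m i)) (inner W (vvec n i)) < e" by blast
 qed
 then show f: "far_conv W" unfolding far_conv_iff by (simp add: Cauchy_convergent_iff)
 show "norm (drift W - nearpart L W) <= t L" if "1 <= L"
 proof (rule LIMSEQ_le_const2[OF tendsto_norm[OF zfar_tendsto[OF f]]])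
  show "\<exists>N. \<forall>n\<ge>N. norm (zfar L n W) <= t L"
   using c that unfolding confined_def by blast
 qed
qed

lemma zfar_wcont: "wcont_on_ball R (%W. max 0 (norm (zfar L n W) - c))"
 unfolding wcont_on_ball_def
proof (intro allI impI)
 fix X x assume X: "(\<forall>n. norm (X n) <= R) \<and> wconv X x"
 have "(%m. zfar L n (X m)) ----> zfar L n x"
  by (rule vec_tendstoI) (use X in \<open>simp add: zfar_def wconvD\<close>)
 then show "(%m. max 0 (norm (zfar L n (X m)) - c)) ----> max 0 (norm (zfar L n x) - c)"
  by (intro tendsto_intros)
qed

text \<open>The excess of the far field over its bound is a weakly continuous function of mean zero.\<close>

lemma confined_limit:
 assumes \<mu>0: "borel_probability \<mu>0" and R: "AE W in \<mu>0. norm W <= R"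
  and c: "!!n. AE W in \<mu> n. confined R t W" and \<mu>: "!!n. borel_probability (\<mu> n)"
  and lim: "!!F. F \<in> Borel ==> wcont_on_ball R F ==>
   (%n. LINT W|\<mu> n. F W) ----> (LINT W|\<mu>0. F W)"
 shows "AE W in \<mu>0. confined R t W"
proof -
 have one: "AE W in \<mu>0. norm (zfar L n W) <= t L" if L: "1 <= L" "L <= n" for L n
 proof -
  let ?F = "%W. max 0 (norm (zfar L n W) - t L)"
  have "(LINT W|\<mu> k. ?F W) = 0" for k
  proof (rule integral_eq_zero_AE)
   show "AE W in \<mu> k. ?F W = 0"
    using c[of k] by eventually_elim (use L in \<open>simp add: confined_def\<close>)
  qed
  moreover have "(%k. LINT W|\<mu> k. ?F W) ----> (LINT W|\<mu>0. ?F W)"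
   by (rule lim[OF _ zfar_wcont]) measurable
  ultimately have "(LINT W|\<mu>0. ?F W) = 0" by (simp add: LIMSEQ_const_iff)
  moreover have "integrable \<mu>0 ?F" by (rule wcont_bounded_integrable[OF \<mu>0 R zfar_wcont])
  ultimately have "AE W in \<mu>0. ?F W = 0"
   using integral_nonneg_eq_0_iff_AE[of \<mu>0 ?F] by simp
  then show ?thesis by eventually_elim (simp add: max_def split: if_splits)
 qed
 have "AE W in \<mu>0. \<forall>L n. 1 <= L \<and> L <= n --> norm (zfar L n W) <= t L"
  unfolding AE_all_countable using one by (auto simp: AE_conj_iff intro: AE_I2)
 with R show ?thesis by eventually_elim (auto simp: confined_def)
qed

lemma integral_close:
 assumes \<mu>: "prob_space \<mu>" and f: "integrable \<mu> f" "integrable \<mu> h" and c: "AE x in \<mu>. \<bar>f x - h x\<bar> <= (c :: real)"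
 shows "\<bar>(LINT x|\<mu>. f x) - (LINT x|\<mu>. h x)\<bar> <= c"
proof -
 interpret prob_space \<mu> by fact
 have "\<bar>(LINT x|\<mu>. f x) - (LINT x|\<mu>. h x)\<bar> = \<bar>LINT x|\<mu>. f x - h x\<bar>"
  using f by simp
 also have "... <= (LINT x|\<mu>. \<bar>f x - h x\<bar>)" by (rule integral_abs_bound)
 also have "... <= (LINT x|\<mu>. c)"
  by (rule integral_mono_AE) (use f c in auto)
 finally show ?thesis by (simp add: prob_space)
qed

text \<open>Replacing the drift by the far field inside the radius \<open>L\<close> makes the integrand weakly continuous at
 the price of an error of order \<open>t L\<close>, uniformly in the viscosity. The limits are taken first in
 the viscosity and then in \<open>L\<close>.\<close>

lemma euler_limit:
 assumes j: "is_mollifier j" and \<Psi>: "\<Psi> \<in> test_functionals j"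
  and \<mu>0: "borel_probability \<mu>0" and c0: "AE W in \<mu>0. confined R t W"
  and sol: "!!n. stat_sol_NS j \<gamma> g (\<nu> n) (\<mu> n)" and c: "!!n. AE W in \<mu> n. confined R t W"
  and \<nu>: "\<nu> ----> 0" and t: "t ----> 0"
  and lim: "!!F. F \<in> Borel ==> wcont_on_ball R F ==>
   (%n. LINT W|\<mu> n. F W) ----> (LINT W|\<mu>0. F W)"
 shows "has_bochner_integral \<mu>0 (%W. euler_pairing \<gamma> g W (func_deriv \<Psi> W)) 0"
proof -
 define P where "P = func_deriv \<Psi>"
 have gf: "gradient_family_on r P" for r unfolding P_def by (rule gradient_family_test_functional[OF j \<Psi>])
 have P: "C2_0 (P W)" for W
  using gf[of "norm W"] unfolding gradient_family_on_def C2_bounds_def by blast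
 have \<mu>: "borel_probability (\<mu> n)" for n using sol[of n] by (simp add: stat_sol_NS_def)
 have ps: "prob_space (\<mu> n)" "prob_space \<mu>0" for n using \<mu>[of n] \<mu>0 by (simp_all add: borel_probability_def)
 have [measurable_cong]: "sets (\<mu> n) = sets borel" "sets \<mu>0 = sets borel" for n
  using \<mu>[of n] \<mu>0 by (simp_all add: borel_probability_def)
 have R: "AE W in \<mu> n. norm W <= R" "AE W in \<mu>0. norm W <= R" for n
  using c[of n] c0 by (auto simp: confined_def)
 note wc = wcont_gradient_family[OF gf]
 obtain KD1 where D1: "!!W. norm W <= R ==> \<bar>dpart W (P W) 1\<bar> <= KD1" and D10: "0 <= KD1"
  using wcont_on_ball_bounded[OF wc(2)[of R 1]] by blast
 obtain KD2 where D2: "!!W. norm W <= R ==> \<bar>dpart W (P W) 2\<bar> <= KD2" and D20: "0 <= KD2"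
  using wcont_on_ball_bounded[OF wc(2)[of R 2]] by blast
 define M where "M = KD1 + KD2"
 have D: "\<bar>dpart W (P W) i\<bar> <= M" if "norm W <= R" for W i
  by (rule forall_2_cases) (use D1[OF that] D2[OF that] D10 D20 in \<open>simp_all add: M_def\<close>)
 obtain K\<Lambda> where \<Lambda>: "!!W. norm W <= R ==> \<bar>inner W (abs_l2 (laplacian (P W)))\<bar> <= K\<Lambda>" and \<Lambda>0: "0 <= K\<Lambda>"
  using wcont_on_ball_bounded[OF wc(3)[of R]] by blast
 define N where "N v W = ns_term \<gamma> g v W (P W)" for v W
 define Q where "Q L W = regpart \<gamma> g 0 W (P W) - (\<Sum>i\<in>UNIV. nearpart L W $ i * dpart W (P W) i)" for L W
 have Qw: "wcont_on_ball r (Q L)" for r L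
  unfolding wcont_on_ball_def
 proof (intro allI impI)
  fix X x assume X: "(\<forall>n. norm (X n) <= r) \<and> wconv X x"
  then have Xr: "!!n. norm (X n) <= r" and Xw: "wconv X x" by auto
  have n: "(%n. nearpart L (X n) $ i) ----> nearpart L x $ i" for i
   using wconvD[OF Xw] by (simp add: nearpart_def)
  show "(%n. Q L (X n)) ----> Q L x"
   unfolding Q_def
   by (intro tendsto_diff tendsto_sum tendsto_mult n wcont_on_ballD[OF wc(1) Xr Xw] wcont_on_ballD[OF wc(2) Xr Xw])
 qed
 have Qm: "Q L \<in> Borel" for L by (rule borel_measurable_wcont[OF Qw])
 have Qi: "integrable (\<mu> n) (Q L)" "integrable \<mu>0 (Q L)" for n L
  by (rule wcont_bounded_integrable[OF \<mu> R(1) Qw] wcont_bounded_integrable[OF \<mu>0 R(2) Qw])+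
 have close: "\<bar>N v W - Q L W\<bar> <= 2 * M * t L + \<bar>v\<bar> * K\<Lambda>" if W: "confined R t W" and L: "1 <= L" for W v L
 proof -
  have r: "norm W <= R" using W by (simp add: confined_def)
  have "\<bar>\<Sum>i\<in>UNIV. (drift W - nearpart L W) $ i * dpart W (P W) i\<bar> <= 2 * M * norm (drift W - nearpart L W)"
   by (rule sum_coord_le[OF D[OF r]])
  also have "... <= 2 * M * t L"
   by (rule mult_left_mono[OF confined_far_conv(2)[OF W t L]]) (use D10 D20 in \<open>simp add: M_def\<close>)
  finally have d: "\<bar>\<Sum>i\<in>UNIV. (drift W - nearpart L W) $ i * dpart W (P W) i\<bar> <= 2 * M * t L" .
  have l: "\<bar>v * inner W (abs_l2 (laplacian (P W)))\<bar> <= \<bar>v\<bar> * K\<Lambda>"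
   unfolding abs_mult by (rule mult_left_mono[OF \<Lambda>[OF r]]) simp
  have "N v W - Q L W = - (\<Sum>i\<in>UNIV. (drift W - nearpart L W) $ i * dpart W (P W) i)
   - v * inner W (abs_l2 (laplacian (P W)))"
   unfolding N_def Q_def ns_term_def regpart_def by (simp add: sum_2 algebra_simps)
  then show ?thesis using d l by linarith
 qed
 have Nsol: "has_bochner_integral (\<mu> n) (N (\<nu> n)) 0" for n
 proof -
  have "has_bochner_integral (\<mu> n) (%W. euler_pairing \<gamma> g W (func_deriv \<Psi> W)
      + \<nu> n * (- pairing (laplacian (func_deriv \<Psi> W)) (rep_l2 W))) 0"
   using sol[of n] \<Psi> unfolding stat_sol_NS_def by blast
  then show ?thesis unfolding P_def[symmetric] ns_term_eq[OF P] N_def by simp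
 qed
 have Qn: "\<bar>LINT W|\<mu> n. Q L W\<bar> <= 2 * M * t L + \<bar>\<nu> n\<bar> * K\<Lambda>" if L: "1 <= L" for n L
 proof -
  have i: "integrable (\<mu> n) (N (\<nu> n))" "(LINT W|\<mu> n. N (\<nu> n) W) = 0"
   using Nsol[of n] by (simp_all add: has_bochner_integral_iff)
  have "AE W in \<mu> n. \<bar>N (\<nu> n) W - Q L W\<bar> <= 2 * M * t L + \<bar>\<nu> n\<bar> * K\<Lambda>"
   using c[of n] by eventually_elim (rule close[OF _ L])
  from integral_close[OF ps(1) i(1) Qi(1) this] show ?thesis using i(2) by simp
 qed
 have Q0: "\<bar>LINT W|\<mu>0. Q L W\<bar> <= 2 * M * t L" if L: "1 <= L" for L
 proof (rule LIMSEQ_le[OF tendsto_rabs[OF lim[OF Qm Qw]]])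
  have "(%n. 2 * M * t L + \<bar>\<nu> n\<bar> * K\<Lambda>) ----> 2 * M * t L + \<bar>0\<bar> * K\<Lambda>"
   by (intro tendsto_intros \<nu>)
  then show "(%n. 2 * M * t L + \<bar>\<nu> n\<bar> * K\<Lambda>) ----> 2 * M * t L" by simp
  show "\<exists>N. \<forall>n\<ge>N. \<bar>LINT W|\<mu> n. Q L W\<bar> <= 2 * M * t L + \<bar>\<nu> n\<bar> * K\<Lambda>" using Qn[OF L] by blast
 qed
 have c1: "AE W in \<mu>0. \<bar>N 0 W - Q L W\<bar> <= 2 * M * t L" if L: "1 <= L" for L
  using c0 by eventually_elim (use close[OF _ L, of _ 0] in simp)
 have N0m: "N 0 \<in> Borel" unfolding N_def by (rule measurable_ns_term[OF gf])
 have N0i: "integrable \<mu>0 (N 0)"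
 proof (rule Bochner_Integration.integrable_bound)
  interpret prob_space \<mu>0 by (rule ps)
  show "integrable \<mu>0 (%W. \<bar>Q 1 W\<bar> + 2 * M * t 1)" using Qi(2)[of 1] by auto
  show "N 0 \<in> borel_measurable \<mu>0" using N0m by measurable
  show "AE W in \<mu>0. norm (N 0 W) <= norm (\<bar>Q 1 W\<bar> + 2 * M * t 1)"
   using c1[OF order_refl]
  proof eventually_elim
   case (elim W)
   then show ?case unfolding real_norm_def by arith
  qed
 qed
 have "\<bar>LINT W|\<mu>0. N 0 W\<bar> <= 4 * M * t L" if L: "1 <= L" for L
  using integral_close[OF ps(2) N0i Qi(2) c1[OF L]] Q0[OF L] by linarith
 then have b: "\<exists>n0. \<forall>L\<ge>n0. \<bar>LINT W|\<mu>0. N 0 W\<bar> <= 4 * M * t L" by blast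
 have "(%L. 4 * M * t L) ----> 4 * M * 0" by (intro tendsto_intros t)
 from LIMSEQ_le_const[OF this b] have "(LINT W|\<mu>0. N 0 W) = 0" by simp
 moreover have "N 0 = (%W. euler_pairing \<gamma> g W (func_deriv \<Psi> W))"
 proof (rule ext)
  fix W
  show "N 0 W = euler_pairing \<gamma> g W (func_deriv \<Psi> W)"
   using ns_term_eq[OF P[of W], of \<gamma> g W 0] by (simp add: N_def P_def[symmetric])
 qed
 ultimately show ?thesis using N0i by (simp add: has_bochner_integral_iff)
qed

text \<open>The confinement scale depends on the viscosities only through an upper bound.\<close>

lemma uniform_confinement:
 assumes \<gamma>: "0 < \<gamma>" and F: "0 <= F" and R: "0 <= R"
 shows "\<exists>t. t ----> 0 \<and> (\<forall>j g \<nu> \<mu>. stationary_NS j \<gamma> g \<nu> \<mu> R F B --> (AE W in \<mu>. confined R t W))"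
proof -
 have "(%L. 4 * slope R L) ----> 4 * 0" by (intro tendsto_intros slope_tendsto)
 then have "\<forall>\<^sub>F L in sequentially. 4 * slope R L < \<gamma>" using \<gamma> by (intro order_tendstoD(2)) simp_all
 then have "\<forall>\<^sub>F L in sequentially. 4 * slope R L < \<gamma> \<and> 1 <= L" by (intro eventually_conj eventually_ge_at_top)
 then obtain L0 where L0: "4 * slope R L0 <= \<gamma>" "1 <= L0" unfolding eventually_sequentially using less_imp_le by blast
 define S where "S = drift_radius \<gamma> R F B L0 + near_bound R L0"
 define t where "t L = 2 * (offset R F B L + slope R L * S) / \<gamma>" for L
 have "(%L. 2 * (offset R F B L + slope R L * S) / \<gamma>) ----> 2 * (0 + 0 * S) / \<gamma>"
  by (intro tendsto_intros offset_tendsto slope_tendsto) (use \<gamma> in simp)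
 then have t: "t ----> 0" by (simp add: t_def[abs_def])
 have "AE W in \<mu>. confined R t W" if st: "stationary_NS j \<gamma> g \<nu> \<mu> R F B" for j g \<nu> \<mu>
 proof -
  interpret stationary_NS j \<gamma> g \<nu> \<mu> R F B by (rule st)
  interpret drift_estimate j \<gamma> g \<nu> \<mu> R F B L0 by unfold_locales (use L0 in auto)
  have d: "AE W in \<mu>. norm (drift W) <= S" unfolding S_def by (rule drift_bounded)
  have S: "0 <= S" using const_facts unfolding S_def by linarith
  have "AE W in \<mu>. norm (zfar L n W) <= t L" if "1 <= L" "L <= n" for L n
   unfolding t_def by (rule far_field_confined[OF d S that])
  then have "AE W in \<mu>. \<forall>L n. 1 <= L \<and> L <= n --> norm (zfar L n W) <= t L"
   unfolding AE_all_countable by (auto intro: AE_I2)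
  with supp show ?thesis by eventually_elim (auto simp: confined_def)
 qed
 with t show ?thesis by blast
qed

theorem theorem4p6:
 fixes j :: "plane \<Rightarrow> real" and \<gamma> :: real and f :: "plane \<Rightarrow> plane" and g :: l2
  and \<nu> :: "nat \<Rightarrow> real" and \<mu> :: "nat \<Rightarrow> l2 measure"
 assumes "is_mollifier j"
  and "\<gamma> > 0"
  and "\<forall>i. W1_infinity (\<lambda>x. f x $ i) \<and> H1 (\<lambda>x. f x $ i)"
  and "(LINT x|lborel. f x) = 0"
  and "is_curl f g"
  and "\<forall>n. \<nu> n > 0" and "\<nu> \<longlonglongrightarrow> 0"
  and "\<forall>n. stat_sol_NS j \<gamma> g (\<nu> n) (\<mu> n)"
 shows "\<exists>(r :: nat \<Rightarrow> nat) \<mu>0. strict_mono r \<and> borel_probability \<mu>0 \<and>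
  (\<forall>\<Phi>. weakly_continuous \<Phi> \<and> locally_bounded \<Phi> \<longrightarrow>
   (\<forall>n. integrable (\<mu> (r n)) \<Phi>) \<and> integrable \<mu>0 \<Phi> \<and>
   (\<lambda>n. LINT \<omega>|\<mu> (r n). \<Phi> \<omega>) \<longlonglongrightarrow> (LINT \<omega>|\<mu>0. \<Phi> \<omega>)) \<and>
  renormalized_stat_sol_Euler j \<gamma> g \<mu>0"
proof -
 have sol: "stat_sol_NS j \<gamma> g (\<nu> n) (\<mu> n)" for n using assms(8) by blast
 have bp: "borel_probability (\<mu> n)" for n using sol[of n] by (simp add: stat_sol_NS_def)
 define R where "R = norm g / \<gamma>"
 define F where "F = (\<Sum>i\<in>UNIV. norm (abs_l2 (%x. f x $ i)))"
 have R0: "0 <= R" using assms(2) by (simp add: R_def)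
 have F0: "0 <= F" by (simp add: F_def sum_nonneg)
 have supp: "AE W in \<mu> n. norm W <= R" for n
  unfolding R_def by (rule energy_support[OF sol assms(2)]) (use assms(6) in blast)
 have "Bseq \<nu>" by (rule convergent_imp_Bseq[OF convergentI[OF assms(7)]])
 then obtain B where B: "!!n. \<bar>\<nu> n\<bar> <= B" by (auto simp: Bseq_def)
 have st: "stationary_NS j \<gamma> g (\<nu> n) (\<mu> n) R F B" for n
 proof
  show "0 < \<gamma>" "0 < \<nu> n" using assms(2,6) by auto
  show "\<nu> n <= B" using B[of n] by simp
  show "0 <= F" "0 <= R" by (fact F0, fact R0)
  show "stat_sol_NS j \<gamma> g (\<nu> n) (\<mu> n)" by (rule sol)
  show "AE W in \<mu> n. norm W <= R" by (rule supp)
  show "\<bar>inner g (abs_l2 w)\<bar> <= F * C" if "C2_0 w" "!!i. norm (abs_l2 (pd i w)) <= C" for w C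
   unfolding F_def by (rule curl_pairing_bound[OF assms(1) _ assms(5) that]) (use assms(3) in blast)
 qed
 obtain t where t: "t ----> 0" and conf: "!!n. AE W in \<mu> n. confined R t W"
  using uniform_confinement[OF assms(2) F0 R0, of B] st by blast
 obtain r \<mu>0 where r: "strict_mono r" and \<mu>0: "borel_probability \<mu>0" and R\<mu>0: "AE W in \<mu>0. norm W <= R"
  and lim: "!!F. F \<in> Borel ==> wcont_on_ball R F ==>
   (%n. LINT W|\<mu> (r n). F W) ----> (LINT W|\<mu>0. F W)"
  using weak_compactness_probability[of \<mu> R, OF bp supp R0] by blast
 have \<nu>r: "(%n. \<nu> (r n)) ----> 0" using LIMSEQ_subseq_LIMSEQ[OF assms(7) r] by (simp add: comp_def)
 have c0: "AE W in \<mu>0. confined R t W" by (rule confined_limit[OF \<mu>0 R\<mu>0 conf bp lim])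
 have "renormalized_stat_sol_Euler j \<gamma> g \<mu>0"
  unfolding renormalized_stat_sol_Euler_def
  using \<mu>0 euler_limit[OF assms(1) _ \<mu>0 c0 sol conf \<nu>r t lim] by blast
 moreover have "(\<forall>n. integrable (\<mu> (r n)) \<Phi>) \<and> integrable \<mu>0 \<Phi> \<and>
   (%n. LINT W|\<mu> (r n). \<Phi> W) ----> (LINT W|\<mu>0. \<Phi> W)" if \<Phi>: "weakly_continuous \<Phi>" for \<Phi>
 proof -
  note w = weakly_continuous_wcont[OF \<Phi>]
  show ?thesis
   using wcont_bounded_integrable[OF bp supp w] wcont_bounded_integrable[OF \<mu>0 R\<mu>0 w]
    lim[OF borel_measurable_wcont[OF w] w] by blast
 qed
 ultimately show ?thesis using r \<mu>0 by blast
qed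

end
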